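(* Let $0<r<R<\infty$, $0<r_\ast<R_\ast<\infty$, $\mathbb A=A(r,R)=\{z:r<|z|<R\}$ and $\mathbb A^\ast=A(r_\ast,R_\ast)$. There exists a harmonic homeomorphism $h:\mathbb A\to\mathbb A^\ast$ (onto) if and only if $$\frac{R_\ast}{r_\ast}\geqslant \frac12\left(\frac Rr+\frac rR\right).$$ Moreover, when equality holds, every $h\in\mathcal H(\mathbb A,\mathbb A^\ast)$ has the form $h(z)=\frac12\left(\frac zr+\frac r{\bar z}\right)r_\ast e^{i\alpha}$ for some $0\leqslant\alpha<2\pi$.
   Context: A map $h$ is harmonic if $\Delta h=0$ (for complex-valued $h$, real and imaginary parts are harmonic). $\mathcal H(\mathbb A,\mathbb A^\ast)$ denotes the set of sense-preserving harmonic homeomorphisms $h$ of $\mathbb A$ onto $\mathbb A^\ast$ that preserve the order of boundary components, i.e. $|h(z)|\to r_\ast$ as $|z|\to r$ and $|h(z)|\to R_\ast$ as $|z|\to R$. *)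

theory Defs
  imports "HOL-Analysis.Analysis"
begin

definition annulus :: "real \<Rightarrow> real \<Rightarrow> complex set" where
  "annulus a b = {z. a < cmod z \<and> cmod z < b}"

definition harmonic_real_on :: "complex set \<Rightarrow> (complex \<Rightarrow> real) \<Rightarrow> bool" where
  "harmonic_real_on S u \<longleftrightarrow>
     (\<exists>ux uy uxx uxy uyx uyy.
        (\<forall>z\<in>S.
           ((\<lambda>t. u (z + of_real t)) has_real_derivative ux z) (at 0) \<and>
           ((\<lambda>t. u (z + \<i> * of_real t)) has_real_derivative uy z) (at 0) \<and>
           ((\<lambda>t. ux (z + of_real t)) has_real_derivative uxx z) (at 0) \<and>
           ((\<lambda>t. ux (z + \<i> * of_real t)) has_real_derivative uxy z) (at 0) \<and>
           ((\<lambda>t. uy (z + of_real t)) has_real_derivative uyx z) (at 0) \<and>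
           ((\<lambda>t. uy (z + \<i> * of_real t)) has_real_derivative uyy z) (at 0) \<and>
           uxx z + uyy z = 0) \<and>
        continuous_on S u \<and> continuous_on S ux \<and> continuous_on S uy \<and>
        continuous_on S uxx \<and> continuous_on S uxy \<and> continuous_on S uyx \<and>
        continuous_on S uyy)"

definition harmonic_on :: "complex set \<Rightarrow> (complex \<Rightarrow> complex) \<Rightarrow> bool" where
  "harmonic_on S h \<longleftrightarrow> harmonic_real_on S (\<lambda>z. Re (h z)) \<and> harmonic_real_on S (\<lambda>z. Im (h z))"

text \<open>Sense-preserving: positive Jacobian u_x v_y - u_y v_x, where h = u + i v.
  For the real-linear differential D, D 1 = u_x + i v_x and D i = u_y + i v_y.\<close>
definition sense_preserving_on :: "complex set \<Rightarrow> (complex \<Rightarrow> complex) \<Rightarrow> bool" where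
  "sense_preserving_on S h \<longleftrightarrow>
     (\<forall>z\<in>S. \<exists>D. (h has_derivative D) (at z) \<and> Im (cnj (D 1) * D \<i>) > 0)"

definition harm_homeo_class ::
  "real \<Rightarrow> real \<Rightarrow> real \<Rightarrow> real \<Rightarrow> (complex \<Rightarrow> complex) set" where
  "harm_homeo_class r R rs Rs =
     {h. harmonic_on (annulus r R) h \<and> sense_preserving_on (annulus r R) h \<and>
         (\<exists>g. homeomorphism (annulus r R) (annulus rs Rs) h g) \<and>
         (\<forall>e>0. \<exists>d>0. \<forall>z\<in>annulus r R. cmod z < r + d \<longrightarrow> \<bar>cmod (h z) - rs\<bar> < e) \<and>
         (\<forall>e>0. \<exists>d>0. \<forall>z\<in>annulus r R. cmod z > R - d \<longrightarrow> \<bar>cmod (h z) - Rs\<bar> < e)}"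

end

theory Submission
  imports Defs "HOL-Complex_Analysis.Complex_Analysis"
begin

text \<open>In logarithmic coordinates \<open>z = t + i\<theta>\<close> on the strip \<open>0 < t < T = ln (R/r)\<close>, and after scaling the
  target by \<open>1/r\<^sub>*\<close>, the map is \<open>2\<pi>i\<close>-periodic and of the form \<open>h = F + cnj G\<close> with \<open>F\<close>, \<open>G\<close> holomorphic.
  The correlation \<open>c(a; s, t) = Im \<integral> cnj h(s,\<theta>) (h(t,\<theta>+a) - h(t,\<theta>-a)) d\<theta> / 4\<pi>\<close> is the imaginary part of a
  holomorphic function of \<open>t + ia\<close>, is symmetric in \<open>s\<close> and \<open>t\<close>, and vanishes for \<open>a = 0\<close> and \<open>a = \<pi>\<close>.
  Near each end the curves \<open>\<theta> \<mapsto> h(t,\<theta>)\<close> have almost constant modulus and, because the Jacobian is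
  nonnegative, almost monotone argument; as the sine is concave, their mean chord is then asymptotically at most
  that of a uniformly parametrised circle. Two applications of the maximum principle give
  \<open>c(a; s, t) \<le> \<Lambda>(s) \<Lambda>(t) sin a\<close> with \<open>\<Lambda>(t) = (sinh (T-t) + (R\<^sub>*/r\<^sub>*) sinh t) / sinh T\<close>. At \<open>s = t\<close>, \<open>a \<rightarrow> 0\<close> the
  left-hand side yields the area enclosed by the curve divided by \<open>\<pi>\<close>, which is at least 1. Hence \<open>\<Lambda> \<ge> 1\<close>
  near \<open>t = 0\<close>, and this is the inequality \<open>R\<^sub>*/r\<^sub>* \<ge> cosh T\<close>.

  If equality holds, then \<open>\<Lambda> = cosh\<close>, and the defect \<open>cosh s cosh t sin a - c(a; s, t)\<close> is nonnegative with
  normal derivative at most \<open>sinh\<^sup>2 t\<close> at \<open>a = 0\<close>, \<open>s = t\<close>. A Hopf lemma at the corner of the strip and Harnack's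
  inequality force the defect to vanish in the limit \<open>s \<rightarrow> 0\<close>. This determines the first Fourier coefficient of
  \<open>h\<close>, and the mean square distance from \<open>h\<close> to the expected extremal map is then a convex function of \<open>t\<close>
  which tends to 0 at both ends.\<close>

section \<open>Stokes' theorem on rectangles\<close>

text \<open>The map need not extend continuously to the boundary, so there is no boundary
  parametrisation to work with. What replaces it: where the modulus of \<open>h\<close> tends to a
  constant, the gradient is o(1/t), and averages over short vertical segments stay stable down to
  the boundary. This is enough for the sign of the Jacobian to force a monotone argument up to any
  prescribed error. The odd difference of the two shifts in the correlation makes both horizontal
  sides of the half strip 0 \<le> a \<le> \<pi> harmless, so that only the two ends matter, and
  there chords are controlled. A bound in \<open>t\<close> alone still contains the supremum of the
  modulus at \<open>s\<close>; symmetry trades it for the boundary values, which gives a product of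
  two factors. With \<open>R\<close> the ratio of the target radii, \<Lambda>(0) = 1 is also the
  lower bound for the area, so the information sits in the derivative: \<Lambda>'(0) = (R - cosh T)
  / sinh T must be nonnegative. When it is 0, the comparison is tight to first order at a corner of
  the half strip, and this is what a Hopf lemma can exploit.\<close>

lemma integral_periodic_shift:
  fixes f :: "real \<Rightarrow> 'a::euclidean_space"
  assumes cont: "continuous_on UNIV f" and per: "\<And>x. f (x + p) = f x" and "p > 0"
  shows "integral {0..p} (\<lambda>x. f (x + a)) = integral {0..p} f"
proof -
  have pern: "f (x + of_nat n * p) = f x" for x n
  proof (induction n)
    case (Suc n)
    have "f (x + of_nat (Suc n) * p) = f ((x + of_nat n * p) + p)"
      by (simp add: algebra_simps)
    then show ?case using per Suc by simp
  qed simp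
  have peri: "f (x + of_int n * p) = f x" for x n
  proof (cases "n \<ge> 0")
    case True
    then show ?thesis using pern[of x "nat n"] by simp
  next
    case False
    then have "f ((x + of_int n * p) + of_nat (nat (-n)) * p) = f (x + of_int n * p)"
      by (rule_tac pern)
    with False show ?thesis by (simp add: of_nat_nat)
  qed
  define b where "b = a - of_int \<lfloor>a / p\<rfloor> * p"
  have b: "0 \<le> b" "b \<le> p"
  proof -
    have "of_int \<lfloor>a/p\<rfloor> \<le> a/p" "a/p \<le> of_int \<lfloor>a/p\<rfloor> + 1" by linarith+
    from this[THEN mult_right_mono, of p]
    have "of_int \<lfloor>a/p\<rfloor> * p \<le> a / p * p" "a / p * p \<le> (of_int \<lfloor>a/p\<rfloor> + 1) * p"
      using \<open>p > 0\<close> less_imp_le by blast+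
    then have "of_int \<lfloor>a/p\<rfloor> * p \<le> a" "a \<le> (of_int \<lfloor>a/p\<rfloor> + 1) * p"
      using \<open>p > 0\<close> by simp_all
    then show "0 \<le> b" "b \<le> p"
      by (simp_all add: b_def algebra_simps)
  qed
  have int: "f integrable_on {u..v}" for u v
    by (rule integrable_continuous_interval) (rule continuous_on_subset[OF cont], simp)
  have "f (x + a) = f (x + b)" for x
    using peri[of "x + b" "\<lfloor>a / p\<rfloor>"] by (simp add: b_def)
  then have "integral {0..p} (\<lambda>x. f (x + a)) = integral {0..p} (\<lambda>x. f (x + b))" by simp
  also have "\<dots> = integral {b..p+b} f"
    using integral_shift[of 0 b p f] continuous_on_subset[OF cont] by (simp add: o_def)
  also have "\<dots> = integral {b..p} f + integral {p..p+b} f"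
    by (rule Henstock_Kurzweil_Integration.integral_combine[symmetric]) (use b int in auto)
  also have "integral {p..p+b} f = integral {0..b} (\<lambda>x. f (x + p))"
    using integral_shift[of 0 p b f] continuous_on_subset[OF cont] by (simp add: o_def add.commute)
  also have "\<dots> = integral {0..b} f" using per by simp
  also have "integral {b..p} f + integral {0..b} f = integral {0..p} f"
    using Henstock_Kurzweil_Integration.integral_combine[of 0 b p f] b int by (simp add: add.commute)
  finally show ?thesis .
qed

text \<open>Cut-offs for Stokes' theorem, used both in the squared modulus and in the argument. The
  bump \<open>B\<close> itself has to be continuously differentiable, because it multiplies the
  differential of the argument, whose mixed derivatives are taken. The final height \<open>c\<close>
  is left unnormalised since only signs are used.\<close>

lemma smooth_step:
  fixes p q :: real
  assumes "p < q"
  obtains b B B' :: "real \<Rightarrow> real" and c :: real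
  where "c > 0"
    and "\<And>y. (b has_real_derivative B y) (at y)"
    and "\<And>y. (B has_real_derivative B' y) (at y)"
    and "continuous_on UNIV B'"
    and "\<And>y. B y \<ge> 0"
    and "\<And>y. y \<le> p \<Longrightarrow> b y = 0" "\<And>y. y \<le> p \<Longrightarrow> B y = 0"
    and "\<And>y. y \<ge> q \<Longrightarrow> b y = c" "\<And>y. y \<ge> q \<Longrightarrow> B y = 0"
proof -
  define s :: "real \<Rightarrow> real" where "s y = (max 0 y)\<^sup>2" for y
  have ds: "(s has_real_derivative 2 * max 0 y) (at y)" for y
  proof -
    consider "y < 0" | "y = 0" | "y > 0" by linarith
    then show ?thesis
    proof cases
      case 1
      have "((\<lambda>_. 0) has_real_derivative 0) (at y)" by simp
      moreover have "eventually (\<lambda>x. x < 0) (nhds y)"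
        using 1 eventually_nhds_in_open[of "{..<0}" y] by auto
      then have "eventually (\<lambda>x. 0 = s x) (nhds y)"
        by eventually_elim (simp add: s_def)
      ultimately have "(s has_real_derivative 0) (at y)"
        using DERIV_cong_ev[OF refl, of "\<lambda>_. 0" s y 0 0] by simp
      then show ?thesis using 1 by simp
    next
      case 2
      have "((\<lambda>h. (s (0 + h) - s 0) / h) \<longlongrightarrow> 0) (at 0)"
      proof (rule Lim_null_comparison[where g = "\<lambda>h. \<bar>h\<bar>"])
        show "\<forall>\<^sub>F h in at 0. norm ((s (0 + h) - s 0) / h) \<le> \<bar>h\<bar>"
          by (rule always_eventually) (auto simp: s_def max_def power2_eq_square)
        show "((\<lambda>h. \<bar>h\<bar>) \<longlongrightarrow> 0) (at (0::real))" by (rule tendsto_rabs_zero) simp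
      qed
      then show ?thesis using 2 by (simp add: DERIV_def)
    next
      case 3
      have "((\<lambda>y. y\<^sup>2) has_real_derivative 2 * y) (at y)"
        by (auto intro!: derivative_eq_intros)
      moreover have "eventually (\<lambda>x. x > 0) (nhds y)"
        using 3 eventually_nhds_in_open[of "{0<..}" y] by auto
      then have "eventually (\<lambda>x. x\<^sup>2 = s x) (nhds y)"
        by eventually_elim (simp add: s_def)
      ultimately have "(s has_real_derivative 2 * y) (at y)"
        using DERIV_cong_ev[OF refl, of "\<lambda>y. y\<^sup>2" s y "2*y" "2*y"] by simp
      then show ?thesis using 3 by simp
    qed
  qed
  define B where "B y = s (y - p) * s (q - y)" for y
  define B' where "B' y = 2 * max 0 (y - p) * s (q - y) - s (y - p) * (2 * max 0 (q - y))" for y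
  have dB: "(B has_real_derivative B' y) (at y)" for y
    unfolding B_def B'_def
    by (rule derivative_eq_intros DERIV_chain2[OF ds] | simp add: algebra_simps)+
  have contB: "continuous_on S B" for S
    using dB by (meson DERIV_isCont continuous_at_imp_continuous_on)
  have contB': "continuous_on UNIV B'"
    unfolding B'_def s_def by (intro continuous_intros)
  have B0: "B y \<ge> 0" for y by (simp add: B_def s_def)
  have Bp: "y \<le> p \<Longrightarrow> B y = 0" and Bq: "y \<ge> q \<Longrightarrow> B y = 0" for y
    by (simp_all add: B_def s_def)
  \<comment> \<open>The base point lies strictly to the left of \<open>p\<close>, so every y \<ge> p
    is interior to the interval on which the integral is differentiated.\<close>
  define b where "b y = integral {p-1..y} B" for y
  have bp: "b y = 0" if "y \<le> p" for y
  proof -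
    have "integral {p-1..y} B = integral {p-1..y} (\<lambda>_. 0)"
      by (rule integral_cong) (use that Bp in auto)
    then show ?thesis by (simp add: b_def)
  qed
  have db: "(b has_real_derivative B y) (at y)" for y
  proof (cases "y < p")
    case True
    have "((\<lambda>_. 0) has_real_derivative 0) (at y)" by simp
    moreover have "eventually (\<lambda>x. x < p) (nhds y)"
      using True eventually_nhds_in_open[of "{..<p}" y] by auto
    then have "eventually (\<lambda>x. 0 = b x) (nhds y)"
      by eventually_elim (simp add: bp)
    ultimately show ?thesis
      using DERIV_cong_ev[OF refl, of "\<lambda>_. 0" b y 0 0] Bp True by simp
  next
    case False
    have "(b has_real_derivative B y) (at y within {p-1..y+1})"
      unfolding b_def by (rule integral_has_real_derivative) (use False contB in auto)
    moreover have "at y within {p-1..y+1} = at y"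
      by (rule at_within_interior) (use False in auto)
    ultimately show ?thesis by simp
  qed
  have bq: "b y = b q" if "y \<ge> q" for y
  proof -
    have "integral {p-1..q} B + integral {q..y} B = integral {p-1..y} B"
      by (rule Henstock_Kurzweil_Integration.integral_combine)
        (use that assms contB in \<open>simp_all add: integrable_continuous_interval\<close>)
    then have "b q + integral {q..y} B = b y" by (simp add: b_def)
    moreover have "integral {q..y} B = integral {q..y} (\<lambda>_. 0)"
      by (rule integral_cong) (use Bq in auto)
    ultimately show ?thesis by simp
  qed
  have "b p < b q"
  proof (rule DERIV_pos_imp_increasing_open[OF assms])
    fix x assume "p < x" "x < q"
    then show "\<exists>y. DERIV b x :> y \<and> y > 0"
      using db[of x] by (intro exI[of _ "B x"]) (simp add: B_def s_def)
  qed (use db in \<open>meson DERIV_isCont continuous_at_imp_continuous_on\<close>)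
  then have "b q > 0" using bp[of p] by simp
  then show ?thesis
    using that[of "b q" b B B'] db dB contB' B0 bp Bp bq Bq by blast
qed

text \<open>Stokes' theorem for the form \<open>\<alpha> d\<beta>\<close>: the last hypothesis says that \<open>d\<alpha> \<and> d\<beta>\<close> has a sign.\<close>

lemma stokes_rectangle_mono:
  fixes \<alpha> \<alpha>t \<alpha>h \<beta>t \<beta>h m :: "real \<Rightarrow> real \<Rightarrow> real"
  assumes "s < t" "a < b"
    and d\<alpha>t: "\<And>\<tau> \<theta>. \<lbrakk>\<tau> \<in> {s..t}; \<theta> \<in> {a..b}\<rbrakk> \<Longrightarrow> ((\<lambda>x. \<alpha> x \<theta>) has_real_derivative \<alpha>t \<tau> \<theta>) (at \<tau>)"
    and d\<alpha>h: "\<And>\<tau> \<theta>. \<lbrakk>\<tau> \<in> {s..t}; \<theta> \<in> {a..b}\<rbrakk> \<Longrightarrow> (\<alpha> \<tau> has_real_derivative \<alpha>h \<tau> \<theta>) (at \<theta>)"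
    and d\<beta>h: "\<And>\<tau> \<theta>. \<lbrakk>\<tau> \<in> {s..t}; \<theta> \<in> {a..b}\<rbrakk> \<Longrightarrow> ((\<lambda>x. \<beta>h x \<theta>) has_real_derivative m \<tau> \<theta>) (at \<tau>)"
    and d\<beta>t: "\<And>\<tau> \<theta>. \<lbrakk>\<tau> \<in> {s..t}; \<theta> \<in> {a..b}\<rbrakk> \<Longrightarrow> (\<beta>t \<tau> has_real_derivative m \<tau> \<theta>) (at \<theta>)"
    and cont: "continuous_on ({s..t} \<times> {a..b}) (\<lambda>(x,y). \<alpha> x y)"
      "continuous_on ({s..t} \<times> {a..b}) (\<lambda>(x,y). \<alpha>t x y)"
      "continuous_on ({s..t} \<times> {a..b}) (\<lambda>(x,y). \<alpha>h x y)"
      "continuous_on ({s..t} \<times> {a..b}) (\<lambda>(x,y). \<beta>t x y)"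
      "continuous_on ({s..t} \<times> {a..b}) (\<lambda>(x,y). \<beta>h x y)"
      "continuous_on ({s..t} \<times> {a..b}) (\<lambda>(x,y). m x y)"
    and sides: "\<And>\<tau>. \<tau> \<in> {s..t} \<Longrightarrow> \<alpha> \<tau> b * \<beta>t \<tau> b = \<alpha> \<tau> a * \<beta>t \<tau> a"
    and sgn: "\<And>\<tau> \<theta>. \<lbrakk>\<tau> \<in> {s..t}; \<theta> \<in> {a..b}\<rbrakk> \<Longrightarrow> \<alpha>t \<tau> \<theta> * \<beta>h \<tau> \<theta> - \<alpha>h \<tau> \<theta> * \<beta>t \<tau> \<theta> \<ge> 0"
  shows "integral {a..b} (\<lambda>\<theta>. \<alpha> s \<theta> * \<beta>h s \<theta>) \<le> integral {a..b} (\<lambda>\<theta>. \<alpha> t \<theta> * \<beta>h t \<theta>)"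
proof -
  define Y where "Y \<tau> = integral {a..b} (\<lambda>\<theta>. \<alpha> \<tau> \<theta> * \<beta>h \<tau> \<theta>)" for \<tau>
  define D where "D \<tau> \<theta> = \<alpha>t \<tau> \<theta> * \<beta>h \<tau> \<theta> + m \<tau> \<theta> * \<alpha> \<tau> \<theta>" for \<tau> \<theta>
  note c = cont[unfolded split_beta']
  have c1: "continuous_on {a..b} (\<lambda>y. f \<tau> y)"
    if "continuous_on ({s..t} \<times> {a..b}) (\<lambda>p. f (fst p) (snd p))" "\<tau> \<in> {s..t}" for f :: "real \<Rightarrow> real \<Rightarrow> real" and \<tau>
  proof -
    have "continuous_on {a..b} (\<lambda>y. (\<tau>, y))" by (intro continuous_intros)
    from continuous_on_compose2[OF that(1) this] that(2) show ?thesis by (auto simp: image_subset_iff)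
  qed
  note cc = c1[OF c(1)] c1[OF c(2)] c1[OF c(3)] c1[OF c(4)] c1[OF c(5)] c1[OF c(6)]
  have dY: "(Y has_real_derivative integral {a..b} (D \<tau>)) (at \<tau> within {s..t})" if \<tau>: "\<tau> \<in> {s..t}" for \<tau>
    unfolding Y_def
  proof (rule leibniz_rule_field_derivative[of "{s..t}" a b, unfolded cbox_interval])
    fix x y assume "x \<in> {s..t}" "y \<in> {a..b}"
    then show "((\<lambda>x. \<alpha> x y * \<beta>h x y) has_real_derivative D x y) (at x within {s..t})"
      unfolding D_def
      by (intro DERIV_mult has_field_derivative_at_within[OF d\<alpha>t] has_field_derivative_at_within[OF d\<beta>h])
  next
    fix x assume "x \<in> {s..t}"
    then show "(\<lambda>y. \<alpha> x y * \<beta>h x y) integrable_on {a..b}"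
      by (intro integrable_continuous_interval continuous_intros cc)
  next
    show "continuous_on ({s..t} \<times> {a..b}) (\<lambda>(x, y). D x y)"
      unfolding D_def split_beta' by (intro continuous_intros c)
  qed (use \<tau> in auto)
  have D_nonneg: "integral {a..b} (D \<tau>) \<ge> 0" if \<tau>: "\<tau> \<in> {s..t}" for \<tau>
  proof -
    \<comment> \<open>\<open>K\<close> is the \<theta>-derivative of \<alpha> times \<beta>t, whose
      integral vanishes by \<open>sides\<close>. Subtracting it from \<open>D\<close> cancels the
      terms with \<open>m\<close> and leaves the density whose sign is assumed.\<close>
    define K where "K \<theta> = \<alpha>h \<tau> \<theta> * \<beta>t \<tau> \<theta> + m \<tau> \<theta> * \<alpha> \<tau> \<theta>" for \<theta>
    have "(K has_integral \<alpha> \<tau> b * \<beta>t \<tau> b - \<alpha> \<tau> a * \<beta>t \<tau> a) {a..b}"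
    proof (rule fundamental_theorem_of_calculus)
      fix x assume "x \<in> {a..b}"
      then have "((\<lambda>\<theta>. \<alpha> \<tau> \<theta> * \<beta>t \<tau> \<theta>) has_real_derivative K x) (at x within {a..b})"
        unfolding K_def
        by (intro DERIV_mult has_field_derivative_at_within[OF d\<alpha>h] has_field_derivative_at_within[OF d\<beta>t] \<tau>)
      then show "((\<lambda>\<theta>. \<alpha> \<tau> \<theta> * \<beta>t \<tau> \<theta>) has_vector_derivative K x) (at x within {a..b})"
        by (simp add: has_real_derivative_iff_has_vector_derivative)
    qed (use assms in simp)
    then have K: "(K has_integral 0) {a..b}" using sides[OF \<tau>] by simp
    have "D \<tau> integrable_on {a..b}"
      unfolding D_def by (intro integrable_continuous_interval continuous_intros cc \<tau>)
    then have "integral {a..b} (D \<tau>) = integral {a..b} (\<lambda>\<theta>. D \<tau> \<theta> - K \<theta>)"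
      using K by (subst integral_diff) (auto simp: integral_unique has_integral_integrable)
    moreover have "0 \<le> integral {a..b} (\<lambda>\<theta>. D \<tau> \<theta> - K \<theta>)"
    proof (rule Henstock_Kurzweil_Integration.integral_nonneg)
      show "(\<lambda>\<theta>. D \<tau> \<theta> - K \<theta>) integrable_on {a..b}"
        using \<open>D \<tau> integrable_on {a..b}\<close> K by (intro integrable_diff) (auto simp: has_integral_integrable)
      show "0 \<le> D \<tau> \<theta> - K \<theta>" if "\<theta> \<in> {a..b}" for \<theta>
        using sgn[OF \<tau> that] by (simp add: D_def K_def)
    qed
    ultimately show ?thesis by simp
  qed
  have "Y s \<le> Y t"
  proof (rule DERIV_nonneg_imp_increasing_open[of s t Y])
    show "s \<le> t" using assms by simp
    show "\<exists>y. (Y has_real_derivative y) (at x) \<and> 0 \<le> y" if "s < x" "x < t" for x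
      using dY[of x] D_nonneg[of x] that at_within_Icc_at[of s x t] by auto
    show "continuous_on {s..t} Y"
      using dY by (meson DERIV_atLeastAtMost_imp_continuous_on DERIV_continuous_on)
  qed
  then show ?thesis by (simp add: Y_def)
qed

text \<open>On [0, \<pi>] the concave sine lies below its tangent at \<open>a\<close>. A point
  outside is first projected to the nearest \<open>z\<close> of the interval; this costs
  \<open>k\<close> for the sine and \<open>k\<close> for the tangent, both being
  1-Lipschitz.\<close>

lemma abs_sin_le_tangent:
  fixes a y k :: real
  assumes "0 \<le> a" "a \<le> pi" "-k \<le> y" "y \<le> pi + k" and k: "k \<ge> 0"
  shows "\<bar>sin y\<bar> \<le> sin a + cos a * (y - a) + 2 * k"
proof -
  define z where "z = max 0 (min pi y)"
  have z: "0 \<le> z" "z \<le> pi" "\<bar>y - z\<bar> \<le> k"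
    using assms k pi_gt_zero by (auto simp: z_def max_def min_def)
  have "- cos a * (z - a) \<le> - sin z - - sin a"
  proof (rule f''_imp_f'[where C = "{0..pi}" and f = "\<lambda>x. - sin x" and f' = "\<lambda>x. - cos x" and f'' = sin])
  qed (use z assms in \<open>auto intro!: derivative_eq_intros sin_ge_zero\<close>)
  then have 1: "sin z \<le> sin a + cos a * (z - a)" by simp
  have "\<bar>cos a * (z - y)\<bar> \<le> 1 * k"
    unfolding abs_mult by (rule mult_mono) (use z in auto)
  then have 2: "cos a * (z - a) \<le> cos a * (y - a) + k"
    by (simp add: algebra_simps abs_le_iff)
  have "\<bar>sin y - sin z\<bar> \<le> \<bar>y - z\<bar>"
    using abs_sin_x_le_abs_x[of "(y - z)/2"]
    by (simp add: sin_diff_sin abs_mult)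
      (smt (verit) abs_cos_le_one mult_left_le abs_ge_zero mult_mono)
  then have "\<bar>sin y\<bar> \<le> sin z + k"
    using z sin_ge_zero[of z] by linarith
  then show ?thesis using 1 2 by linarith
qed

text \<open>Fourier coefficients of index 0, 1 and -1 on a circle: Cauchy's formula for the
  function, Cauchy's formula for its derivative, and Cauchy's theorem.\<close>

lemma circle_average_powers:
  fixes F :: "complex \<Rightarrow> complex"
  assumes hol: "F holomorphic_on S" and "open S" "cball z r \<subseteq> S" "r > 0"
  shows "((\<lambda>\<phi>. F (z + of_real r * cis \<phi>)) has_integral of_real (2*pi) * F z) {0..2*pi}"
    and "((\<lambda>\<phi>. F (z + of_real r * cis \<phi>) * cis (-\<phi>)) has_integral of_real (2*pi*r) * deriv F z) {0..2*pi}"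
    and "((\<lambda>\<phi>. F (z + of_real r * cis \<phi>) * cis \<phi>) has_integral 0) {0..2*pi}"
proof -
  have hc: "F holomorphic_on cball z r" and hb: "F holomorphic_on ball z r" and cc: "continuous_on (cball z r) F"
    subgoal using hol assms(3) by (rule holomorphic_on_subset)
    subgoal using hol by (rule holomorphic_on_subset) (use assms(3) ball_subset_cball in blast)
    subgoal using hol assms(3) by (intro holomorphic_on_imp_continuous_on) (rule holomorphic_on_subset)
    done
  have circ: "circlepath z r = part_circlepath z r 0 (2*pi)" by (simp add: circlepath_def)
  have iff: "(f has_contour_integral I) (circlepath z r) \<longleftrightarrow>
     ((\<lambda>t. f (z + of_real r * cis t) * of_real r * \<i> * cis t) has_integral I) {0..2*pi}" for f I
    unfolding circ by (rule has_contour_integral_part_circlepath_iff) simp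
  have "((\<lambda>u. F u / (u - z)) has_contour_integral (2 * of_real pi * \<i> * F z)) (circlepath z r)"
    by (rule Cauchy_integral_circlepath_simple[OF hc]) (use assms in simp)
  then have "((\<lambda>t. (F (z + of_real r * cis t) / (of_real r * cis t)) * of_real r * \<i> * cis t) has_integral (2 * of_real pi * \<i> * F z)) {0..2*pi}"
    unfolding iff by simp
  then have "((\<lambda>t. \<i> * F (z + of_real r * cis t)) has_integral (\<i> * (of_real (2*pi) * F z))) {0..2*pi}"
    using assms(4) by (simp add: field_simps cis_neq_zero)
  from has_integral_mult_right[OF this, of "-\<i>"]
  show "((\<lambda>\<phi>. F (z + of_real r * cis \<phi>)) has_integral of_real (2*pi) * F z) {0..2*pi}"
    by simp
  have "((\<lambda>u. F u / (u - z) ^ Suc 1) has_contour_integral ((2 * pi * \<i>) / (fact 1) * (deriv ^^ 1) F z)) (circlepath z r)"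
    by (rule Cauchy_has_contour_integral_higher_derivative_circlepath[OF cc hb]) (use assms in simp)
  then have "((\<lambda>t. (F (z + of_real r * cis t) / (of_real r * cis t)\<^sup>2) * of_real r * \<i> * cis t) has_integral (2 * of_real pi * \<i> * deriv F z)) {0..2*pi}"
    unfolding iff by (simp add: power2_eq_square)
  moreover have "(F (z + of_real r * cis t) / (of_real r * cis t)\<^sup>2) * of_real r * \<i> * cis t
      = \<i> / of_real r * (F (z + of_real r * cis t) * cis (-t))" for t
  proof -
    have "cis (-t) = 1 / cis t" by (simp add: divide_inverse flip: cis_inverse)
    then show ?thesis using assms(4) by (simp add: field_simps power2_eq_square)
  qed
  ultimately have "((\<lambda>t. \<i> / of_real r * (F (z + of_real r * cis t) * cis (-t))) has_integral (2 * of_real pi * \<i> * deriv F z)) {0..2*pi}"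
    by simp
  from has_integral_mult_right[OF this, of "-\<i> * of_real r"]
  show "((\<lambda>\<phi>. F (z + of_real r * cis \<phi>) * cis (-\<phi>)) has_integral of_real (2*pi*r) * deriv F z) {0..2*pi}"
    using assms(4) by (simp add: field_simps)
  have "(F has_contour_integral 0) (circlepath z r)"
    by (rule Cauchy_theorem_convex_simple[OF hc convex_cball]) (use assms in auto)
  then have "((\<lambda>t. (F (z + of_real r * cis t)) * of_real r * \<i> * cis t) has_integral 0) {0..2*pi}"
    unfolding iff by simp
  from has_integral_mult_right[OF this, of "-\<i> / of_real r"]
  show "((\<lambda>\<phi>. F (z + of_real r * cis \<phi>) * cis \<phi>) has_integral 0) {0..2*pi}"
    using assms(4) by (simp add: field_simps)
qed

section \<open>Harmonic maps on a strip\<close>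

definition strip :: "real \<Rightarrow> complex set" where
  "strip T = {z. 0 < Re z \<and> Re z < T}"

text \<open>The general harmonic map on a simply connected domain. For holomorphic \<open>F\<close>
  and \<open>G\<close> the derivative of \<open>F\<close> and the conjugated derivative of
  \<open>G\<close> are its two Wirtinger derivatives; partial derivatives are again written with
  \<open>hmap\<close>.\<close>

definition hmap :: "(complex \<Rightarrow> complex) \<Rightarrow> (complex \<Rightarrow> complex) \<Rightarrow> complex \<Rightarrow> complex" where
  "hmap F G z = F z + cnj (G z)"

lemma open_strip: "open (strip T)"
proof -
  have "strip T = {z. 0 < Re z} \<inter> {z. Re z < T}" by (auto simp: strip_def)
  then show ?thesis by (simp add: open_Int open_halfspace_Re_gt open_halfspace_Re_lt)
qed

lemma convex_strip: "convex (strip T)"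
proof -
  have "strip T = {z. 0 < Re z} \<inter> {z. Re z < T}" by (auto simp: strip_def)
  then show ?thesis by (simp add: convex_Int convex_halfspace_Re_gt convex_halfspace_Re_lt)
qed

lemma Complex_in_strip [simp]: "Complex t y \<in> strip T \<longleftrightarrow> 0 < t \<and> t < T"
  by (simp add: strip_def)

lemma has_vector_derivative_Complex:
  "((\<lambda>x. Complex x y) has_vector_derivative 1) (at t within A)"
  "(Complex x has_vector_derivative \<i>) (at y within A)"
proof -
  have "((\<lambda>x. of_real x + \<i> * of_real y) has_vector_derivative 1) (at t within A)"
    by (auto intro!: derivative_eq_intros)
  then show "((\<lambda>x. Complex x y) has_vector_derivative 1) (at t within A)" by (simp add: Complex_eq)
  have "((\<lambda>y. of_real x + \<i> * of_real y) has_vector_derivative \<i>) (at y within A)"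
    by (auto intro!: derivative_eq_intros)
  then show "(Complex x has_vector_derivative \<i>) (at y within A)"
    by (simp add: Complex_eq[abs_def])
qed

lemma has_vector_derivative_cnj':
  "(f has_vector_derivative f') F \<Longrightarrow> ((\<lambda>x. cnj (f x)) has_vector_derivative cnj f') F"
  by (rule bounded_linear.has_vector_derivative[OF bounded_linear_cnj])

text \<open>The two functions under \<open>hmap\<close> in the conclusion are constant, so
  \<open>z\<close> is arbitrary and can be instantiated to the point at hand.\<close>

lemma hmap_derivative_t:
  assumes "(F has_field_derivative F') (at (Complex t y))" "(G has_field_derivative G') (at (Complex t y))"
  shows "((\<lambda>x. hmap F G (Complex x y)) has_vector_derivative hmap (\<lambda>_. F') (\<lambda>_. G') z) (at t)"
proof -
  have "((\<lambda>x. F (Complex x y)) has_vector_derivative F') (at t)"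
    using field_vector_diff_chain_at[OF has_vector_derivative_Complex(1) assms(1)] by (simp add: o_def)
  moreover have "((\<lambda>x. G (Complex x y)) has_vector_derivative G') (at t)"
    using field_vector_diff_chain_at[OF has_vector_derivative_Complex(1) assms(2)] by (simp add: o_def)
  ultimately show ?thesis
    unfolding hmap_def by (intro has_vector_derivative_add has_vector_derivative_cnj')
qed

lemma hmap_derivative_th:
  assumes "(F has_field_derivative F') (at (Complex t y))" "(G has_field_derivative G') (at (Complex t y))"
  shows "((\<lambda>y. hmap F G (Complex t y)) has_vector_derivative hmap (\<lambda>_. \<i> * F') (\<lambda>_. \<i> * G') z) (at y)"
proof -
  have "((\<lambda>y. F (Complex t y)) has_vector_derivative \<i> * F') (at y)"
    using field_vector_diff_chain_at[OF has_vector_derivative_Complex(2) assms(1)] by (simp add: o_def)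
  moreover have "((\<lambda>y. G (Complex t y)) has_vector_derivative \<i> * G') (at y)"
    using field_vector_diff_chain_at[OF has_vector_derivative_Complex(2) assms(2)] by (simp add: o_def)
  ultimately show ?thesis
    unfolding hmap_def by (intro has_vector_derivative_add has_vector_derivative_cnj')
qed

lemma norm_increment_le:
  fixes f :: "real \<Rightarrow> 'a::real_normed_vector"
  assumes "a \<le> b" and d: "\<And>x. a \<le> x \<Longrightarrow> x \<le> b \<Longrightarrow> (f has_vector_derivative f' x) (at x)"
    and B: "\<And>x. a \<le> x \<Longrightarrow> x \<le> b \<Longrightarrow> norm (f' x) \<le> B"
  shows "norm (f b - f a) \<le> B * (b - a)"
proof (cases "a = b")
  case False
  have "norm (f b - f a) \<le> B * b - B * a"
  proof (rule differentiable_bound_general[of a b f "\<lambda>x. B * x" f' "\<lambda>_. B"])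
    show "a < b" using False assms by simp
    show "continuous_on {a..b} f"
      using d by (meson atLeastAtMost_iff continuous_at_imp_continuous_on has_vector_derivative_continuous)
  qed (use d B in \<open>auto intro!: continuous_intros derivative_eq_intros\<close>)
  then show ?thesis by (simp add: algebra_simps)
qed simp

lemma continuous_on_vector_derivative_at:
  fixes f :: "real \<Rightarrow> 'a::real_normed_vector"
  assumes "\<And>x. x \<in> A \<Longrightarrow> (f has_vector_derivative f' x) (at x)"
  shows "continuous_on A f"
  using assms by (meson continuous_at_imp_continuous_on has_vector_derivative_continuous)

section \<open>Harmonic maps on the strip: derivatives and gradient estimates\<close>

locale strip_map =
  fixes T :: real and F G :: "complex \<Rightarrow> complex"
  assumes T_pos: "0 < T" and F_hol: "F holomorphic_on strip T" and G_hol: "G holomorphic_on strip T"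
begin

abbreviation "h \<equiv> hmap F G"
abbreviation "P \<equiv> deriv F"
abbreviation "Q \<equiv> deriv G"

lemma dF: "z \<in> strip T \<Longrightarrow> (F has_field_derivative P z) (at z)"
  and dG: "z \<in> strip T \<Longrightarrow> (G has_field_derivative Q z) (at z)"
  using F_hol G_hol open_strip holomorphic_derivI by blast+

lemma P_hol: "P holomorphic_on strip T" and Q_hol: "Q holomorphic_on strip T"
  using F_hol G_hol open_strip holomorphic_deriv by blast+

lemma dP: "z \<in> strip T \<Longrightarrow> (P has_field_derivative deriv P z) (at z)"
  and dQ: "z \<in> strip T \<Longrightarrow> (Q has_field_derivative deriv Q z) (at z)"
  using P_hol Q_hol open_strip holomorphic_derivI by blast+

lemma cont_hol: "f holomorphic_on strip T \<Longrightarrow> continuous_on (strip T) f"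
  by (rule holomorphic_on_imp_continuous_on)

lemma cont_h: "continuous_on (strip T) h"
  unfolding hmap_def by (intro continuous_intros cont_hol F_hol G_hol)

lemma h_t: "0 < t \<Longrightarrow> t < T \<Longrightarrow>
    ((\<lambda>x. h (Complex x y)) has_vector_derivative hmap P Q (Complex t y)) (at t)"
  using hmap_derivative_t[OF dF dG, of t y] by (simp add: hmap_def)

lemma h_th: "0 < t \<Longrightarrow> t < T \<Longrightarrow>
    ((\<lambda>y. h (Complex t y)) has_vector_derivative hmap (\<lambda>z. \<i> * P z) (\<lambda>z. \<i> * Q z) (Complex t y)) (at y)"
  using hmap_derivative_th[OF dF dG, of t y] by (simp add: hmap_def)

lemma circle_integrals:
  assumes "cball z r \<subseteq> strip T" "r > 0"
  shows "((\<lambda>\<phi>. h (z + of_real r * cis \<phi>)) has_integral of_real (2*pi) * h z) {0..2*pi}"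
    and "((\<lambda>\<phi>. h (z + of_real r * cis \<phi>) * cis (-\<phi>)) has_integral of_real (2*pi*r) * P z) {0..2*pi}"
    and "((\<lambda>\<phi>. h (z + of_real r * cis \<phi>) * cis \<phi>) has_integral of_real (2*pi*r) * cnj (Q z)) {0..2*pi}"
proof -
  have cn: "((\<lambda>x. cnj (f x)) has_integral cnj I) A" if "(f has_integral I) A" for f I and A :: "real set"
    using that has_integral_cnj[of f I A] by (simp add: o_def)
  note CF = circle_average_powers[OF F_hol open_strip assms]
  note CG = circle_average_powers[OF G_hol open_strip assms]
  show "((\<lambda>\<phi>. h (z + of_real r * cis \<phi>)) has_integral of_real (2*pi) * h z) {0..2*pi}"
    using has_integral_add[OF CF(1) cn[OF CG(1)]] by (simp add: hmap_def algebra_simps)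
  show "((\<lambda>\<phi>. h (z + of_real r * cis \<phi>) * cis (-\<phi>)) has_integral of_real (2*pi*r) * P z) {0..2*pi}"
    using has_integral_add[OF CF(2) cn[OF CG(3)]] by (simp add: hmap_def algebra_simps cis_cnj)
  show "((\<lambda>\<phi>. h (z + of_real r * cis \<phi>) * cis \<phi>) has_integral of_real (2*pi*r) * cnj (Q z)) {0..2*pi}"
    using has_integral_add[OF CF(3) cn[OF CG(2)]] by (simp add: hmap_def algebra_simps cis_cnj)
qed

text \<open>If \<open>\<bar>h\<bar>\<close> is nearly constant on a disc, then the mean square deviation of \<open>h\<close> from its value
  at the centre is small, and the first Fourier coefficients control the derivatives.\<close>

lemma gradient_bound:
  assumes ball: "cball z r \<subseteq> strip T" "r > 0" and k: "k > 0"
    and bd: "\<And>w. w \<in> cball z r \<Longrightarrow> m \<le> cmod (h w) \<and> cmod (h w) \<le> M" and m: "0 \<le> m"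
  shows "r * cmod (P z) \<le> (M\<^sup>2 - m\<^sup>2) / (2*k) + k/2" and "r * cmod (Q z) \<le> (M\<^sup>2 - m\<^sup>2) / (2*k) + k/2"
proof -
  define w where "w \<phi> = z + of_real r * cis \<phi>" for \<phi>
  have wb: "w \<phi> \<in> cball z r" for \<phi> using ball(2) by (simp add: w_def dist_norm norm_mult)
  have contw: "continuous_on A w" for A unfolding w_def by (intro continuous_intros)
  have conthw: "continuous_on A (\<lambda>\<phi>. h (w \<phi>))" for A
    by (rule continuous_on_compose2[OF cont_h contw]) (use wb ball in auto)
  define N where "N \<phi> = cmod (h (w \<phi>) - h z)" for \<phi>
  have contN: "continuous_on A N" for A
    unfolding N_def by (intro continuous_intros conthw)
  have int: "f integrable_on {0..2*pi}" if "continuous_on {0..2*pi} f" for f :: "real \<Rightarrow> 'b::banach"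
    using that by (rule integrable_continuous_interval)
  \<comment> \<open>The square of \<open>N\<close> is expanded; by the mean value property the cross
    term integrates to twice the squared modulus at the centre. So the mean square deviation is the
    mean of the squared modulus minus its value at the centre.\<close>
  have "integral {0..2*pi} (\<lambda>\<phi>. (N \<phi>)\<^sup>2) \<le> 2*pi*(M\<^sup>2 - m\<^sup>2)"
  proof -
    have "((\<lambda>\<phi>. Re (cnj (h z) * h (w \<phi>))) has_integral Re (cnj (h z) * (of_real (2*pi) * h z))) {0..2*pi}"
      using has_integral_Re[OF has_integral_mult_right[OF circle_integrals(1)[OF ball], of "cnj (h z)"]]
      by (simp add: w_def)
    moreover have "Re (cnj (h z) * (of_real (2*pi) * h z)) = 2*pi*(cmod (h z))\<^sup>2"
      unfolding cmod_power2 by (simp add: power2_eq_square algebra_simps)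
    ultimately have 1: "((\<lambda>\<phi>. Re (cnj (h z) * h (w \<phi>))) has_integral 2*pi*(cmod (h z))\<^sup>2) {0..2*pi}" by simp
    have c: "((\<lambda>_. c) has_integral 2*pi*c) {0..2*pi}" for c :: real
      using has_integral_const_real[of c 0 "2*pi"] by simp
    have 2: "((\<lambda>\<phi>. M\<^sup>2 - 2 * Re (cnj (h z) * h (w \<phi>)) + (cmod (h z))\<^sup>2) has_integral 2*pi*(M\<^sup>2 - (cmod (h z))\<^sup>2)) {0..2*pi}"
      using has_integral_add[OF has_integral_diff[OF c has_integral_mult_right[OF 1, of 2]] c, of "M\<^sup>2" "(cmod (h z))\<^sup>2"]
      by (simp add: algebra_simps)
    have "integral {0..2*pi} (\<lambda>\<phi>. (N \<phi>)\<^sup>2) \<le> 2*pi*(M\<^sup>2 - (cmod (h z))\<^sup>2)"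
    proof (rule has_integral_le[OF integrable_integral 2])
      show "(\<lambda>\<phi>. (N \<phi>)\<^sup>2) integrable_on {0..2*pi}" by (intro int continuous_intros contN)
      fix \<phi>
      have "(N \<phi>)\<^sup>2 = (cmod (h (w \<phi>)))\<^sup>2 - 2 * Re (cnj (h z) * h (w \<phi>)) + (cmod (h z))\<^sup>2"
        unfolding N_def cmod_power2 by (simp add: power2_eq_square algebra_simps)
      moreover have "(cmod (h (w \<phi>)))\<^sup>2 \<le> M\<^sup>2" using bd[OF wb] by (intro power_mono) auto
      ultimately show "(N \<phi>)\<^sup>2 \<le> M\<^sup>2 - 2 * Re (cnj (h z) * h (w \<phi>)) + (cmod (h z))\<^sup>2" by simp
    qed
    also have "\<dots> \<le> 2*pi*(M\<^sup>2 - m\<^sup>2)"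
      using bd[of z] ball m by (intro mult_left_mono diff_left_mono power_mono) auto
    finally show ?thesis .
  qed
  moreover have "integral {0..2*pi} (\<lambda>\<phi>. (N \<phi>)\<^sup>2 / (2*k) + k/2) = integral {0..2*pi} (\<lambda>\<phi>. (N \<phi>)\<^sup>2) / (2*k) + pi * k"
    using k by (subst integral_add) (auto intro!: int continuous_intros contN)
  ultimately have I: "integral {0..2*pi} (\<lambda>\<phi>. (N \<phi>)\<^sup>2 / (2*k) + k/2) \<le> 2*pi * ((M\<^sup>2 - m\<^sup>2)/(2*k) + k/2)"
    using k divide_right_mono[of "integral {0..2*pi} (\<lambda>\<phi>. (N \<phi>)\<^sup>2)" "2*pi*(M\<^sup>2 - m\<^sup>2)" "2*k"]
    by (simp add: algebra_simps)
  \<comment> \<open>The weight \<open>e\<close> has mean 0, so h(z) can be subtracted for free. The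
    linear quantity \<open>N\<close> is then bounded by the weighted inequality N \<le> N^2/(2k) +
    k/2, in place of Cauchy-Schwarz.\<close>
  have key: "r * cmod c \<le> (M\<^sup>2 - m\<^sup>2) / (2*k) + k/2"
    if c: "((\<lambda>\<phi>. h (w \<phi>) * e \<phi>) has_integral of_real (2*pi*r) * c) {0..2*pi}"
      and e: "(e has_integral 0) {0..2*pi}" "\<And>\<phi>. cmod (e \<phi>) = 1" for c e
  proof -
    have D: "((\<lambda>\<phi>. (h (w \<phi>) - h z) * e \<phi>) has_integral of_real (2*pi*r) * c) {0..2*pi}"
      using has_integral_diff[OF c has_integral_mult_right[OF e(1), of "h z"]] by (simp add: algebra_simps)
    have "2*pi*(r * cmod c) = norm (integral {0..2*pi} (\<lambda>\<phi>. (h (w \<phi>) - h z) * e \<phi>))"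
      using integral_unique[OF D] ball(2) by (simp add: norm_mult mult.assoc)
    also have "\<dots> \<le> integral {0..2*pi} (\<lambda>\<phi>. (N \<phi>)\<^sup>2 / (2*k) + k/2)"
    proof (rule integral_norm_bound_integral)
      show "(\<lambda>\<phi>. (h (w \<phi>) - h z) * e \<phi>) integrable_on {0..2*pi}" using D by blast
      show "(\<lambda>\<phi>. (N \<phi>)\<^sup>2 / (2*k) + k/2) integrable_on {0..2*pi}"
        using k by (intro int continuous_intros contN) auto
      fix \<phi>
      have "0 \<le> (N \<phi> - k)\<^sup>2 / (2*k)" using k by simp
      also have "\<dots> = (N \<phi>)\<^sup>2 / (2*k) + k/2 - N \<phi>" using k by (simp add: power2_eq_square field_simps)
      finally show "norm ((h (w \<phi>) - h z) * e \<phi>) \<le> (N \<phi>)\<^sup>2 / (2*k) + k/2"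
        using e(2) by (simp add: norm_mult N_def)
    qed
    also note I
    finally show ?thesis by (rule mult_left_le_imp_le) simp
  qed
  have e1: "(cis has_integral 0) {0..2*pi}" and e2: "((\<lambda>\<phi>. cis (-\<phi>)) has_integral 0) {0..2*pi}"
    using circle_average_powers(2,3)[of "\<lambda>_. 1" UNIV 0 1] by (auto)
  show "r * cmod (P z) \<le> (M\<^sup>2 - m\<^sup>2) / (2*k) + k/2"
    by (rule key[OF _ e2]) (use circle_integrals(2)[OF ball] in \<open>auto simp: w_def\<close>)
  show "r * cmod (Q z) \<le> (M\<^sup>2 - m\<^sup>2) / (2*k) + k/2"
    using key[OF _ e1, of "cnj (Q z)"] circle_integrals(3)[OF ball] by (auto simp: w_def)
qed

text \<open>\<open>gradient_bound\<close> is applied on the disc whose radius is half the distance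
  to the left side; the whole disc is still so close to that side that the modulus is almost \<rho>
  on it.\<close>

lemma gradient_little_o:
  assumes \<rho>: "\<rho> > 0" and lim: "\<And>e. e > 0 \<Longrightarrow> \<exists>d>0. \<forall>z\<in>strip T. Re z < d \<longrightarrow> \<bar>cmod (h z) - \<rho>\<bar> < e"
    and k: "k > 0"
  shows "\<exists>d>0. d < T \<and> (\<forall>z. 0 < Re z \<longrightarrow> Re z \<le> d \<longrightarrow> Re z * cmod (P z) \<le> k \<and> Re z * cmod (Q z) \<le> k)"
proof -
  \<comment> \<open>The disc has radius Re z / 2, which costs a factor 2.\<close>
  define k' where "k' = k/2"
  have k': "k' > 0" using k by (simp add: k'_def)
  \<comment> \<open>The squares of \<rho> + e and \<rho> - e differ by 4 \<rho> e, which has to be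
    at most the square of \<open>k'\<close>.\<close>
  define e where "e = min (\<rho>/2) (k'\<^sup>2 / (4*\<rho>))"
  have e: "e > 0" "e < \<rho>" "4 * \<rho> * e \<le> k'\<^sup>2"
  proof -
    show "e > 0" "e < \<rho>" using \<rho> k' by (auto simp: e_def)
    have "e \<le> k'\<^sup>2 / (4*\<rho>)" by (simp add: e_def)
    then show "4 * \<rho> * e \<le> k'\<^sup>2" using \<rho> by (simp add: field_simps)
  qed
  obtain d where d: "d > 0" "\<And>z. z \<in> strip T \<Longrightarrow> Re z < d \<Longrightarrow> \<bar>cmod (h z) - \<rho>\<bar> < e"
    using lim[OF e(1)] by blast
  define d' where "d' = min d T / 2"
  have d': "0 < d'" "d' < T" "2*d' \<le> d" "2*d' \<le> T" using d T_pos by (auto simp: d'_def)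
  have "Re z * cmod (P z) \<le> k \<and> Re z * cmod (Q z) \<le> k" if z: "0 < Re z" "Re z \<le> d'" for z
  proof -
    define r where "r = Re z / 2"
    have r: "r > 0" using z by (simp add: r_def)
    have b: "0 < Re w \<and> Re w < 2*d'" if "w \<in> cball z r" for w
    proof -
      have "\<bar>Re (w - z)\<bar> \<le> r" using that abs_Re_le_cmod[of "w - z"] by (simp add: dist_norm norm_minus_commute)
      then have "\<bar>Re w - Re z\<bar> \<le> Re z / 2" by (simp add: r_def)
      then show ?thesis using z by linarith
    qed
    have ball: "cball z r \<subseteq> strip T" using b d' by (force simp: strip_def)
    have bd: "\<rho> - e \<le> cmod (h w) \<and> cmod (h w) \<le> \<rho> + e" if "w \<in> cball z r" for w
      using d(2)[of w] b[OF that] d' ball that by (smt (verit) subsetD)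
    have "(\<rho> + e)\<^sup>2 - (\<rho> - e)\<^sup>2 = 4 * \<rho> * e" by (simp add: power2_eq_square algebra_simps)
    then have "((\<rho> + e)\<^sup>2 - (\<rho> - e)\<^sup>2) / (2*k') + k'/2 \<le> k'\<^sup>2/(2*k') + k'/2"
      using e k' by (intro add_right_mono divide_right_mono) auto
    also have "\<dots> = k'" using k' by (simp add: power2_eq_square field_simps)
    finally have le: "((\<rho> + e)\<^sup>2 - (\<rho> - e)\<^sup>2) / (2*k') + k'/2 \<le> k'" .
    show ?thesis
      using gradient_bound[OF ball r k' bd] e le by (simp add: r_def k'_def)
  qed
  then show ?thesis using d' by blast
qed

end

section \<open>Oscillation of maps whose gradient is at most a small multiple of 1/t\<close>

locale strip_gradient = strip_map +
  fixes d \<kappa> :: real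
  assumes d_less: "d < T" and \<kappa>: "0 \<le> \<kappa>"
    and grad: "\<And>z. 0 < Re z \<Longrightarrow> Re z \<le> d \<Longrightarrow> Re z * cmod (P z) \<le> \<kappa> \<and> Re z * cmod (Q z) \<le> \<kappa>"
begin

lemma grad_le:
  assumes "0 < t" "t \<le> d"
  shows "cmod (hmap P Q (Complex t y)) \<le> 2*\<kappa>/t"
    "cmod (hmap (\<lambda>z. \<i> * P z) (\<lambda>z. \<i> * Q z) (Complex t y)) \<le> 2*\<kappa>/t"
    "cmod (hmap (\<lambda>z. -\<i> * P z) (\<lambda>z. -\<i> * Q z) (Complex t y)) \<le> 2*\<kappa>/t"
proof -
  have "t * cmod (P (Complex t y)) \<le> \<kappa>" "t * cmod (Q (Complex t y)) \<le> \<kappa>"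
    using grad[of "Complex t y"] assms by auto
  then have *: "cmod (P (Complex t y)) + cmod (Q (Complex t y)) \<le> 2*\<kappa>/t"
    using assms by (simp add: field_simps)
  show "cmod (hmap P Q (Complex t y)) \<le> 2*\<kappa>/t"
    "cmod (hmap (\<lambda>z. \<i> * P z) (\<lambda>z. \<i> * Q z) (Complex t y)) \<le> 2*\<kappa>/t"
    "cmod (hmap (\<lambda>z. -\<i> * P z) (\<lambda>z. -\<i> * Q z) (Complex t y)) \<le> 2*\<kappa>/t"
    unfolding hmap_def
    by (rule order_trans[OF norm_triangle_ineq], use * in \<open>simp add: norm_mult\<close>)+
qed

lemma h_vertical:
  assumes "0 < t" "t \<le> d" "y \<le> y'"
  shows "cmod (h (Complex t y') - h (Complex t y)) \<le> 2*\<kappa>/t * (y' - y)"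
  by (rule norm_increment_le[OF assms(3) h_th grad_le(2)]) (use assms d_less in auto)

lemma h_horizontal:
  assumes "0 < t" "t \<le> t'" "t' \<le> d"
  shows "cmod (h (Complex t' y) - h (Complex t y)) \<le> 2*\<kappa>/t * (t' - t)"
proof (rule norm_increment_le[OF assms(2) h_t])
  fix x assume x: "t \<le> x" "x \<le> t'"
  then show "0 < x" "x < T" using assms d_less by auto
  have "cmod (hmap P Q (Complex x y)) \<le> 2*\<kappa>/x" by (rule grad_le) (use x assms in auto)
  also have "\<dots> \<le> 2*\<kappa>/t" using x assms \<kappa> by (intro divide_left_mono) auto
  finally show "cmod (hmap P Q (Complex x y)) \<le> 2*\<kappa>/t" .
qed

text \<open>Averages of \<open>h\<close> over vertical segments vary little with the abscissa, because
  their second derivative is a boundary term of order \<open>\<kappa>/t\<close>, which is integrable twice.\<close>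

lemma segment_averages:
  obtains A :: "complex \<Rightarrow> complex"
  where "\<And>b L s \<tau> y. \<lbrakk>0 < s; s \<le> L; L \<le> d; L/2 \<le> \<tau>; \<tau> \<le> L; b \<le> y; y \<le> b + L\<rbrakk> \<Longrightarrow>
     cmod (A (Complex s (b + L)) - A (Complex s b) - of_real L * h (Complex \<tau> y)) \<le> 10 * \<kappa> * L"
proof -
  obtain F2 where F2: "\<And>z. z \<in> strip T \<Longrightarrow> (F2 has_field_derivative F z) (at z)"
    using holomorphic_convex_primitive'[OF convex_strip open_strip F_hol] at_within_open[OF _ open_strip] by metis
  obtain G2 where G2: "\<And>z. z \<in> strip T \<Longrightarrow> (G2 has_field_derivative G z) (at z)"
    using holomorphic_convex_primitive'[OF convex_strip open_strip G_hol] at_within_open[OF _ open_strip] by metis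
  \<comment> \<open>\<open>A\<close> is a vertical antiderivative of \<open>h\<close>, so its
    differences are integrals of \<open>h\<close> over vertical segments; \<open>K\<close> is its
    horizontal derivative. Moving a segment horizontally therefore only involves values of
    \<open>K\<close> at its two ends.\<close>
  define A where "A = hmap (\<lambda>z. -\<i> * F2 z) (\<lambda>z. -\<i> * G2 z)"
  define K where "K = hmap (\<lambda>z. -\<i> * F z) (\<lambda>z. -\<i> * G z)"
  have dF2: "((\<lambda>z. -\<i> * F2 z) has_field_derivative -\<i> * F z) (at z)"
    and dG2: "((\<lambda>z. -\<i> * G2 z) has_field_derivative -\<i> * G z) (at z)" if "z \<in> strip T" for z
    by (rule DERIV_cmult[OF F2[OF that]] DERIV_cmult[OF G2[OF that]])+
  have A_th: "((\<lambda>y. A (Complex t y)) has_vector_derivative h (Complex t y)) (at y)"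
    and A_t: "((\<lambda>t. A (Complex t y)) has_vector_derivative K (Complex t y)) (at t)" if "0 < t" "t < T" for t y
    using hmap_derivative_th[OF dF2 dG2, of t y] hmap_derivative_t[OF dF2 dG2, of t y] that
    by (simp_all add: A_def K_def hmap_def)
  have dFi: "((\<lambda>z. -\<i> * F z) has_field_derivative -\<i> * P z) (at z)"
    and dGi: "((\<lambda>z. -\<i> * G z) has_field_derivative -\<i> * Q z) (at z)" if "z \<in> strip T" for z
    by (rule DERIV_cmult[OF dF[OF that]] DERIV_cmult[OF dG[OF that]])+
  have K_th: "((\<lambda>y. K (Complex t y)) has_vector_derivative hmap P Q (Complex t y)) (at y)"
    and K_t: "((\<lambda>t. K (Complex t y)) has_vector_derivative hmap (\<lambda>z. -\<i> * P z) (\<lambda>z. -\<i> * Q z) (Complex t y)) (at t)"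
    if "0 < t" "t < T" for t y
    using hmap_derivative_th[OF dFi dGi, of t y] hmap_derivative_t[OF dFi dGi, of t y] that
    by (simp_all add: K_def hmap_def)
  show ?thesis
  proof (rule that[of A])
    fix b L s \<tau> y :: real
    assume a: "0 < s" "s \<le> L" "L \<le> d" "L/2 \<le> \<tau>" "\<tau> \<le> L" "b \<le> y" "y \<le> b + L"
    define D where "D t = A (Complex t (b + L)) - A (Complex t b)" for t
    define D' where "D' t = K (Complex t (b + L)) - K (Complex t b)" for t
    define D'' where "D'' t = hmap (\<lambda>z. -\<i> * P z) (\<lambda>z. -\<i> * Q z) (Complex t (b + L)) -
         hmap (\<lambda>z. -\<i> * P z) (\<lambda>z. -\<i> * Q z) (Complex t b)" for t
    have L: "0 < L" "L < T" using a d_less by auto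
    have D: "(D has_vector_derivative D' t) (at t)" and D': "(D' has_vector_derivative D'' t) (at t)"
      if "0 < t" "t < T" for t
      unfolding D_def D'_def D''_def by (intro has_vector_derivative_diff A_t K_t that)+
    have "norm (D' L) \<le> 2*\<kappa>/L * (b + L - b)"
      unfolding D'_def by (rule norm_increment_le[OF _ K_th grad_le(1)]) (use L a in auto)
    then have D'L: "norm (D' L) \<le> 2*\<kappa>" using L by simp
    \<comment> \<open>The second derivative is at most 4\<kappa>/t, so the first one grows at most
      logarithmically towards the boundary, which is integrable.\<close>
    have D't: "norm (D' t) \<le> 2*\<kappa> + 4*\<kappa>*(ln L - ln t)" if t: "s \<le> t" "t \<le> L" for t
    proof (cases "t = L")
      case False
      have "norm (D' L - D' t) \<le> 4*\<kappa>*ln L - 4*\<kappa>*ln t"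
      proof (rule differentiable_bound_general[of t L D' "\<lambda>x. 4*\<kappa>*ln x" D'' "\<lambda>x. 4*\<kappa>/x"])
        show "continuous_on {t..L} D'"
          by (rule continuous_on_vector_derivative_at, rule D') (use t a L in auto)
        show "continuous_on {t..L} (\<lambda>x. 4*\<kappa>*ln x)"
          using t a by (intro continuous_intros) auto
        fix x assume x: "t < x" "x < L"
        show "(D' has_vector_derivative D'' x) (at x)" by (rule D') (use x t a L in auto)
        show "((\<lambda>x. 4*\<kappa>*ln x) has_vector_derivative 4*\<kappa>/x) (at x)"
          unfolding has_real_derivative_iff_has_vector_derivative[symmetric]
          using x t a by (auto intro!: derivative_eq_intros)
        have "norm (D'' x) \<le> 2*\<kappa>/x + 2*\<kappa>/x"
          unfolding D''_def by (rule order_trans[OF norm_triangle_ineq4 add_mono[OF grad_le(3) grad_le(3)]]) (use x t a in auto)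
        then show "norm (D'' x) \<le> 4*\<kappa>/x" by simp
      qed (use False t in simp)
      then show ?thesis using D'L norm_triangle_ineq2[of "D' t" "D' L"]
        by (simp add: norm_minus_commute algebra_simps)
    qed (use D'L in simp)
    have DLs: "norm (D L - D s) \<le> 6*\<kappa>*L"
    proof (cases "s = L")
      case False
      \<comment> \<open>A primitive of the logarithmic bound. Its increment stays below 6\<kappa>L
        however small \<open>s\<close> is.\<close>
      define \<phi> where "\<phi> t = 2*\<kappa>*t + 4*\<kappa>*(t * ln L - t * ln t + t)" for t
      have "norm (D L - D s) \<le> \<phi> L - \<phi> s"
      proof (rule differentiable_bound_general[of s L D \<phi> D' "\<lambda>x. 2*\<kappa> + 4*\<kappa>*(ln L - ln x)"])
        show "continuous_on {s..L} D"
          by (rule continuous_on_vector_derivative_at, rule D) (use a L in auto)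
        show "continuous_on {s..L} \<phi>"
          unfolding \<phi>_def using a by (intro continuous_intros) auto
        fix x assume x: "s < x" "x < L"
        show "(D has_vector_derivative D' x) (at x)" by (rule D) (use x a L in auto)
        show "(\<phi> has_vector_derivative 2*\<kappa> + 4*\<kappa>*(ln L - ln x)) (at x)"
          unfolding has_real_derivative_iff_has_vector_derivative[symmetric] \<phi>_def
          using x a by (auto intro!: derivative_eq_intros simp: algebra_simps)
        show "norm (D' x) \<le> 2*\<kappa> + 4*\<kappa>*(ln L - ln x)" by (rule D't) (use x in auto)
      qed (use False a in simp)
      also have "\<phi> L - \<phi> s = 6*\<kappa>*L - (2*\<kappa> * s + 4*\<kappa>*(s * (ln L - ln s) + s))"
        by (simp add: \<phi>_def algebra_simps)
      also have "\<dots> \<le> 6*\<kappa>*L"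
      proof -
        have "0 \<le> ln L - ln s" using a by simp
        then have "0 \<le> 4*\<kappa>*(s * (ln L - ln s) + s)"
          using \<kappa> a(1) by (intro mult_nonneg_nonneg add_nonneg_nonneg) auto
        moreover have "0 \<le> 2*\<kappa> * s" using \<kappa> a(1) by simp
        ultimately show ?thesis by linarith
      qed
      finally show ?thesis .
    qed (use \<kappa> L in simp)
    have hL: "cmod (h (Complex L y') - h (Complex L y)) \<le> 2*\<kappa>" if "b \<le> y'" "y' \<le> b + L" for y'
    proof -
      have "cmod (h (Complex L y') - h (Complex L y)) \<le> 2*\<kappa>/L * \<bar>y' - y\<bar>"
        using h_vertical[of L y y'] h_vertical[of L y' y] L a
        by (cases "y \<le> y'") (auto simp: norm_minus_commute)
      also have "\<dots> \<le> 2*\<kappa>/L * L" using that a L \<kappa> by (intro mult_left_mono) auto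
      finally show ?thesis using L by simp
    qed
    define E where "E x = A (Complex L x) - of_real x * h (Complex L y)" for x
    have "norm (E (b + L) - E b) \<le> 2*\<kappa>*(b + L - b)"
    proof (rule norm_increment_le)
      fix x assume x: "b \<le> x" "x \<le> b + L"
      show "(E has_vector_derivative (h (Complex L x) - h (Complex L y))) (at x)"
        unfolding E_def using L
        by (auto intro!: derivative_eq_intros A_th)
      show "norm (h (Complex L x) - h (Complex L y)) \<le> 2*\<kappa>" by (rule hL[OF x])
    qed (use L in simp)
    then have E: "norm (D L - of_real L * h (Complex L y)) \<le> 2*\<kappa>*L"
      by (simp add: E_def D_def algebra_simps)
    have \<tau>0: "0 < \<tau>" using a by linarith
    have "cmod (h (Complex L y) - h (Complex \<tau> y)) \<le> 2*\<kappa>/\<tau> * (L - \<tau>)"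
      by (rule h_horizontal) (use a \<tau>0 in auto)
    also have "\<dots> \<le> 2*\<kappa>/\<tau> * \<tau>" using a \<tau>0 \<kappa> by (intro mult_left_mono) auto
    finally have "cmod (h (Complex L y) - h (Complex \<tau> y)) \<le> 2*\<kappa>" using \<tau>0 by simp
    then have "L * cmod (h (Complex L y) - h (Complex \<tau> y)) \<le> L * (2*\<kappa>)"
      using L by (intro mult_left_mono) auto
    then have H: "norm (of_real L * h (Complex L y) - of_real L * h (Complex \<tau> y)) \<le> 2*\<kappa>*L"
      unfolding right_diff_distrib[symmetric] norm_mult using L by (simp add: mult.commute mult.left_commute)
    \<comment> \<open>The three errors are 6\<kappa>L for moving the segment from abscissa
      \<open>s\<close> to \<open>L\<close>, 2\<kappa>L for replacing the average there by the value
      at \<open>y\<close>, and 2\<kappa>L for moving that value from \<open>L\<close> to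
      \<tau>.\<close>
    have "D s - of_real L * h (Complex \<tau> y) = - (D L - D s) + (D L - of_real L * h (Complex L y))
       + (of_real L * h (Complex L y) - of_real L * h (Complex \<tau> y))" by simp
    also have "norm \<dots> \<le> norm (- (D L - D s)) + norm (D L - of_real L * h (Complex L y))
       + norm (of_real L * h (Complex L y) - of_real L * h (Complex \<tau> y))"
      by (meson add_mono_thms_linordered_semiring(3) norm_triangle_ineq order_trans)
    finally show "cmod (A (Complex s (b + L)) - A (Complex s b) - of_real L * h (Complex \<tau> y)) \<le> 10 * \<kappa> * L"
      using DLs E H unfolding D_def[symmetric] norm_minus_cancel by linarith
  qed
qed

text \<open>Halving the segment repeatedly and always keeping the half with the larger average
  leads to an ordinate at which \<open>h\<close> hardly moves on its way to the boundary.\<close>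

lemma nearly_constant_path:
  assumes t: "0 < t" "t \<le> d" and \<omega>: "cmod \<omega> \<le> 1"
  shows "\<exists>y. y0 \<le> y \<and> y \<le> y0 + t \<and>
    (\<forall>\<tau>. t/2^n \<le> \<tau> \<longrightarrow> \<tau> \<le> t \<longrightarrow> Re (\<omega> * h (Complex \<tau> y)) \<ge> Re (\<omega> * h (Complex t y0)) - 20*\<kappa>)"
proof -
  obtain A where A: "\<And>b L s \<tau> y. \<lbrakk>0 < s; s \<le> L; L \<le> d; L/2 \<le> \<tau>; \<tau> \<le> L; b \<le> y; y \<le> b + L\<rbrakk> \<Longrightarrow>
     cmod (A (Complex s (b + L)) - A (Complex s b) - of_real L * h (Complex \<tau> y)) \<le> 10 * \<kappa> * L"
    using segment_averages by blast
  \<comment> \<open>All averages are taken at this one finest abscissa, whatever the length of the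
    segment. This makes them additive under halving.\<close>
  define s where "s = t/2^n"
  have s: "0 < s" "2^n * s = t" using t by (auto simp: s_def)
  define m where "m b L = Re (\<omega> * (A (Complex s (b + L)) - A (Complex s b)))" for b L
  have mA: "\<bar>m b L - L * Re (\<omega> * h (Complex \<tau> y))\<bar> \<le> 10 * \<kappa> * L"
    if "s \<le> L" "L \<le> d" "L/2 \<le> \<tau>" "\<tau> \<le> L" "b \<le> y" "y \<le> b + L" for b L \<tau> y
  proof -
    have "m b L - L * Re (\<omega> * h (Complex \<tau> y)) =
        Re (\<omega> * (A (Complex s (b + L)) - A (Complex s b) - of_real L * h (Complex \<tau> y)))"
      by (simp add: m_def algebra_simps)
    also have "\<bar>\<dots>\<bar> \<le> cmod \<omega> * cmod (A (Complex s (b + L)) - A (Complex s b) - of_real L * h (Complex \<tau> y))"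
      by (metis abs_Re_le_cmod norm_mult)
    also have "\<dots> \<le> 1 * (10 * \<kappa> * L)" using \<omega> A[OF s(1) that] by (intro mult_mono) auto
    finally show ?thesis by simp
  qed
  have greedy: "k \<le> n \<Longrightarrow> \<exists>y. b \<le> y \<and> y \<le> b + 2^k * s \<and>
     (\<forall>\<tau>. s \<le> \<tau> \<longrightarrow> \<tau> \<le> 2^k * s \<longrightarrow> 2^k * s * Re (\<omega> * h (Complex \<tau> y)) \<ge> m b (2^k * s) - 10*\<kappa>*(2^k * s))" for k b
  proof (induction k arbitrary: b)
    case 0
    have "1 * s \<le> 2^n * s" using s(1) by (intro mult_right_mono) auto
    then have "s \<le> d" using s t by linarith
    then show ?case using mA[of s s b b] s by (intro exI[of _ b]) (auto simp: abs_le_iff)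
  next
    case (Suc k)
    define M where "M = 2^k * s"
    have M: "0 < M" "s \<le> M" "2^(Suc k) * s = 2*M" using s by (auto simp: M_def)
    have "2^(Suc k) * s \<le> 2^n * s" using Suc.prems s by (intro mult_right_mono power_increasing) auto
    then have Md: "2*M \<le> d" using M s t by linarith
    \<comment> \<open>Exact additivity means that the better half has at least half of the total, so
      halving loses nothing.\<close>
    have split: "m b (2*M) = m b M + m (b + M) M"
      by (simp add: m_def algebra_simps)
    obtain b' where b': "b' = b \<or> b' = b + M" "m b (2*M) \<le> 2 * m b' M"
    proof (cases "m b M \<le> m (b + M) M")
      case True then show ?thesis using that[of "b + M"] split by simp
    next
      case False then show ?thesis using that[of b] split by simp
    qed
    obtain y where y: "b' \<le> y" "y \<le> b' + M"
      "\<And>\<tau>. s \<le> \<tau> \<Longrightarrow> \<tau> \<le> M \<Longrightarrow> M * Re (\<omega> * h (Complex \<tau> y)) \<ge> m b' M - 10*\<kappa>*M"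
      using Suc.IH[of b'] Suc.prems unfolding M_def by auto
    have "2*M * Re (\<omega> * h (Complex \<tau> y)) \<ge> m b (2*M) - 10*\<kappa>*(2*M)" if "s \<le> \<tau>" "\<tau> \<le> 2*M" for \<tau>
    proof (cases "\<tau> \<le> M")
      case True
      then show ?thesis using y(3)[OF that(1) True] b'(2) by simp
    next
      case False
      then show ?thesis using mA[of "2*M" \<tau> b y] that y(1,2) b'(1) M Md by (auto simp: abs_le_iff)
    qed
    then show ?case unfolding M(3) using y(1,2) b'(1) M(1) by (intro exI[of _ y]) auto
  qed
  obtain y where y: "y0 \<le> y" "y \<le> y0 + t"
     "\<And>\<tau>. s \<le> \<tau> \<Longrightarrow> \<tau> \<le> t \<Longrightarrow> t * Re (\<omega> * h (Complex \<tau> y)) \<ge> m y0 t - 10*\<kappa>*t"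
    using greedy[of n y0] unfolding s(2) by auto
  have "1 * s \<le> 2^n * s" using s(1) by (intro mult_right_mono) auto
  then have "s \<le> t" using s(2) by linarith
  then have "\<bar>m y0 t - t * Re (\<omega> * h (Complex t y0))\<bar> \<le> 10 * \<kappa> * t"
    using t by (intro mA) auto
  \<comment> \<open>Errors occur only twice, however many scales there are: 10\<kappa> from the
    value at (t, y0) to the average over the full segment, and 10\<kappa> from an average at the
    scale of \<tau> back to a value.\<close>
  then have "t * Re (\<omega> * h (Complex \<tau> y)) \<ge> t * (Re (\<omega> * h (Complex t y0)) - 20*\<kappa>)" if "s \<le> \<tau>" "\<tau> \<le> t" for \<tau>
    using y(3)[OF that] by (simp add: algebra_simps abs_le_iff)
  then have "Re (\<omega> * h (Complex \<tau> y)) \<ge> Re (\<omega> * h (Complex t y0)) - 20*\<kappa>" if "s \<le> \<tau>" "\<tau> \<le> t" for \<tau>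
    using that t by (meson mult_le_cancel_left_pos)
  then show ?thesis using y(1,2) unfolding s_def by blast
qed

end

section \<open>Almost monotone boundary argument\<close>

text \<open>By continuity \<open>l y - l x\<close> has imaginary part in (-\<pi>, \<pi>) near
  \<open>x\<close>, so there \<open>l y\<close> is \<open>l x\<close> plus the principal logarithm
  of \<open>g y / g x\<close>, and the chain rule applies.\<close>

lemma log_lift_derivative:
  fixes l g :: "real \<Rightarrow> complex"
  assumes "isCont l x" and "\<forall>\<^sub>F y in nhds x. exp (l y) = g y"
    and g: "(g has_vector_derivative g') (at x)"
  shows "(l has_vector_derivative g' / g x) (at x)"
proof -
  have gx: "g x = exp (l x)" using eventually_nhds_x_imp_x[OF assms(2)] by simp
  then have gnz: "g x \<noteq> 0" by simp
  have "((\<lambda>y. g y / g x) has_vector_derivative g' / g x) (at x)"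
    using has_vector_derivative_mult_left[OF g, of "inverse (g x)"] by (simp add: divide_inverse)
  moreover have "(Ln has_field_derivative 1) (at (g x / g x))"
    using has_field_derivative_Ln[of 1] gnz by simp
  ultimately have "((Ln \<circ> (\<lambda>y. g y / g x)) has_vector_derivative g' / g x * 1) (at x)"
    by (rule field_vector_diff_chain_at)
  then have "((\<lambda>y. l x + Ln (g y / g x)) has_vector_derivative g' / g x) (at x)"
    by (auto simp: o_def intro!: derivative_eq_intros)
  moreover have "\<forall>\<^sub>F y in nhds x. l x + Ln (g y / g x) = l y"
  proof -
    have "\<forall>\<^sub>F y in nhds x. dist (l y) (l x) < pi"
      using assms(1) pi_gt_zero
      by (simp add: isCont_def tendsto_iff eventually_nhds_conv_at)
    then show ?thesis using assms(2)
    proof eventually_elim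
      case (elim y)
      have "\<bar>Im (l y - l x)\<bar> < pi"
        using elim(1) abs_Im_le_cmod[of "l y - l x"] by (simp add: dist_norm)
      then have "Ln (exp (l y - l x)) = l y - l x" by (intro Ln_exp) auto
      then show ?case using elim(2) gx by (simp add: exp_diff)
    qed
  qed
  ultimately show ?thesis
    using has_vector_derivative_cong_ev[where f="\<lambda>y. l x + Ln (g y / g x)" and g=l and x=x and S=UNIV]
      eventually_nhds_x_imp_x[of "\<lambda>y. l x + Ln (g y / g x) = l y" x]
    by simp
qed

text \<open>The exponential stays in a disc about 1 inside the right half plane, so the angle, which
  starts at 0 for \<open>x = t\<close>, can never reach \<pi>/2 or -\<pi>/2. Hence it is the
  principal one, and Ln(1 + w) is at most 2|w| in modulus.\<close>

lemma lift_angle_small: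
  fixes l :: "real \<Rightarrow> complex"
  assumes cont: "continuous_on {s..t} l" and st: "s \<le> t" and q: "q < 1/2"
    and near: "\<And>x. x \<in> {s..t} \<Longrightarrow> cmod (exp (l x - l t) - 1) \<le> q"
  shows "\<bar>Im (l s) - Im (l t)\<bar> \<le> 2 * q"
proof -
  define D where "D x = Im (l x) - Im (l t)" for x
  have contD: "continuous_on {s..t} D" unfolding D_def by (intro continuous_intros cont)
  have pos: "cos (D x) > 0" if "x \<in> {s..t}" for x
  proof -
    have "\<bar>Re (exp (l x - l t) - 1)\<bar> < 1/2"
      using near[OF that] q abs_Re_le_cmod[of "exp (l x - l t) - 1"] by linarith
    then have "Re (exp (l x - l t)) > 0" unfolding minus_complex.sel one_complex.sel by linarith
    then show ?thesis by (simp add: Re_exp D_def zero_less_mult_iff)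
  qed
  have "\<bar>D s\<bar> < pi/2"
  proof (rule ccontr)
    assume "\<not> \<bar>D s\<bar> < pi/2"
    then consider "D s \<ge> pi/2" | "D s \<le> -pi/2" by linarith
    then show False
    proof cases
      case 1
      then obtain x where "x \<in> {s..t}" "D x = pi/2"
        using IVT2'[of D t "pi/2" s] contD st pi_gt_zero by (auto simp: D_def)
      moreover from this have "cos (D x) = 0" by (simp only: cos_pi_half)
      ultimately show False using pos[of x] by simp
    next
      case 2
      then obtain x where "x \<in> {s..t}" "D x = - (pi/2)"
        using IVT'[of D s "- (pi/2)" t] contD st pi_gt_zero by (auto simp: D_def)
      moreover from this have "cos (D x) = 0" by (simp only: cos_minus cos_pi_half)
      ultimately show False using pos[of x] by simp
    qed
  qed
  then have D: "\<bar>Im (l s - l t)\<bar> < pi/2" by (simp add: D_def)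
  have n: "cmod (exp (l s - l t) - 1) \<le> q" using near st by simp
  have "- pi < Im (l s - l t)" "Im (l s - l t) \<le> pi" using D pi_gt_zero by linarith+
  then have "Ln (1 + (exp (l s - l t) - 1)) = l s - l t" by (simp add: Ln_exp)
  moreover have "cmod (Ln (1 + (exp (l s - l t) - 1))) \<le> 2 * cmod (exp (l s - l t) - 1)"
    by (rule norm_Ln_le) (use n q in linarith)
  ultimately have "cmod (l s - l t) \<le> 2 * q" using n by simp
  then show ?thesis using abs_Im_le_cmod[of "l s - l t"] by simp
qed

lemma norm_square_derivative:
  fixes f :: "real \<Rightarrow> complex"
  assumes "(f has_vector_derivative f') (at x)"
  shows "((\<lambda>x. (cmod (f x))\<^sup>2) has_real_derivative 2 * Re (cnj (f x) * f')) (at x)"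
proof -
  have "((\<lambda>x. Re (f x)) has_real_derivative Re f') (at x)" "((\<lambda>x. Im (f x)) has_real_derivative Im f') (at x)"
    unfolding has_real_derivative_iff_has_vector_derivative
    by (rule bounded_linear.has_vector_derivative[OF bounded_linear_Re assms]
          bounded_linear.has_vector_derivative[OF bounded_linear_Im assms])+
  from DERIV_add[OF this[THEN DERIV_power, of 2]] show ?thesis
    unfolding cmod_power2 by (simp add: algebra_simps)
qed

locale strip_lift = strip_map +
  fixes L :: "complex \<Rightarrow> complex"
  assumes L_cont: "continuous_on (strip T) L" and exp_L: "\<And>z. z \<in> strip T \<Longrightarrow> exp (L z) = h z"
begin

abbreviation "\<eta> z \<equiv> Im (L z)"
abbreviation "ht \<equiv> hmap P Q"
abbreviation "hth \<equiv> hmap (\<lambda>z. \<i> * P z) (\<lambda>z. \<i> * Q z)"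
abbreviation "htth \<equiv> hmap (\<lambda>z. \<i> * deriv P z) (\<lambda>z. \<i> * deriv Q z)"
abbreviation "J z \<equiv> (cmod (P z))\<^sup>2 - (cmod (Q z))\<^sup>2"

lemma h_nz: "z \<in> strip T \<Longrightarrow> h z \<noteq> 0"
  using exp_L by (metis exp_not_eq_zero)

lemma L_derivatives:
  assumes "0 < t" "t < T"
  shows "((\<lambda>x. L (Complex x y)) has_vector_derivative ht (Complex t y) / h (Complex t y)) (at t)"
    "((\<lambda>y. L (Complex t y)) has_vector_derivative hth (Complex t y) / h (Complex t y)) (at y)"
proof -
  have z: "Complex t y \<in> strip T" using assms by simp
  have c: "isCont L (Complex t y)"
    using L_cont open_strip z continuous_on_eq_continuous_at by blast
  have c1: "isCont (\<lambda>x. Complex x y) t" and c2: "isCont (Complex t) y"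
    using has_vector_derivative_Complex has_vector_derivative_continuous by blast+
  show "((\<lambda>x. L (Complex x y)) has_vector_derivative ht (Complex t y) / h (Complex t y)) (at t)"
  proof (rule log_lift_derivative[OF _ _ h_t[OF assms]])
    show "isCont (\<lambda>x. L (Complex x y)) t"
      using continuous_within_compose3[OF c c1] by simp
    have "\<forall>\<^sub>F x in nhds t. x \<in> {0<..<T}"
      by (rule eventually_nhds_in_open) (use assms in auto)
    then show "\<forall>\<^sub>F x in nhds t. exp (L (Complex x y)) = h (Complex x y)"
      by eventually_elim (simp add: exp_L)
  qed
  show "((\<lambda>y. L (Complex t y)) has_vector_derivative hth (Complex t y) / h (Complex t y)) (at y)"
  proof (rule log_lift_derivative[OF _ _ h_th[OF assms]])
    show "isCont (\<lambda>y. L (Complex t y)) y"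
      using continuous_within_compose3[OF c c2] by simp
    show "\<forall>\<^sub>F y in nhds y. exp (L (Complex t y)) = h (Complex t y)"
      using assms by (intro always_eventually) (simp add: exp_L)
  qed
qed

lemma vd_Im: "(f has_vector_derivative f') (at x) \<Longrightarrow> ((\<lambda>x. Im (f x)) has_real_derivative Im f') (at x)"
  for f :: "real \<Rightarrow> complex"
  unfolding has_real_derivative_iff_has_vector_derivative
  by (rule bounded_linear.has_vector_derivative[OF bounded_linear_Im])

lemma eta_derivatives:
  assumes "0 < t" "t < T"
  shows "((\<lambda>x. \<eta> (Complex x y)) has_real_derivative Im (ht (Complex t y) / h (Complex t y))) (at t)"
    "((\<lambda>y. \<eta> (Complex t y)) has_real_derivative Im (hth (Complex t y) / h (Complex t y))) (at y)"
  using L_derivatives[OF assms] by (auto intro: vd_Im)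

lemma hol_i: "(\<lambda>z. \<i> * f z) holomorphic_on A" if "f holomorphic_on A" for f A
  using that by (intro holomorphic_intros)

lemma cont_hmap: "f holomorphic_on strip T \<Longrightarrow> g holomorphic_on strip T \<Longrightarrow> continuous_on (strip T) (hmap f g)"
  unfolding hmap_def by (intro continuous_intros cont_hol)

lemma cont_parts:
  "continuous_on (strip T) ht" "continuous_on (strip T) hth" "continuous_on (strip T) htth"
  using P_hol Q_hol open_strip by (auto intro!: cont_hmap hol_i holomorphic_deriv)

text \<open>\<open>m\<close> is the mixed second derivative of the logarithm of \<open>h\<close>.
  That both orders of differentiation give it says that the differential of the argument is closed,
  as Stokes' theorem requires.\<close>

lemma mixed_derivatives:
  assumes "0 < t" "t < T"
  defines "m \<equiv> \<lambda>z. (htth z * h z - ht z * hth z) / (h z)\<^sup>2"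
  shows "((\<lambda>x. Im (hth (Complex x y) / h (Complex x y))) has_real_derivative Im (m (Complex t y))) (at t)"
    "((\<lambda>y. Im (ht (Complex t y) / h (Complex t y))) has_real_derivative Im (m (Complex t y))) (at y)"
proof -
  have z: "Complex t y \<in> strip T" using assms by simp
  have P: "(P has_field_derivative deriv P (Complex t y)) (at (Complex t y))"
    and Q: "(Q has_field_derivative deriv Q (Complex t y)) (at (Complex t y))"
    using dP[OF z] dQ[OF z] .
  have quot: "((\<lambda>x. f x / g x) has_vector_derivative (f' * g x - f x * g') / (g x)\<^sup>2) (at x)"
    if "(f has_vector_derivative f') (at x)" "(g has_vector_derivative g') (at x)" "g x \<noteq> 0"
    for f g :: "real \<Rightarrow> complex" and f' g' x
  proof -
    have "((\<lambda>x. inverse (g x)) has_vector_derivative g' * (- (inverse (g x) * inverse (g x)))) (at x)"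
      using field_vector_diff_chain_at[OF that(2) DERIV_inverse'[OF DERIV_ident that(3)]]
      by (simp add: o_def)
    from has_vector_derivative_mult[OF that(1) this] show ?thesis
      using that(3) by (simp add: divide_inverse power2_eq_square algebra_simps)
  qed
  have "((\<lambda>x. hth (Complex x y)) has_vector_derivative htth (Complex t y)) (at t)"
    using hmap_derivative_t[OF DERIV_cmult[OF P, of \<i>] DERIV_cmult[OF Q, of \<i>]] by (simp add: hmap_def)
  from quot[OF this h_t[OF assms(1,2)] h_nz[OF z]]
  show "((\<lambda>x. Im (hth (Complex x y) / h (Complex x y))) has_real_derivative Im (m (Complex t y))) (at t)"
    unfolding m_def by (intro vd_Im) (simp add: mult.commute)
  have "((\<lambda>y. ht (Complex t y)) has_vector_derivative htth (Complex t y)) (at y)"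
    using hmap_derivative_th[OF P Q] by (simp add: hmap_def)
  from quot[OF this h_th[OF assms(1,2)] h_nz[OF z]]
  show "((\<lambda>y. Im (ht (Complex t y) / h (Complex t y))) has_real_derivative Im (m (Complex t y))) (at y)"
    unfolding m_def by (intro vd_Im) simp
qed

lemma square_derivatives:
  assumes "0 < t" "t < T"
  shows "((\<lambda>x. (cmod (h (Complex x y)))\<^sup>2) has_real_derivative 2 * Re (cnj (h (Complex t y)) * ht (Complex t y))) (at t)"
    "((\<lambda>y. (cmod (h (Complex t y)))\<^sup>2) has_real_derivative 2 * Re (cnj (h (Complex t y)) * hth (Complex t y))) (at y)"
  by (rule norm_square_derivative[OF h_t[OF assms]], rule norm_square_derivative[OF h_th[OF assms]])

text \<open>In polar coordinates the area form is half of d(\<bar>h\<bar>^2) \<and> d\<eta>, and its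
  pull-back under \<open>h\<close> has density \<open>J\<close>.\<close>

lemma jacobian_polar:
  assumes "z \<in> strip T"
  shows "2 * Re (cnj (h z) * ht z) * Im (hth z / h z) - 2 * Re (cnj (h z) * hth z) * Im (ht z / h z) = 2 * J z"
proof -
  have nz: "h z \<noteq> 0" by (rule h_nz[OF assms])
  have gen: "2 * Re (cnj w * (a * w)) * Im b - 2 * Re (cnj w * (b * w)) * Im a = 2 * Im (cnj (a * w) * (b * w))" for a b w
    by (simp add: algebra_simps)
  have "2 * Re (cnj (h z) * ht z) * Im (hth z / h z) - 2 * Re (cnj (h z) * hth z) * Im (ht z / h z) = 2 * Im (cnj (ht z) * hth z)"
    using gen[of "h z" "ht z / h z" "hth z / h z"] nz by simp
  also have "\<dots> = 2 * J z"
    unfolding cmod_power2 by (simp add: hmap_def algebra_simps power2_eq_square)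
  finally show ?thesis .
qed

lemma cont_rect:
  assumes "continuous_on (strip T) f" "0 < s" "t < T"
  shows "continuous_on ({s..t} \<times> {a..b}) (\<lambda>p. f (Complex (fst p) (snd p)))"
proof (rule continuous_on_compose2[OF assms(1)])
  show "continuous_on ({s..t} \<times> {a..b}) (\<lambda>p. Complex (fst p) (snd p))"
    unfolding Complex_eq by (intro continuous_intros)
qed (use assms in auto)

lemma cont_line:
  assumes "continuous_on (strip T) f" "0 < t" "t < T"
  shows "continuous_on A (\<lambda>y. f (Complex t y))"
proof (rule continuous_on_compose2[OF assms(1)])
  show "continuous_on A (Complex t)"
    using has_vector_derivative_Complex(2) by (rule continuous_on_vector_derivative_at)
qed (use assms in auto)

text \<open>The form \<open>a(\<bar>h\<bar>\<^sup>2) B(\<eta>) d\<eta>\<close> has exterior derivative \<open>2 a' B J dt d\<theta>\<close>.\<close>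

lemma polar_stokes:
  fixes a a' B B' :: "real \<Rightarrow> real"
  assumes st: "0 < s" "s < t" "t < T" and y: "y1 < y2"
    and a: "\<And>u. (a has_real_derivative a' u) (at u)" "continuous_on UNIV a'"
    and B: "\<And>u. (B has_real_derivative B' u) (at u)" "continuous_on UNIV B'"
    and sgn: "\<And>z. z \<in> strip T \<Longrightarrow> a' ((cmod (h z))\<^sup>2) * B (\<eta> z) * J z \<ge> 0"
    and sides: "\<And>\<tau>. \<tau> \<in> {s..t} \<Longrightarrow>
       a ((cmod (h (Complex \<tau> y2)))\<^sup>2) * (B (\<eta> (Complex \<tau> y2)) * Im (ht (Complex \<tau> y2) / h (Complex \<tau> y2))) =
       a ((cmod (h (Complex \<tau> y1)))\<^sup>2) * (B (\<eta> (Complex \<tau> y1)) * Im (ht (Complex \<tau> y1) / h (Complex \<tau> y1)))"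
  shows "integral {y1..y2} (\<lambda>y. a ((cmod (h (Complex s y)))\<^sup>2) * (B (\<eta> (Complex s y)) * Im (hth (Complex s y) / h (Complex s y))))
       \<le> integral {y1..y2} (\<lambda>y. a ((cmod (h (Complex t y)))\<^sup>2) * (B (\<eta> (Complex t y)) * Im (hth (Complex t y) / h (Complex t y))))"
proof -
  define m where "m z = (htth z * h z - ht z * hth z) / (h z)\<^sup>2" for z
  have conta: "continuous_on UNIV a" and contB: "continuous_on UNIV B"
    using a(1) B(1) by (meson DERIV_isCont continuous_at_imp_continuous_on)+
  note C = cont_h cont_parts L_cont
  have c2: "continuous_on (strip T) (\<lambda>z. f ((cmod (h z))\<^sup>2))" if "continuous_on UNIV f" for f :: "real \<Rightarrow> real"
    by (rule continuous_on_compose2[OF that]) (auto intro!: continuous_intros C)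
  have ce: "continuous_on (strip T) (\<lambda>z. f (\<eta> z))" if "continuous_on UNIV f" for f :: "real \<Rightarrow> real"
    by (rule continuous_on_compose2[OF that]) (auto intro!: continuous_intros C)
  have cm: "continuous_on (strip T) m"
    unfolding m_def by (intro continuous_intros C) (use h_nz in auto)
  have cq: "continuous_on (strip T) (\<lambda>z. Im (ht z / h z))" "continuous_on (strip T) (\<lambda>z. Im (hth z / h z))"
    by (intro continuous_intros C, use h_nz in auto)+
  \<comment> \<open>\<alpha> is the function of the squared modulus, and \<beta>t, \<beta>h are the
    components of B(\<eta>) d\<eta>. This form is closed for every \<open>B\<close>, so its
    components share the derivative passed as \<open>m\<close>.\<close>
  show ?thesis
  proof (rule stokes_rectangle_mono[where s=s and t=t and a=y1 and b=y2
      and \<alpha> = "\<lambda>x y. a ((cmod (h (Complex x y)))\<^sup>2)"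
      and \<alpha>t = "\<lambda>x y. a' ((cmod (h (Complex x y)))\<^sup>2) * (2 * Re (cnj (h (Complex x y)) * ht (Complex x y)))"
      and \<alpha>h = "\<lambda>x y. a' ((cmod (h (Complex x y)))\<^sup>2) * (2 * Re (cnj (h (Complex x y)) * hth (Complex x y)))"
      and \<beta>t = "\<lambda>x y. B (\<eta> (Complex x y)) * Im (ht (Complex x y) / h (Complex x y))"
      and \<beta>h = "\<lambda>x y. B (\<eta> (Complex x y)) * Im (hth (Complex x y) / h (Complex x y))"
      and m = "\<lambda>x y. B' (\<eta> (Complex x y)) * Im (ht (Complex x y) / h (Complex x y)) * Im (hth (Complex x y) / h (Complex x y))
                  + Im (m (Complex x y)) * B (\<eta> (Complex x y))"])
    fix \<tau> \<theta> assume "\<tau> \<in> {s..t}" "\<theta> \<in> {y1..y2}"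
    then have \<tau>: "0 < \<tau>" "\<tau> < T" using st by auto
    have z: "Complex \<tau> \<theta> \<in> strip T" using \<tau> by simp
    show "((\<lambda>x. a ((cmod (h (Complex x \<theta>)))\<^sup>2)) has_real_derivative
        a' ((cmod (h (Complex \<tau> \<theta>)))\<^sup>2) * (2 * Re (cnj (h (Complex \<tau> \<theta>)) * ht (Complex \<tau> \<theta>)))) (at \<tau>)"
      by (rule DERIV_chain2[OF a(1) square_derivatives(1)[OF \<tau>]])
    show "((\<lambda>y. a ((cmod (h (Complex \<tau> y)))\<^sup>2)) has_real_derivative
        a' ((cmod (h (Complex \<tau> \<theta>)))\<^sup>2) * (2 * Re (cnj (h (Complex \<tau> \<theta>)) * hth (Complex \<tau> \<theta>)))) (at \<theta>)"
      by (rule DERIV_chain2[OF a(1) square_derivatives(2)[OF \<tau>]])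
    show "((\<lambda>x. B (\<eta> (Complex x \<theta>)) * Im (hth (Complex x \<theta>) / h (Complex x \<theta>))) has_real_derivative
       B' (\<eta> (Complex \<tau> \<theta>)) * Im (ht (Complex \<tau> \<theta>) / h (Complex \<tau> \<theta>)) * Im (hth (Complex \<tau> \<theta>) / h (Complex \<tau> \<theta>))
                  + Im (m (Complex \<tau> \<theta>)) * B (\<eta> (Complex \<tau> \<theta>))) (at \<tau>)"
      unfolding m_def
      by (rule DERIV_mult[OF DERIV_chain2[OF B(1) eta_derivatives(1)[OF \<tau>]] mixed_derivatives(1)[OF \<tau>]])
    have "((\<lambda>y. B (\<eta> (Complex \<tau> y)) * Im (ht (Complex \<tau> y) / h (Complex \<tau> y))) has_real_derivative
       B' (\<eta> (Complex \<tau> \<theta>)) * Im (hth (Complex \<tau> \<theta>) / h (Complex \<tau> \<theta>)) * Im (ht (Complex \<tau> \<theta>) / h (Complex \<tau> \<theta>))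
                  + Im (m (Complex \<tau> \<theta>)) * B (\<eta> (Complex \<tau> \<theta>))) (at \<theta>)"
      unfolding m_def
      by (rule DERIV_mult[OF DERIV_chain2[OF B(1) eta_derivatives(2)[OF \<tau>]] mixed_derivatives(2)[OF \<tau>]])
    then show "((\<lambda>y. B (\<eta> (Complex \<tau> y)) * Im (ht (Complex \<tau> y) / h (Complex \<tau> y))) has_real_derivative
       B' (\<eta> (Complex \<tau> \<theta>)) * Im (ht (Complex \<tau> \<theta>) / h (Complex \<tau> \<theta>)) * Im (hth (Complex \<tau> \<theta>) / h (Complex \<tau> \<theta>))
                  + Im (m (Complex \<tau> \<theta>)) * B (\<eta> (Complex \<tau> \<theta>))) (at \<theta>)"
      by (simp only: mult.assoc mult.commute[of "Im (hth (Complex \<tau> \<theta>) / h (Complex \<tau> \<theta>))"])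
    have "0 \<le> 2 * (a' ((cmod (h (Complex \<tau> \<theta>)))\<^sup>2) * B (\<eta> (Complex \<tau> \<theta>)) * J (Complex \<tau> \<theta>))"
      using sgn[OF z] by simp
    also have "\<dots> = a' ((cmod (h (Complex \<tau> \<theta>)))\<^sup>2) * B (\<eta> (Complex \<tau> \<theta>)) * (2 * J (Complex \<tau> \<theta>))" by simp
    also note jacobian_polar[OF z, symmetric]
    finally show "0 \<le> a' ((cmod (h (Complex \<tau> \<theta>)))\<^sup>2) * (2 * Re (cnj (h (Complex \<tau> \<theta>)) * ht (Complex \<tau> \<theta>))) *
        (B (\<eta> (Complex \<tau> \<theta>)) * Im (hth (Complex \<tau> \<theta>) / h (Complex \<tau> \<theta>))) -
        a' ((cmod (h (Complex \<tau> \<theta>)))\<^sup>2) * (2 * Re (cnj (h (Complex \<tau> \<theta>)) * hth (Complex \<tau> \<theta>))) *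
        (B (\<eta> (Complex \<tau> \<theta>)) * Im (ht (Complex \<tau> \<theta>) / h (Complex \<tau> \<theta>)))"
      by (simp only: right_diff_distrib mult_ac)
  next
    fix \<tau> assume "\<tau> \<in> {s..t}"
    then show "a ((cmod (h (Complex \<tau> y2)))\<^sup>2) * (B (\<eta> (Complex \<tau> y2)) * Im (ht (Complex \<tau> y2) / h (Complex \<tau> y2))) =
       a ((cmod (h (Complex \<tau> y1)))\<^sup>2) * (B (\<eta> (Complex \<tau> y1)) * Im (ht (Complex \<tau> y1) / h (Complex \<tau> y1)))"
      by (rule sides)
  qed (unfold split_beta', (intro cont_rect[of _ s t] continuous_intros C c2[OF conta] c2[OF a(2)] ce[OF contB] ce[OF B(2)] cm cq st y)+)
qed

lemma eta_increment:
  assumes "0 < t" "t < T" "y1 \<le> y2" and b: "\<And>u. (b has_real_derivative B u) (at u)"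
  shows "((\<lambda>y. B (\<eta> (Complex t y)) * Im (hth (Complex t y) / h (Complex t y))) has_integral
     b (\<eta> (Complex t y2)) - b (\<eta> (Complex t y1))) {y1..y2}"
proof (rule fundamental_theorem_of_calculus[OF assms(3)])
  fix x assume "x \<in> {y1..y2}"
  have "((\<lambda>y. b (\<eta> (Complex t y))) has_real_derivative B (\<eta> (Complex t x)) * Im (hth (Complex t x) / h (Complex t x))) (at x)"
    by (rule DERIV_chain2[OF b eta_derivatives(2)[OF assms(1,2)]])
  then show "((\<lambda>y. b (\<eta> (Complex t y))) has_vector_derivative B (\<eta> (Complex t x)) * Im (hth (Complex t x) / h (Complex t x))) (at x within {y1..y2})"
    using has_real_derivative_iff_has_vector_derivative has_vector_derivative_at_within by blast
qed

end

text \<open>One sign covers both boundary components: \<sigma> = 1 when the image lies outside the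
  limit circle and \<sigma> = -1 when it lies inside. The right end is brought to the left by a
  reflection, which also reverses the orientation, so the same \<sigma> governs the
  Jacobian.\<close>

locale strip_end = strip_lift +
  fixes \<rho> \<sigma> :: real
  assumes \<rho>: "\<rho> > 0" and \<sigma>: "\<sigma> = 1 \<or> \<sigma> = -1"
    and lim: "\<And>e. e > 0 \<Longrightarrow> \<exists>d>0. \<forall>z\<in>strip T. Re z < d \<longrightarrow> \<bar>cmod (h z) - \<rho>\<bar> < e"
    and J_sgn: "\<And>z. z \<in> strip T \<Longrightarrow> \<sigma> * J z \<ge> 0"
    and outside: "\<And>z. z \<in> strip T \<Longrightarrow> \<sigma> * (cmod (h z) - \<rho>) > 0"
begin

text \<open>If the argument decreased by more than \<open>k\<close> from \<open>y1\<close> to \<open>y2\<close>, a bump form supported in a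
  sector between the two values and vanishing near the boundary circle would violate
  Stokes' theorem on a rectangle whose vertical sides are nearly constant paths.\<close>

lemma eta_almost_increasing:
  assumes k: "0 < k" "k \<le> 1"
  shows "\<exists>d>0. \<forall>t y1 y2. 0 < t \<longrightarrow> t < d \<longrightarrow> y1 \<le> y2 \<longrightarrow> \<eta> (Complex t y2) \<ge> \<eta> (Complex t y1) - k"
proof -
  \<comment> \<open>Chosen so that 64 \<rho> \<kappa> is exactly the square of \<rho> k / 32, the
    distance allowed along a path in \<open>close\<close>.\<close>
  define \<kappa> where "\<kappa> = \<rho> * k\<^sup>2 / 65536"
  have k2: "k\<^sup>2 \<le> k" using k by (simp add: power2_eq_square mult_left_le)
  have k1: "k\<^sup>2 \<le> 1" using k k2 by linarith
  have \<kappa>0: "0 < \<kappa>" using \<rho> k by (simp add: \<kappa>_def)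
  have "\<rho> * k\<^sup>2 \<le> \<rho> * 1" using \<rho> k1 by (intro mult_left_mono) auto
  then have \<kappa>1: "\<kappa> \<le> \<rho>/2" using \<rho> by (simp add: \<kappa>_def)
  have \<kappa>2: "4 * \<kappa> / \<rho> \<le> k/4" using \<rho> k k2 by (simp add: \<kappa>_def)
  have \<kappa>3: "64 * \<rho> * \<kappa> \<le> (\<rho> * k / 32)\<^sup>2" by (simp add: \<kappa>_def power2_eq_square)
  note kap = \<kappa>0 \<kappa>1 \<kappa>2 \<kappa>3
  obtain d1 where d1: "d1 > 0" "d1 < T"
    "\<And>z. 0 < Re z \<Longrightarrow> Re z \<le> d1 \<Longrightarrow> Re z * cmod (P z) \<le> \<kappa> \<and> Re z * cmod (Q z) \<le> \<kappa>"
    using gradient_little_o[OF \<rho> lim kap(1)] by blast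
  obtain d2 where d2: "d2 > 0" "\<And>z. z \<in> strip T \<Longrightarrow> Re z < d2 \<Longrightarrow> \<bar>cmod (h z) - \<rho>\<bar> < \<kappa>"
    using lim[OF kap(1)] by blast
  interpret strip_gradient T F G d1 \<kappa>
    by unfold_locales (use d1 kap in auto)
  have near: "\<bar>cmod (h (Complex t y)) - \<rho>\<bar> < \<kappa>" if "0 < t" "t < min d1 d2" for t y
    using d2(2)[of "Complex t y"] that d1 by simp
  have big: "cmod (h (Complex t y)) \<ge> \<rho>/2" if "0 < t" "t < min d1 d2" for t y
    using near[OF that, of y] kap(2) by linarith
  have horiz: "\<bar>\<eta> (Complex t y') - \<eta> (Complex t y)\<bar> \<le> k/4"
    if t: "0 < t" "t < min d1 d2" and y: "y \<le> y'" "y' \<le> y + t" for t y y'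
  proof -
    have "norm (L (Complex t y') - L (Complex t y)) \<le> 4*\<kappa>/(t*\<rho>) * (y' - y)"
    proof (rule norm_increment_le[OF y(1) L_derivatives(2)])
      fix x
      have "norm (hth (Complex t x) / h (Complex t x)) \<le> (2*\<kappa>/t) / (\<rho>/2)"
        unfolding norm_divide
        by (rule frac_le[OF _ grad_le(2) _ big]) (use t kap \<rho> in auto)
      then show "norm (hth (Complex t x) / h (Complex t x)) \<le> 4*\<kappa>/(t*\<rho>)" by (simp add: field_simps)
    qed (use t d1 in auto)
    also have "\<dots> \<le> 4*\<kappa>/(t*\<rho>) * t" using t kap \<rho> y by (intro mult_left_mono) auto
    also have "\<dots> \<le> k/4" using kap(3) t by simp
    finally show ?thesis using abs_Im_le_cmod[of "L (Complex t y') - L (Complex t y)"] by simp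
  qed
  have path: "\<exists>y'. y \<le> y' \<and> y' \<le> y + t \<and> (\<forall>\<tau>. t/2^n \<le> \<tau> \<longrightarrow> \<tau> \<le> t \<longrightarrow> \<bar>\<eta> (Complex \<tau> y') - \<eta> (Complex t y)\<bar> \<le> k/2)"
    if t: "0 < t" "t < min d1 d2" for t y n
  proof -
    define c where "c = h (Complex t y)"
    have c0: "cmod c > 0" using big[OF t, of y] \<rho> unfolding c_def by linarith
    \<comment> \<open>Multiplication by \<omega> rotates \<open>c\<close> onto the positive real
      axis, so the real part measures the component in direction \<open>c\<close>.\<close>
    define \<omega> where "\<omega> = cnj c / of_real (cmod c)"
    have \<omega>: "cmod \<omega> \<le> 1" using c0 by (simp add: \<omega>_def norm_divide)
    have \<omega>c: "\<omega> * w = (cnj c * w) / of_real (cmod c)" for w by (simp add: \<omega>_def)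
    have \<omega>c': "\<omega> * c = of_real (cmod c)"
      unfolding \<omega>c using c0 by (simp add: complex_norm_square[symmetric] mult.commute power2_eq_square)
    obtain y' where y': "y \<le> y'" "y' \<le> y + t"
      "\<And>\<tau>. t/2^n \<le> \<tau> \<Longrightarrow> \<tau> \<le> t \<Longrightarrow> Re (\<omega> * h (Complex \<tau> y')) \<ge> Re (\<omega> * h (Complex t y)) - 20*\<kappa>"
      using nearly_constant_path[of t \<omega> y n] t \<omega> by auto
    \<comment> \<open>A vector of modulus at most \<rho> + \<kappa> whose component along
      \<open>c\<close> nearly equals |c| is close to \<open>c\<close>. The squared distance is at
      most 4\<rho>\<kappa> from the moduli plus 40\<kappa>|c| \<le> 60\<rho>\<kappa> from the
      component.\<close>
    have close: "cmod (h (Complex \<tau> y') - c) \<le> \<rho> * k / 32" if "t/2^n \<le> \<tau>" "\<tau> \<le> t" for \<tau>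
    proof -
      have "0 < t/2^n" using t by simp
      then have \<tau>: "0 < \<tau>" "\<tau> < min d1 d2" using that t by linarith+
      have "Re (cnj c * h (Complex \<tau> y')) / cmod c \<ge> cmod c - 20*\<kappa>"
        using y'(3)[OF that] \<omega>c' unfolding \<omega>c c_def[symmetric] by simp
      then have "(cmod c - 20*\<kappa>) * cmod c \<le> Re (cnj c * h (Complex \<tau> y'))"
        using c0 by (simp only: pos_le_divide_eq)
      then have "Re (cnj c * h (Complex \<tau> y')) \<ge> (cmod c)\<^sup>2 - 20*\<kappa>*cmod c"
        by (simp add: power2_eq_square left_diff_distrib)
      moreover have "(cmod (h (Complex \<tau> y') - c))\<^sup>2 = (cmod (h (Complex \<tau> y')))\<^sup>2 - 2 * Re (cnj c * h (Complex \<tau> y')) + (cmod c)\<^sup>2"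
        unfolding cmod_power2 by (simp add: power2_eq_square algebra_simps)
      moreover have "(cmod (h (Complex \<tau> y')))\<^sup>2 \<le> (\<rho> + \<kappa>)\<^sup>2"
        using near[OF \<tau>, of y'] by (intro power_mono) auto
      moreover have "(cmod c)\<^sup>2 \<ge> (\<rho> - \<kappa>)\<^sup>2"
        using near[OF t, of y] kap \<rho> unfolding c_def by (intro power_mono) auto
      moreover have "\<kappa> * cmod c \<le> \<kappa> * (\<rho> + \<rho>/2)"
        using near[OF t, of y] kap unfolding c_def by (intro mult_left_mono) auto
      ultimately have "(cmod (h (Complex \<tau> y') - c))\<^sup>2 \<le> 64 * \<rho> * \<kappa>"
        by (simp add: power2_eq_square algebra_simps)
      then have "(cmod (h (Complex \<tau> y') - c))\<^sup>2 \<le> (\<rho> * k / 32)\<^sup>2" using kap(4) by linarith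
      then show ?thesis using \<rho> k by (auto intro: power2_le_imp_le)
    qed
    have vert: "\<bar>\<eta> (Complex \<tau> y') - \<eta> (Complex t y')\<bar> \<le> k/4" if \<tau>: "t/2^n \<le> \<tau>" "\<tau> \<le> t" for \<tau>
    proof -
      have s0: "0 < t/2^n" using t by simp
      then have \<tau>0: "0 < \<tau>" using \<tau> by linarith
      have "\<bar>\<eta> (Complex \<tau> y') - \<eta> (Complex t y')\<bar> \<le> 2 * (k/8)"
      proof (rule lift_angle_small[of \<tau> t "\<lambda>x. L (Complex x y')"])
        show "continuous_on {\<tau>..t} (\<lambda>x. L (Complex x y'))"
          by (rule continuous_on_vector_derivative_at, rule L_derivatives(1)) (use \<tau>0 t d1 in auto)
        fix x assume x: "x \<in> {\<tau>..t}"
        then have x': "t/2^n \<le> x" "x \<le> t" using \<tau> by auto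
        then have "0 < x" using s0 by linarith
        then have z: "Complex x y' \<in> strip T" "Complex t y' \<in> strip T" using x' t d1(2) by auto
        have "t/2^n \<le> t" using \<tau> by linarith
        have "exp (L (Complex x y') - L (Complex t y')) - 1 = (h (Complex x y') - h (Complex t y')) / h (Complex t y')"
          using exp_L[OF z(1)] exp_L[OF z(2)] h_nz[OF z(2)] by (simp add: exp_diff field_simps)
        moreover have "cmod (h (Complex x y') - h (Complex t y')) \<le> \<rho> * k / 16"
          using close[OF x'] close[OF \<open>t/2^n \<le> t\<close> order_refl] norm_triangle_ineq4[of "h (Complex x y') - c" "h (Complex t y') - c"]
          by simp
        then have "cmod (h (Complex x y') - h (Complex t y')) / cmod (h (Complex t y')) \<le> (\<rho> * k / 16) / (\<rho>/2)"
          using big[OF t, of y'] \<rho> k by (intro frac_le) auto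
        ultimately show "cmod (exp (L (Complex x y') - L (Complex t y')) - 1) \<le> k/8"
          using \<rho> by (simp add: norm_divide)
      qed (use \<tau> k in auto)
      then show ?thesis by simp
    qed
    have hor: "\<bar>\<eta> (Complex t y') - \<eta> (Complex t y)\<bar> \<le> k/4" by (rule horiz[OF t y'(1,2)])
    have "\<bar>\<eta> (Complex \<tau> y') - \<eta> (Complex t y)\<bar> \<le> k/2" if "t/2^n \<le> \<tau>" "\<tau> \<le> t" for \<tau>
      using vert[OF that] hor by linarith
    then show ?thesis using y'(1,2) by blast
  qed
  have "\<eta> (Complex t y2) \<ge> \<eta> (Complex t y1) - k" if t: "0 < t" "t < min d1 d2" and y: "y1 \<le> y2" for t y1 y2
  proof (rule ccontr)
    assume "\<not> \<eta> (Complex t y2) \<ge> \<eta> (Complex t y1) - k"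
    then have less: "\<eta> (Complex t y2) + k < \<eta> (Complex t y1)" by simp
    have far: "y1 + t < y2"
    proof (rule ccontr)
      assume "\<not> y1 + t < y2"
      then have "\<bar>\<eta> (Complex t y2) - \<eta> (Complex t y1)\<bar> \<le> k/4" using horiz[OF t y] by simp
      then show False using less k by linarith
    qed
    have tT: "t < T" using t d1 by simp
    define g where "g y = \<sigma> * ((cmod (h (Complex t y)))\<^sup>2 - \<rho>\<^sup>2)" for y
    have gpos: "\<sigma> * ((cmod (h z))\<^sup>2 - \<rho>\<^sup>2) > 0" if "z \<in> strip T" for z
    proof -
      have "\<sigma> * ((cmod (h z))\<^sup>2 - \<rho>\<^sup>2) = (\<sigma> * (cmod (h z) - \<rho>)) * (cmod (h z) + \<rho>)"
        by (simp add: power2_eq_square algebra_simps)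
      also have "\<dots> > 0"
        by (rule mult_pos_pos[OF outside[OF that]]) (use \<rho> in \<open>simp add: add_nonneg_pos\<close>)
      finally show ?thesis .
    qed
    \<comment> \<open>The interval reaches to y2 + t because the vertical position of each side of
      the rectangle below is only known to within \<open>t\<close>.\<close>
    have "continuous_on {y1..y2+t} g"
      unfolding g_def by (intro continuous_intros cont_line[OF cont_h] t tT)
    moreover have "{y1..y2+t} \<noteq> {}" using t y by simp
    ultimately obtain ym where ym: "ym \<in> {y1..y2+t}" "\<And>y. y \<in> {y1..y2+t} \<Longrightarrow> g ym \<le> g y"
      using continuous_attains_inf[of "{y1..y2+t}" g] by auto
    define \<mu> where "\<mu> = g ym"
    have \<mu>: "\<mu> > 0" unfolding \<mu>_def g_def by (rule gpos) (use t tT in simp)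
    \<comment> \<open>At abscissa \<open>s\<close> the squared modulus should differ from the square
      of \<rho> by at most \<mu>/2; the other factor, |h| + \<rho>, is at most 3\<rho>
      there.\<close>
    define e where "e = min \<rho> (\<mu> / (6*\<rho>))"
    have e: "e > 0" "e \<le> \<rho>" "e * (3*\<rho>) \<le> \<mu>/2"
    proof -
      show "e > 0" "e \<le> \<rho>" using \<rho> \<mu> by (auto simp: e_def)
      have "e \<le> \<mu> / (6*\<rho>)" by (simp add: e_def)
      then show "e * (3*\<rho>) \<le> \<mu>/2" using \<rho> by (simp add: field_simps)
    qed
    obtain d3 where d3: "d3 > 0" "\<And>z. z \<in> strip T \<Longrightarrow> Re z < d3 \<Longrightarrow> \<bar>cmod (h z) - \<rho>\<bar> < e"
      using lim[OF e(1)] by blast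
    obtain n where n: "t / d3 < 2^n" using real_arch_pow[of 2] by fastforce
    \<comment> \<open>The extra halving guarantees s < t even if \<open>n\<close> is 0.\<close>
    define s where "s = t / 2^(Suc n)"
    have s: "0 < s" "s < t" "s < d3"
    proof -
      show "0 < s" using t by (simp add: s_def)
      have "(1::real) \<le> 2^n" by simp
      then have "(1::real) < 2 * 2^n" by linarith
      then have "t * 1 < t * (2 * 2^n)" using t(1) by (rule mult_strict_left_mono)
      then show "s < t" using t by (simp add: s_def field_simps)
      have "t < d3 * 2^n" using n d3 by (simp add: field_simps)
      also have "\<dots> \<le> d3 * 2^(Suc n)" using d3 by simp
      finally show "s < d3" by (simp add: s_def field_simps)
    qed
    obtain y1' where y1': "y1 \<le> y1'" "y1' \<le> y1 + t"
      "\<And>\<tau>. s \<le> \<tau> \<Longrightarrow> \<tau> \<le> t \<Longrightarrow> \<bar>\<eta> (Complex \<tau> y1') - \<eta> (Complex t y1)\<bar> \<le> k/2"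
      using path[OF t, of y1 "Suc n"] unfolding s_def by blast
    obtain y2' where y2': "y2 \<le> y2'" "y2' \<le> y2 + t"
      "\<And>\<tau>. s \<le> \<tau> \<Longrightarrow> \<tau> \<le> t \<Longrightarrow> \<bar>\<eta> (Complex \<tau> y2') - \<eta> (Complex t y2)\<bar> \<le> k/2"
      using path[OF t, of y2 "Suc n"] unfolding s_def by blast
    have y12: "y1' < y2'" using y1' y2' far by linarith
    \<comment> \<open>The radial cut-off rises between gaps \<mu>/2 and \<mu>: it vanishes on the
      side at abscissa \<open>s\<close> and is constant on the side at abscissa
      \<open>t\<close>.\<close>
    have "\<sigma> * \<rho>\<^sup>2 + \<mu>/2 < \<sigma> * \<rho>\<^sup>2 + \<mu>" using \<mu> by simp
    then obtain a0 A0 A0' :: "real \<Rightarrow> real" and c0 where a0: "c0 > 0"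
      "\<And>y. (a0 has_real_derivative A0 y) (at y)" "\<And>y. (A0 has_real_derivative A0' y) (at y)"
      "continuous_on UNIV A0'" "\<And>y. A0 y \<ge> 0"
      "\<And>y. y \<le> \<sigma> * \<rho>\<^sup>2 + \<mu>/2 \<Longrightarrow> a0 y = 0" "\<And>y. y \<le> \<sigma> * \<rho>\<^sup>2 + \<mu>/2 \<Longrightarrow> A0 y = 0"
      "\<And>y. y \<ge> \<sigma> * \<rho>\<^sup>2 + \<mu> \<Longrightarrow> a0 y = c0" "\<And>y. y \<ge> \<sigma> * \<rho>\<^sup>2 + \<mu> \<Longrightarrow> A0 y = 0"
      by (rule smooth_step) (rule that; assumption)
    \<comment> \<open>The angular cut-off rises inside the sector between the values of the argument
      on the two paths, which each deviate by at most k/2. Hence \<open>B\<close> vanishes on both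
      paths.\<close>
    have "\<eta> (Complex t y2) + k/2 < \<eta> (Complex t y1) - k/2" using less by simp
    then obtain b B B' :: "real \<Rightarrow> real" and c where b: "c > 0"
      "\<And>y. (b has_real_derivative B y) (at y)" "\<And>y. (B has_real_derivative B' y) (at y)"
      "continuous_on UNIV B'" "\<And>y. B y \<ge> 0"
      "\<And>y. y \<le> \<eta> (Complex t y2) + k/2 \<Longrightarrow> b y = 0" "\<And>y. y \<le> \<eta> (Complex t y2) + k/2 \<Longrightarrow> B y = 0"
      "\<And>y. y \<ge> \<eta> (Complex t y1) - k/2 \<Longrightarrow> b y = c" "\<And>y. y \<ge> \<eta> (Complex t y1) - k/2 \<Longrightarrow> B y = 0"
      by (rule smooth_step) (rule that; assumption)
    define a where "a u = a0 (\<sigma> * u)" for u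
    define a' where "a' u = \<sigma> * A0 (\<sigma> * u)" for u
    have da: "(a has_real_derivative a' u) (at u)" for u
      unfolding a_def a'_def
      by (rule DERIV_cong[OF DERIV_chain2[OF a0(2) DERIV_cmult[OF DERIV_ident]]]) simp
    have contA0: "continuous_on UNIV A0" using a0(3) by (meson DERIV_isCont continuous_at_imp_continuous_on)
    have ca': "continuous_on UNIV a'"
      unfolding a'_def by (intro continuous_intros continuous_on_compose2[OF contA0]) auto
    have "integral {y1'..y2'} (\<lambda>y. a ((cmod (h (Complex s y)))\<^sup>2) * (B (\<eta> (Complex s y)) * Im (hth (Complex s y) / h (Complex s y))))
       \<le> integral {y1'..y2'} (\<lambda>y. a ((cmod (h (Complex t y)))\<^sup>2) * (B (\<eta> (Complex t y)) * Im (hth (Complex t y) / h (Complex t y))))"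
    proof (rule polar_stokes[OF s(1,2) tT y12 da ca' b(3,4)])
      fix z assume "z \<in> strip T"
      have "a' ((cmod (h z))\<^sup>2) * B (\<eta> z) * J z = A0 (\<sigma> * (cmod (h z))\<^sup>2) * B (\<eta> z) * (\<sigma> * J z)"
        by (simp add: a'_def)
      also have "\<dots> \<ge> 0"
        by (rule mult_nonneg_nonneg[OF mult_nonneg_nonneg[OF a0(5) b(5)] J_sgn[OF \<open>z \<in> strip T\<close>]])
      finally show "a' ((cmod (h z))\<^sup>2) * B (\<eta> z) * J z \<ge> 0" .
    next
      fix \<tau> assume "\<tau> \<in> {s..t}"
      then have "\<bar>\<eta> (Complex \<tau> y1') - \<eta> (Complex t y1)\<bar> \<le> k/2" "\<bar>\<eta> (Complex \<tau> y2') - \<eta> (Complex t y2)\<bar> \<le> k/2"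
        using y1'(3) y2'(3) by auto
      then have "\<eta> (Complex \<tau> y1') \<ge> \<eta> (Complex t y1) - k/2" "\<eta> (Complex \<tau> y2') \<le> \<eta> (Complex t y2) + k/2"
        by linarith+
      then have "B (\<eta> (Complex \<tau> y1')) = 0" "B (\<eta> (Complex \<tau> y2')) = 0"
        using b(7,9) by blast+
      then show "a ((cmod (h (Complex \<tau> y2')))\<^sup>2) * (B (\<eta> (Complex \<tau> y2')) * Im (ht (Complex \<tau> y2') / h (Complex \<tau> y2'))) =
       a ((cmod (h (Complex \<tau> y1')))\<^sup>2) * (B (\<eta> (Complex \<tau> y1')) * Im (ht (Complex \<tau> y1') / h (Complex \<tau> y1')))"
        by simp
    qed
    moreover have "a ((cmod (h (Complex s y)))\<^sup>2) = 0" for y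
    proof -
      have "\<bar>cmod (h (Complex s y)) - \<rho>\<bar> < e" using d3(2)[of "Complex s y"] s tT by simp
      then have "\<bar>cmod (h (Complex s y)) - \<rho>\<bar> * \<bar>cmod (h (Complex s y)) + \<rho>\<bar> \<le> e * (3*\<rho>)"
        using e \<rho> by (intro mult_mono) auto
      moreover have "(cmod (h (Complex s y)))\<^sup>2 - \<rho>\<^sup>2 = (cmod (h (Complex s y)) - \<rho>) * (cmod (h (Complex s y)) + \<rho>)"
        by (simp add: power2_eq_square algebra_simps)
      ultimately have "\<bar>(cmod (h (Complex s y)))\<^sup>2 - \<rho>\<^sup>2\<bar> \<le> \<mu>/2"
        using e(3) by (simp only: abs_mult)
      then have "\<sigma> * ((cmod (h (Complex s y)))\<^sup>2 - \<rho>\<^sup>2) \<le> \<mu>/2"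
        using \<sigma> abs_ge_self[of "(cmod (h (Complex s y)))\<^sup>2 - \<rho>\<^sup>2"]
          abs_ge_minus_self[of "(cmod (h (Complex s y)))\<^sup>2 - \<rho>\<^sup>2"]
        by (elim disjE; simp only: mult_1 mult_minus1; linarith)
      then show ?thesis unfolding a_def by (intro a0(6)) (simp add: algebra_simps)
    qed
    moreover have "integral {y1'..y2'} (\<lambda>y. a ((cmod (h (Complex t y)))\<^sup>2) * (B (\<eta> (Complex t y)) * Im (hth (Complex t y) / h (Complex t y))))
        = integral {y1'..y2'} (\<lambda>y. c0 * (B (\<eta> (Complex t y)) * Im (hth (Complex t y) / h (Complex t y))))"
    proof (rule integral_cong)
      fix y assume "y \<in> {y1'..y2'}"
      then have "\<mu> \<le> g y" unfolding \<mu>_def by (intro ym(2)) (use y1' y2' in auto)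
      then have "a ((cmod (h (Complex t y)))\<^sup>2) = c0"
        unfolding a_def by (intro a0(8)) (simp add: g_def algebra_simps)
      then show "a ((cmod (h (Complex t y)))\<^sup>2) * (B (\<eta> (Complex t y)) * Im (hth (Complex t y) / h (Complex t y)))
         = c0 * (B (\<eta> (Complex t y)) * Im (hth (Complex t y) / h (Complex t y)))" by simp
    qed
    \<comment> \<open>The integral at \<open>s\<close> is 0, while the one at \<open>t\<close> is
      \<open>c0\<close> times the increment of b(\<eta>), which falls from \<open>c\<close> to
      0.\<close>
    ultimately have "0 \<le> integral {y1'..y2'} (\<lambda>y. c0 * (B (\<eta> (Complex t y)) * Im (hth (Complex t y) / h (Complex t y))))"
      by simp
    also have "\<dots> = c0 * (b (\<eta> (Complex t y2')) - b (\<eta> (Complex t y1')))"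
      using has_integral_mult_right[OF eta_increment[OF t(1) tT less_imp_le[OF y12] b(2)], of c0] by (rule integral_unique)
    also have "b (\<eta> (Complex t y2')) = 0" using y2'(3)[of t] s by (intro b(6)) linarith
    also have "b (\<eta> (Complex t y1')) = c" using y1'(3)[of t] s by (intro b(8)) linarith
    finally have "0 \<le> c0 * (0 - c)" .
    moreover have "c0 * c > 0" using a0(1) b(1) by simp
    ultimately show False by simp
  qed
  then show ?thesis using d1 d2 by (intro exI[of _ "min d1 d2"]) auto
qed

end

section \<open>Chords of the image curves\<close>

text \<open>The open set \<open>U\<close> replaces a computation of the frontier: an open subset of
  \<open>S\<close> cannot meet it, so a bound on \<open>S - U\<close> covers it.\<close>

lemma harmonic_maximum:
  assumes "f holomorphic_on V" "open V" "compact S" "S \<subseteq> V" "open U" "U \<subseteq> S"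
    and B: "\<And>z. z \<in> S - U \<Longrightarrow> Im (f z) \<le> B" and "z \<in> S"
  shows "Im (f z) \<le> B"
proof -
  have "Re (- \<i> * f z) \<le> B"
  proof (rule maximum_real_frontier[of "\<lambda>z. - \<i> * f z" S])
    have hS: "(\<lambda>z. - \<i> * f z) holomorphic_on S"
      using assms by (intro holomorphic_intros) (rule holomorphic_on_subset)
    then show "(\<lambda>z. - \<i> * f z) holomorphic_on interior S"
      by (rule holomorphic_on_subset) (rule interior_subset)
    have cl: "closure S = S" using assms(3) by (simp add: compact_imp_closed)
    then show "continuous_on (closure S) (\<lambda>z. - \<i> * f z)"
      using hS by (simp add: holomorphic_on_imp_continuous_on)
    show "bounded S" using assms(3) by (rule compact_imp_bounded)
    fix w assume "w \<in> frontier S"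
    then have "w \<in> S - U"
      using interior_maximal[OF assms(6,5)] unfolding frontier_def cl by blast
    then show "Re (- \<i> * f w) \<le> B" using B by simp
  qed (use assms in auto)
  then show ?thesis by simp
qed

text \<open>The kernel \<open>k\<close> will be the conjugated curve at a fixed abscissa or its
  conjugate; the average stays holomorphic in the other variable.\<close>

lemma holomorphic_vertical_average:
  assumes k: "continuous_on {a..b} k" and f: "f holomorphic_on strip T"
  shows "(\<lambda>z. integral {a..b} (\<lambda>y. k y * f (z + \<i> * of_real y))) holomorphic_on strip T"
proof -
  have sh: "z + \<i> * of_real y \<in> strip T" if "z \<in> strip T" for z y
    using that by (simp add: strip_def)
  have d: "(f has_field_derivative deriv f z) (at z)" if "z \<in> strip T" for z
    using f open_strip that holomorphic_derivI by blast
  have cf: "continuous_on (strip T) f" and cf': "continuous_on (strip T) (deriv f)"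
    using f open_strip by (auto intro: holomorphic_on_imp_continuous_on holomorphic_deriv)
  have c2: "continuous_on (strip T \<times> {a..b}) (\<lambda>p. g (fst p + \<i> * of_real (snd p)))" if "continuous_on (strip T) g" for g :: "complex \<Rightarrow> complex"
    by (rule continuous_on_compose2[OF that]) (auto intro!: continuous_intros simp: sh)
  have ck: "continuous_on (strip T \<times> {a..b}) (\<lambda>p. k (snd p))"
    by (rule continuous_on_compose2[OF k]) (auto intro!: continuous_intros)
  have D: "((\<lambda>z. integral {a..b} (\<lambda>y. k y * f (z + \<i> * of_real y))) has_field_derivative
      integral {a..b} (\<lambda>y. k y * deriv f (z + \<i> * of_real y))) (at z within strip T)" if z: "z \<in> strip T" for z
  proof (rule leibniz_rule_field_derivative[of "strip T" a b, unfolded cbox_interval])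
    fix x y assume "x \<in> strip T"
    then have f': "(f has_field_derivative deriv f (x + \<i> * of_real y)) (at (x + \<i> * of_real y))"
      by (intro d sh)
    have "((\<lambda>x. x + \<i> * of_real y) has_field_derivative 1) (at x)"
      by (auto intro!: derivative_eq_intros)
    from DERIV_chain2[where g = "\<lambda>x. x + \<i> * of_real y", OF f' this]
    have "((\<lambda>x. f (x + \<i> * of_real y)) has_field_derivative deriv f (x + \<i> * of_real y)) (at x)" by simp
    then show "((\<lambda>x. k y * f (x + \<i> * of_real y)) has_field_derivative k y * deriv f (x + \<i> * of_real y)) (at x within strip T)"
      by (intro DERIV_cmult) (rule has_field_derivative_at_within)
  next
    fix x assume "x \<in> strip T"
    then have "continuous_on {a..b} (\<lambda>y. f (x + \<i> * of_real y))"
      by (intro continuous_on_compose2[OF cf]) (auto intro!: continuous_intros simp: sh)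
    then show "(\<lambda>y. k y * f (x + \<i> * of_real y)) integrable_on {a..b}"
      by (intro integrable_continuous_interval continuous_on_mult k)
  next
    show "continuous_on (strip T \<times> {a..b}) (\<lambda>(x, y). k y * deriv f (x + \<i> * of_real y))"
      unfolding split_beta' by (rule continuous_on_mult[OF ck c2[OF cf']])
  qed (rule z, rule convex_strip)
  show ?thesis
    unfolding holomorphic_on_def field_differentiable_def by (intro ballI exI) (rule D)
qed

lemma norm_cis_diff: "cmod (cis x - cis y) = 2 * \<bar>sin ((x - y) / 2)\<bar>"
proof -
  have "(cmod (cis x - cis y))\<^sup>2 = ((cos x)\<^sup>2 + (sin x)\<^sup>2) + ((cos y)\<^sup>2 + (sin y)\<^sup>2) - 2 * (cos x * cos y + sin x * sin y)"
    unfolding cmod_power2 by (simp add: power2_eq_square algebra_simps)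
  also have "\<dots> = 2 - 2 * cos (x - y)" by (simp add: cos_diff)
  also have "\<dots> = (2 * \<bar>sin ((x - y) / 2)\<bar>)\<^sup>2"
  proof -
    have "x - y = 2 * ((x - y)/2)" by simp
    then have "cos (x - y) = 1 - 2 * (sin ((x - y) / 2))\<^sup>2" by (metis cos_double_sin)
    then show ?thesis by (simp add: power_mult_distrib)
  qed
  finally show ?thesis by (rule power2_eq_imp_eq) auto
qed

text \<open>The reflection z \<mapsto> T - cnj z in the middle line exchanges the two ends of the
  strip and keeps ordinates. Composed with it, F + cnj G has the same form with the two parts
  interchanged, so the Jacobian changes sign.\<close>

lemma cnj_reflect_holomorphic:
  assumes "f holomorphic_on strip T"
  shows "(\<lambda>z. cnj (f (of_real T - cnj z))) holomorphic_on strip T"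
    "z \<in> strip T \<Longrightarrow> deriv (\<lambda>z. cnj (f (of_real T - cnj z))) z = - cnj (deriv f (of_real T - cnj z))"
proof -
  have d: "((\<lambda>z. cnj (f (of_real T - cnj z))) has_field_derivative - cnj (deriv f (of_real T - cnj z))) (at z)"
    if "z \<in> strip T" for z
  proof -
    have "of_real T - cnj z \<in> strip T" using that by (simp add: strip_def)
    then have "(f has_field_derivative deriv f (of_real T - cnj z)) (at (of_real T - cnj z))"
      using assms open_strip holomorphic_derivI by blast
    moreover have "((\<lambda>w. of_real T - w) has_field_derivative -1) (at (cnj z))"
      by (auto intro!: derivative_eq_intros)
    ultimately have "((\<lambda>w. f (of_real T - w)) has_field_derivative - deriv f (of_real T - cnj z)) (at (cnj z))"
      using DERIV_chain2[where g = "\<lambda>w. of_real T - w" and x = "cnj z" and f = f and s = UNIV] by fastforce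
    from has_field_derivative_cnj_cnj[OF this] show ?thesis by (simp add: o_def)
  qed
  then show "(\<lambda>z. cnj (f (of_real T - cnj z))) holomorphic_on strip T"
    unfolding holomorphic_on_def using field_differentiable_at_within field_differentiable_def by blast
  show "z \<in> strip T \<Longrightarrow> deriv (\<lambda>z. cnj (f (of_real T - cnj z))) z = - cnj (deriv f (of_real T - cnj z))"
    using d DERIV_imp_deriv by blast
qed

section \<open>Closed curves around the unit disc: winding and enclosed area\<close>

locale strip_loop = strip_lift +
  assumes per: "\<And>t y. 0 < t \<Longrightarrow> t < T \<Longrightarrow> h (Complex t (y + 2*pi)) = h (Complex t y)"
    and lim0: "\<And>e. e > 0 \<Longrightarrow> \<exists>d>0. \<forall>z\<in>strip T. Re z < d \<longrightarrow> \<bar>cmod (h z) - 1\<bar> < e"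
    and gt1: "\<And>z. z \<in> strip T \<Longrightarrow> cmod (h z) > 1"
    and J_nonneg: "\<And>z. z \<in> strip T \<Longrightarrow> J z \<ge> 0"
begin

lemma ht_per: "0 < t \<Longrightarrow> t < T \<Longrightarrow> ht (Complex t (y + 2*pi)) = ht (Complex t y)"
proof -
  assume t: "0 < t" "t < T"
  have "\<forall>\<^sub>F x in nhds t. x \<in> {0<..<T}" by (rule eventually_nhds_in_open) (use t in auto)
  then have "\<forall>\<^sub>F x in nhds t. x \<in> UNIV \<longrightarrow> h (Complex x (y + 2*pi)) = h (Complex x y)"
    by eventually_elim (simp add: per)
  then have "((\<lambda>x. h (Complex x y)) has_vector_derivative ht (Complex t (y + 2*pi))) (at t)"
    using h_t[OF t, of "y + 2*pi"] has_vector_derivative_cong_ev[of UNIV "\<lambda>x. h (Complex x (y + 2*pi))" "\<lambda>x. h (Complex x y)" t] per[OF t]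
    by simp
  then show ?thesis using h_t[OF t, of y] by (rule vector_derivative_unique_at)
qed

text \<open>Stokes' theorem over one period: the horizontal sides cancel by periodicity, and near
  the left end the squared modulus is at most \<open>p\<close>, where \<open>a\<close>
  vanishes.\<close>

lemma loop_stokes:
  fixes a a' :: "real \<Rightarrow> real"
  assumes t: "0 < t" "t < T" and p: "p > 1"
    and a: "\<And>u. (a has_real_derivative a' u) (at u)" "continuous_on UNIV a'" "\<And>u. u \<ge> 1 \<Longrightarrow> a' u \<ge> 0"
    and a0: "\<And>u. u \<le> p \<Longrightarrow> a u = 0"
  shows "0 \<le> integral {0..2*pi} (\<lambda>y. a ((cmod (h (Complex t y)))\<^sup>2) * Im (hth (Complex t y) / h (Complex t y)))"
proof -
  define e where "e = sqrt p - 1"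
  have e: "e > 0" using p by (simp add: e_def)
  obtain d where d: "d > 0" "\<And>z. z \<in> strip T \<Longrightarrow> Re z < d \<Longrightarrow> \<bar>cmod (h z) - 1\<bar> < e"
    using lim0[OF e] by blast
  define s where "s = min d t / 2"
  have s: "0 < s" "s < t" "s < d" using d t by (auto simp: s_def)
  have small: "a ((cmod (h (Complex s y)))\<^sup>2) = 0" for y
  proof (rule a0)
    have "cmod (h (Complex s y)) \<le> sqrt p" using d(2)[of "Complex s y"] s t by (simp add: e_def)
    then have "(cmod (h (Complex s y)))\<^sup>2 \<le> (sqrt p)\<^sup>2" by (intro power_mono) auto
    then show "(cmod (h (Complex s y)))\<^sup>2 \<le> p" using p by simp
  qed
  have "integral {0..2*pi} (\<lambda>y. a ((cmod (h (Complex s y)))\<^sup>2) * (1 * Im (hth (Complex s y) / h (Complex s y))))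
       \<le> integral {0..2*pi} (\<lambda>y. a ((cmod (h (Complex t y)))\<^sup>2) * (1 * Im (hth (Complex t y) / h (Complex t y))))"
  proof (rule polar_stokes[where B = "\<lambda>_. 1" and B' = "\<lambda>_. 0", OF s(1,2) t(2) _ a(1,2)])
    fix z assume z: "z \<in> strip T"
    have "(cmod (h z))\<^sup>2 \<ge> 1" using gt1[OF z] by (simp add: one_le_power)
    then show "0 \<le> a' ((cmod (h z))\<^sup>2) * 1 * J z" using a(3) J_nonneg[OF z] by simp
  next
    fix \<tau> assume "\<tau> \<in> {s..t}"
    then have \<tau>: "0 < \<tau>" "\<tau> < T" using s t by auto
    show "a ((cmod (h (Complex \<tau> (2*pi))))\<^sup>2) * (1 * Im (ht (Complex \<tau> (2*pi)) / h (Complex \<tau> (2*pi)))) =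
       a ((cmod (h (Complex \<tau> 0)))\<^sup>2) * (1 * Im (ht (Complex \<tau> 0) / h (Complex \<tau> 0)))"
      using per[OF \<tau>, of 0] ht_per[OF \<tau>, of 0] by simp
  qed auto
  then show ?thesis by (simp add: small)
qed

lemma square_min:
  assumes "0 < t" "t < T"
  obtains q where "q > 1" "\<And>y. y \<in> {0..2*pi} \<Longrightarrow> q \<le> (cmod (h (Complex t y)))\<^sup>2"
proof -
  have "continuous_on {0..2*pi} (\<lambda>y. (cmod (h (Complex t y)))\<^sup>2)"
    by (intro continuous_intros cont_line[OF cont_h] assms)
  then obtain ym where ym: "ym \<in> {0..2*pi}" "\<And>y. y \<in> {0..2*pi} \<Longrightarrow> (cmod (h (Complex t ym)))\<^sup>2 \<le> (cmod (h (Complex t y)))\<^sup>2"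
    using continuous_attains_inf[of "{0..2*pi}" "\<lambda>y. (cmod (h (Complex t y)))\<^sup>2"] pi_ge_zero by auto
  have "cmod (h (Complex t ym)) > 1" using gt1 assms by simp
  then have "(cmod (h (Complex t ym)))\<^sup>2 > 1" by (simp add: one_less_power)
  then show ?thesis using that ym(2) by blast
qed

text \<open>With a cut-off that is constant on the curve, Stokes' theorem yields a nonnegative
  increment of the argument. With (u - 1) times that cut-off it says that the integral of
  \<bar>h\<bar>^2 - 1 against d\<eta>, twice the area between the unit circle and the curve, is
  nonnegative.\<close>

lemma winding_and_area:
  assumes t: "0 < t" "t < T"
  shows "\<eta> (Complex t 0) \<le> \<eta> (Complex t (2*pi))"
    and "\<eta> (Complex t (2*pi)) - \<eta> (Complex t 0) \<le> integral {0..2*pi} (\<lambda>y. Im (cnj (h (Complex t y)) * hth (Complex t y)))"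
proof -
  obtain q where q: "q > 1" "\<And>y. y \<in> {0..2*pi} \<Longrightarrow> q \<le> (cmod (h (Complex t y)))\<^sup>2"
    using square_min[OF t] by blast
  define p where "p = (1 + q)/2"
  have p: "p > 1" "p < q" using q by (auto simp: p_def)
  obtain b B B' :: "real \<Rightarrow> real" and c where b: "c > 0"
      "\<And>y. (b has_real_derivative B y) (at y)" "\<And>y. (B has_real_derivative B' y) (at y)"
      "continuous_on UNIV B'" "\<And>y. B y \<ge> 0"
      "\<And>y. y \<le> p \<Longrightarrow> b y = 0" "\<And>y. y \<le> p \<Longrightarrow> B y = 0"
      "\<And>y. y \<ge> q \<Longrightarrow> b y = c" "\<And>y. y \<ge> q \<Longrightarrow> B y = 0"
    using p(2) by (rule smooth_step) (rule that; assumption)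
  have contB: "continuous_on UNIV B" and contb: "continuous_on UNIV b"
    using b(2,3) by (meson DERIV_isCont continuous_at_imp_continuous_on)+
  have b_nonneg: "b u \<ge> 0" for u
  proof (cases "u \<le> p")
    case False
    then have "b p \<le> b u"
      by (intro DERIV_nonneg_imp_nondecreasing[of p u b]) (use b(2,5) in auto)
    then show ?thesis using b(6)[of p] by simp
  qed (use b(6) in simp)
  have I: "((\<lambda>y. 1 * Im (hth (Complex t y) / h (Complex t y))) has_integral
      \<eta> (Complex t (2*pi)) - \<eta> (Complex t 0)) {0..2*pi}"
    using eta_increment[where b = "\<lambda>x. x" and B = "\<lambda>_. 1", OF t, of 0 "2*pi"] by simp
  have "0 \<le> integral {0..2*pi} (\<lambda>y. b ((cmod (h (Complex t y)))\<^sup>2) * Im (hth (Complex t y) / h (Complex t y)))"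
    using b(5) by (intro loop_stokes[OF t p(1) b(2) contB _ b(6)]) auto
  also have "\<dots> = integral {0..2*pi} (\<lambda>y. c * (1 * Im (hth (Complex t y) / h (Complex t y))))"
    by (rule integral_cong) (use b(8) q in auto)
  also have "\<dots> = c * (\<eta> (Complex t (2*pi)) - \<eta> (Complex t 0))"
    using has_integral_mult_right[OF I, of c] by (rule integral_unique)
  finally show "\<eta> (Complex t 0) \<le> \<eta> (Complex t (2*pi))"
    using b(1) by (simp add: zero_le_mult_iff)
  \<comment> \<open>The cut-off factor makes \<open>a\<close> vanish below \<open>p\<close>, as
    \<open>loop_stokes\<close> demands; on the curve itself it is the constant
    \<open>c\<close>.\<close>
  define a where "a u = (u - 1) * b u" for u
  define a' where "a' u = (u - 1) * B u + b u" for u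
  have "0 \<le> integral {0..2*pi} (\<lambda>y. a ((cmod (h (Complex t y)))\<^sup>2) * Im (hth (Complex t y) / h (Complex t y)))"
  proof (rule loop_stokes[OF t p(1), of a a'])
    show "(a has_real_derivative a' u) (at u)" for u
      unfolding a_def a'_def by (auto intro!: derivative_eq_intros b(2))
    show "continuous_on UNIV a'" unfolding a'_def by (intro continuous_intros contB contb)
    show "0 \<le> a' u" if "1 \<le> u" for u using that b(5) b_nonneg by (simp add: a'_def)
    show "a u = 0" if "u \<le> p" for u using b(6)[OF that] by (simp add: a_def)
  qed
  also have "\<dots> = integral {0..2*pi} (\<lambda>y. c * (Im (cnj (h (Complex t y)) * hth (Complex t y)) - 1 * Im (hth (Complex t y) / h (Complex t y))))"
  proof (rule integral_cong)
    fix y assume y: "y \<in> {0..2*pi}"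
    have "h (Complex t y) \<noteq> 0" using h_nz t by simp
    then have "cnj (h (Complex t y)) * hth (Complex t y) = (h (Complex t y) * cnj (h (Complex t y))) * (hth (Complex t y) / h (Complex t y))"
      by simp
    also have "\<dots> = of_real ((cmod (h (Complex t y)))\<^sup>2) * (hth (Complex t y) / h (Complex t y))"
      by (simp only: complex_norm_square)
    finally have "Im (cnj (h (Complex t y)) * hth (Complex t y)) = (cmod (h (Complex t y)))\<^sup>2 * Im (hth (Complex t y) / h (Complex t y))"
      by (simp only: Im_complex_of_real Re_complex_of_real times_complex.sel mult_zero_left add_0_right)
    moreover have "b ((cmod (h (Complex t y)))\<^sup>2) = c" using q(2)[OF y] by (rule b(8))
    ultimately show "a ((cmod (h (Complex t y)))\<^sup>2) * Im (hth (Complex t y) / h (Complex t y))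
       = c * (Im (cnj (h (Complex t y)) * hth (Complex t y)) - 1 * Im (hth (Complex t y) / h (Complex t y)))"
      by (simp only: a_def) (simp add: algebra_simps)
  qed
  also have "\<dots> = c * (integral {0..2*pi} (\<lambda>y. Im (cnj (h (Complex t y)) * hth (Complex t y))) - (\<eta> (Complex t (2*pi)) - \<eta> (Complex t 0)))"
  proof (rule integral_unique, rule has_integral_mult_right, rule has_integral_diff[OF _ I])
    have "continuous_on {0..2*pi} (\<lambda>y. Im (cnj (h (Complex t y)) * hth (Complex t y)))"
      by (intro continuous_intros cont_line[OF cont_h] cont_line[OF cont_parts(2)] t)
    then show "((\<lambda>y. Im (cnj (h (Complex t y)) * hth (Complex t y))) has_integral integral {0..2*pi} (\<lambda>y. Im (cnj (h (Complex t y)) * hth (Complex t y)))) {0..2*pi}"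
      by (intro integrable_integral integrable_continuous_interval)
  qed
  finally show "\<eta> (Complex t (2*pi)) - \<eta> (Complex t 0) \<le> integral {0..2*pi} (\<lambda>y. Im (cnj (h (Complex t y)) * hth (Complex t y)))"
    using b(1) by (simp add: zero_le_mult_iff)
qed

end

text \<open>The normalised situation: inner target radius 1, degree 1, orientation preserved. Here
  \<open>R\<close> is the ratio of the target radii, while the domain enters only through
  \<open>T\<close>.\<close>

locale annulus_map = strip_loop +
  fixes R :: real
  assumes limT: "\<And>e. e > 0 \<Longrightarrow> \<exists>d>0. \<forall>z\<in>strip T. Re z > T - d \<longrightarrow> \<bar>cmod (h z) - R\<bar> < e"
    and R_gt: "1 < R" and ltR: "\<And>z. z \<in> strip T \<Longrightarrow> cmod (h z) < R"
    and deg: "\<And>t y. 0 < t \<Longrightarrow> t < T \<Longrightarrow> \<eta> (Complex t (y + 2*pi)) = \<eta> (Complex t y) + 2*pi"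
begin

lemma monotone_left:
  assumes "0 < k" "k \<le> 1"
  shows "\<exists>d>0. \<forall>t y1 y2. 0 < t \<longrightarrow> t < d \<longrightarrow> y1 \<le> y2 \<longrightarrow> \<eta> (Complex t y2) \<ge> \<eta> (Complex t y1) - k"
proof -
  interpret E: strip_end T F G L 1 1
  proof unfold_locales
    show "\<exists>d>0. \<forall>z\<in>strip T. Re z < d \<longrightarrow> \<bar>cmod (h z) - 1\<bar> < e" if "e > 0" for e
      by (rule lim0[OF that])
    show "0 \<le> 1 * J z" if "z \<in> strip T" for z using J_nonneg[OF that] by simp
    show "0 < 1 * (cmod (h z) - 1)" if "z \<in> strip T" for z using gt1[OF that] by simp
  qed auto
  show ?thesis by (rule E.eta_almost_increasing[OF assms])
qed

text \<open>The reflected map satisfies \<open>strip_end\<close> with \<sigma> = -1. Ordinates are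
  untouched, so the argument is almost increasing in the same direction as at the left end.\<close>

lemma monotone_right:
  assumes "0 < k" "k \<le> 1"
  shows "\<exists>d>0. \<forall>t y1 y2. t < T \<longrightarrow> T - d < t \<longrightarrow> y1 \<le> y2 \<longrightarrow> \<eta> (Complex t y2) \<ge> \<eta> (Complex t y1) - k"
proof -
  define F' where "F' z = cnj (G (of_real T - cnj z))" for z
  define G' where "G' z = cnj (F (of_real T - cnj z))" for z
  define L' where "L' z = L (of_real T - cnj z)" for z
  have rs: "of_real T - cnj z \<in> strip T" if "z \<in> strip T" for z using that by (simp add: strip_def)
  have h': "hmap F' G' z = h (of_real T - cnj z)" for z
    by (simp add: hmap_def F'_def G'_def)
  note FG = cnj_reflect_holomorphic[OF G_hol, folded F'_def] cnj_reflect_holomorphic[OF F_hol, folded G'_def]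
  interpret E: strip_end T F' G' L' R "-1"
  proof unfold_locales
    show "0 < T" by (rule T_pos)
    show "F' holomorphic_on strip T" "G' holomorphic_on strip T"
      by (rule FG(1), rule FG(3))
    show "continuous_on (strip T) L'"
      unfolding L'_def by (rule continuous_on_compose2[OF L_cont]) (auto intro!: continuous_intros rs)
    show "exp (L' z) = hmap F' G' z" if "z \<in> strip T" for z
      using exp_L[OF rs[OF that]] by (simp add: h' L'_def)
    show "0 < R" using R_gt by simp
    show "\<exists>d>0. \<forall>z\<in>strip T. Re z < d \<longrightarrow> \<bar>cmod (hmap F' G' z) - R\<bar> < e" if "e > 0" for e
      using limT[OF that] rs unfolding h' by force
    fix z assume z: "z \<in> strip T"
    show "0 \<le> - 1 * ((cmod (deriv F' z))\<^sup>2 - (cmod (deriv G' z))\<^sup>2)"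
      using J_nonneg[OF rs[OF z]] FG(2)[OF z] FG(4)[OF z] by simp
    show "0 < - 1 * (cmod (hmap F' G' z) - R)"
      using ltR[OF rs[OF z]] by (simp add: h')
  qed auto
  obtain d where d: "d > 0" "\<And>t y1 y2. 0 < t \<Longrightarrow> t < d \<Longrightarrow> y1 \<le> y2 \<Longrightarrow> E.\<eta> (Complex t y2) \<ge> E.\<eta> (Complex t y1) - k"
    using E.eta_almost_increasing[OF assms] by blast
  have "of_real T - cnj (Complex (T - t) y) = Complex t y" for t y
    by (simp add: complex_eq_iff)
  then have "\<eta> (Complex t y2) \<ge> \<eta> (Complex t y1) - k" if "t < T" "T - d < t" "y1 \<le> y2" for t y1 y2
    using d(2)[of "T - t" y1 y2] that by (simp add: L'_def)
  then show ?thesis using d(1) by blast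
qed

text \<open>By degree 1 the function \<eta> - y is periodic, so its translates by \<open>a\<close>
  and by \<open>-a\<close> have the same integral.\<close>

lemma integral_lift_increment:
  assumes t: "0 < t" "t < T"
  shows "((\<lambda>y. \<eta> (Complex t (y + a)) - \<eta> (Complex t (y - a)) - 2 * a) has_integral 0) {0..2*pi}"
proof -
  define p where "p y = \<eta> (Complex t y) - y" for y
  have contp: "continuous_on A p" for A
    unfolding p_def by (intro continuous_intros cont_line[OF L_cont] t)
  have perp: "p (y + 2*pi) = p y" for y using deg[OF t] by (simp add: p_def)
  have int: "(\<lambda>y. p (y + b)) integrable_on {0..2*pi}" for b
    by (rule integrable_continuous_interval) (rule continuous_on_compose2[OF contp[of UNIV]], auto intro!: continuous_intros)
  have "integral {0..2*pi} (\<lambda>y. p (y + b)) = integral {0..2*pi} p" for b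
    by (rule integral_periodic_shift[OF contp perp]) simp
  then have "((\<lambda>y. p (y + b)) has_integral integral {0..2*pi} p) {0..2*pi}" for b
    using integrable_integral[OF int[of b]] by simp
  from has_integral_diff[OF this[of a] this[of "-a"]]
  show ?thesis by (simp add: p_def algebra_simps)
qed

text \<open>By concavity of \<open>sin\<close> on \<open>[0, \<pi>]\<close>, circles parametrised monotonically have the
  largest mean chord when the parametrisation is uniform.\<close>

lemma chord_integral_bound:
  assumes t: "0 < t" "t < T" and a: "0 \<le> a" "a \<le> pi" and k: "0 \<le> k" and r: "0 \<le> r"
    and mono: "\<And>y1 y2. y1 \<le> y2 \<Longrightarrow> \<eta> (Complex t y2) \<ge> \<eta> (Complex t y1) - k"
    and rad: "\<And>y. \<bar>cmod (h (Complex t y)) - r\<bar> \<le> e"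
  shows "integral {0..2*pi} (\<lambda>y. cmod (h (Complex t (y + a)) - h (Complex t (y - a)))) \<le> 2*pi * (2*r * sin a + 2*r*k + 2*e)"
proof -
  define D where "D y = \<eta> (Complex t (y + a)) - \<eta> (Complex t (y - a))" for y
  have hc: "h z = of_real (cmod (h z)) * cis (\<eta> z)" if "z \<in> strip T" for z
    using exp_L[OF that] by (metis exp_eq_polar norm_exp_eq_Re)
  have nc: "cmod (h (Complex t y) - of_real r * cis (\<eta> (Complex t y))) \<le> e" for y
  proof -
    have "h (Complex t y) - of_real r * cis (\<eta> (Complex t y)) = of_real (cmod (h (Complex t y)) - r) * cis (\<eta> (Complex t y))"
      using hc[of "Complex t y"] t by (simp add: algebra_simps)
    also have "cmod \<dots> = \<bar>cmod (h (Complex t y)) - r\<bar>" by (simp add: norm_mult del: of_real_diff)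
    finally show ?thesis using rad[of y] by simp
  qed
  have bound: "cmod (h (Complex t (y + a)) - h (Complex t (y - a))) \<le> 2*e + 2*r*(sin a + k) + r * cos a * (D y - 2 * a)" for y
  proof -
    have D1: "D y \<ge> - k" unfolding D_def using mono[of "y - a" "y + a"] a by simp
    \<comment> \<open>The upper bound for the angle swept comes from the complementary arc, on which
      the argument does not drop by more than \<open>k\<close> either.\<close>
    have "\<eta> (Complex t (y - a + 2*pi)) \<ge> \<eta> (Complex t (y + a)) - k" by (rule mono) (use a in simp)
    then have D2: "D y \<le> 2*pi + k" unfolding D_def using deg[OF t, of "y - a"] by simp
    have "\<bar>sin (D y / 2)\<bar> \<le> sin a + cos a * (D y / 2 - a) + 2 * (k/2)"
      by (rule abs_sin_le_tangent) (use a D1 D2 k in auto)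
    then have "2 * r * \<bar>sin (D y / 2)\<bar> \<le> 2 * r * (sin a + cos a * (D y / 2 - a) + k)"
      using r by (intro mult_left_mono) auto
    also have "\<dots> = 2*r*(sin a + k) + r * cos a * (D y - 2 * a)" by (simp add: algebra_simps)
    finally have s: "2 * r * \<bar>sin (D y / 2)\<bar> \<le> 2*r*(sin a + k) + r * cos a * (D y - 2 * a)" .
    let ?p = "Complex t (y + a)" and ?m = "Complex t (y - a)"
    have "h ?p - h ?m = (h ?p - of_real r * cis (\<eta> ?p)) + of_real r * (cis (\<eta> ?p) - cis (\<eta> ?m)) - (h ?m - of_real r * cis (\<eta> ?m))"
      by (simp add: algebra_simps)
    also have "cmod \<dots> \<le> cmod (h ?p - of_real r * cis (\<eta> ?p)) + cmod (of_real r * (cis (\<eta> ?p) - cis (\<eta> ?m))) + cmod (h ?m - of_real r * cis (\<eta> ?m))"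
      by (rule order_trans[OF norm_triangle_ineq4 add_right_mono[OF norm_triangle_ineq]])
    also have "cmod (of_real r * (cis (\<eta> ?p) - cis (\<eta> ?m))) = 2 * r * \<bar>sin (D y / 2)\<bar>"
      using r by (simp add: norm_mult norm_cis_diff D_def)
    finally show ?thesis using nc[of "y + a"] nc[of "y - a"] s by linarith
  qed
  have c: "((\<lambda>_. x) has_integral 2*pi*x) {0..2*pi}" for x :: real
    using has_integral_const_real[of x 0 "2*pi"] by simp
  \<comment> \<open>The tangent line estimate is affine in the swept angle, whose mean is exactly
    2a; only the constant part survives the integration.\<close>
  have "((\<lambda>y. 2*e + 2*r*(sin a + k) + r * cos a * (D y - 2 * a)) has_integral 2*pi*(2*e + 2*r*(sin a + k)) + r * cos a * 0) {0..2*pi}"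
    unfolding D_def by (intro has_integral_add c has_integral_mult_right integral_lift_increment t)
  moreover have "(\<lambda>y. cmod (h (Complex t (y + a)) - h (Complex t (y - a)))) integrable_on {0..2*pi}"
    by (intro integrable_continuous_interval continuous_intros continuous_on_compose2[OF cont_line[OF cont_h t, of UNIV]]) auto
  ultimately have "integral {0..2*pi} (\<lambda>y. cmod (h (Complex t (y + a)) - h (Complex t (y - a)))) \<le> 2*pi*(2*e + 2*r*(sin a + k)) + r * cos a * 0"
    using bound by (intro has_integral_le[OF integrable_integral]) auto
  then show ?thesis by (simp add: algebra_simps)
qed

lemma chord_integral_left:
  assumes "\<delta> > 0"
  shows "\<exists>d>0. \<forall>t a. 0 < t \<longrightarrow> t < d \<longrightarrow> 0 \<le> a \<longrightarrow> a \<le> pi \<longrightarrow>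
    integral {0..2*pi} (\<lambda>y. cmod (h (Complex t (y + a)) - h (Complex t (y - a)))) \<le> 4*pi * (sin a + \<delta>)"
proof -
  define k where "k = min 1 (\<delta>/2)"
  have k: "0 < k" "k \<le> 1" "2*k \<le> \<delta>" using assms by (auto simp: k_def)
  obtain d1 where d1: "d1 > 0" "\<And>t y1 y2. 0 < t \<Longrightarrow> t < d1 \<Longrightarrow> y1 \<le> y2 \<Longrightarrow> \<eta> (Complex t y2) \<ge> \<eta> (Complex t y1) - k"
    using monotone_left[OF k(1,2)] by blast
  obtain d2 where d2: "d2 > 0" "\<And>z. z \<in> strip T \<Longrightarrow> Re z < d2 \<Longrightarrow> \<bar>cmod (h z) - 1\<bar> < k"
    using lim0[OF k(1)] by blast
  have "integral {0..2*pi} (\<lambda>y. cmod (h (Complex t (y + a)) - h (Complex t (y - a)))) \<le> 4*pi * (sin a + \<delta>)"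
    if "0 < t" "t < min T (min d1 d2)" "0 \<le> a" "a \<le> pi" for t a
  proof -
    have "integral {0..2*pi} (\<lambda>y. cmod (h (Complex t (y + a)) - h (Complex t (y - a)))) \<le> 2*pi * (2*1 * sin a + 2*1*k + 2*k)"
      by (rule chord_integral_bound) (use that k d1(2) d2(2)[of "Complex t y" for y] in \<open>auto intro: less_imp_le\<close>)
    also have "\<dots> = 4*pi * (sin a + 2*k)" by (simp add: algebra_simps)
    also have "\<dots> \<le> 4*pi * (sin a + \<delta>)" using k by (intro mult_left_mono) auto
    finally show ?thesis .
  qed
  then show ?thesis using d1 d2 T_pos by (intro exI[of _ "min T (min d1 d2)"]) auto
qed

lemma chord_integral_right:
  assumes "\<delta> > 0"
  shows "\<exists>d>0. \<forall>t a. t < T \<longrightarrow> T - d < t \<longrightarrow> 0 \<le> a \<longrightarrow> a \<le> pi \<longrightarrow>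
    integral {0..2*pi} (\<lambda>y. cmod (h (Complex t (y + a)) - h (Complex t (y - a)))) \<le> 4*pi * (R * sin a + \<delta>)"
proof -
  define k where "k = min 1 (\<delta>/(R+1))"
  have "k \<le> \<delta>/(R+1)" by (simp add: k_def)
  then have "k * (R+1) \<le> \<delta>" using R_gt by (simp add: pos_le_divide_eq)
  moreover have "0 < k" "k \<le> 1" using assms R_gt by (auto simp: k_def)
  ultimately have k: "0 < k" "k \<le> 1" "R*k + k \<le> \<delta>" by (simp_all add: algebra_simps)
  obtain d1 where d1: "d1 > 0" "\<And>t y1 y2. t < T \<Longrightarrow> T - d1 < t \<Longrightarrow> y1 \<le> y2 \<Longrightarrow> \<eta> (Complex t y2) \<ge> \<eta> (Complex t y1) - k"
    using monotone_right[OF k(1,2)] by blast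
  obtain d2 where d2: "d2 > 0" "\<And>z. z \<in> strip T \<Longrightarrow> Re z > T - d2 \<Longrightarrow> \<bar>cmod (h z) - R\<bar> < k"
    using limT[OF k(1)] by blast
  have "integral {0..2*pi} (\<lambda>y. cmod (h (Complex t (y + a)) - h (Complex t (y - a)))) \<le> 4*pi * (R * sin a + \<delta>)"
    if "t < T" "T - min T (min d1 d2) < t" "0 \<le> a" "a \<le> pi" for t a
  proof -
    have "integral {0..2*pi} (\<lambda>y. cmod (h (Complex t (y + a)) - h (Complex t (y - a)))) \<le> 2*pi * (2*R * sin a + 2*R*k + 2*k)"
      by (rule chord_integral_bound) (use that k R_gt d1(2) d2(2)[of "Complex t y" for y] in \<open>auto intro: less_imp_le\<close>)
    also have "\<dots> = 4*pi * (R * sin a + (R*k + k))" by (simp add: algebra_simps)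
    also have "\<dots> \<le> 4*pi * (R * sin a + \<delta>)" using k by (intro mult_left_mono) auto
    finally show ?thesis .
  qed
  then show ?thesis using d1 d2 T_pos by (intro exI[of _ "min T (min d1 d2)"]) auto
qed

end

section \<open>Correlations and the lower bound\<close>

lemma Im_cosh_complex: "Im (cosh (Complex t a)) = sinh t * sin a"
  by (simp add: cosh_field_def sinh_field_def Im_exp Re_exp algebra_simps diff_divide_distrib)

text \<open>The comparison function \<open>(A sinh (T - t) + B sinh t) sin a / sinh T\<close> is the imaginary part of
  \<open>(B cosh z - A cosh (T - z)) / sinh T\<close> at \<open>z = t + i a\<close>.\<close>

lemma sine_comparison:
  fixes A B T :: real
  assumes T: "T > 0" and \<Psi>: "\<Psi> holomorphic_on strip T" and AB: "A \<ge> 0" "B \<ge> 0"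
    and z0: "\<And>t. 0 < t \<Longrightarrow> t < T \<Longrightarrow> Im (\<Psi> (Complex t 0)) = 0"
    and zpi: "\<And>t. 0 < t \<Longrightarrow> t < T \<Longrightarrow> Im (\<Psi> (Complex t pi)) = 0"
    and left: "\<And>\<delta>. \<delta> > 0 \<Longrightarrow> \<exists>d>0. \<forall>t a. 0 < t \<longrightarrow> t < d \<longrightarrow> 0 \<le> a \<longrightarrow> a \<le> pi \<longrightarrow> Im (\<Psi> (Complex t a)) \<le> A * sin a + \<delta>"
    and right: "\<And>\<delta>. \<delta> > 0 \<Longrightarrow> \<exists>d>0. \<forall>t a. t < T \<longrightarrow> T - d < t \<longrightarrow> 0 \<le> a \<longrightarrow> a \<le> pi \<longrightarrow> Im (\<Psi> (Complex t a)) \<le> B * sin a + \<delta>"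
    and t: "0 < t" "t < T" and a: "0 \<le> a" "a \<le> pi"
  shows "Im (\<Psi> (Complex t a)) \<le> (A * sinh (T - t) + B * sinh t) / sinh T * sin a"
proof -
  define W where "W z = (of_real B * cosh z - of_real A * cosh (of_real T - z)) / of_real (sinh T)" for z :: complex
  have sT: "sinh T > 0" using T by simp
  have W: "Im (W (Complex t a)) = (A * sinh (T - t) + B * sinh t) / sinh T * sin a" for t a
  proof -
    have "of_real T - Complex t a = Complex (T - t) (- a)" by (simp add: complex_eq_iff)
    then show ?thesis by (simp add: W_def Im_cosh_complex Im_divide_of_real ring_distribs)
  qed
  have Whol: "W holomorphic_on strip T"
    unfolding W_def cosh_field_def using sT by (intro holomorphic_intros) auto
  show ?thesis
  proof (rule field_le_epsilon)
    fix e :: real assume e: "e > 0"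
    define \<delta> where "\<delta> = e/2"
    have \<delta>: "\<delta> > 0" using e by (simp add: \<delta>_def)
    obtain d1 where d1: "d1 > 0" "\<And>t a. \<lbrakk>0 < t; t < d1; 0 \<le> a; a \<le> pi\<rbrakk> \<Longrightarrow> Im (\<Psi> (Complex t a)) \<le> A * sin a + \<delta>"
      using left[OF \<delta>] by blast
    obtain d2 where d2: "d2 > 0" "\<And>t a. \<lbrakk>t < T; T - d2 < t; 0 \<le> a; a \<le> pi\<rbrakk> \<Longrightarrow> Im (\<Psi> (Complex t a)) \<le> B * sin a + \<delta>"
      using right[OF \<delta>] by blast
    \<comment> \<open>At distance \<epsilon> from an end the comparison function has dropped by the
      factor sinh (T - \<epsilon>) / sinh T; \<gamma> limits this loss so that it costs at most
      \<delta>.\<close>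
    define \<gamma> where "\<gamma> = \<delta> / (A + B + 1)"
    have \<gamma>: "\<gamma> > 0" "A * \<gamma> \<le> \<delta>" "B * \<gamma> \<le> \<delta>"
      using \<delta> AB by (auto simp: \<gamma>_def field_simps)
    have "isCont (\<lambda>x. sinh (T - x) / sinh T) 0" using sT by (intro continuous_intros) auto
    then obtain d3 where d3: "d3 > 0" "\<And>x. \<bar>x\<bar> < d3 \<Longrightarrow> \<bar>sinh (T - x) / sinh T - 1\<bar> < \<gamma>"
      using \<gamma>(1) sT unfolding continuous_at_eps_delta by (auto simp: dist_real_def)
    define \<epsilon> where "\<epsilon> = Min {t, T - t, d1, d2, d3} / 2"
    have \<epsilon>: "0 < \<epsilon>" "\<epsilon> < t" "\<epsilon> < T - t" "\<epsilon> < d1" "\<epsilon> < d2" "\<epsilon> < d3"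
      using t d1(1) d2(1) d3(1) by (auto simp: \<epsilon>_def)
    define m where "m = sinh (T - \<epsilon>) / sinh T"
    have m: "1 - m \<le> \<gamma>" using d3(2)[of \<epsilon>] \<epsilon> by (simp add: m_def abs_less_iff)
    have s\<epsilon>: "sinh \<epsilon> / sinh T \<ge> 0" using \<epsilon> sT by simp
    let ?S = "cbox (Complex \<epsilon> 0) (Complex (T - \<epsilon>) pi)" and ?U = "box (Complex \<epsilon> 0) (Complex (T - \<epsilon>) pi)"
    have "Im (\<Psi> (Complex t a) - W (Complex t a)) \<le> 2 * \<delta>"
    proof (rule harmonic_maximum[of "\<lambda>z. \<Psi> z - W z" "strip T" ?S ?U])
      show "(\<lambda>z. \<Psi> z - W z) holomorphic_on strip T" by (intro holomorphic_intros \<Psi> Whol)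
      show "?S \<subseteq> strip T" using \<epsilon> by (auto simp: strip_def in_cbox_complex_iff)
      show "Complex t a \<in> ?S" using \<epsilon> a by (auto simp: in_cbox_complex_iff)
      fix z assume z: "z \<in> ?S - ?U"
      obtain x y where xy: "z = Complex x y" by (metis complex.exhaust)
      have b: "\<epsilon> \<le> x" "x \<le> T - \<epsilon>" "0 \<le> y" "y \<le> pi" using z by (auto simp: xy in_cbox_complex_iff)
      have sy: "0 \<le> sin y" "sin y \<le> 1" using b by (auto intro: sin_ge_zero)
      have x: "0 < x" "x < T" using b \<epsilon> by auto
      consider "x = \<epsilon>" | "x = T - \<epsilon>" | "y = 0" | "y = pi"
        using z b by (fastforce simp: xy in_box_complex_iff in_cbox_complex_iff)
      then show "Im (\<Psi> z - W z) \<le> 2 * \<delta>"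
      proof cases
        case 1
        have "Im (\<Psi> z) \<le> A * sin y + \<delta>" unfolding xy by (rule d1(2)) (use b \<epsilon> 1 in auto)
        moreover have "Im (W z) = A * m * sin y + B * (sinh \<epsilon> / sinh T) * sin y"
          unfolding xy W 1 m_def by (simp add: add_divide_distrib ring_distribs)
        moreover have "B * (sinh \<epsilon> / sinh T) * sin y \<ge> 0" by (intro mult_nonneg_nonneg AB s\<epsilon> sy)
        moreover have "(A * (1 - m)) * sin y \<le> \<delta>"
        proof -
          have "A * (1 - m) \<le> A * \<gamma>" using m AB by (intro mult_left_mono)
          then have "(A * (1 - m)) * sin y \<le> \<delta> * sin y" using \<gamma> sy by (intro mult_right_mono) auto
          also have "\<dots> \<le> \<delta>" using sy \<delta> by (simp add: mult_left_le)
          finally show ?thesis .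
        qed
        ultimately show ?thesis by (simp add: algebra_simps)
      next
        case 2
        have "Im (\<Psi> z) \<le> B * sin y + \<delta>" unfolding xy by (rule d2(2)) (use b \<epsilon> 2 in auto)
        moreover have "Im (W z) = A * (sinh \<epsilon> / sinh T) * sin y + B * m * sin y"
          unfolding xy W 2 m_def by (simp add: add_divide_distrib ring_distribs)
        moreover have "A * (sinh \<epsilon> / sinh T) * sin y \<ge> 0" by (intro mult_nonneg_nonneg AB s\<epsilon> sy)
        moreover have "(B * (1 - m)) * sin y \<le> \<delta>"
        proof -
          have "B * (1 - m) \<le> B * \<gamma>" using m AB by (intro mult_left_mono)
          then have "(B * (1 - m)) * sin y \<le> \<delta> * sin y" using \<gamma> sy by (intro mult_right_mono) auto
          also have "\<dots> \<le> \<delta>" using sy \<delta> by (simp add: mult_left_le)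
          finally show ?thesis .
        qed
        ultimately show ?thesis by (simp add: algebra_simps)
      next
        case 3
        then show ?thesis using z0[OF x] \<delta> by (simp add: xy W)
      next
        case 4
        then show ?thesis using zpi[OF x] \<delta> by (simp add: xy W)
      qed
    qed (auto simp: open_strip compact_cbox open_box box_subset_cbox)
    then show "Im (\<Psi> (Complex t a)) \<le> (A * sinh (T - t) + B * sinh t) / sinh T * sin a + e"
      by (simp add: W \<delta>_def)
  qed
qed

section \<open>The correlation of two image curves and its upper bound\<close>

context annulus_map
begin

text \<open>Normalised so that the extremal map cosh t cis \<theta> has correlation cosh s cosh t
  sin a.\<close>

definition corr :: "real \<Rightarrow> real \<Rightarrow> real \<Rightarrow> real" where
  "corr s t a = Im (integral {0..2*pi} (\<lambda>y. cnj (h (Complex s y)) * (h (Complex t (y + a)) - h (Complex t (y - a))))) / (4*pi)"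

lemma cont_shift:
  assumes "0 < t" "t < T"
  shows "continuous_on A (\<lambda>y. h (Complex t (y + a)))" "continuous_on A (\<lambda>y. h (Complex t (y - a)))"
    "continuous_on A (\<lambda>y. h (Complex t y))"
  by (intro continuous_on_compose2[OF cont_line[OF cont_h assms, of UNIV]] continuous_intros; simp)+

lemma integrable_corr:
  assumes "0 < s" "s < T" "0 < t" "t < T"
  shows "(\<lambda>y. cnj (h (Complex s y)) * (h (Complex t (y + a)) - h (Complex t (y - a)))) integrable_on {0..2*pi}"
  by (intro integrable_continuous_interval continuous_intros cont_shift assms)

text \<open>Translating the variable of integration moves the shifts to the other curve. The
  integral turns into minus its conjugate with \<open>s\<close> and \<open>t\<close> exchanged,
  which has the same imaginary part.\<close>

lemma corr_sym:
  assumes s: "0 < s" "s < T" and t: "0 < t" "t < T"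
  shows "corr s t a = corr t s a"
proof -
  have shift: "integral {0..2*pi} (\<lambda>y. cnj (h (Complex s y)) * h (Complex t (y + b))) =
      integral {0..2*pi} (\<lambda>y. cnj (h (Complex s (y - b))) * h (Complex t y))" for b
  proof -
    have "integral {0..2*pi} (\<lambda>y. cnj (h (Complex s (y + (-b)))) * h (Complex t ((y + (-b)) + b))) =
        integral {0..2*pi} (\<lambda>y. cnj (h (Complex s y)) * h (Complex t (y + b)))"
    proof (rule integral_periodic_shift[where f = "\<lambda>y. cnj (h (Complex s y)) * h (Complex t (y + b))"])
      show "continuous_on UNIV (\<lambda>y. cnj (h (Complex s y)) * h (Complex t (y + b)))"
        by (intro continuous_intros cont_shift s t)
      show "cnj (h (Complex s (x + 2*pi))) * h (Complex t (x + 2*pi + b)) = cnj (h (Complex s x)) * h (Complex t (x + b))" for x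
        using per[OF s, of x] per[OF t, of "x + b"] by (simp add: add_ac)
    qed simp
    then show ?thesis by simp
  qed
  have int: "(\<lambda>y. cnj (h (Complex s (y + b))) * h (Complex t (y + c))) integrable_on {0..2*pi}" for b c
    by (intro integrable_continuous_interval continuous_intros cont_shift s t)
  have "integral {0..2*pi} (\<lambda>y. cnj (h (Complex s y)) * (h (Complex t (y + a)) - h (Complex t (y - a)))) =
     integral {0..2*pi} (\<lambda>y. cnj (h (Complex s y)) * h (Complex t (y + a))) - integral {0..2*pi} (\<lambda>y. cnj (h (Complex s y)) * h (Complex t (y + - a)))"
    using int[of 0 a] int[of 0 "-a"] by (simp add: right_diff_distrib integral_diff)
  also have "\<dots> = integral {0..2*pi} (\<lambda>y. cnj (h (Complex s (y - a))) * h (Complex t y)) - integral {0..2*pi} (\<lambda>y. cnj (h (Complex s (y - - a))) * h (Complex t y))"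
    by (simp only: shift)
  also have "\<dots> = integral {0..2*pi} (\<lambda>y. cnj (h (Complex s (y - a))) * h (Complex t y) - cnj (h (Complex s (y + a))) * h (Complex t y))"
    using int[of "-a" 0] int[of a 0] by (simp add: integral_diff)
  also have "\<dots> = integral {0..2*pi} (\<lambda>y. - cnj (cnj (h (Complex t y)) * (h (Complex s (y + a)) - h (Complex s (y - a)))))"
    by (rule arg_cong[where f = "integral {0..2*pi}"]) (auto simp: algebra_simps)
  also have "\<dots> = - cnj (integral {0..2*pi} (\<lambda>y. cnj (h (Complex t y)) * (h (Complex s (y + a)) - h (Complex s (y - a)))))"
    by (simp add: integral_cnj)
  finally show ?thesis by (simp add: corr_def)
qed

lemma corr_harmonic:
  assumes s: "0 < s" "s < T"
  obtains \<Psi> where "\<Psi> holomorphic_on strip T" "\<And>t a. 0 < t \<Longrightarrow> t < T \<Longrightarrow> corr s t a = Im (\<Psi> (Complex t a))"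
proof -
  define k where "k y = cnj (h (Complex s y))" for y
  have ck: "continuous_on {0..2*pi} k" "continuous_on {0..2*pi} (\<lambda>y. cnj (k y))"
    unfolding k_def by (intro continuous_intros cont_shift s)+
  define Fc where "Fc z = integral {0..2*pi} (\<lambda>y. k y * F (z + \<i> * of_real y))" for z
  define Gc where "Gc z = integral {0..2*pi} (\<lambda>y. cnj (k y) * G (z + \<i> * of_real y))" for z
  have hol: "Fc holomorphic_on strip T" "Gc holomorphic_on strip T"
    unfolding Fc_def Gc_def by (intro holomorphic_vertical_average ck F_hol G_hol)+
  define \<Phi> where "\<Phi> z = Fc z - Gc z" for z
  have \<Phi>: "\<Phi> holomorphic_on strip T" unfolding \<Phi>_def by (intro holomorphic_intros hol)
  \<comment> \<open>Only imaginary parts count, and Im (cnj w) = - Im w. So the conjugate of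
    \<open>Gc\<close> is replaced by \<open>- Gc\<close>, and the shift by \<open>-a\<close>, which
    would give -\<Phi>(cnj z), by the holomorphic function cnj (\<Phi> (cnj z)).\<close>
  define \<Psi> where "\<Psi> z = (\<Phi> z + cnj (\<Phi> (cnj z))) / of_real (4*pi)" for z
  have "cnj ` strip T = strip T"
    using image_eqI[of z cnj "cnj z" "strip T" for z] by (auto simp: strip_def)
  then have "(\<lambda>z. cnj (\<Phi> (cnj z))) holomorphic_on strip T"
    using holomorphic_on_compose_cnj_cnj[of \<Phi> "strip T"] \<Phi> open_strip by (simp add: o_def)
  then have "\<Psi> holomorphic_on strip T" unfolding \<Psi>_def by (intro holomorphic_intros \<Phi>) auto
  moreover have "corr s t a = Im (\<Psi> (Complex t a))" if t: "0 < t" "t < T" for t a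
  proof -
    have sh: "Complex t b + \<i> * of_real y = Complex t (y + b)" for b y by (simp add: complex_eq_iff)
    have cF: "continuous_on {0..2*pi} (\<lambda>y. f (Complex t (y + b)))" if "f holomorphic_on strip T" for f b
      by (rule continuous_on_compose2[OF cont_line[OF cont_hol[OF that] t, of UNIV]]) (auto intro!: continuous_intros)
    have I: "integral {0..2*pi} (\<lambda>y. k y * h (Complex t (y + b))) = Fc (Complex t b) + cnj (Gc (Complex t b))" for b
    proof -
      have "integral {0..2*pi} (\<lambda>y. k y * h (Complex t (y + b))) =
         integral {0..2*pi} (\<lambda>y. k y * F (Complex t (y + b)) + cnj (cnj (k y) * G (Complex t (y + b))))"
        by (simp add: hmap_def algebra_simps)
      also have "\<dots> = integral {0..2*pi} (\<lambda>y. k y * F (Complex t (y + b))) + integral {0..2*pi} (\<lambda>y. cnj (cnj (k y) * G (Complex t (y + b))))"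
        by (intro integral_add integrable_continuous_interval continuous_intros ck cF F_hol G_hol)
      also have "integral {0..2*pi} (\<lambda>y. cnj (cnj (k y) * G (Complex t (y + b)))) = cnj (integral {0..2*pi} (\<lambda>y. cnj (k y) * G (Complex t (y + b))))"
        by (rule integral_cnj[symmetric])
      finally show ?thesis by (simp add: Fc_def Gc_def sh)
    qed
    have "integral {0..2*pi} (\<lambda>y. k y * (h (Complex t (y + a)) - h (Complex t (y - a)))) =
      integral {0..2*pi} (\<lambda>y. k y * h (Complex t (y + a))) - integral {0..2*pi} (\<lambda>y. k y * h (Complex t (y + - a)))"
      unfolding right_diff_distrib
      by (simp, intro integral_diff integrable_continuous_interval continuous_intros ck cont_shift t)
    then have "corr s t a = Im (Fc (Complex t a) + cnj (Gc (Complex t a)) - (Fc (Complex t (-a)) + cnj (Gc (Complex t (-a))))) / (4*pi)"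
      unfolding corr_def k_def[symmetric] by (simp only: I)
    also have "\<dots> = Im (\<Psi> (Complex t a))"
      by (simp add: \<Psi>_def \<Phi>_def Im_divide_of_real complex_cnj)
    finally show ?thesis .
  qed
  ultimately show ?thesis by (rule that)
qed

lemma corr_0: "corr s t 0 = 0" by (simp add: corr_def)

lemma corr_pi:
  assumes "0 < t" "t < T"
  shows "corr s t pi = 0"
proof -
  have "h (Complex t (y + pi)) = h (Complex t (y - pi))" for y
    using per[OF assms, of "y - pi"] by (simp add: add.commute)
  then show ?thesis by (simp add: corr_def)
qed

lemma corr_le_chord:
  assumes s: "0 < s" "s < T" and t: "0 < t" "t < T" and m: "\<And>y. cmod (h (Complex s y)) \<le> m"
  shows "corr s t a \<le> m / (4*pi) * integral {0..2*pi} (\<lambda>y. cmod (h (Complex t (y + a)) - h (Complex t (y - a))))"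
proof -
  let ?f = "\<lambda>y. cnj (h (Complex s y)) * (h (Complex t (y + a)) - h (Complex t (y - a)))"
  let ?g = "\<lambda>y. m * cmod (h (Complex t (y + a)) - h (Complex t (y - a)))"
  have "Im (integral {0..2*pi} ?f) \<le> norm (integral {0..2*pi} ?f)"
    using abs_Im_le_cmod by (rule abs_le_D1)
  also have "\<dots> \<le> integral {0..2*pi} ?g"
  proof (rule integral_norm_bound_integral[OF integrable_corr[OF s t]])
    show "?g integrable_on {0..2*pi}"
      by (intro integrable_continuous_interval continuous_intros cont_shift t)
    show "norm (?f y) \<le> ?g y" for y
      by (simp add: norm_mult mult_right_mono m)
  qed
  also have "\<dots> = m * integral {0..2*pi} (\<lambda>y. cmod (h (Complex t (y + a)) - h (Complex t (y - a))))"
    by simp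
  finally show ?thesis unfolding corr_def using pi_gt_zero by (simp add: divide_right_mono field_simps)
qed

text \<open>The solution of \<Lambda>'' = \<Lambda> with values 1 at 0 and \<open>R\<close> at
  \<open>T\<close>. Thus \<Lambda>(t) sin a is harmonic in t + i a and has the end values that the
  chords dictate.\<close>

definition \<Lambda> :: "real \<Rightarrow> real" where
  "\<Lambda> t = (sinh (T - t) + R * sinh t) / sinh T"

lemma \<Lambda>_nonneg: "0 < t \<Longrightarrow> t < T \<Longrightarrow> \<Lambda> t \<ge> 0"
  unfolding \<Lambda>_def using T_pos R_gt by simp

text \<open>First maximum principle, with \<open>s\<close> fixed and only the crude bound
  \<open>m\<close> on the curve at \<open>s\<close>: the chord estimates supply the boundary values
  m sin a and m R sin a.\<close>

lemma corr_le_one_sided: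
  assumes s: "0 < s" "s < T" and t: "0 < t" "t < T" and m: "\<And>y. cmod (h (Complex s y)) \<le> m"
    and a: "0 \<le> a" "a \<le> pi"
  shows "corr s t a \<le> m * \<Lambda> t * sin a"
proof -
  have "0 < cmod (h (Complex s 0))" using h_nz s by simp
  then have m0: "m > 0" using m[of 0] by linarith
  obtain \<Psi> where \<Psi>: "\<Psi> holomorphic_on strip T" "\<And>t a. 0 < t \<Longrightarrow> t < T \<Longrightarrow> corr s t a = Im (\<Psi> (Complex t a))"
    using corr_harmonic[OF s] by blast
  have "Im (\<Psi> (Complex t a)) \<le> (m * sinh (T - t) + (m * R) * sinh t) / sinh T * sin a"
  proof (rule sine_comparison[OF T_pos \<Psi>(1) _ _ _ _ _ _ t a])
    show "0 \<le> m" "0 \<le> m * R" using m0 R_gt by auto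
    show "Im (\<Psi> (Complex t 0)) = 0" if "0 < t" "t < T" for t using \<Psi>(2)[OF that, of 0] by (simp add: corr_0)
    show "Im (\<Psi> (Complex t pi)) = 0" if "0 < t" "t < T" for t using \<Psi>(2)[OF that, of pi] corr_pi[OF that] by simp
    fix \<delta> :: real assume "\<delta> > 0"
    then have \<delta>: "\<delta> / m > 0" using m0 by simp
    have bd: "Im (\<Psi> (Complex t a)) \<le> m * r * sin a + \<delta>" if t: "0 < t" "t < T" and
      c: "integral {0..2*pi} (\<lambda>y. cmod (h (Complex t (y + a)) - h (Complex t (y - a)))) \<le> 4*pi * (r * sin a + \<delta>/m)" for t a r
    proof -
      have "Im (\<Psi> (Complex t a)) \<le> m / (4*pi) * integral {0..2*pi} (\<lambda>y. cmod (h (Complex t (y + a)) - h (Complex t (y - a))))"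
        using corr_le_chord[OF s t m] \<Psi>(2)[OF t] by simp
      also have "\<dots> \<le> m / (4*pi) * (4*pi * (r * sin a + \<delta>/m))"
        using c m0 by (intro mult_left_mono) auto
      also have "\<dots> = m * r * sin a + \<delta>" using m0 by (simp add: field_simps)
      finally show ?thesis .
    qed
    obtain d where d: "d > 0" "\<And>t a. \<lbrakk>0 < t; t < d; 0 \<le> a; a \<le> pi\<rbrakk> \<Longrightarrow>
      integral {0..2*pi} (\<lambda>y. cmod (h (Complex t (y + a)) - h (Complex t (y - a)))) \<le> 4*pi * (sin a + \<delta>/m)"
      using chord_integral_left[OF \<delta>] by blast
    show "\<exists>d>0. \<forall>t a. 0 < t \<longrightarrow> t < d \<longrightarrow> 0 \<le> a \<longrightarrow> a \<le> pi \<longrightarrow> Im (\<Psi> (Complex t a)) \<le> m * sin a + \<delta>"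
      using d bd[where r = 1] T_pos by (intro exI[of _ "min d T"]) auto
    obtain d where d: "d > 0" "\<And>t a. \<lbrakk>t < T; T - d < t; 0 \<le> a; a \<le> pi\<rbrakk> \<Longrightarrow>
      integral {0..2*pi} (\<lambda>y. cmod (h (Complex t (y + a)) - h (Complex t (y - a)))) \<le> 4*pi * (R * sin a + \<delta>/m)"
      using chord_integral_right[OF \<delta>] by blast
    show "\<exists>d>0. \<forall>t a. t < T \<longrightarrow> T - d < t \<longrightarrow> 0 \<le> a \<longrightarrow> a \<le> pi \<longrightarrow> Im (\<Psi> (Complex t a)) \<le> m * R * sin a + \<delta>"
      using d bd[where r = R] T_pos by (intro exI[of _ "min d T"]) auto
  qed
  also have "\<dots> = m * \<Lambda> t * sin a" by (simp add: \<Lambda>_def algebra_simps)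
  finally show ?thesis using \<Psi>(2)[OF t] by simp
qed

text \<open>Second maximum principle. When \<open>t\<close> approaches an end, the curve at
  \<open>t\<close> has modulus close to 1 or to \<open>R\<close>, so the one-sided bound with
  \<open>s\<close> and \<open>t\<close> exchanged provides boundary values with the factor
  \<Lambda>(s) in place of \<open>m\<close>.\<close>

lemma corr_le:
  assumes s: "0 < s" "s < T" and t: "0 < t" "t < T" and a: "0 \<le> a" "a \<le> pi"
  shows "corr s t a \<le> \<Lambda> s * \<Lambda> t * sin a"
proof -
  obtain \<Psi> where \<Psi>: "\<Psi> holomorphic_on strip T" "\<And>t a. 0 < t \<Longrightarrow> t < T \<Longrightarrow> corr s t a = Im (\<Psi> (Complex t a))"
    using corr_harmonic[OF s] by blast
  have l: "\<Lambda> s \<ge> 0" by (rule \<Lambda>_nonneg[OF s])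
  have "Im (\<Psi> (Complex t a)) \<le> (\<Lambda> s * sinh (T - t) + (R * \<Lambda> s) * sinh t) / sinh T * sin a"
  proof (rule sine_comparison[OF T_pos \<Psi>(1) _ _ _ _ _ _ t a])
    show "0 \<le> \<Lambda> s" "0 \<le> R * \<Lambda> s" using l R_gt by auto
    show "Im (\<Psi> (Complex t 0)) = 0" if "0 < t" "t < T" for t using \<Psi>(2)[OF that, of 0] by (simp add: corr_0)
    show "Im (\<Psi> (Complex t pi)) = 0" if "0 < t" "t < T" for t using \<Psi>(2)[OF that, of pi] corr_pi[OF that] by simp
    fix \<delta> :: real assume \<delta>: "\<delta> > 0"
    define e where "e = \<delta> / (\<Lambda> s + 1)"
    have e: "e > 0" "e * \<Lambda> s \<le> \<delta>" using \<delta> l by (auto simp: e_def field_simps)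
    have bd: "Im (\<Psi> (Complex t a)) \<le> r * \<Lambda> s * sin a + \<delta>"
      if t: "0 < t" "t < T" and m: "\<And>y. cmod (h (Complex t y)) \<le> r + e" and a: "0 \<le> a" "a \<le> pi" for t a r
    proof -
      \<comment> \<open>Here the crude bound is applied to the curve at \<open>t\<close>, where it
        is almost sharp.\<close>
      have "Im (\<Psi> (Complex t a)) = corr t s a" using \<Psi>(2)[OF t] corr_sym[OF s t] by simp
      also have "\<dots> \<le> (r + e) * \<Lambda> s * sin a" by (rule corr_le_one_sided[OF t s m a])
      also have "\<dots> = r * \<Lambda> s * sin a + (e * \<Lambda> s) * sin a" by (simp add: algebra_simps)
      also have "(e * \<Lambda> s) * sin a \<le> \<delta> * 1" using e l \<delta> a by (intro mult_mono) (auto intro: sin_ge_zero)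
      finally show ?thesis by simp
    qed
    obtain d where d: "d > 0" "\<And>z. z \<in> strip T \<Longrightarrow> Re z < d \<Longrightarrow> \<bar>cmod (h z) - 1\<bar> < e"
      using lim0[OF e(1)] by blast
    have "Im (\<Psi> (Complex t a)) \<le> \<Lambda> s * sin a + \<delta>" if "0 < t" "t < min d T" "0 \<le> a" "a \<le> pi" for t a
    proof -
      have "cmod (h (Complex t y)) \<le> 1 + e" for y using d(2)[of "Complex t y"] that by (simp add: abs_less_iff)
      then show ?thesis using bd[of t 1 a] that by simp
    qed
    then show "\<exists>d>0. \<forall>t a. 0 < t \<longrightarrow> t < d \<longrightarrow> 0 \<le> a \<longrightarrow> a \<le> pi \<longrightarrow> Im (\<Psi> (Complex t a)) \<le> \<Lambda> s * sin a + \<delta>"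
      using d(1) T_pos by (intro exI[of _ "min d T"]) auto
    obtain d where d: "d > 0" "\<And>z. z \<in> strip T \<Longrightarrow> Re z > T - d \<Longrightarrow> \<bar>cmod (h z) - R\<bar> < e"
      using limT[OF e(1)] by blast
    have "Im (\<Psi> (Complex t a)) \<le> R * \<Lambda> s * sin a + \<delta>" if "t < T" "T - min d T < t" "0 \<le> a" "a \<le> pi" for t a
    proof -
      have t': "0 < t" "T - d < t" using that(2) by linarith+
      have "cmod (h (Complex t y)) \<le> R + e" for y using d(2)[of "Complex t y"] that t' by (simp add: abs_less_iff)
      then show ?thesis using bd[of t R a] that t' by simp
    qed
    then show "\<exists>d>0. \<forall>t a. t < T \<longrightarrow> T - d < t \<longrightarrow> 0 \<le> a \<longrightarrow> a \<le> pi \<longrightarrow> Im (\<Psi> (Complex t a)) \<le> R * \<Lambda> s * sin a + \<delta>"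
      using d(1) T_pos by (intro exI[of _ "min d T"]) auto
  qed
  also have "\<dots> = \<Lambda> s * \<Lambda> t * sin a" by (simp add: \<Lambda>_def[of t] algebra_simps)
  finally show ?thesis using \<Psi>(2)[OF t] by simp
qed

section \<open>Comparison with the enclosed area and the lower bound for the modulus\<close>

definition area :: "real \<Rightarrow> real" where
  "area t = integral {0..2*pi} (\<lambda>y. Im (cnj (h (Complex t y)) * hth (Complex t y))) / (2*pi)"

lemma area_ge_1:
  assumes "0 < t" "t < T"
  shows "area t \<ge> 1"
  using winding_and_area(2)[OF assms] deg[OF assms, of 0] by (simp add: area_def)

lemma corr_derivative:
  assumes t: "0 < t" "t < T"
  shows "(corr t t has_real_derivative area t) (at 0)"
proof -
  let ?f = "\<lambda>a y. cnj (h (Complex t y)) * (h (Complex t (y + a)) - h (Complex t (y - a)))"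
  let ?d = "\<lambda>a y. cnj (h (Complex t y)) * (hth (Complex t (y + a)) + hth (Complex t (y - a)))"
  have d: "((\<lambda>a. ?f a y) has_vector_derivative ?d a y) (at a)" for a y
  proof -
    have "((\<lambda>a. y + a) has_vector_derivative 1) (at a)" "((\<lambda>a. y - a) has_vector_derivative -1) (at a)"
      by (auto intro!: derivative_eq_intros)
    note this[THEN vector_diff_chain_at, OF h_th[OF t], unfolded o_def]
    then have "((\<lambda>a. h (Complex t (y + a))) has_vector_derivative 1 *\<^sub>R hth (Complex t (y + a))) (at a)"
      "((\<lambda>a. h (Complex t (y - a))) has_vector_derivative (-1) *\<^sub>R hth (Complex t (y - a))) (at a)"
      by blast+
    then have "((\<lambda>a. h (Complex t (y + a)) - h (Complex t (y - a))) has_vector_derivative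
        1 *\<^sub>R hth (Complex t (y + a)) - (-1) *\<^sub>R hth (Complex t (y - a))) (at a)"
      by (rule has_vector_derivative_diff)
    from has_vector_derivative_mult_right[OF this, of "cnj (h (Complex t y))"] show ?thesis by simp
  qed
  have c: "continuous_on (UNIV \<times> {0..2*pi}) (\<lambda>p. g (Complex t (l p)))"
    if "continuous_on (strip T) g" "continuous_on (UNIV \<times> {0..2*pi}) l" for g :: "complex \<Rightarrow> complex" and l :: "real \<times> real \<Rightarrow> real"
    by (rule continuous_on_compose2[OF cont_line[OF that(1) t, of UNIV] that(2)]) simp
  have "((\<lambda>a. integral {0..2*pi} (?f a)) has_vector_derivative integral {0..2*pi} (?d 0)) (at 0 within UNIV)"
  proof (rule leibniz_rule_vector_derivative[of UNIV 0 "2*pi" ?f ?d 0, unfolded cbox_interval])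
    show "?f a integrable_on {0..2*pi}" for a by (rule integrable_corr[OF t t])
    show "continuous_on (UNIV \<times> {0..2*pi}) (\<lambda>(a, y). ?d a y)"
      unfolding split_beta' by (intro continuous_intros c[OF cont_h] c[OF cont_parts(2)])
  qed (use d in auto)
  then have "((\<lambda>a. Im (integral {0..2*pi} (?f a))) has_real_derivative Im (integral {0..2*pi} (?d 0))) (at 0)"
    by (simp add: vd_Im)
  from DERIV_cdivide[OF this, of "4*pi"]
  have 1: "(corr t t has_real_derivative Im (integral {0..2*pi} (?d 0)) / (4*pi)) (at 0)"
    by (simp add: corr_def[abs_def])
  have int: "(\<lambda>y. cnj (h (Complex t y)) * hth (Complex t y)) integrable_on {0..2*pi}"
    by (intro integrable_continuous_interval continuous_intros cont_line[OF cont_h] cont_line[OF cont_parts(2)] t)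
  have "integral {0..2*pi} (?d 0) = integral {0..2*pi} (\<lambda>y. 2 * (cnj (h (Complex t y)) * hth (Complex t y)))"
    by (simp add: algebra_simps)
  also have "\<dots> = 2 * integral {0..2*pi} (\<lambda>y. cnj (h (Complex t y)) * hth (Complex t y))" by simp
  finally have "Im (integral {0..2*pi} (?d 0)) = 2 * integral {0..2*pi} (\<lambda>y. Im (cnj (h (Complex t y)) * hth (Complex t y)))"
    using integral_unique[OF has_integral_Im[OF integrable_integral[OF int]]] by simp
  then show ?thesis using 1 by (simp add: area_def)
qed

text \<open>Both sides of \<open>corr_le\<close> with s = t vanish at a = 0, so their derivatives
  there are ordered in the same way.\<close>

lemma area_le:
  assumes t: "0 < t" "t < T"
  shows "area t \<le> (\<Lambda> t)\<^sup>2"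
proof (rule ccontr)
  assume "\<not> ?thesis"
  then have neg: "(\<Lambda> t)\<^sup>2 - area t < 0" by simp
  have "((\<lambda>a. (\<Lambda> t)\<^sup>2 * sin a - corr t t a) has_real_derivative (\<Lambda> t)\<^sup>2 - area t) (at 0)"
    by (auto intro!: derivative_eq_intros corr_derivative t)
  from DERIV_neg_dec_right[OF this neg] obtain d where d: "d > 0"
    "\<And>x. 0 < x \<Longrightarrow> x < d \<Longrightarrow> (\<Lambda> t)\<^sup>2 * sin x - corr t t x < 0"
    by (auto simp: corr_0)
  define a where "a = min (d/2) pi"
  have "0 < a" "a < d" "a \<le> pi" using d(1) by (auto simp: a_def)
  then show False using d(2)[of a] corr_le[OF t t, of a] by (simp add: power2_eq_square)
qed

theorem cosh_le_R: "cosh T \<le> R"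
proof -
  \<comment> \<open>At the abscissa 2t the inequality \<Lambda> \<ge> 1 has the common factor 2 sinh
    t; cancelling it takes the place of differentiating \<Lambda> at 0.\<close>
  have "cosh (T - t) \<le> R * cosh t" if t: "0 < t" "t < T/2" for t
  proof -
    have t2: "0 < 2*t" "2*t < T" using t by auto
    have "1 \<le> (\<Lambda> (2*t))\<^sup>2" using area_ge_1[OF t2] area_le[OF t2] by linarith
    then have "1 \<le> \<Lambda> (2*t)" using \<Lambda>_nonneg[OF t2] by (metis one_power2 power2_le_imp_le)
    then have "sinh T - sinh (T - 2*t) \<le> R * sinh (2*t)"
      unfolding \<Lambda>_def using T_pos by (simp add: pos_le_divide_eq)
    moreover have "sinh T - sinh (T - 2*t) = 2 * sinh t * cosh (T - t)"
      using sinh_add[of "T - t" t] sinh_diff[of "T - t" t] by (simp add: algebra_simps)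
    moreover have "R * sinh (2*t) = 2 * sinh t * (R * cosh t)" by (simp add: sinh_double)
    ultimately have "2 * sinh t * cosh (T - t) \<le> 2 * sinh t * (R * cosh t)" by simp
    then show ?thesis using t by simp
  qed
  then have "\<forall>\<^sub>F t in at_right 0. cosh (T - t) \<le> R * cosh t"
    unfolding eventually_at_right_field using T_pos by (intro exI[of _ "T/2"]) auto
  moreover have "((\<lambda>t. cosh (T - t)) \<longlongrightarrow> cosh (T - 0)) (at_right 0)"
    by (intro tendsto_intros)
  moreover have "((\<lambda>t. R * cosh t) \<longlongrightarrow> R * cosh 0) (at_right 0)"
    by (intro tendsto_intros)
  ultimately show ?thesis
    using tendsto_le[of "at_right (0::real)" "\<lambda>t. R * cosh t" "R * cosh 0" "\<lambda>t. cosh (T - t)" "cosh (T - 0)"] by simp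
qed

end

section \<open>A Hopf lemma at a corner\<close>

text \<open>The coefficient of \<open>f\<close> against cis \<phi> is 0, so its conjugate can be
  subtracted from the one that gives the derivative. This replaces \<open>f\<close> by 2 \<i> Im f,
  whose modulus is 2 Im f by positivity, and the mean value property finishes.\<close>

lemma holomorphic_gradient_le:
  assumes f: "f holomorphic_on V" "open V" and b: "cball z r \<subseteq> V" "r > 0"
    and pos: "\<And>w. w \<in> cball z r \<Longrightarrow> 0 \<le> Im (f w)"
  shows "r * cmod (deriv f z) \<le> 2 * Im (f z)"
proof -
  define w where "w \<phi> = z + of_real r * cis \<phi>" for \<phi>
  note C = circle_average_powers[OF f b, folded w_def]
  have wb: "w \<phi> \<in> cball z r" for \<phi> using b(2) by (simp add: w_def dist_norm norm_mult)
  have "((\<lambda>\<phi>. cnj (f (w \<phi>) * cis \<phi>)) has_integral cnj 0) {0..2*pi}"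
    using C(3) has_integral_cnj[of "\<lambda>\<phi>. f (w \<phi>) * cis \<phi>" 0 "{0..2*pi}"] by (simp add: o_def)
  from has_integral_diff[OF C(2) this]
  have D: "((\<lambda>\<phi>. (f (w \<phi>) - cnj (f (w \<phi>))) * cis (-\<phi>)) has_integral of_real (2*pi*r) * deriv f z) {0..2*pi}"
    by (simp add: left_diff_distrib cis_cnj)
  have I: "((\<lambda>\<phi>. 2 * Im (f (w \<phi>))) has_integral 2 * Im (of_real (2*pi) * f z)) {0..2*pi}"
    by (intro has_integral_mult_right has_integral_Im C(1))
  have "norm (integral {0..2*pi} (\<lambda>\<phi>. (f (w \<phi>) - cnj (f (w \<phi>))) * cis (-\<phi>))) \<le> integral {0..2*pi} (\<lambda>\<phi>. 2 * Im (f (w \<phi>)))"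
  proof (rule integral_norm_bound_integral)
    show "(\<lambda>\<phi>. (f (w \<phi>) - cnj (f (w \<phi>))) * cis (-\<phi>)) integrable_on {0..2*pi}" using D by blast
    show "(\<lambda>\<phi>. 2 * Im (f (w \<phi>))) integrable_on {0..2*pi}" using I by blast
    show "norm ((f (w \<phi>) - cnj (f (w \<phi>))) * cis (-\<phi>)) \<le> 2 * Im (f (w \<phi>))" for \<phi>
      using pos[OF wb] by (simp add: norm_mult complex_diff_cnj)
  qed
  then have "2*pi*(r * cmod (deriv f z)) \<le> 2*pi*(2 * Im (f z))"
    unfolding integral_unique[OF D] integral_unique[OF I] using b(2) by (simp add: norm_mult mult_ac)
  then show ?thesis by (rule mult_left_le_imp_le) simp
qed

text \<open>The gradient estimate says that Im f changes at logarithmic rate at most 2/r. The weight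
  exp(c x) expresses this without dividing by Im f, which may vanish.\<close>

lemma harnack_segment:
  assumes f: "f holomorphic_on V" "open V" and r: "r > 0"
    and b: "\<And>\<zeta>. \<zeta> \<in> closed_segment z w \<Longrightarrow> cball \<zeta> r \<subseteq> V"
    and pos: "\<And>\<zeta> u. \<zeta> \<in> closed_segment z w \<Longrightarrow> u \<in> cball \<zeta> r \<Longrightarrow> 0 \<le> Im (f u)"
  shows "Im (f z) \<le> exp (2 * cmod (w - z) / r) * Im (f w)"
proof -
  define c where "c = 2 * cmod (w - z) / r"
  define \<gamma> where "\<gamma> x = z + of_real x * (w - z)" for x :: real
  define g where "g x = exp (c * x) * Im (f (\<gamma> x))" for x
  have seg: "\<gamma> x \<in> closed_segment z w" if "0 \<le> x" "x \<le> 1" for x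
    using that unfolding closed_segment_def \<gamma>_def
    by (auto intro!: exI[of _ x] simp: scaleR_conv_of_real algebra_simps)
  have "g 0 \<le> g 1"
  proof (rule DERIV_nonneg_imp_nondecreasing[of 0 1 g])
    fix x :: real assume x: "0 \<le> x" "x \<le> 1"
    have gV: "\<gamma> x \<in> V" using b[OF seg[OF x]] r by auto
    have "(f has_field_derivative deriv f (\<gamma> x)) (at (\<gamma> x))"
      using f gV holomorphic_derivI by blast
    moreover have "(\<gamma> has_vector_derivative (w - z)) (at x)"
      unfolding \<gamma>_def by (auto intro!: derivative_eq_intros)
    ultimately have "((\<lambda>x. f (\<gamma> x)) has_vector_derivative (w - z) * deriv f (\<gamma> x)) (at x)"
      using field_vector_diff_chain_at[of \<gamma> "w - z" x f] by (simp add: o_def)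
    then have "((\<lambda>x. Im (f (\<gamma> x))) has_real_derivative Im ((w - z) * deriv f (\<gamma> x))) (at x)"
      unfolding has_real_derivative_iff_has_vector_derivative
      by (rule bounded_linear.has_vector_derivative[OF bounded_linear_Im])
    moreover have "((\<lambda>x. exp (c * x)) has_real_derivative c * exp (c * x)) (at x)"
      by (auto intro!: derivative_eq_intros)
    ultimately have "(g has_real_derivative c * exp (c * x) * Im (f (\<gamma> x)) + Im ((w - z) * deriv f (\<gamma> x)) * exp (c * x)) (at x)"
      unfolding g_def by (intro DERIV_mult)
    moreover have "0 \<le> c * exp (c * x) * Im (f (\<gamma> x)) + Im ((w - z) * deriv f (\<gamma> x)) * exp (c * x)"
    proof -
      have "r * cmod (deriv f (\<gamma> x)) \<le> 2 * Im (f (\<gamma> x))"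
        by (rule holomorphic_gradient_le[OF f b[OF seg[OF x]] r pos[OF seg[OF x]]])
      then have "cmod (deriv f (\<gamma> x)) \<le> 2 * Im (f (\<gamma> x)) / r" using r by (simp add: field_simps)
      have "\<bar>Im ((w - z) * deriv f (\<gamma> x))\<bar> \<le> cmod (w - z) * cmod (deriv f (\<gamma> x))"
        using abs_Im_le_cmod[of "(w - z) * deriv f (\<gamma> x)"] by (simp only: norm_mult)
      also have "\<dots> \<le> cmod (w - z) * (2 * Im (f (\<gamma> x)) / r)"
        by (rule mult_left_mono[OF \<open>cmod (deriv f (\<gamma> x)) \<le> _\<close>]) simp
      also have "\<dots> = c * Im (f (\<gamma> x))" by (simp add: c_def)
      finally have "\<bar>Im ((w - z) * deriv f (\<gamma> x))\<bar> \<le> c * Im (f (\<gamma> x))" .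
      then have "0 \<le> c * Im (f (\<gamma> x)) + Im ((w - z) * deriv f (\<gamma> x))" by linarith
      then have "0 \<le> exp (c * x) * (c * Im (f (\<gamma> x)) + Im ((w - z) * deriv f (\<gamma> x)))"
        by simp
      then show ?thesis by (simp add: algebra_simps)
    qed
    ultimately show "\<exists>y. (g has_real_derivative y) (at x) \<and> 0 \<le> y" by blast
  qed simp
  then show ?thesis by (simp add: g_def \<gamma>_def c_def)
qed

text \<open>Hopf's lemma at a corner. The barrier is \<open>Im (w\<^sup>2 - w\<^sup>6 / (2 \<rho>\<^sup>4))\<close> with \<open>w = z - t/2\<close>: it vanishes on
  the sides of a quarter disc of radius \<open>\<rho>\<close> and is positive only on the middle part of the arc.\<close>

lemma corner_hopf:
  assumes f: "f holomorphic_on strip T" and \<rho>: "0 < \<rho>" "2 * \<rho> < T" "\<rho> \<le> 1"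
    and pos: "\<And>z. z \<in> strip T \<Longrightarrow> 0 \<le> Im z \<Longrightarrow> Im z \<le> pi \<Longrightarrow> 0 \<le> Im (f z)"
    and m: "\<And>x y. \<rho>/4 \<le> x \<Longrightarrow> x \<le> 3*\<rho>/2 \<Longrightarrow> \<rho>/4 \<le> y \<Longrightarrow> y \<le> \<rho> \<Longrightarrow> m \<le> Im (f (Complex x y))" "0 \<le> m"
    and t: "0 < t" "t \<le> \<rho>" and z0: "Im (f (Complex t 0)) = 0"
    and D: "((\<lambda>a. Im (f (Complex t a))) has_real_derivative D) (at 0)"
  shows "m * t / (3 * \<rho>\<^sup>2) \<le> D"
proof -
  \<comment> \<open>With its corner at t/2 the quarter disc stays inside the strip, and the boundary
    point t lies on its bottom side at distance t/2 from the corner, where the normal derivative of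
    the barrier is of order \<open>t\<close>.\<close>
  define \<sigma> where "\<sigma> = t/2"
  \<comment> \<open>The maximum of the barrier on the arc is 3/2 times the square of \<rho>; the
    scaling makes it equal to \<open>m\<close>.\<close>
  define c where "c = m / (3/2 * \<rho>\<^sup>2)"
  have c: "c \<ge> 0" "c * (3/2 * \<rho>\<^sup>2) = m" using m(2) \<rho> by (auto simp: c_def)
  define B where "B z = (z - of_real \<sigma>)^2 - (z - of_real \<sigma>)^6 / of_real (2 * \<rho>^4)" for z :: complex
  \<comment> \<open>With u the imaginary part of w^2, this is the triple angle formula sin 3\<phi> =
    3 sin \<phi> - 4 sin^3 \<phi> for the cube of w^2.\<close>
  have ImB: "Im (B z) = u - (3 * u * cmod (z - of_real \<sigma>)^4 - 4 * u^3) / (2 * \<rho>^4)"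
    if "u = 2 * (Re z - \<sigma>) * Im z" for z u
  proof -
    define x where "x = Re z - \<sigma>"
    define y where "y = Im z"
    have w: "z - of_real \<sigma> = Complex x y" by (simp add: x_def y_def complex_eq_iff)
    have "cmod (z - of_real \<sigma>)^4 = ((cmod (z - of_real \<sigma>))\<^sup>2)\<^sup>2" by simp
    then have n: "cmod (z - of_real \<sigma>)^4 = (x\<^sup>2 + y\<^sup>2)\<^sup>2" unfolding w cmod_power2 by simp
    have "Im ((Complex x y)^2) = 2 * x * y" by (simp add: power2_eq_square)
    moreover have "Im ((Complex x y)^6) = 3 * (2*x*y) * (x\<^sup>2 + y\<^sup>2)\<^sup>2 - 4 * (2*x*y)^3"
      by (simp add: eval_nat_numeral algebra_simps)
    ultimately show ?thesis
      unfolding B_def n unfolding w that x_def[symmetric] y_def[symmetric]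
      by (simp add: Im_divide_of_real del: of_real_mult of_real_power)
  qed
  have Bhol: "B holomorphic_on A" for A
    unfolding B_def using \<rho> by (intro holomorphic_intros) auto
  define S where "S = {z. \<sigma> \<le> Re z \<and> 0 \<le> Im z \<and> cmod (z - of_real \<sigma>) \<le> \<rho>}"
  define U where "U = {z. \<sigma> < Re z \<and> 0 < Im z \<and> cmod (z - of_real \<sigma>) < \<rho>}"
  have S: "Re z \<le> 3*\<rho>/2" "Im z \<le> \<rho>" if "z \<in> S" for z
    using that abs_Re_le_cmod[of "z - of_real \<sigma>"] abs_Im_le_cmod[of "z - of_real \<sigma>"] t
    by (auto simp: S_def \<sigma>_def)
  have Sstrip: "S \<subseteq> strip T"
    using S \<rho> t by (force simp: strip_def S_def \<sigma>_def)
  have key: "c * Im (B z) \<le> Im (f z)" if "z \<in> S" for z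
  proof -
    have "Im (of_real c * B z - f z) \<le> 0"
    proof (rule harmonic_maximum[of "\<lambda>z. of_real c * B z - f z" "strip T" S U])
      show "(\<lambda>z. of_real c * B z - f z) holomorphic_on strip T"
        by (intro holomorphic_intros Bhol f)
      have "S = {z. \<sigma> \<le> Re z} \<inter> {z. 0 \<le> Im z} \<inter> cball (of_real \<sigma>) \<rho>"
        by (auto simp: S_def dist_norm norm_minus_commute)
      then show "compact S"
        by (auto intro!: closed_Int_compact closed_Int closed_halfspace_Re_ge closed_halfspace_Im_ge)
      have "U = {z. \<sigma> < Re z} \<inter> {z. 0 < Im z} \<inter> ball (of_real \<sigma>) \<rho>"
        by (auto simp: U_def dist_norm norm_minus_commute)
      then show "open U" by (auto intro!: open_Int open_halfspace_Re_gt open_halfspace_Im_gt)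
      show "U \<subseteq> S" by (auto simp: U_def S_def)
      fix w assume w: "w \<in> S - U"
      define u where "u = 2 * (Re w - \<sigma>) * Im w"
      have wn: "0 \<le> Re w - \<sigma>" "0 \<le> Im w" using w by (auto simp: S_def)
      have fpos: "0 \<le> Im (f w)"
        by (rule pos) (use w S[of w] Sstrip \<rho> pi_ge_two in \<open>auto simp: S_def\<close>)
      have "c * Im (B w) \<le> Im (f w)"
      proof (cases "Im (B w) \<le> 0")
        case True
        then have "c * Im (B w) \<le> 0" using c by (simp add: mult_nonneg_nonpos)
        then show ?thesis using fpos by linarith
      next
        case False
        have "u \<noteq> 0" using False ImB[OF u_def] by auto
        then have "Re w \<noteq> \<sigma>" "Im w \<noteq> 0" by (auto simp: u_def)
        then have arc: "cmod (w - of_real \<sigma>) = \<rho>" using w by (auto simp: S_def U_def)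
        have r2: "(Re w - \<sigma>)\<^sup>2 + (Im w)\<^sup>2 = \<rho>\<^sup>2" using arc cmod_power2[of "w - of_real \<sigma>"] by simp
        have u0: "u \<ge> 0" using wn by (simp add: u_def)
        \<comment> \<open>On the arc the barrier is positive only if 2u exceeds the square of
          \<rho>. Then neither coordinate of \<open>w\<close> relative to the corner can be below
          \<rho>/4, so the bound \<open>m\<close> is available.\<close>
        have uB: "Im (B w) = u * (2 * u\<^sup>2 / \<rho>^4 - 1/2)"
          unfolding ImB[OF u_def] arc using \<rho> by (simp add: field_simps eval_nat_numeral)
        have "2 * u\<^sup>2 / \<rho>^4 - 1/2 > 0"
          using False u0 unfolding uB by (simp add: mult_le_0_iff not_le)
        then have "(\<rho>\<^sup>2)\<^sup>2 < (2*u)\<^sup>2" using \<rho> by (simp add: field_simps power_mult_distrib)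
        then have "\<rho>\<^sup>2 < 2*u" using u0 by (auto intro: power2_less_imp_less)
        moreover have "2 * u = 4 * ((Re w - \<sigma>) * Im w)" by (simp add: u_def)
        ultimately have prod: "\<rho> * \<rho> / 4 < (Re w - \<sigma>) * Im w" unfolding power2_eq_square by linarith
        have le: "Re w - \<sigma> \<le> \<rho>" "Im w \<le> \<rho>"
          using abs_Re_le_cmod[of "w - of_real \<sigma>"] abs_Im_le_cmod[of "w - of_real \<sigma>"] arc by auto
        have "\<rho> * (\<rho>/4) < \<rho> * Im w"
          using prod mult_right_mono[OF le(1) wn(2)] by simp
        then have b1: "\<rho>/4 \<le> Im w" using \<rho> by simp
        have "\<rho> * (\<rho>/4) < \<rho> * (Re w - \<sigma>)"
          using prod mult_left_mono[OF le(2) wn(1)] by (simp add: mult.commute)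
        then have b2: "\<rho>/4 \<le> Re w - \<sigma>" using \<rho> by simp
        have "m \<le> Im (f (Complex (Re w) (Im w)))"
          by (rule m) (use b1 b2 S[of w] w le t in \<open>auto simp: \<sigma>_def\<close>)
        moreover have "Im (B w) \<le> 3/2 * \<rho>\<^sup>2"
        proof -
          have "u \<le> \<rho>\<^sup>2"
            using r2 sum_squares_bound[of "Re w - \<sigma>" "Im w"] by (simp add: u_def)
          then have "u\<^sup>2 \<le> (\<rho>\<^sup>2)\<^sup>2" using u0 by (rule power_mono)
          then have "2 * u\<^sup>2 / \<rho>^4 - 1/2 \<le> 3/2" using \<rho> by (simp add: field_simps)
          then have "Im (B w) \<le> u * (3/2)" unfolding uB using u0 by (rule mult_left_mono)
          then show ?thesis using \<open>u \<le> \<rho>\<^sup>2\<close> by simp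
        qed
        then have "c * Im (B w) \<le> c * (3/2 * \<rho>\<^sup>2)" using c(1) by (rule mult_left_mono)
        ultimately show ?thesis using c(2) by simp
      qed
      then show "Im (of_real c * B w - f w) \<le> 0" by simp
    qed (use that Sstrip open_strip in auto)
    then show ?thesis by simp
  qed
  define E where "E = 2 * \<sigma> - 3 * \<sigma>^5 / \<rho>^4"
  have dB: "((\<lambda>a. Im (B (Complex t a))) has_real_derivative E) (at 0)"
  proof -
    have eq: "Im (B (Complex t a)) = 2 * \<sigma> * a - (3 * (2 * \<sigma> * a) * (\<sigma>\<^sup>2 + a\<^sup>2)\<^sup>2 - 4 * (2 * \<sigma> * a)^3) / (2 * \<rho>^4)" for a
    proof -
      have "cmod (Complex t a - of_real \<sigma>)^4 = ((cmod (Complex t a - of_real \<sigma>))\<^sup>2)\<^sup>2" by simp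
      also have "\<dots> = (\<sigma>\<^sup>2 + a\<^sup>2)\<^sup>2" unfolding cmod_power2 by (simp add: \<sigma>_def)
      finally show ?thesis
        using ImB[of "2 * \<sigma> * a" "Complex t a"] by (simp add: \<sigma>_def)
    qed
    have "(\<sigma>\<^sup>2)\<^sup>2 * \<sigma> = \<sigma>^5" by (simp add: eval_nat_numeral)
    then show ?thesis
      unfolding eq E_def using \<rho>
      by (auto intro!: derivative_eq_intros simp: field_simps)
  qed
  have "c * E \<le> D"
  proof (rule ccontr)
    assume "\<not> c * E \<le> D"
    then have neg: "D - c * E < 0" by simp
    have "((\<lambda>a. Im (f (Complex t a)) - c * Im (B (Complex t a))) has_real_derivative D - c * E) (at 0)"
      by (intro DERIV_diff DERIV_cmult D dB)
    from DERIV_neg_dec_right[OF this neg] obtain d where d: "d > 0"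
      "\<And>x. 0 < x \<Longrightarrow> x < d \<Longrightarrow> Im (f (Complex t x)) - c * Im (B (Complex t x)) < Im (f (Complex t 0)) - c * Im (B (Complex t 0))"
      by auto
    define a where "a = min (d/2) (\<rho>/2)"
    have a: "0 < a" "a < d" "a \<le> \<rho>/2" using d(1) \<rho> by (auto simp: a_def)
    have "Complex t a - of_real \<sigma> = Complex \<sigma> a" by (simp add: \<sigma>_def complex_eq_iff)
    then have "cmod (Complex t a - of_real \<sigma>) \<le> \<bar>\<sigma>\<bar> + \<bar>a\<bar>" using cmod_le[of "Complex \<sigma> a"] by simp
    then have "Complex t a \<in> S" using a t by (simp add: S_def \<sigma>_def)
    then have "c * Im (B (Complex t a)) \<le> Im (f (Complex t a))" by (rule key)
    moreover have "Im (B (Complex t 0)) = 0" using ImB[of 0 "Complex t 0"] by simp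
    ultimately show False using d(2)[OF a(1,2)] z0 by simp
  qed
  moreover have "\<sigma> \<le> E"
  proof -
    have "\<sigma> \<le> \<rho>/2" using t by (simp add: \<sigma>_def)
    then have "\<sigma>^4 \<le> (\<rho>/2)^4" using t by (intro power_mono) (auto simp: \<sigma>_def)
    then have "\<sigma> * \<sigma>^4 \<le> \<sigma> * (\<rho>/2)^4" using t by (intro mult_left_mono) (auto simp: \<sigma>_def)
    then have "3 * \<sigma>^5 / \<rho>^4 \<le> 3 * \<sigma> / 16" using \<rho> by (simp add: field_simps eval_nat_numeral)
    then show ?thesis using t by (simp add: E_def \<sigma>_def)
  qed
  then have "c * \<sigma> \<le> c * E" using c(1) by (rule mult_left_mono)
  moreover have "c * \<sigma> = m * t / (3 * \<rho>\<^sup>2)" by (simp add: c_def \<sigma>_def)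
  ultimately show ?thesis by simp
qed

section \<open>Boundary moments in the equality case\<close>

context annulus_map
begin

lemma Lambda_extremal:
  assumes "R = cosh T"
  shows "\<Lambda> t = cosh t"
proof -
  have sT: "sinh T > 0" using T_pos by simp
  have "\<Lambda> t = (sinh (T - t) + R * sinh t) / sinh T" by (rule \<Lambda>_def)
  also have "\<dots> = cosh t" unfolding assms sinh_diff using sT by (simp add: field_simps)
  finally show ?thesis .
qed

text \<open>Harnack transports the defect at (t, a) to the middle of the quarter disc with a
  constant independent of \<open>s\<close>; \<open>corner_hopf\<close> then bounds \<open>s\<close>
  times the defect by a multiple of cosh^2 s - area s. As the area is at least 1, this is at most
  sinh^2 s, so the defect is O(sinh^2 s / s).\<close>

lemma corr_defect_bound:
  assumes R: "R = cosh T" and t: "0 < t" "t < T" and a: "0 < a" "a < pi"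
  obtains K \<rho> where "0 < K" "0 < \<rho>"
    "\<And>s. 0 < s \<Longrightarrow> s \<le> \<rho> \<Longrightarrow> cosh s * cosh t * sin a - corr s t a \<le> K * (sinh s * (sinh s / s))"
proof -
  define \<rho> where "\<rho> = min 1 (T/4)"
  have \<rho>: "0 < \<rho>" "2 * \<rho> < T" "\<rho> \<le> 1" "3*\<rho>/2 < T" using T_pos by (auto simp: \<rho>_def)
  \<comment> \<open>All distances from the relevant points to the sides of the half strip. Discs of
    half the minimal size about points of the shrunken rectangle remain where the defect is
    nonnegative.\<close>
  define A where "A = {t, T - t, a, pi - a, \<rho>/4, T - 3*\<rho>/2, pi - \<rho>}"
  define r where "r = Min A / 2"
  have "0 < Min A" using t a \<rho> pi_ge_two by (simp add: A_def)
  then have r0: "0 < r" by (simp add: r_def)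
  have rA: "2 * r \<le> x" if "x \<in> A" for x
  proof -
    have "Min A \<le> x" by (rule Min_le[OF _ that]) (simp add: A_def)
    then show ?thesis by (simp add: r_def)
  qed
  have r: "0 < r" "2*r \<le> t" "2*r \<le> T - t" "2*r \<le> a" "2*r \<le> pi - a" "2*r \<le> \<rho>/4" "2*r \<le> T - 3*\<rho>/2" "2*r \<le> pi - \<rho>"
    using r0 rA unfolding A_def by blast+
  \<comment> \<open>T + \<pi> bounds the length of every Harnack segment, so this constant serves
    all end points and all \<open>s\<close>.\<close>
  define K0 where "K0 = exp (2 * (T + pi) / r)"
  have K0: "0 < K0" by (simp add: K0_def)
  have main: "cosh s * cosh t * sin a - corr s t a \<le> K0 * (3 * \<rho>\<^sup>2) * (sinh s * (sinh s / s))"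
    if s: "0 < s" "s \<le> \<rho>" for s
  proof -
    have sT: "0 < s" "s < T" using s \<rho> by auto
    obtain \<Psi> where \<Psi>: "\<Psi> holomorphic_on strip T" "\<And>t a. 0 < t \<Longrightarrow> t < T \<Longrightarrow> corr s t a = Im (\<Psi> (Complex t a))"
      using corr_harmonic[OF sT] by blast
    \<comment> \<open>Im (sinh (x + i y)) = cosh x sin y, so the imaginary part of \<open>f\<close>
      is the defect.\<close>
    define f where "f z = of_real (cosh s) * sinh z - \<Psi> z" for z
    have fhol: "f holomorphic_on strip T"
      unfolding f_def sinh_field_def by (intro holomorphic_intros \<Psi>) auto
    have Imf: "Im (f (Complex x y)) = cosh s * cosh x * sin y - corr s x y" if "0 < x" "x < T" for x y
    proof -
      have "Im (sinh (Complex x y)) = cosh x * sin y"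
        by (simp add: cosh_field_def sinh_field_def Im_exp Re_exp algebra_simps diff_divide_distrib add_divide_distrib)
      then show ?thesis using \<Psi>(2)[OF that] by (simp add: f_def)
    qed
    have pos: "0 \<le> Im (f z)" if "z \<in> strip T" "0 \<le> Im z" "Im z \<le> pi" for z
    proof -
      have x: "0 < Re z" "Re z < T" using that(1) by (auto simp: strip_def)
      show ?thesis
        using Imf[OF x, of "Im z"] corr_le[OF sT x that(2,3)] by (simp add: Lambda_extremal[OF R])
    qed
    have ball: "cball \<zeta> r \<subseteq> strip T \<inter> {z. 0 \<le> Im z \<and> Im z \<le> pi}"
      if "\<zeta> \<in> cbox (Complex (2*r) (2*r)) (Complex (T - 2*r) (pi - 2*r))" for \<zeta>
    proof
      fix u assume u: "u \<in> cball \<zeta> r"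
      then have "\<bar>Re (u - \<zeta>)\<bar> \<le> r" "\<bar>Im (u - \<zeta>)\<bar> \<le> r"
        using abs_Re_le_cmod[of "u - \<zeta>"] abs_Im_le_cmod[of "u - \<zeta>"] by (auto simp: dist_norm norm_minus_commute)
      then have "\<bar>Re u - Re \<zeta>\<bar> \<le> r" "\<bar>Im u - Im \<zeta>\<bar> \<le> r" by simp_all
      moreover have "2*r \<le> Re \<zeta>" "Re \<zeta> \<le> T - 2*r" "2*r \<le> Im \<zeta>" "Im \<zeta> \<le> pi - 2*r"
        using that by (auto simp: in_cbox_complex_iff)
      ultimately have "0 < Re u" "Re u < T" "0 \<le> Im u" "Im u \<le> pi" using r(1) by linarith+
      then show "u \<in> strip T \<inter> {z. 0 \<le> Im z \<and> Im z \<le> pi}" by (simp add: strip_def)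
    qed
    let ?z = "Complex t a"
    have zb: "?z \<in> cbox (Complex (2*r) (2*r)) (Complex (T - 2*r) (pi - 2*r))"
      using r by (auto simp: in_cbox_complex_iff)
    have low: "Im (f ?z) / K0 \<le> Im (f (Complex x y))"
      if xy: "\<rho>/4 \<le> x" "x \<le> 3*\<rho>/2" "\<rho>/4 \<le> y" "y \<le> \<rho>" for x y
    proof -
      let ?w = "Complex x y"
      have wb: "?w \<in> cbox (Complex (2*r) (2*r)) (Complex (T - 2*r) (pi - 2*r))"
        using r xy by (auto simp: in_cbox_complex_iff)
      have seg: "closed_segment ?z ?w \<subseteq> cbox (Complex (2*r) (2*r)) (Complex (T - 2*r) (pi - 2*r))"
        by (rule closed_segment_subset[OF zb wb]) (rule convex_box)
      have hs: "Im (f ?z) \<le> exp (2 * cmod (?w - ?z) / r) * Im (f ?w)"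
      proof (rule harnack_segment[OF fhol open_strip r(1)])
        fix \<zeta> assume "\<zeta> \<in> closed_segment ?z ?w"
        then have b: "cball \<zeta> r \<subseteq> strip T \<inter> {z. 0 \<le> Im z \<and> Im z \<le> pi}" using seg ball by blast
        show "cball \<zeta> r \<subseteq> strip T" using b by blast
        show "0 \<le> Im (f u)" if "u \<in> cball \<zeta> r" for u using b that pos by blast
      qed
      have "cmod (?w - ?z) \<le> \<bar>x - t\<bar> + \<bar>y - a\<bar>" using cmod_le[of "?w - ?z"] by simp
      also have "\<dots> \<le> T + pi" using xy t a \<rho> pi_ge_two by linarith
      finally have "2 * cmod (?w - ?z) / r \<le> 2 * (T + pi) / r" using r(1) by (intro divide_right_mono) auto
      then have "exp (2 * cmod (?w - ?z) / r) \<le> K0" by (simp add: K0_def)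
      moreover have "0 \<le> Im (f ?w)"
        by (rule pos) (use xy \<rho> pi_ge_two in auto)
      ultimately have "exp (2 * cmod (?w - ?z) / r) * Im (f ?w) \<le> K0 * Im (f ?w)" by (rule mult_right_mono)
      then show ?thesis using hs K0 by (simp add: field_simps)
    qed
    have "Im (f ?z) / K0 * s / (3 * \<rho>\<^sup>2) \<le> (cosh s)\<^sup>2 - area s"
    proof (rule corner_hopf[OF fhol \<rho>(1-3) pos low _ s])
      show "0 \<le> Im (f ?z) / K0" using pos[of ?z] t a K0 by simp
      show "Im (f (Complex s 0)) = 0" using Imf[OF sT, of 0] by (simp add: corr_0)
      have "((\<lambda>y. cosh s * cosh s * sin y - corr s s y) has_real_derivative (cosh s)\<^sup>2 - area s) (at 0)"
        by (auto intro!: derivative_eq_intros corr_derivative sT simp: power2_eq_square)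
      then show "((\<lambda>y. Im (f (Complex s y))) has_real_derivative (cosh s)\<^sup>2 - area s) (at 0)"
        unfolding Imf[OF sT] .
    qed
    also have "\<dots> \<le> (sinh s)\<^sup>2"
      using area_ge_1[OF sT] cosh_square_eq[of s] by simp
    finally have "Im (f ?z) / K0 * s / (3 * \<rho>\<^sup>2) \<le> (sinh s)\<^sup>2" .
    then have "Im (f ?z) * s \<le> (sinh s)\<^sup>2 * (K0 * (3 * \<rho>\<^sup>2))"
      using K0 \<rho>(1) by (simp add: field_simps)
    then have "Im (f ?z) \<le> (sinh s)\<^sup>2 * (K0 * (3 * \<rho>\<^sup>2)) / s" using s(1) by (simp add: pos_le_divide_eq)
    then show ?thesis using Imf[OF t, of a] by (simp add: power2_eq_square mult_ac)
  qed
  show ?thesis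
    by (rule that[of "K0 * (3 * \<rho>\<^sup>2)" \<rho>]) (use main K0 \<rho>(1) in auto)
qed

lemma corr_limit:
  assumes R: "R = cosh T" and t: "0 < t" "t < T" and a: "0 < a" "a < pi"
  shows "((\<lambda>s. corr s t a) \<longlongrightarrow> cosh t * sin a) (at_right 0)"
proof -
  obtain K \<rho> where K: "0 < K" "0 < \<rho>"
    "\<And>s. 0 < s \<Longrightarrow> s \<le> \<rho> \<Longrightarrow> cosh s * cosh t * sin a - corr s t a \<le> K * (sinh s * (sinh s / s))"
    using corr_defect_bound[OF assms] by blast
  have "((\<lambda>s. sinh s / s) \<longlongrightarrow> 1) (at (0::real))"
  proof -
    have "(sinh has_real_derivative cosh 0) (at 0)" by (auto intro!: derivative_eq_intros)
    from DERIV_D[OF this] show ?thesis by simp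
  qed
  then have "((\<lambda>s. sinh s / s) \<longlongrightarrow> 1) (at_right (0::real))" by (rule filterlim_mono) (auto simp: at_le)
  moreover have "((\<lambda>s. sinh s) \<longlongrightarrow> sinh 0) (at_right (0::real))" by (intro tendsto_intros)
  ultimately have "((\<lambda>s. K * (sinh s * (sinh s / s))) \<longlongrightarrow> K * (sinh 0 * 1)) (at_right 0)"
    by (intro tendsto_intros)
  then have up: "((\<lambda>s. K * (sinh s * (sinh s / s))) \<longlongrightarrow> 0) (at_right 0)" by simp
  have "((\<lambda>s. cosh s * cosh t * sin a - corr s t a) \<longlongrightarrow> 0) (at_right 0)"
  proof (rule tendsto_sandwich[OF _ _ tendsto_const up])
    show "\<forall>\<^sub>F s in at_right 0. 0 \<le> cosh s * cosh t * sin a - corr s t a"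
      unfolding eventually_at_right_field
    proof (intro exI[of _ T] conjI allI impI)
      fix s :: real assume s: "0 < s" "s < T"
      show "0 \<le> cosh s * cosh t * sin a - corr s t a"
        using corr_le[OF s t, of a] a by (simp add: Lambda_extremal[OF R])
    qed (rule T_pos)
    show "\<forall>\<^sub>F s in at_right 0. cosh s * cosh t * sin a - corr s t a \<le> K * (sinh s * (sinh s / s))"
      unfolding eventually_at_right_field using K by (intro exI[of _ \<rho>]) auto
  qed
  moreover have "((\<lambda>s. cosh s * cosh t * sin a) \<longlongrightarrow> cosh 0 * cosh t * sin a) (at_right 0)"
    by (intro tendsto_intros)
  ultimately have "((\<lambda>s. cosh s * cosh t * sin a - (cosh s * cosh t * sin a - corr s t a)) \<longlongrightarrow> cosh 0 * cosh t * sin a - 0) (at_right 0)"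
    by (intro tendsto_diff)
  then show ?thesis by simp
qed

text \<open>\<open>X1\<close> and \<open>Y1\<close> are 2\<pi> times the Fourier coefficients of
  index 1 and -1 of the curve at abscissa \<open>t\<close>.\<close>

definition X1 :: "real \<Rightarrow> complex" where
  "X1 t = integral {0..2*pi} (\<lambda>y. h (Complex t y) * cis (-y))"

definition Y1 :: "real \<Rightarrow> complex" where
  "Y1 t = integral {0..2*pi} (\<lambda>y. h (Complex t y) * cis y)"

text \<open>The odd difference times the odd sine unfolds to an integral over a full period, a
  convolution of the curve with the sine. Only the frequencies 1 and -1 survive.\<close>

lemma sine_moment:
  assumes t: "0 < t" "t < T"
  shows "integral {0..pi} (\<lambda>a. (h (Complex t (y + a)) - h (Complex t (y - a))) * of_real (sin a))
    = (cis (-y) * Y1 t - cis y * X1 t) / (2 * \<i>)"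
proof -
  define q where "q a = h (Complex t (y + a)) * of_real (sin a)" for a
  have cq: "continuous_on A q" for A
    unfolding q_def
    by (intro continuous_intros continuous_on_compose2[OF cont_line[OF cont_h t, of UNIV]]) auto
  have iq: "q integrable_on {u..v}" for u v by (rule integrable_continuous_interval[OF cq])
  have pq: "q (a + 2*pi) = q a" for a using per[OF t, of "y + a"] by (simp add: q_def add_ac)
  have "integral {0..pi} (\<lambda>a. (h (Complex t (y + a)) - h (Complex t (y - a))) * of_real (sin a)) = integral {0..pi} (\<lambda>a. q a + q (-a))"
    by (simp add: q_def algebra_simps)
  also have "\<dots> = integral {0..pi} q + integral {0..pi} (\<lambda>a. q (-a))"
  proof (rule integral_add[OF iq])
    show "(\<lambda>a. q (-a)) integrable_on {0..pi}"
      by (intro integrable_continuous_interval continuous_on_compose2[OF cq[of UNIV]] continuous_intros) auto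
  qed
  also have "integral {0..pi} (\<lambda>a. q (-a)) = integral {-pi..0} q"
    using Henstock_Kurzweil_Integration.integral_reflect_real[of 0 "-pi" q] by simp
  also have "integral {0..pi} q + integral {-pi..0} q = integral {-pi..pi} q"
    using Henstock_Kurzweil_Integration.integral_combine[of "-pi" 0 pi q] iq by (simp add: add.commute)
  also have "\<dots> = integral {0..2*pi} (\<lambda>a. q (a - pi))"
    using integral_shift[of 0 "-pi" "2*pi" q] cq by (simp add: o_def)
  also have "\<dots> = integral {0..2*pi} q"
    using integral_periodic_shift[OF cq pq, of "-pi"] by simp
  also have "\<dots> = integral {0..2*pi} (\<lambda>a. h (Complex t (a + y)) * of_real (sin ((a + y) - y)))"
    by (simp add: q_def[abs_def] add.commute)
  also have "\<dots> = integral {0..2*pi} (\<lambda>b. h (Complex t b) * of_real (sin (b - y)))"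
  proof (rule integral_periodic_shift[where f = "\<lambda>b. h (Complex t b) * of_real (sin (b - y))"])
    show "continuous_on UNIV (\<lambda>b. h (Complex t b) * of_real (sin (b - y)))"
      by (intro continuous_intros cont_line[OF cont_h t])
    show "h (Complex t (x + 2*pi)) * of_real (sin (x + 2*pi - y)) = h (Complex t x) * of_real (sin (x - y))" for x
      using per[OF t, of x] sin_periodic[of "x - y"] by (simp add: algebra_simps)
  qed simp
  also have "\<dots> = integral {0..2*pi} (\<lambda>b. (cis (-y) / (2*\<i>)) * (h (Complex t b) * cis b) - (cis y / (2*\<i>)) * (h (Complex t b) * cis (-b)))"
  proof (rule integral_cong)
    fix b
    have "cis b * cis (-y) = cis (b - y)" "cis (-b) * cis y = cis (- (b - y))" by (simp_all add: cis_mult)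
    moreover have "cis u - cis (- u) = of_real (sin u) * (2 * \<i>)" for u
      by (simp add: complex_eq_iff)
    from this[of "b - y"] have "cis (b - y) - cis (- (b - y)) = of_real (sin (b - y)) * (2 * \<i>)" .
    ultimately have "of_real (sin (b - y)) * (2 * \<i>) = cis b * cis (-y) - cis (-b) * cis y"
      by (simp only:)
    then have "of_real (sin (b - y)) = (cis b * cis (-y) - cis (-b) * cis y) / (2*\<i>)"
      by (subst nonzero_eq_divide_eq) simp_all
    then show "h (Complex t b) * of_real (sin (b - y)) = (cis (-y) / (2*\<i>)) * (h (Complex t b) * cis b) - (cis y / (2*\<i>)) * (h (Complex t b) * cis (-b))"
      by (simp add: diff_divide_distrib right_diff_distrib mult_ac)
  qed
  also have "\<dots> = (cis (-y) / (2*\<i>)) * Y1 t - (cis y / (2*\<i>)) * X1 t"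
    unfolding X1_def Y1_def
    by (subst integral_diff) (auto intro!: integrable_continuous_interval continuous_intros cont_line[OF cont_h t])
  finally show ?thesis by (simp add: field_simps)
qed

text \<open>Testing the correlation against sin a isolates the first Fourier coefficients of both
  curves; this is how the limit in \<open>corr_limit\<close> becomes a statement about
  \<open>h\<close>.\<close>

lemma corr_sine_coefficient:
  assumes s: "0 < s" "s < T" and t: "0 < t" "t < T"
  shows "integral {0..pi} (\<lambda>a. corr s t a * sin a) = Re (X1 t * cnj (X1 s) - Y1 t * cnj (Y1 s)) / (8*pi)"
proof -
  define f where "f a y = cnj (h (Complex s y)) * ((h (Complex t (y + a)) - h (Complex t (y - a))) * of_real (sin a))" for a y
  have cf: "continuous_on (cbox (0,0) (pi, 2*pi)) (\<lambda>(a, y). f a y)"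
    unfolding f_def split_beta'
    by (intro continuous_intros continuous_on_compose2[OF cont_line[OF cont_h s, of UNIV]]
        continuous_on_compose2[OF cont_line[OF cont_h t, of UNIV]]) auto
  have ci: "continuous_on {0..pi} (\<lambda>a. integral {0..2*pi} (f a))"
    using integral_continuous_on_param[of "{0..pi}" 0 "2*pi" f] cf by (simp add: cbox_Pair_eq)
  have "integral {0..pi} (\<lambda>a. corr s t a * sin a) = integral {0..pi} (\<lambda>a. Im (integral {0..2*pi} (f a)) / (4*pi))"
  proof (rule integral_cong)
    fix a
    have "integral {0..2*pi} (f a) = integral {0..2*pi} (\<lambda>y. cnj (h (Complex s y)) * (h (Complex t (y + a)) - h (Complex t (y - a)))) * of_real (sin a)"
      by (simp add: f_def[abs_def] flip: integral_mult_left mult.assoc)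
    then show "corr s t a * sin a = Im (integral {0..2*pi} (f a)) / (4*pi)" by (simp add: corr_def)
  qed
  also have "\<dots> = integral {0..pi} (\<lambda>a. Im (integral {0..2*pi} (f a))) / (4*pi)" by simp
  also have "integral {0..pi} (\<lambda>a. Im (integral {0..2*pi} (f a))) = Im (integral {0..pi} (\<lambda>a. integral {0..2*pi} (f a)))"
    by (rule integral_unique, rule has_integral_Im, rule integrable_integral, rule integrable_continuous_interval[OF ci])
  also have "integral {0..pi} (\<lambda>a. integral {0..2*pi} (f a)) = integral {0..2*pi} (\<lambda>y. integral {0..pi} (\<lambda>a. f a y))"
    using integral_swap_continuous[OF cf] by simp
  also have "\<dots> = integral {0..2*pi} (\<lambda>y. cnj (h (Complex s y)) * ((cis (-y) * Y1 t - cis y * X1 t) / (2 * \<i>)))"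
    by (simp add: f_def sine_moment[OF t])
  also have "\<dots> = integral {0..2*pi} (\<lambda>y. (Y1 t / (2*\<i>)) * cnj (h (Complex s y) * cis y) - (X1 t / (2*\<i>)) * cnj (h (Complex s y) * cis (-y)))"
    by (rule integral_cong) (simp add: cis_cnj field_simps)
  also have "\<dots> = (Y1 t / (2*\<i>)) * cnj (Y1 s) - (X1 t / (2*\<i>)) * cnj (X1 s)"
    unfolding X1_def Y1_def integral_cnj
    by (subst integral_diff) (auto intro!: integrable_continuous_interval continuous_intros cont_line[OF cont_h s])
  also have "\<dots> = (Y1 t * cnj (Y1 s) - X1 t * cnj (X1 s)) / (2*\<i>)" by (simp add: field_simps)
  also have "Im \<dots> = Re (X1 t * cnj (X1 s) - Y1 t * cnj (Y1 s)) / 2"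
  proof -
    have "Im (w / (2 * \<i>)) = - Re w / 2" for w by (simp add: Im_divide power2_eq_square)
    then show ?thesis unfolding minus_complex.sel by (simp only: minus_diff_eq minus_complex.sel)
  qed
  finally show ?thesis by simp
qed

lemma norm_moment_le:
  assumes t: "0 < t" "t < T" and m: "\<And>y. cmod (h (Complex t y)) \<le> m"
  shows "cmod (X1 t) \<le> 2*pi*m" "cmod (Y1 t) \<le> 2*pi*m"
proof -
  have *: "cmod (integral {0..2*pi} (\<lambda>y. h (Complex t y) * e y)) \<le> 2*pi*m"
    if "continuous_on {0..2*pi} e" "\<And>y. cmod (e y) = 1" for e
  proof -
    have "norm (integral {0..2*pi} (\<lambda>y. h (Complex t y) * e y)) \<le> integral {0..2*pi} (\<lambda>_. m)"
      by (rule integral_norm_bound_integral)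
        (auto intro!: integrable_continuous_interval continuous_intros that cont_line[OF cont_h t] simp: norm_mult that m)
    then show ?thesis by simp
  qed
  show "cmod (X1 t) \<le> 2*pi*m" "cmod (Y1 t) \<le> 2*pi*m"
    unfolding X1_def Y1_def by (rule *; auto intro!: continuous_intros)+
qed

lemma corr_bound:
  assumes s: "0 < s" "s < T" and t: "0 < t" "t < T"
  shows "\<bar>corr s t a\<bar> \<le> R\<^sup>2"
proof -
  have hb: "cmod (h (Complex x y)) \<le> R" if "0 < x" "x < T" for x y using ltR[of "Complex x y"] that by simp
  have "norm (integral {0..2*pi} (\<lambda>y. cnj (h (Complex s y)) * (h (Complex t (y + a)) - h (Complex t (y - a))))) \<le> integral {0..2*pi} (\<lambda>_. 2 * R\<^sup>2)"
  proof (rule integral_norm_bound_integral[OF integrable_corr[OF s t]])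
    fix y
    have "cmod (h (Complex t (y + a)) - h (Complex t (y - a))) \<le> R + R"
      by (rule order_trans[OF norm_triangle_ineq4 add_mono[OF hb[OF t] hb[OF t]]])
    then have "cmod (h (Complex s y)) * cmod (h (Complex t (y + a)) - h (Complex t (y - a))) \<le> R * (R + R)"
      using hb[OF s] R_gt by (intro mult_mono) auto
    then show "norm (cnj (h (Complex s y)) * (h (Complex t (y + a)) - h (Complex t (y - a)))) \<le> 2 * R\<^sup>2"
      by (simp add: norm_mult power2_eq_square)
  qed auto
  then have "\<bar>Im (integral {0..2*pi} (\<lambda>y. cnj (h (Complex s y)) * (h (Complex t (y + a)) - h (Complex t (y - a)))))\<bar> \<le> 4*pi*R\<^sup>2"
    using abs_Im_le_cmod order_trans by fastforce
  then show ?thesis unfolding corr_def by (simp add: field_simps)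
qed

text \<open>Subsequential limits \<open>X0\<close>, \<open>Y0\<close> of the moments stand in for
  boundary values. The limit of the correlation relates them to the moments at \<open>t\<close>;
  letting \<open>t\<close> tend to 0 along the same sequence gives |X0|^2 - |Y0|^2 = (2\<pi>)^2. As
  |X0| is at most 2\<pi>, this forces Y0 = 0.\<close>

lemma boundary_moments:
  assumes R: "R = cosh T"
  obtains x0 where "cmod x0 = 1" "\<And>t. 0 < t \<Longrightarrow> t < T \<Longrightarrow> Re (X1 t * cnj x0) = 2*pi * cosh t"
proof -
  \<comment> \<open>The offset 2 keeps s n below \<open>T\<close> already for n = 0.\<close>
  define s where "s n = T / (2 + real n)" for n
  have s: "0 < s n" "s n < T" for n
  proof -
    show "0 < s n" using T_pos by (simp add: s_def add_pos_nonneg)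
    have "s n \<le> T / 2" unfolding s_def using T_pos by (intro divide_left_mono) auto
    then show "s n < T" using T_pos by simp
  qed
  have s0: "s \<longlonglongrightarrow> 0"
    unfolding s_def by (rule real_tendsto_divide_at_top[OF tendsto_const filterlim_tendsto_add_at_top[OF tendsto_const filterlim_real_sequentially]])
  then have sr: "filterlim s (at_right 0) sequentially"
    unfolding at_within_def using s by (intro filterlim_inf[THEN iffD2] conjI) (auto simp: filterlim_principal)
  have sin2: "((\<lambda>a. sin a * sin a) has_integral pi / 2) {0..pi}"
  proof -
    have "((\<lambda>a. sin a * sin a) has_integral (pi - sin pi * cos pi) / 2 - (0 - sin 0 * cos 0) / 2) {0..pi}"
    proof (rule fundamental_theorem_of_calculus)
      fix x :: real
      have "((\<lambda>a. (a - sin a * cos a) / 2) has_real_derivative (1 - (cos x * cos x - sin x * sin x)) / 2) (at x within {0..pi})"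
        by (auto intro!: derivative_eq_intros)
      moreover have "cos x * cos x = 1 - sin x * sin x"
        using sin_cos_squared_add3[of x] by (simp add: eq_diff_eq)
      then have "(1 - (cos x * cos x - sin x * sin x)) / 2 = sin x * sin x" by simp
      ultimately show "((\<lambda>a. (a - sin a * cos a) / 2) has_vector_derivative sin x * sin x) (at x within {0..pi})"
        by (simp add: has_real_derivative_iff_has_vector_derivative)
    qed simp
    then show ?thesis by simp
  qed
  have lim: "(\<lambda>n. Re (X1 t * cnj (X1 (s n)) - Y1 t * cnj (Y1 (s n)))) \<longlonglongrightarrow> 4*pi\<^sup>2 * cosh t" if t: "0 < t" "t < T" for t
  proof -
    \<comment> \<open>Pointwise convergence inside (0, \<pi>) is \<open>corr_limit\<close>; at the
      end points the factor sin a vanishes.\<close>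
    have "(\<lambda>n. integral {0..pi} (\<lambda>a. corr (s n) t a * sin a)) \<longlonglongrightarrow> integral {0..pi} (\<lambda>a. cosh t * (sin a * sin a))"
    proof (rule dominated_convergence(2))
      fix n
      obtain \<Psi> where \<Psi>: "\<Psi> holomorphic_on strip T" "\<And>t a. 0 < t \<Longrightarrow> t < T \<Longrightarrow> corr (s n) t a = Im (\<Psi> (Complex t a))"
        using corr_harmonic[OF s] by blast
      have "continuous_on {0..pi} (\<lambda>a. Im (\<Psi> (Complex t a)) * sin a)"
        by (intro continuous_intros cont_line[OF cont_hol[OF \<Psi>(1)] t])
      then show "(\<lambda>a. corr (s n) t a * sin a) integrable_on {0..pi}"
        unfolding \<Psi>(2)[OF t] by (rule integrable_continuous_interval)
      show "(\<lambda>_. R\<^sup>2) integrable_on {0..pi}" by (rule integrable_const_ivl)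
      fix a
      have "\<bar>corr (s n) t a\<bar> * \<bar>sin a\<bar> \<le> R\<^sup>2 * 1" using corr_bound[OF s t] by (intro mult_mono) auto
      then show "norm (corr (s n) t a * sin a) \<le> R\<^sup>2" by (simp add: abs_mult)
    next
      fix a assume a: "a \<in> {0..pi}"
      show "(\<lambda>n. corr (s n) t a * sin a) \<longlonglongrightarrow> cosh t * (sin a * sin a)"
      proof (cases "a = 0 \<or> a = pi")
        case False
        then have "((\<lambda>s. corr s t a) \<longlongrightarrow> cosh t * sin a) (at_right 0)"
          using a by (intro corr_limit[OF R t]) auto
        then have "(\<lambda>n. corr (s n) t a) \<longlonglongrightarrow> cosh t * sin a" using sr by (rule filterlim_compose)
        from tendsto_mult_right[OF this, of "sin a"] show ?thesis by (simp add: mult.assoc)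
      qed auto
    qed
    also have "integral {0..pi} (\<lambda>a. cosh t * (sin a * sin a)) = cosh t * (pi / 2)"
      by (rule integral_unique, rule has_integral_mult_right, rule sin2)
    finally have "(\<lambda>n. Re (X1 t * cnj (X1 (s n)) - Y1 t * cnj (Y1 (s n))) / (8*pi)) \<longlonglongrightarrow> cosh t * (pi / 2)"
      unfolding corr_sine_coefficient[OF s t] .
    from tendsto_mult_left[OF this, of "8*pi"]
    have "(\<lambda>n. 8*pi * (Re (X1 t * cnj (X1 (s n)) - Y1 t * cnj (Y1 (s n))) / (8*pi))) \<longlonglongrightarrow> 8*pi * (cosh t * (pi / 2))" .
    moreover have "8*pi * (x / (8*pi)) = x" for x :: real by simp
    moreover have "8*pi * (cosh t * (pi / 2)) = 4*pi\<^sup>2 * cosh t" by (simp add: power2_eq_square)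
    ultimately show ?thesis by (simp only:)
  qed
  have hb: "cmod (h (Complex x y)) \<le> R" if "0 < x" "x < T" for x y using ltR[of "Complex x y"] that by simp
  have bX: "cmod (X1 (s n)) \<le> 2*pi*R" and bY: "cmod (Y1 (s n)) \<le> 2*pi*R" for n
    using norm_moment_le[OF s hb[OF s]] by auto
  define p where "p n = (X1 (s n), Y1 (s n))" for n
  have "norm (p n) \<le> 2*pi*R + 2*pi*R" for n
    unfolding p_def using norm_Pair_le[of "X1 (s n)" "Y1 (s n)"] bX[of n] bY[of n] by linarith
  then have "bounded (range p)" unfolding bounded_iff by blast
  then obtain l r where r: "strict_mono r" and l: "(p \<circ> r) \<longlonglongrightarrow> l"
    using bounded_imp_convergent_subsequence by blast
  obtain X0 Y0 where XY: "l = (X0, Y0)" by (cases l)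
  have X: "(\<lambda>n. X1 (s (r n))) \<longlonglongrightarrow> X0" and Y: "(\<lambda>n. Y1 (s (r n))) \<longlonglongrightarrow> Y0"
    using tendsto_fst[OF l] tendsto_snd[OF l] by (simp_all add: p_def o_def XY)
  have eq: "Re (X1 t * cnj X0 - Y1 t * cnj Y0) = 4*pi\<^sup>2 * cosh t" if t: "0 < t" "t < T" for t
  proof (rule LIMSEQ_unique)
    show "(\<lambda>n. Re (X1 t * cnj (X1 (s (r n))) - Y1 t * cnj (Y1 (s (r n))))) \<longlonglongrightarrow> Re (X1 t * cnj X0 - Y1 t * cnj Y0)"
      by (intro tendsto_intros X Y)
    show "(\<lambda>n. Re (X1 t * cnj (X1 (s (r n))) - Y1 t * cnj (Y1 (s (r n))))) \<longlonglongrightarrow> 4*pi\<^sup>2 * cosh t"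
      using LIMSEQ_subseq_LIMSEQ[OF lim[OF t] r] by (simp add: o_def)
  qed
  have sr0: "(\<lambda>n. s (r n)) \<longlonglongrightarrow> 0" using LIMSEQ_subseq_LIMSEQ[OF s0 r] by (simp add: o_def)
  \<comment> \<open>The previous identity holds for every \<open>t\<close>, so it may be used at t =
    s (r n) with \<open>X0\<close> and \<open>Y0\<close> already fixed.\<close>
  have "Re (X0 * cnj X0 - Y0 * cnj Y0) = 4*pi\<^sup>2 * cosh 0"
  proof (rule LIMSEQ_unique)
    show "(\<lambda>n. Re (X1 (s (r n)) * cnj X0 - Y1 (s (r n)) * cnj Y0)) \<longlonglongrightarrow> Re (X0 * cnj X0 - Y0 * cnj Y0)"
      by (intro tendsto_intros X Y)
    show "(\<lambda>n. Re (X1 (s (r n)) * cnj X0 - Y1 (s (r n)) * cnj Y0)) \<longlonglongrightarrow> 4*pi\<^sup>2 * cosh 0"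
      unfolding eq[OF s] by (intro tendsto_intros sr0)
  qed
  then have diff: "(cmod X0)\<^sup>2 - (cmod Y0)\<^sup>2 = (2*pi)\<^sup>2"
    unfolding cmod_power2 by (simp add: power2_eq_square)
  \<comment> \<open>Near the left end |h| is at most 1 plus a small error, and so is the modulus of
    each normalised coefficient.\<close>
  have "cmod X0 \<le> 2*pi"
  proof (rule field_le_epsilon)
    fix e :: real assume "e > 0"
    define e' where "e' = e / (2*pi)"
    have e': "e' > 0" using \<open>e > 0\<close> by (simp add: e'_def)
    obtain d where d: "d > 0" "\<And>z. z \<in> strip T \<Longrightarrow> Re z < d \<Longrightarrow> \<bar>cmod (h z) - 1\<bar> < e'"
      using lim0[OF e'] by blast
    have "\<forall>\<^sub>F n in sequentially. s (r n) < d" using sr0 d(1) by (rule order_tendstoD)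
    then have "\<forall>\<^sub>F n in sequentially. cmod (X1 (s (r n))) \<le> 2*pi + e"
    proof eventually_elim
      case (elim n)
      have "cmod (h (Complex (s (r n)) y)) \<le> 1 + e'" for y
        using d(2)[of "Complex (s (r n)) y"] elim s[of "r n"] by (simp add: abs_less_iff)
      then have "cmod (X1 (s (r n))) \<le> 2*pi*(1 + e')" by (rule norm_moment_le(1)[OF s])
      moreover have "2*pi*(1 + e') = 2*pi + e" by (simp add: e'_def distrib_left)
      ultimately show ?case by simp
    qed
    then show "cmod X0 \<le> 2*pi + e"
      using tendsto_upperbound[OF tendsto_norm[OF X]] by simp
  qed
  then have "(cmod X0)\<^sup>2 \<le> (2*pi)\<^sup>2" by (intro power_mono) auto
  then have "(cmod Y0)\<^sup>2 \<le> 0" using diff by linarith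
  then have Y0: "Y0 = 0" by simp
  then have "(cmod X0)\<^sup>2 = (2*pi)\<^sup>2" using diff by simp
  then have X0: "cmod X0 = 2*pi" by (rule power2_eq_imp_eq) auto
  show ?thesis
  proof (rule that[of "X0 / of_real (2*pi)"])
    show "cmod (X0 / of_real (2*pi)) = 1" using X0 by (simp add: norm_divide)
    fix t assume t: "0 < t" "t < T"
    have "Re (X1 t * cnj X0) = 4*pi\<^sup>2 * cosh t" using eq[OF t] Y0 by simp
    moreover have "X1 t * cnj (X0 / of_real (2*pi)) = (X1 t * cnj X0) / of_real (2*pi)" by simp
    ultimately show "Re (X1 t * cnj (X0 / of_real (2*pi))) = 2*pi * cosh t"
      by (simp only: Re_divide_of_real) (simp add: power2_eq_square)
  qed
qed

end

section \<open>Rigidity\<close>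

lemma Re_cnj_mult_derivative:
  fixes f g :: "real \<Rightarrow> complex"
  assumes "(f has_vector_derivative f') (at x)" "(g has_vector_derivative g') (at x)"
  shows "((\<lambda>x. Re (cnj (f x) * g x)) has_real_derivative Re (cnj (f x) * g') + Re (cnj f' * g x)) (at x)"
proof -
  have "((\<lambda>x. cnj (f x) * g x) has_vector_derivative cnj (f x) * g' + cnj f' * g x) (at x)"
    by (rule has_vector_derivative_mult[OF has_vector_derivative_cnj'[OF assms(1)] assms(2)])
  from bounded_linear.has_vector_derivative[OF bounded_linear_Re this] show ?thesis
    by (simp add: has_real_derivative_iff_has_vector_derivative)
qed

context strip_map
begin

text \<open>The Laplacian of \<bar>h\<bar>^2 is twice the squared gradient, hence nonnegative. Its
  \<theta>\<theta> part integrates to 0 over a period, so the second derivative of the mean square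
  is the integral of the whole Laplacian.\<close>

lemma mean_square_convex:
  assumes per: "\<And>t y. 0 < t \<Longrightarrow> t < T \<Longrightarrow> h (Complex t (y + 2*pi)) = h (Complex t y)"
    and ab: "0 < a" "b < T"
  shows "convex_on {a..b} (\<lambda>t. integral {0..2*pi} (\<lambda>y. (cmod (h (Complex t y)))\<^sup>2))"
proof -
  let ?ht = "hmap P Q" and ?hy = "hmap (\<lambda>z. \<i> * P z) (\<lambda>z. \<i> * Q z)" and ?htt = "hmap (deriv P) (deriv Q)"
  have c: "continuous_on (strip T) h" "continuous_on (strip T) ?ht" "continuous_on (strip T) ?hy" "continuous_on (strip T) ?htt"
    unfolding hmap_def
    by (intro continuous_intros cont_hol[OF F_hol] cont_hol[OF G_hol] cont_hol[OF P_hol] cont_hol[OF Q_hol]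
        cont_hol[OF holomorphic_deriv[OF P_hol open_strip]] cont_hol[OF holomorphic_deriv[OF Q_hol open_strip]])+
  have dtt: "((\<lambda>x. ?ht (Complex x y)) has_vector_derivative ?htt (Complex t y)) (at t)"
    and dyy: "((\<lambda>y. ?hy (Complex t y)) has_vector_derivative - ?htt (Complex t y)) (at y)" if "0 < t" "t < T" for t y
  proof -
    have z: "Complex t y \<in> strip T" using that by simp
    show "((\<lambda>x. ?ht (Complex x y)) has_vector_derivative ?htt (Complex t y)) (at t)"
      using hmap_derivative_t[OF dP[OF z] dQ[OF z]] by (simp add: hmap_def)
    show "((\<lambda>y. ?hy (Complex t y)) has_vector_derivative - ?htt (Complex t y)) (at y)"
      using hmap_derivative_th[OF DERIV_cmult[OF dP[OF z], of \<i>] DERIV_cmult[OF dQ[OF z], of \<i>]] by (simp add: hmap_def)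
  qed
  have c2: "continuous_on ({0<..<T} \<times> {0..2*pi}) (\<lambda>p. f (Complex (fst p) (snd p)))" if "continuous_on (strip T) f" for f :: "complex \<Rightarrow> complex"
    unfolding Complex_eq by (rule continuous_on_compose2[OF that]) (auto intro!: continuous_intros simp: strip_def)
  have c1: "continuous_on A (\<lambda>y. f (Complex t y))" if "continuous_on (strip T) f" "0 < t" "t < T" for f :: "complex \<Rightarrow> complex" and t A
    unfolding Complex_eq by (rule continuous_on_compose2[OF that(1)]) (use that in \<open>auto intro!: continuous_intros simp: strip_def\<close>)
  define V' where "V' t = integral {0..2*pi} (\<lambda>y. 2 * Re (cnj (h (Complex t y)) * ?ht (Complex t y)))" for t
  define D where "D t y = 2 * (Re (cnj (h (Complex t y)) * ?htt (Complex t y)) + Re (cnj (?ht (Complex t y)) * ?ht (Complex t y)))" for t y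
  have at: "at t within {0<..<T} = at t" if "0 < t" "t < T" for t
    by (rule at_within_open) (use that in auto)
  have d1: "((\<lambda>t. integral {0..2*pi} (\<lambda>y. (cmod (h (Complex t y)))\<^sup>2)) has_real_derivative V' t) (at t)" if t: "0 < t" "t < T" for t
  proof -
    have "((\<lambda>t. integral {0..2*pi} (\<lambda>y. (cmod (h (Complex t y)))\<^sup>2)) has_real_derivative V' t) (at t within {0<..<T})"
      unfolding V'_def
    proof (rule leibniz_rule_field_derivative[of "{0<..<T}" 0 "2*pi", unfolded cbox_interval])
      fix x y assume "x \<in> {0<..<T}"
      then show "((\<lambda>x. (cmod (h (Complex x y)))\<^sup>2) has_real_derivative 2 * Re (cnj (h (Complex x y)) * ?ht (Complex x y))) (at x within {0<..<T})"
        by (intro has_field_derivative_at_within[OF norm_square_derivative[OF h_t]]) auto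
    next
      fix x assume "x \<in> {0<..<T}"
      then show "(\<lambda>y. (cmod (h (Complex x y)))\<^sup>2) integrable_on {0..2*pi}"
        by (intro integrable_continuous_interval continuous_intros c1 c) auto
    next
      show "continuous_on ({0<..<T} \<times> {0..2*pi}) (\<lambda>(x, y). 2 * Re (cnj (h (Complex x y)) * ?ht (Complex x y)))"
        unfolding split_beta' by (intro continuous_intros c2 c)
    qed (use t in auto)
    then show ?thesis using at[OF t] by simp
  qed
  have d2: "(V' has_real_derivative integral {0..2*pi} (D t)) (at t)" if t: "0 < t" "t < T" for t
  proof -
    have "(V' has_real_derivative integral {0..2*pi} (D t)) (at t within {0<..<T})"
      unfolding V'_def
    proof (rule leibniz_rule_field_derivative[of "{0<..<T}" 0 "2*pi", unfolded cbox_interval])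
      fix x y assume "x \<in> {0<..<T}"
      then show "((\<lambda>x. 2 * Re (cnj (h (Complex x y)) * ?ht (Complex x y))) has_real_derivative D x y) (at x within {0<..<T})"
        unfolding D_def
        by (intro has_field_derivative_at_within[OF DERIV_cmult[OF Re_cnj_mult_derivative[OF h_t dtt]]]) auto
    next
      fix x assume "x \<in> {0<..<T}"
      then show "(\<lambda>y. 2 * Re (cnj (h (Complex x y)) * ?ht (Complex x y))) integrable_on {0..2*pi}"
        by (intro integrable_continuous_interval continuous_intros c1 c) auto
    next
      show "continuous_on ({0<..<T} \<times> {0..2*pi}) (\<lambda>(x, y). D x y)"
        unfolding D_def split_beta' by (intro continuous_intros c2 c)
    qed (use t in auto)
    then show ?thesis using at[OF t] by simp
  qed
  have pos: "0 \<le> integral {0..2*pi} (D t)" if t: "0 < t" "t < T" for t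
  proof -
    \<comment> \<open>\<open>?K\<close> is half of the \<theta>\<theta> part of the Laplacian of
      \<bar>h\<bar>^2; adding it twice cancels the second derivatives of \<open>h\<close> and leaves
      a sum of squares.\<close>
    let ?K = "\<lambda>y. Re (cnj (h (Complex t y)) * - ?htt (Complex t y)) + Re (cnj (?hy (Complex t y)) * ?hy (Complex t y))"
    have hyper: "?hy (Complex t (0 + 2*pi)) = ?hy (Complex t 0)"
    proof (rule vector_derivative_unique_at)
      have "((\<lambda>y. h (Complex t (y + 2*pi))) has_vector_derivative 1 *\<^sub>R ?hy (Complex t (0 + 2*pi))) (at 0)"
      proof (rule vector_diff_chain_at[of "\<lambda>y. y + 2*pi" 1 0 "\<lambda>y. h (Complex t y)", unfolded o_def])
        show "((\<lambda>y. y + 2*pi) has_vector_derivative 1) (at 0)" by (auto intro!: derivative_eq_intros)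
      qed (rule h_th[OF t])
      then show "((\<lambda>y. h (Complex t y)) has_vector_derivative ?hy (Complex t (0 + 2*pi))) (at 0)"
        by (simp add: per[OF t])
      show "((\<lambda>y. h (Complex t y)) has_vector_derivative ?hy (Complex t 0)) (at 0)" by (rule h_th[OF t])
    qed
    have "(?K has_integral Re (cnj (h (Complex t (2*pi))) * ?hy (Complex t (2*pi))) - Re (cnj (h (Complex t 0)) * ?hy (Complex t 0))) {0..2*pi}"
    proof (rule fundamental_theorem_of_calculus)
      fix x
      show "((\<lambda>y. Re (cnj (h (Complex t y)) * ?hy (Complex t y))) has_vector_derivative ?K x) (at x within {0..2*pi})"
        using Re_cnj_mult_derivative[OF h_th[OF t] dyy[OF t], of x]
        by (simp add: has_real_derivative_iff_has_vector_derivative has_vector_derivative_at_within)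
    qed simp
    then have K: "(?K has_integral 0) {0..2*pi}" using hyper per[OF t, of 0] by simp
    have intD: "D t integrable_on {0..2*pi}"
      unfolding D_def by (intro integrable_continuous_interval continuous_intros c1 c t)
    have "integral {0..2*pi} (D t) = integral {0..2*pi} (\<lambda>y. D t y + 2 * ?K y)"
      using integral_unique[OF has_integral_add[OF integrable_integral[OF intD] has_integral_mult_right[OF K, of 2]]] by simp
    also have "\<dots> \<ge> 0"
    proof (rule Henstock_Kurzweil_Integration.integral_nonneg)
      show "(\<lambda>y. D t y + 2 * ?K y) integrable_on {0..2*pi}"
        using has_integral_add[OF integrable_integral[OF intD] has_integral_mult_right[OF K, of 2]] by (rule has_integral_integrable)
      show "0 \<le> D t y + 2 * ?K y" for y
      proof -
        have nn: "0 \<le> Re (cnj w * w)" for w by simp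
        have eq: "D t y + 2 * ?K y = 2 * (Re (cnj (?ht (Complex t y)) * ?ht (Complex t y)) + Re (cnj (?hy (Complex t y)) * ?hy (Complex t y)))"
          by (simp add: D_def)
        show ?thesis unfolding eq by (intro mult_nonneg_nonneg add_nonneg_nonneg nn) simp
      qed
    qed
    finally show ?thesis .
  qed
  show ?thesis
    by (rule f''_ge0_imp_convex[where f' = V' and f'' = "\<lambda>t. integral {0..2*pi} (D t)"])
      (use ab in \<open>auto intro: d1 d2 pos\<close>)
qed

end

context annulus_map
begin

theorem extremal_form:
  assumes R: "R = cosh T"
  obtains x0 where "cmod x0 = 1" "\<And>t y. 0 < t \<Longrightarrow> t < T \<Longrightarrow> 0 \<le> y \<Longrightarrow> y \<le> 2*pi \<Longrightarrow> h (Complex t y) = x0 * of_real (cosh t) * cis y"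
proof -
  obtain x0 where x0: "cmod x0 = 1" "\<And>t. 0 < t \<Longrightarrow> t < T \<Longrightarrow> Re (X1 t * cnj x0) = 2*pi * cosh t"
    using boundary_moments[OF R] by blast
  \<comment> \<open>The extremal map x0 cosh t cis \<theta> is x0/2 exp z plus the conjugate of cnj
    x0/2 exp(-z), so its difference from \<open>h\<close> is again of the form F + cnj G.\<close>
  define F1 where "F1 z = F z - x0 / 2 * exp z" for z
  define G1 where "G1 z = G z - cnj x0 / 2 * exp (- z)" for z
  interpret v: strip_map T F1 G1
    unfolding F1_def G1_def by unfold_locales (auto intro!: holomorphic_intros F_hol G_hol T_pos)
  have v: "hmap F1 G1 (Complex t y) = h (Complex t y) - x0 * of_real (cosh t) * cis y" for t y
  proof -
    have "exp (Complex t y) = of_real (exp t) * cis y" "exp (- cnj (Complex t y)) = of_real (exp (-t)) * cis y"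
      by (simp_all add: exp_eq_polar)
    then show ?thesis
      by (simp add: hmap_def F1_def G1_def cosh_field_def exp_cnj algebra_simps add_divide_distrib)
  qed
  define V where "V t = integral {0..2*pi} (\<lambda>y. (cmod (hmap F1 G1 (Complex t y)))\<^sup>2)" for t
  have cis2pi: "cis (y + 2*pi) = cis y" for y by (simp add: complex_eq_iff)
  have conv: "convex_on {a..b} V" if "0 < a" "b < T" for a b
    unfolding V_def by (rule v.mean_square_convex[OF _ that]) (simp add: v per cis2pi)
  have int: "(\<lambda>y. (cmod (hmap F1 G1 (Complex t y)))\<^sup>2) integrable_on {0..2*pi}" if "0 < t" "t < T" for t
    unfolding v by (intro integrable_continuous_interval continuous_intros cont_line[OF cont_h] that)
  have V_nonneg: "V t \<ge> 0" if "0 < t" "t < T" for t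
    unfolding V_def by (rule Henstock_Kurzweil_Integration.integral_nonneg[OF int[OF that]]) simp
  \<comment> \<open>In the expanded square the cross term is known exactly from the first Fourier
    coefficient, so the distance is at most the gap between the squares of the modulus bound and of
    cosh t.\<close>
  have V_le: "V t \<le> 2*pi*(m\<^sup>2 - (cosh t)\<^sup>2)" if t: "0 < t" "t < T" and m: "\<And>y. cmod (h (Complex t y)) \<le> m" for t m
  proof -
    have I: "((\<lambda>y. Re (h (Complex t y) * cis (-y) * cnj x0)) has_integral 2*pi * cosh t) {0..2*pi}"
    proof -
      have "((\<lambda>y. h (Complex t y) * cis (-y)) has_integral X1 t) {0..2*pi}"
        unfolding X1_def by (intro integrable_integral integrable_continuous_interval continuous_intros cont_line[OF cont_h t])
      from has_integral_Re[OF has_integral_mult_left[OF this, of "cnj x0"]] show ?thesis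
        by (simp only: x0(2)[OF t])
    qed
    have c: "((\<lambda>_. x) has_integral 2*pi*x) {0..2*pi}" for x :: real
      using has_integral_const_real[of x 0 "2*pi"] by simp
    have J: "((\<lambda>y. m\<^sup>2 - 2 * cosh t * Re (h (Complex t y) * cis (-y) * cnj x0) + (cosh t)\<^sup>2) has_integral
        2*pi*m\<^sup>2 - 2 * cosh t * (2*pi * cosh t) + 2*pi*(cosh t)\<^sup>2) {0..2*pi}"
      by (rule has_integral_add[OF has_integral_diff[OF c has_integral_mult_right[OF I]] c])
    have "V t \<le> 2*pi*m\<^sup>2 - 2 * cosh t * (2*pi * cosh t) + 2*pi*(cosh t)\<^sup>2"
      unfolding V_def
    proof (rule has_integral_le[OF integrable_integral[OF int[OF t]] J])
      fix y
      have gen: "(cmod (w - x0 * of_real r * u))\<^sup>2 = (cmod w)\<^sup>2 - 2 * r * Re (w * cnj u * cnj x0) + r\<^sup>2 * (cmod x0)\<^sup>2 * (cmod u)\<^sup>2" for w u r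
        unfolding cmod_power2 by (simp add: power2_eq_square algebra_simps)
      have "(cmod (hmap F1 G1 (Complex t y)))\<^sup>2 = (cmod (h (Complex t y)))\<^sup>2 - 2 * cosh t * Re (h (Complex t y) * cis (-y) * cnj x0) + (cosh t)\<^sup>2"
        unfolding v gen by (simp add: x0(1) cis_cnj)
      moreover have "(cmod (h (Complex t y)))\<^sup>2 \<le> m\<^sup>2" using m by (intro power_mono) auto
      ultimately show "(cmod (hmap F1 G1 (Complex t y)))\<^sup>2 \<le> m\<^sup>2 - 2 * cosh t * Re (h (Complex t y) * cis (-y) * cnj x0) + (cosh t)\<^sup>2"
        by simp
    qed
    also have "\<dots> = 2*pi*(m\<^sup>2 - (cosh t)\<^sup>2)" by (simp add: power2_eq_square algebra_simps)
    finally show ?thesis .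
  qed
  have V0: "V t \<le> e" if t: "0 < t" "t < T" and e: "e > 0" for t e
  proof -
    \<comment> \<open>At the right end the gap is at most (R + k)^2 - (R - k)^2 = 4Rk; at the left
      end it is at most 2k + k^2, which is smaller as R > 1 and k \<le> 1.\<close>
    define k where "k = min 1 (e / (2*pi * (4 * R)))"
    have k: "0 < k" "k \<le> 1" "2*pi*(4*R*k) \<le> e"
    proof -
      show "0 < k" "k \<le> 1" using e R_gt by (auto simp: k_def)
      have "k \<le> e / (2*pi * (4 * R))" by (simp add: k_def)
      then show "2*pi*(4*R*k) \<le> e" using R_gt by (simp add: field_simps)
    qed
    obtain d1 where d1: "d1 > 0" "\<And>z. z \<in> strip T \<Longrightarrow> Re z < d1 \<Longrightarrow> \<bar>cmod (h z) - 1\<bar> < k"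
      using lim0[OF k(1)] by blast
    obtain d2 where d2: "d2 > 0" "\<And>z. z \<in> strip T \<Longrightarrow> Re z > T - d2 \<Longrightarrow> \<bar>cmod (h z) - R\<bar> < k"
      using limT[OF k(1)] by blast
    have "isCont cosh T" by (intro continuous_intros)
    then obtain d3 where d3: "d3 > 0" "\<And>x. \<bar>x - T\<bar> < d3 \<Longrightarrow> \<bar>cosh x - R\<bar> < k"
      using k(1) unfolding continuous_at_eps_delta R dist_real_def by blast
    define a where "a = min t d1 / 2"
    define b where "b = T - min (T - t) (min d2 d3) / 2"
    have a: "0 < a" "a < t" "a < d1" using t d1(1) by (auto simp: a_def)
    have b: "t < b" "b < T" "T - d2 < b" "T - d3 < b" using t d2(1) d3(1) by (auto simp: b_def min_def field_simps)
    have aT: "a < T" and b0: "0 < b" using a b t by auto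
    have kR: "k * 1 \<le> k * R" "k * k \<le> 1 * k" using k R_gt by (auto intro!: mult_left_mono mult_right_mono)
    have "V a \<le> e"
    proof -
      have "cmod (h (Complex a y)) \<le> 1 + k" for y
        using d1(2)[of "Complex a y"] a aT by (simp add: abs_less_iff)
      then have "V a \<le> 2*pi*((1 + k)\<^sup>2 - (cosh a)\<^sup>2)" by (rule V_le[OF a(1) aT])
      also have "\<dots> \<le> 2*pi*(4*R*k)"
      proof (rule mult_left_mono)
        have "1 \<le> (cosh a)\<^sup>2" by (intro one_le_power cosh_real_ge_1)
        moreover have "(1 + k)\<^sup>2 = 1 + 2 * k + k * k" "4*R*k = 4 * (k * R)" by (simp_all add: power2_eq_square algebra_simps)
        ultimately show "(1 + k)\<^sup>2 - (cosh a)\<^sup>2 \<le> 4*R*k" using kR k(1) by linarith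
      qed simp
      finally show ?thesis using k(3) by linarith
    qed
    moreover have "V b \<le> e"
    proof -
      have "cmod (h (Complex b y)) \<le> R + k" for y
        using d2(2)[of "Complex b y"] b b0 by (simp add: abs_less_iff)
      then have "V b \<le> 2*pi*((R + k)\<^sup>2 - (cosh b)\<^sup>2)" by (rule V_le[OF b0 b(2)])
      also have "\<dots> \<le> 2*pi*(4*R*k)"
      proof (rule mult_left_mono)
        have "R - k \<le> cosh b" using d3(2)[of b] b by (simp add: abs_less_iff)
        then have "(R - k)\<^sup>2 \<le> (cosh b)\<^sup>2" using k R_gt by (intro power_mono) auto
        then show "(R + k)\<^sup>2 - (cosh b)\<^sup>2 \<le> 4*R*k" by (simp add: power2_eq_square algebra_simps)
      qed simp
      finally show ?thesis using k(3) by linarith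
    qed
    moreover have "V t \<le> max (V a) (V b)"
      by (rule convex_on_le_max[OF conv[OF a(1) b(2)]]) (use a b in auto)
    ultimately show ?thesis by linarith
  qed
  show ?thesis
  proof (rule that[OF x0(1)])
    fix t y :: real assume t: "0 < t" "t < T" and y: "0 \<le> y" "y \<le> 2*pi"
    have "V t \<le> 0" by (rule field_le_epsilon) (use V0[OF t] in simp)
    then have "V t = 0" using V_nonneg[OF t] by simp
    moreover have "continuous_on {0..2*pi} (\<lambda>y. (cmod (hmap F1 G1 (Complex t y)))\<^sup>2)"
      unfolding v by (intro continuous_intros cont_line[OF cont_h] t)
    ultimately have "(cmod (hmap F1 G1 (Complex t y)))\<^sup>2 = 0"
      unfolding V_def using integral_eq_0_iff[of 0 "2*pi" "\<lambda>y. (cmod (hmap F1 G1 (Complex t y)))\<^sup>2"] y by auto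
    then show "h (Complex t y) = x0 * of_real (cosh t) * cis y" by (simp add: v)
  qed
qed

end

section \<open>Holomorphic decomposition on an annulus\<close>

lemma open_annulus: "open (annulus a b)"
proof -
  have "annulus a b = {z. a < cmod z} \<inter> {z. cmod z < b}" by (auto simp: annulus_def)
  then show ?thesis by (auto intro!: open_Int open_Collect_less continuous_intros)
qed

lemma partial_derivative_line:
  assumes "((\<lambda>t. u (z + c * of_real t)) has_real_derivative D) (at 0)"
    and "z = w + c * of_real s"
  shows "((\<lambda>t. u (w + c * of_real t)) has_real_derivative D) (at s)"
proof -
  have "((\<lambda>t. u (w + c * of_real (t + s))) has_real_derivative D) (at 0)"
    using assms by (simp add: algebra_simps)
  then show ?thesis
    using DERIV_shift[of "\<lambda>t. u (w + c * of_real t)" D 0 s] by simp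
qed

lemma continuous_on_open_eps:
  assumes "continuous_on S f" "open S" "z \<in> S" "e > 0"
  shows "\<exists>d>0. ball z d \<subseteq> S \<and> (\<forall>w\<in>ball z d. dist (f w) (f z) < e)"
proof -
  obtain d1 where d1: "d1 > 0" "ball z d1 \<subseteq> S" using assms open_contains_ball by blast
  obtain d2 where d2: "d2 > 0" "\<And>w. w \<in> S \<Longrightarrow> dist w z < d2 \<Longrightarrow> dist (f w) (f z) < e"
    using assms unfolding continuous_on_iff by blast
  show ?thesis
    by (rule exI[of _ "min d1 d2"]) (use d1 d2 in \<open>auto simp: dist_commute subset_iff\<close>)
qed

lemma real_derivative_diff_le:
  fixes g :: "real \<Rightarrow> real"
  assumes d: "\<And>t. \<bar>t\<bar> \<le> \<bar>s\<bar> \<Longrightarrow> (g has_real_derivative g' t) (at t)"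
    and e: "\<And>t. \<bar>t\<bar> \<le> \<bar>s\<bar> \<Longrightarrow> \<bar>g' t - c\<bar> \<le> e"
  shows "\<bar>g s - g 0 - s * c\<bar> \<le> e * \<bar>s\<bar>"
proof -
  define f where "f t = g t - t * c" for t
  have df: "(f has_vector_derivative g' t - c) (at t)" if "\<bar>t\<bar> \<le> \<bar>s\<bar>" for t
    unfolding f_def has_real_derivative_iff_has_vector_derivative[symmetric]
    using d[OF that] by (auto intro!: derivative_eq_intros)
  show ?thesis
  proof (cases "0 \<le> s")
    case True
    have "norm (f s - f 0) \<le> e * (s - 0)"
      by (rule norm_increment_le[OF True df]) (use True e in auto)
    then show ?thesis using True by (simp add: f_def)
  next
    case False
    have "norm (f 0 - f s) \<le> e * (0 - s)"
      by (rule norm_increment_le[OF _ df]) (use False e in auto)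
    then show ?thesis using False by (simp add: f_def abs_minus_commute algebra_simps)
  qed
qed

lemma continuous_partials_imp_derivative:
  fixes u ux uy :: "complex \<Rightarrow> real"
  assumes S: "open S" "z \<in> S"
    and ux: "\<And>z. z \<in> S \<Longrightarrow> ((\<lambda>t. u (z + of_real t)) has_real_derivative ux z) (at 0)"
    and uy: "\<And>z. z \<in> S \<Longrightarrow> ((\<lambda>t. u (z + \<i> * of_real t)) has_real_derivative uy z) (at 0)"
    and cont: "continuous_on S ux" "continuous_on S uy"
  shows "(u has_derivative (\<lambda>w. ux z * Re w + uy z * Im w)) (at z)"
  unfolding has_derivative_at_alt
proof (intro conjI allI impI)
  show "bounded_linear (\<lambda>w. ux z * Re w + uy z * Im w)"
    by (intro bounded_linear_add bounded_linear_const_mult bounded_linear_Re bounded_linear_Im)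
  fix e :: real assume "e > 0"
  then have e2: "e/2 > 0" by simp
  obtain d1 where d1: "d1 > 0" "ball z d1 \<subseteq> S" "\<And>w. w \<in> ball z d1 \<Longrightarrow> \<bar>ux w - ux z\<bar> < e/2"
    using continuous_on_open_eps[OF cont(1) S e2] by (auto simp: dist_real_def)
  obtain d2 where d2: "d2 > 0" "ball z d2 \<subseteq> S" "\<And>w. w \<in> ball z d2 \<Longrightarrow> \<bar>uy w - uy z\<bar> < e/2"
    using continuous_on_open_eps[OF cont(2) S e2] by (auto simp: dist_real_def)
  define d where "d = min d1 d2 / 2"
  have d: "d > 0" "2 * d \<le> d1" "2 * d \<le> d2" using d1(1) d2(1) by (auto simp: d_def)
  show "\<exists>d>0. \<forall>w. norm (w - z) < d \<longrightarrow>
      norm (u w - u z - (ux z * Re (w - z) + uy z * Im (w - z))) \<le> e * norm (w - z)"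
  proof (intro exI[of _ d] conjI allI impI d(1))
    fix w assume w: "norm (w - z) < d"
    define a where "a = Re (w - z)"
    define b where "b = Im (w - z)"
    have ab: "\<bar>a\<bar> < d" "\<bar>b\<bar> < d" "\<bar>a\<bar> \<le> norm (w - z)" "\<bar>b\<bar> \<le> norm (w - z)"
      using w abs_Re_le_cmod[of "w - z"] abs_Im_le_cmod[of "w - z"] by (auto simp: a_def b_def)
    have wz: "w = z + \<i> * of_real b + of_real a" by (simp add: a_def b_def complex_eq_iff)
    have nb: "z + \<i> * of_real s + of_real t \<in> ball z d1 \<inter> ball z d2" if "\<bar>s\<bar> < d" "\<bar>t\<bar> < d" for s t
    proof -
      have "cmod (\<i> * of_real s + of_real t) \<le> \<bar>s\<bar> + \<bar>t\<bar>"
        by (rule order_trans[OF norm_triangle_ineq]) (simp add: norm_mult)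
      also have "\<dots> < 2 * d" using that by simp
      finally have "cmod (\<i> * of_real s + of_real t) < 2 * d" .
      moreover have "dist z (z + \<i> * of_real s + of_real t) = cmod (\<i> * of_real s + of_real t)"
        by (subst dist_commute) (simp add: dist_norm add.assoc)
      ultimately show ?thesis using d by simp
    qed
    have "\<bar>u (z + \<i> * of_real b + of_real a) - u (z + \<i> * of_real b + of_real 0) - a * ux z\<bar> \<le> e/2 * \<bar>a\<bar>"
    proof (rule real_derivative_diff_le[of a "\<lambda>t. u (z + \<i> * of_real b + of_real t)" "\<lambda>t. ux (z + \<i> * of_real b + of_real t)"])
      fix t assume "\<bar>t\<bar> \<le> \<bar>a\<bar>"
      then have t: "z + \<i> * of_real b + of_real t \<in> ball z d1" using nb[of b t] ab by auto
      then have "((\<lambda>s. u (z + \<i> * of_real b + of_real t + of_real s)) has_real_derivative ux (z + \<i> * of_real b + of_real t)) (at 0)"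
        using d1(2) by (intro ux) auto
      then show "((\<lambda>t. u (z + \<i> * of_real b + of_real t)) has_real_derivative ux (z + \<i> * of_real b + of_real t)) (at t)"
        using partial_derivative_line[of u _ 1 _ "z + \<i> * of_real b" t] by simp
      show "\<bar>ux (z + \<i> * of_real b + of_real t) - ux z\<bar> \<le> e/2" using d1(3)[OF t] by simp
    qed
    moreover have "\<bar>u (z + \<i> * of_real b) - u (z + \<i> * of_real 0) - b * uy z\<bar> \<le> e/2 * \<bar>b\<bar>"
    proof (rule real_derivative_diff_le[of b "\<lambda>t. u (z + \<i> * of_real t)" "\<lambda>t. uy (z + \<i> * of_real t)"])
      fix t assume "\<bar>t\<bar> \<le> \<bar>b\<bar>"
      then have t: "z + \<i> * of_real t \<in> ball z d2" using nb[of t 0] ab d by auto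
      then have "((\<lambda>s. u (z + \<i> * of_real t + \<i> * of_real s)) has_real_derivative uy (z + \<i> * of_real t)) (at 0)"
        using d2(2) by (intro uy) auto
      then show "((\<lambda>t. u (z + \<i> * of_real t)) has_real_derivative uy (z + \<i> * of_real t)) (at t)"
        using partial_derivative_line[of u _ \<i> _ z t] by simp
      show "\<bar>uy (z + \<i> * of_real t) - uy z\<bar> \<le> e/2" using d2(3)[OF t] by simp
    qed
    ultimately have "\<bar>u w - u z - (a * ux z + b * uy z)\<bar> \<le> e/2 * \<bar>a\<bar> + e/2 * \<bar>b\<bar>"
      unfolding wz of_real_0 mult_zero_right add_0_right by linarith
    also have "\<dots> \<le> e/2 * norm (w - z) + e/2 * norm (w - z)"
      using ab \<open>e > 0\<close> by (intro add_mono mult_left_mono) auto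
    finally show "norm (u w - u z - (ux z * Re (w - z) + uy z * Im (w - z))) \<le> e * norm (w - z)"
      by (simp add: a_def b_def mult.commute)
  qed
qed

text \<open>Schwarz's theorem. The second difference of \<open>u\<close> over a small square is the
  squared side times a value of either mixed derivative, by two mean value theorems in either order;
  continuity then brings both values to \<open>z\<close>.\<close>

lemma mixed_partials_eq:
  fixes u ux uy uxy uyx :: "complex \<Rightarrow> real"
  assumes S: "open S" "z \<in> S"
    and ux: "\<And>z. z \<in> S \<Longrightarrow> ((\<lambda>t. u (z + of_real t)) has_real_derivative ux z) (at 0)"
    and uy: "\<And>z. z \<in> S \<Longrightarrow> ((\<lambda>t. u (z + \<i> * of_real t)) has_real_derivative uy z) (at 0)"
    and uxy: "\<And>z. z \<in> S \<Longrightarrow> ((\<lambda>t. ux (z + \<i> * of_real t)) has_real_derivative uxy z) (at 0)"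
    and uyx: "\<And>z. z \<in> S \<Longrightarrow> ((\<lambda>t. uy (z + of_real t)) has_real_derivative uyx z) (at 0)"
    and cont: "continuous_on S uxy" "continuous_on S uyx"
  shows "uxy z = uyx z"
proof (rule ccontr)
  assume neq: "uxy z \<noteq> uyx z"
  define e where "e = \<bar>uxy z - uyx z\<bar> / 2"
  have e: "e > 0" using neq by (simp add: e_def)
  obtain d1 where d1: "d1 > 0" "ball z d1 \<subseteq> S" "\<And>w. w \<in> ball z d1 \<Longrightarrow> \<bar>uxy w - uxy z\<bar> < e"
    using continuous_on_open_eps[OF cont(1) S e] by (auto simp: dist_real_def)
  obtain d2 where d2: "d2 > 0" "ball z d2 \<subseteq> S" "\<And>w. w \<in> ball z d2 \<Longrightarrow> \<bar>uyx w - uyx z\<bar> < e"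
    using continuous_on_open_eps[OF cont(2) S e] by (auto simp: dist_real_def)
  define r where "r = min d1 d2 / 3"
  have r: "r > 0" "2 * r < d1" "2 * r < d2" using d1(1) d2(1) by (auto simp: r_def)
  have nb: "z + of_real s + \<i> * of_real t \<in> ball z d1 \<inter> ball z d2" if "0 \<le> s" "s \<le> r" "0 \<le> t" "t \<le> r" for s t
  proof -
    have "cmod (of_real s + \<i> * of_real t) \<le> \<bar>s\<bar> + \<bar>t\<bar>"
      by (rule order_trans[OF norm_triangle_ineq]) (simp add: norm_mult)
    also have "\<dots> \<le> 2 * r" using that by simp
    finally have "cmod (of_real s + \<i> * of_real t) \<le> 2 * r" .
    moreover have "dist z (z + of_real s + \<i> * of_real t) = cmod (of_real s + \<i> * of_real t)"
      by (subst dist_commute) (simp add: dist_norm add.assoc)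
    ultimately show ?thesis using r by simp
  qed
  have inS: "z + of_real s + \<i> * of_real t \<in> S" if "0 \<le> s" "s \<le> r" "0 \<le> t" "t \<le> r" for s t
    using nb[OF that] d1(2) by auto
  have X: "((\<lambda>s. u (z + of_real s + \<i> * of_real t)) has_real_derivative ux (z + of_real s + \<i> * of_real t)) (at s)"
    and YX: "((\<lambda>s. uy (z + of_real s + \<i> * of_real t)) has_real_derivative uyx (z + of_real s + \<i> * of_real t)) (at s)"
    and Y: "((\<lambda>t. u (z + of_real s + \<i> * of_real t)) has_real_derivative uy (z + of_real s + \<i> * of_real t)) (at t)"
    and XY: "((\<lambda>t. ux (z + of_real s + \<i> * of_real t)) has_real_derivative uxy (z + of_real s + \<i> * of_real t)) (at t)"
    if st: "0 \<le> s" "s \<le> r" "0 \<le> t" "t \<le> r" for s t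
  proof -
    have a: "z + of_real s + \<i> * of_real t = (z + \<i> * of_real t) + 1 * of_real s" by simp
    have "((\<lambda>s. u ((z + \<i> * of_real t) + 1 * of_real s)) has_real_derivative ux (z + of_real s + \<i> * of_real t)) (at s)"
      by (rule partial_derivative_line[OF _ a]) (use ux[OF inS[OF st]] in simp)
    then show "((\<lambda>s. u (z + of_real s + \<i> * of_real t)) has_real_derivative ux (z + of_real s + \<i> * of_real t)) (at s)"
      by (simp add: add_ac)
    have "((\<lambda>s. uy ((z + \<i> * of_real t) + 1 * of_real s)) has_real_derivative uyx (z + of_real s + \<i> * of_real t)) (at s)"
      by (rule partial_derivative_line[OF _ a]) (use uyx[OF inS[OF st]] in simp)
    then show "((\<lambda>s. uy (z + of_real s + \<i> * of_real t)) has_real_derivative uyx (z + of_real s + \<i> * of_real t)) (at s)"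
      by (simp add: add_ac)
    show "((\<lambda>t. u (z + of_real s + \<i> * of_real t)) has_real_derivative uy (z + of_real s + \<i> * of_real t)) (at t)"
      by (rule partial_derivative_line[OF uy[OF inS[OF st]] refl])
    show "((\<lambda>t. ux (z + of_real s + \<i> * of_real t)) has_real_derivative uxy (z + of_real s + \<i> * of_real t)) (at t)"
      by (rule partial_derivative_line[OF uxy[OF inS[OF st]] refl])
  qed
  define \<Delta> where "\<Delta> = u (z + of_real r + \<i> * of_real r) - u (z + of_real r + \<i> * of_real 0) - u (z + of_real 0 + \<i> * of_real r) + u (z + of_real 0 + \<i> * of_real 0)"
  have "((\<lambda>s. u (z + of_real s + \<i> * of_real r) - u (z + of_real s + \<i> * of_real 0)) has_real_derivative
      ux (z + of_real s + \<i> * of_real r) - ux (z + of_real s + \<i> * of_real 0)) (at s)" if "0 \<le> s" "s \<le> r" for s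
    by (intro DERIV_diff X) (use that r in auto)
  from MVT2[OF r(1) this] obtain s1 where s1: "0 < s1" "s1 < r" "(u (z + of_real r + \<i> * of_real r) - u (z + of_real r + \<i> * of_real 0)) - (u (z + of_real 0 + \<i> * of_real r) - u (z + of_real 0 + \<i> * of_real 0))
      = (r - 0) * (ux (z + of_real s1 + \<i> * of_real r) - ux (z + of_real s1 + \<i> * of_real 0))"
    by blast
  have "((\<lambda>t. ux (z + of_real s1 + \<i> * of_real t)) has_real_derivative uxy (z + of_real s1 + \<i> * of_real t)) (at t)" if "0 \<le> t" "t \<le> r" for t
    by (rule XY) (use that s1 in auto)
  from MVT2[OF r(1) this] obtain t1 where t1: "0 < t1" "t1 < r" "ux (z + of_real s1 + \<i> * of_real r) - ux (z + of_real s1 + \<i> * of_real 0) = (r - 0) * uxy (z + of_real s1 + \<i> * of_real t1)"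
    by blast
  have "((\<lambda>t. u (z + of_real r + \<i> * of_real t) - u (z + of_real 0 + \<i> * of_real t)) has_real_derivative
      uy (z + of_real r + \<i> * of_real t) - uy (z + of_real 0 + \<i> * of_real t)) (at t)" if "0 \<le> t" "t \<le> r" for t
    by (intro DERIV_diff Y) (use that r in auto)
  from MVT2[OF r(1) this] obtain t2 where t2: "0 < t2" "t2 < r" "(u (z + of_real r + \<i> * of_real r) - u (z + of_real 0 + \<i> * of_real r)) - (u (z + of_real r + \<i> * of_real 0) - u (z + of_real 0 + \<i> * of_real 0))
      = (r - 0) * (uy (z + of_real r + \<i> * of_real t2) - uy (z + of_real 0 + \<i> * of_real t2))"
    by blast
  have "((\<lambda>s. uy (z + of_real s + \<i> * of_real t2)) has_real_derivative uyx (z + of_real s + \<i> * of_real t2)) (at s)" if "0 \<le> s" "s \<le> r" for s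
    by (rule YX) (use that t2 in auto)
  from MVT2[OF r(1) this] obtain s2 where s2: "0 < s2" "s2 < r" "uy (z + of_real r + \<i> * of_real t2) - uy (z + of_real 0 + \<i> * of_real t2) = (r - 0) * uyx (z + of_real s2 + \<i> * of_real t2)"
    by blast
  have "r * (r * uxy (z + of_real s1 + \<i> * of_real t1)) = r * (r * uyx (z + of_real s2 + \<i> * of_real t2))"
    using s1(3)[unfolded diff_0_right t1(3)[unfolded diff_0_right]]
      t2(3)[unfolded diff_0_right s2(3)[unfolded diff_0_right]] by linarith
  then have "uxy (z + of_real s1 + \<i> * of_real t1) = uyx (z + of_real s2 + \<i> * of_real t2)" using r(1) by simp
  moreover have "\<bar>uxy (z + of_real s1 + \<i> * of_real t1) - uxy z\<bar> < e" by (rule d1(3)) (use nb[of s1 t1] s1 t1 in auto)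
  moreover have "\<bar>uyx (z + of_real s2 + \<i> * of_real t2) - uyx z\<bar> < e" by (rule d2(3)) (use nb[of s2 t2] s2 t2 in auto)
  ultimately have "\<bar>uxy z - uyx z\<bar> < 2 * e" by linarith
  then show False by (simp add: e_def)
qed

text \<open>The function is u_x - \<i> u_y; its Cauchy-Riemann equations are Laplace's equation and
  the symmetry of the mixed derivatives.\<close>

lemma harmonic_gradient_holomorphic:
  assumes harm: "harmonic_real_on S u" and S: "open S"
  obtains f where "f holomorphic_on S" "\<And>z. z \<in> S \<Longrightarrow> (u has_derivative (\<lambda>w. Re (f z * w))) (at z)"
proof -
  obtain ux uy uxx uxy uyx uyy where H: "\<forall>z\<in>S.
           ((\<lambda>t. u (z + of_real t)) has_real_derivative ux z) (at 0) \<and>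
           ((\<lambda>t. u (z + \<i> * of_real t)) has_real_derivative uy z) (at 0) \<and>
           ((\<lambda>t. ux (z + of_real t)) has_real_derivative uxx z) (at 0) \<and>
           ((\<lambda>t. ux (z + \<i> * of_real t)) has_real_derivative uxy z) (at 0) \<and>
           ((\<lambda>t. uy (z + of_real t)) has_real_derivative uyx z) (at 0) \<and>
           ((\<lambda>t. uy (z + \<i> * of_real t)) has_real_derivative uyy z) (at 0) \<and>
           uxx z + uyy z = 0"
    and c: "continuous_on S ux" "continuous_on S uy" "continuous_on S uxx" "continuous_on S uxy" "continuous_on S uyx" "continuous_on S uyy"
    using harm unfolding harmonic_real_on_def by (elim exE conjE) (rule that)
  have d: "\<And>z. z \<in> S \<Longrightarrow> ((\<lambda>t. u (z + of_real t)) has_real_derivative ux z) (at 0)"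
       "\<And>z. z \<in> S \<Longrightarrow> ((\<lambda>t. u (z + \<i> * of_real t)) has_real_derivative uy z) (at 0)"
       "\<And>z. z \<in> S \<Longrightarrow> ((\<lambda>t. ux (z + of_real t)) has_real_derivative uxx z) (at 0)"
       "\<And>z. z \<in> S \<Longrightarrow> ((\<lambda>t. ux (z + \<i> * of_real t)) has_real_derivative uxy z) (at 0)"
       "\<And>z. z \<in> S \<Longrightarrow> ((\<lambda>t. uy (z + of_real t)) has_real_derivative uyx z) (at 0)"
       "\<And>z. z \<in> S \<Longrightarrow> ((\<lambda>t. uy (z + \<i> * of_real t)) has_real_derivative uyy z) (at 0)"
    and lap: "\<And>z. z \<in> S \<Longrightarrow> uxx z + uyy z = 0"
    using H by blast+
  define f where "f z = of_real (ux z) - \<i> * of_real (uy z)" for z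
  have du: "(u has_derivative (\<lambda>w. Re (f z * w))) (at z)" if z: "z \<in> S" for z
    using continuous_partials_imp_derivative[OF S z d(1,2) c(1,2)] by (simp add: f_def algebra_simps)
  have "f field_differentiable (at z)" if z: "z \<in> S" for z
  proof -
    have xy: "uxy z = uyx z" by (rule mixed_partials_eq[OF S z d(1,2,4,5) c(4,5)])
    have "(ux has_derivative (\<lambda>w. uxx z * Re w + uxy z * Im w)) (at z)"
      by (rule continuous_partials_imp_derivative[OF S z d(3,4) c(3,4)])
    moreover have "(uy has_derivative (\<lambda>w. uyx z * Re w + uyy z * Im w)) (at z)"
      by (rule continuous_partials_imp_derivative[OF S z d(5,6) c(5,6)])
    ultimately have "(f has_derivative (\<lambda>w. of_real (uxx z * Re w + uxy z * Im w) - \<i> * of_real (uyx z * Re w + uyy z * Im w))) (at z)"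
      unfolding f_def by (intro derivative_intros)
    moreover have "(\<lambda>w. of_real (uxx z * Re w + uxy z * Im w) - \<i> * of_real (uyx z * Re w + uyy z * Im w)) = (*) (of_real (uxx z) - \<i> * of_real (uyx z))"
    proof
      fix w
      have "uyy z = - uxx z" using lap[OF z] by simp
      then show "of_real (uxx z * Re w + uxy z * Im w) - \<i> * of_real (uyx z * Re w + uyy z * Im w) = (of_real (uxx z) - \<i> * of_real (uyx z)) * w"
        by (simp add: complex_eq_iff xy)
    qed
    ultimately show ?thesis unfolding field_differentiable_def has_field_derivative_def by metis
  qed
  then have "f holomorphic_on S"
    unfolding holomorphic_on_def using field_differentiable_at_within by blast
  then show ?thesis using du by (rule that)
qed

lemma exp_in_annulus:
  assumes "0 < r" "z \<in> strip (ln (R/r))" "r < R"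
  shows "of_real r * exp z \<in> annulus r R"
proof -
  have z: "0 < Re z" "Re z < ln (R/r)" using assms(2) by (auto simp: strip_def)
  have "exp (Re z) < exp (ln (R / r))" using z(2) by simp
  also have "\<dots> = R / r" using assms by (intro exp_ln) auto
  finally have "exp (Re z) < R / r" .
  then show ?thesis using z(1) assms by (simp add: annulus_def norm_mult field_simps)
qed

text \<open>On an annulus a harmonic function need not have a single-valued conjugate. Pulled back
  by r exp to the simply connected strip, its complex gradient has a primitive \<open>F\<close>, and
  \<open>u\<close> differs from Re F by a constant.\<close>

lemma harmonic_on_strip:
  assumes harm: "harmonic_real_on (annulus r R) u" and r: "0 < r" "r < R"
  obtains F where "F holomorphic_on strip (ln (R/r))" "\<And>z. z \<in> strip (ln (R/r)) \<Longrightarrow> u (of_real r * exp z) = Re (F z)"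
proof -
  let ?T = "ln (R/r)"
  obtain f where f: "f holomorphic_on annulus r R" "\<And>z. z \<in> annulus r R \<Longrightarrow> (u has_derivative (\<lambda>w. Re (f z * w))) (at z)"
    using harmonic_gradient_holomorphic[OF harm open_annulus] by blast
  define k where "k z = f (of_real r * exp z) * (of_real r * exp z)" for z
  have "(\<lambda>z. f (of_real r * exp z)) holomorphic_on strip ?T"
    by (rule holomorphic_on_compose_gen[of "\<lambda>z. of_real r * exp z" _ f, unfolded o_def, OF _ f(1)])
      (auto intro!: holomorphic_intros exp_in_annulus r)
  then have khol: "k holomorphic_on strip ?T" unfolding k_def by (intro holomorphic_intros)
  obtain F where F: "\<And>z. z \<in> strip ?T \<Longrightarrow> (F has_field_derivative k z) (at z)"
    using holomorphic_convex_primitive'[OF convex_strip open_strip khol] at_within_open[OF _ open_strip] by metis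
  have "\<exists>c. \<forall>z\<in>strip ?T. u (of_real r * exp z) - Re (F z) = c"
  proof (rule has_derivative_zero_constant[OF convex_strip])
    fix z assume z: "z \<in> strip ?T"
    have "((\<lambda>z. of_real r * exp z) has_derivative (\<lambda>w. of_real r * exp z * w)) (at z)"
      unfolding has_field_derivative_def[symmetric] by (auto intro!: derivative_eq_intros)
    from has_derivative_compose[OF this f(2)[OF exp_in_annulus[OF r(1) z r(2)]]]
    have "((\<lambda>z. u (of_real r * exp z)) has_derivative (\<lambda>w. Re (k z * w))) (at z)"
      by (simp add: k_def mult.assoc)
    moreover have "((\<lambda>z. Re (F z)) has_derivative (\<lambda>w. Re (k z * w))) (at z)"
      using F[OF z] unfolding has_field_derivative_def by (rule has_derivative_Re)
    ultimately have "((\<lambda>z. u (of_real r * exp z) - Re (F z)) has_derivative (\<lambda>w. Re (k z * w) - Re (k z * w))) (at z)"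
      by (rule has_derivative_diff)
    then show "((\<lambda>z. u (of_real r * exp z) - Re (F z)) has_derivative (\<lambda>h. 0)) (at z within strip ?T)"
      by (simp add: has_derivative_at_withinI)
  qed
  then obtain c where c: "\<And>z. z \<in> strip ?T \<Longrightarrow> u (of_real r * exp z) - Re (F z) = c" by blast
  show ?thesis
  proof (rule that[of "\<lambda>z. F z + of_real c"])
    show "(\<lambda>z. F z + of_real c) holomorphic_on strip ?T"
      using F unfolding holomorphic_on_def
      by (intro ballI field_differentiable_add field_differentiable_const) (auto simp: field_differentiable_def intro: has_field_derivative_at_within)
    show "u (of_real r * exp z) = Re (F z + of_real c)" if "z \<in> strip ?T" for z
      using c[OF that] by simp
  qed
qed

text \<open>Re A + \<i> Re B is half the sum of A + \<i>B and the conjugate of A - \<i>B. The factor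
  \<open>c\<close> will be the inner target radius, so that \<open>hmap F G\<close> is normalised to
  inner radius 1.\<close>

lemma harmonic_map_decomposition:
  assumes harm: "harmonic_on (annulus r R) h" and r: "0 < r" "r < R" and c: "c \<noteq> (0::real)"
  obtains F G where "F holomorphic_on strip (ln (R/r))" "G holomorphic_on strip (ln (R/r))"
    "\<And>z. z \<in> strip (ln (R/r)) \<Longrightarrow> h (of_real r * exp z) = of_real c * hmap F G z"
proof -
  let ?T = "ln (R/r)"
  obtain A where A: "A holomorphic_on strip ?T" "\<And>z. z \<in> strip ?T \<Longrightarrow> Re (h (of_real r * exp z)) = Re (A z)"
    using harmonic_on_strip[of r R "\<lambda>z. Re (h z)"] harm r unfolding harmonic_on_def by blast
  obtain B where B: "B holomorphic_on strip ?T" "\<And>z. z \<in> strip ?T \<Longrightarrow> Im (h (of_real r * exp z)) = Re (B z)"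
    using harmonic_on_strip[of r R "\<lambda>z. Im (h z)"] harm r unfolding harmonic_on_def by blast
  show ?thesis
  proof (rule that[of "\<lambda>z. (A z + \<i> * B z) / of_real (2*c)" "\<lambda>z. (A z - \<i> * B z) / of_real (2*c)"])
    show "(\<lambda>z. (A z + \<i> * B z) / of_real (2*c)) holomorphic_on strip ?T"
      "(\<lambda>z. (A z - \<i> * B z) / of_real (2*c)) holomorphic_on strip ?T"
      using c by (auto intro!: holomorphic_intros A(1) B(1))
    fix z assume z: "z \<in> strip ?T"
    have "h (of_real r * exp z) = of_real (Re (A z)) + \<i> * of_real (Re (B z))"
      using A(2)[OF z] B(2)[OF z] by (simp add: complex_eq_iff)
    also have "\<dots> = ((A z + \<i> * B z) + cnj (A z - \<i> * B z)) / 2"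
      by (simp add: complex_eq_iff)
    also have "\<dots> = of_real c * hmap (\<lambda>z. (A z + \<i> * B z) / of_real (2*c)) (\<lambda>z. (A z - \<i> * B z) / of_real (2*c)) z"
      using c by (simp add: hmap_def field_simps)
    finally show "h (of_real r * exp z) = of_real c * hmap (\<lambda>z. (A z + \<i> * B z) / of_real (2*c)) (\<lambda>z. (A z - \<i> * B z) / of_real (2*c)) z" .
  qed
qed

section \<open>Orientation and degree\<close>

lemma winding_number_exp_loop:
  assumes "c \<noteq> 0"
  shows "winding_number (\<lambda>x. c * exp (2 * of_real pi * \<i> * of_real x)) 0 = 1"
    "winding_number (\<lambda>x. cnj (c * exp (2 * of_real pi * \<i> * of_real x))) 0 = -1"
proof -
  have "(\<lambda>x. c * exp (2 * of_real pi * \<i> * of_real x)) = exp \<circ> linepath (Ln c) (Ln c + 2 * of_real pi * \<i>)"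
    using assms by (auto simp: linepath_def scaleR_conv_of_real exp_add algebra_simps exp_diff)
  then show "winding_number (\<lambda>x. c * exp (2 * of_real pi * \<i> * of_real x)) 0 = 1"
    by (simp add: winding_number_compose_exp)
  have "cnj (c * exp (2 * of_real pi * \<i> * of_real x)) = exp (linepath (cnj (Ln c)) (cnj (Ln c) - 2 * of_real pi * \<i>) x)" for x
  proof -
    have "c * exp (2 * of_real pi * \<i> * of_real x) = exp (Ln c + 2 * of_real pi * \<i> * of_real x)"
      using assms by (simp add: exp_add)
    moreover have "cnj (Ln c + 2 * of_real pi * \<i> * of_real x) = linepath (cnj (Ln c)) (cnj (Ln c) - 2 * of_real pi * \<i>) x"
      by (simp add: linepath_def scaleR_conv_of_real algebra_simps)
    ultimately show ?thesis by (metis exp_cnj)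
  qed
  then have "(\<lambda>x. cnj (c * exp (2 * of_real pi * \<i> * of_real x))) = exp \<circ> linepath (cnj (Ln c)) (cnj (Ln c) - 2 * of_real pi * \<i>)"
    by (simp add: fun_eq_iff)
  then show "winding_number (\<lambda>x. cnj (c * exp (2 * of_real pi * \<i> * of_real x))) 0 = -1"
    by (simp add: winding_number_compose_exp)
qed

section \<open>Local degree of injective harmonic maps\<close>

context strip_map
begin

abbreviation loop :: "complex \<Rightarrow> real \<Rightarrow> real \<Rightarrow> complex" where
  "loop z \<rho> \<equiv> \<lambda>x. h (z + of_real \<rho> * exp (2 * of_real pi * \<i> * of_real x)) - h z"

lemma loop_path:
  assumes "cball z \<rho> \<subseteq> strip T" "\<rho> \<ge> 0"
  shows "path (loop z \<rho>)" "pathfinish (loop z \<rho>) = pathstart (loop z \<rho>)"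
proof -
  have "z + of_real \<rho> * exp (2 * of_real pi * \<i> * of_real x) \<in> strip T" for x
    using assms by (intro subsetD[OF assms(1)]) (simp add: dist_norm norm_mult)
  then show "path (loop z \<rho>)"
    unfolding path_def by (intro continuous_intros continuous_on_compose2[OF cont_h]) auto
  show "pathfinish (loop z \<rho>) = pathstart (loop z \<rho>)"
    by (simp add: pathfinish_def pathstart_def)
qed

lemma h_linearization:
  assumes z: "z \<in> strip T" and e: "e > 0"
  shows "\<exists>d>0. \<forall>w. cmod w < d \<longrightarrow> cmod (h (z + w) - h z - (P z * w + cnj (Q z * w))) \<le> e * cmod w"
proof -
  have "(F has_derivative (*) (P z)) (at z)" "(G has_derivative (*) (Q z)) (at z)"
    using dF[OF z] dG[OF z] by (simp_all add: has_field_derivative_def)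
  then have "(h has_derivative (\<lambda>w. P z * w + cnj (Q z * w))) (at z)"
    unfolding hmap_def[abs_def] by (intro derivative_intros)
  then obtain d where d: "d > 0" "\<And>y. cmod (y - z) < d \<Longrightarrow> cmod (h y - h z - (P z * (y - z) + cnj (Q z * (y - z)))) \<le> e * cmod (y - z)"
    unfolding has_derivative_at_alt using e by blast
  show ?thesis
    by (rule exI[of _ d]) (use d(1) d(2)[of "z + w" for w] in auto)
qed

text \<open>The linear part splits into a conformal and an anticonformal term. On small circles the
  larger one, \<open>M\<close>, outweighs the other together with the remainder, so the loop winds
  about 0 as its image under \<open>M\<close> does.\<close>

lemma loop_winding_dominant:
  assumes z: "z \<in> strip T" and M: "continuous_on UNIV M" and qp: "q < p"
    and split: "\<And>w. P z * w + cnj (Q z * w) = M w + E w" "\<And>w. cmod (M w) = p * cmod w" "\<And>w. cmod (E w) = q * cmod w"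
  shows "\<exists>d>0. \<forall>\<rho>. 0 < \<rho> \<longrightarrow> \<rho> < d \<longrightarrow> cball z \<rho> \<subseteq> strip T \<longrightarrow>
    winding_number (loop z \<rho>) 0 = winding_number (\<lambda>x. M (of_real \<rho> * exp (2 * of_real pi * \<i> * of_real x))) 0"
proof -
  let ?e = "\<lambda>x::real. exp (2 * of_real pi * \<i> * of_real x)"
  define e where "e = (p - q) / 2"
  have e: "e > 0" using qp by (simp add: e_def)
  obtain d where d: "d > 0" "\<And>w. cmod w < d \<Longrightarrow> cmod (h (z + w) - h z - (P z * w + cnj (Q z * w))) \<le> e * cmod w"
    using h_linearization[OF z e] by blast
  have "winding_number (loop z \<rho>) 0 = winding_number (\<lambda>x. M (of_real \<rho> * ?e x)) 0"
    if \<rho>: "0 < \<rho>" "\<rho> < d" "cball z \<rho> \<subseteq> strip T" for \<rho>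
  proof (rule winding_number_nearby_loops_eq)
    show "path (\<lambda>x. M (of_real \<rho> * ?e x))"
      unfolding path_def by (rule continuous_on_compose2[OF M]) (auto intro!: continuous_intros)
    show "path (loop z \<rho>)" "pathfinish (loop z \<rho>) = pathstart (loop z \<rho>)" using loop_path[OF \<rho>(3)] \<rho> by auto
    show "pathfinish (\<lambda>x. M (of_real \<rho> * ?e x)) = pathstart (\<lambda>x. M (of_real \<rho> * ?e x))"
      by (simp add: pathfinish_def pathstart_def)
    fix x :: real
    let ?w = "of_real \<rho> * ?e x"
    have nw: "cmod ?w = \<rho>" using \<rho> by (simp add: norm_mult)
    have "loop z \<rho> x - M ?w = (h (z + ?w) - h z - (P z * ?w + cnj (Q z * ?w))) + E ?w"
      unfolding split(1) by simp
    also have "cmod \<dots> \<le> e * \<rho> + q * \<rho>"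
      by (rule order_trans[OF norm_triangle_ineq add_mono]) (use d(2)[of ?w] split(3)[of ?w] nw \<rho> in auto)
    also have "\<dots> = (e + q) * \<rho>" by (simp add: algebra_simps)
    also have "\<dots> < p * \<rho>" using qp \<rho> by (intro mult_strict_right_mono) (auto simp: e_def field_simps)
    also have "\<dots> = cmod (M ?w - 0)" using split(2)[of ?w] nw by simp
    finally show "cmod (loop z \<rho> x - M ?w) < cmod (M ?w - 0)" .
  qed
  then show ?thesis using d(1) by blast
qed

lemma loop_winding:
  assumes z: "z \<in> strip T"
  shows "cmod (P z) > cmod (Q z) \<Longrightarrow> \<exists>d>0. \<forall>\<rho>. 0 < \<rho> \<longrightarrow> \<rho> < d \<longrightarrow> cball z \<rho> \<subseteq> strip T \<longrightarrow> winding_number (loop z \<rho>) 0 = 1"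
    and "cmod (P z) < cmod (Q z) \<Longrightarrow> \<exists>d>0. \<forall>\<rho>. 0 < \<rho> \<longrightarrow> \<rho> < d \<longrightarrow> cball z \<rho> \<subseteq> strip T \<longrightarrow> winding_number (loop z \<rho>) 0 = -1"
proof -
  assume PQ: "cmod (P z) > cmod (Q z)"
  then have "P z \<noteq> 0" by auto
  then have "winding_number (\<lambda>x. P z * (of_real \<rho> * exp (2 * of_real pi * \<i> * of_real x))) 0 = 1" if "\<rho> > 0" for \<rho>
    using winding_number_exp_loop(1)[of "P z * of_real \<rho>"] that by (simp add: mult.assoc)
  moreover have "continuous_on UNIV (\<lambda>w. P z * w)" by (intro continuous_intros)
  note loop_winding_dominant[OF z this PQ, of "\<lambda>w. cnj (Q z * w)"]
  ultimately show "\<exists>d>0. \<forall>\<rho>. 0 < \<rho> \<longrightarrow> \<rho> < d \<longrightarrow> cball z \<rho> \<subseteq> strip T \<longrightarrow> winding_number (loop z \<rho>) 0 = 1"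
    by (simp add: norm_mult)
next
  assume PQ: "cmod (P z) < cmod (Q z)"
  then have "Q z \<noteq> 0" by auto
  then have "winding_number (\<lambda>x. cnj (Q z * (of_real \<rho> * exp (2 * of_real pi * \<i> * of_real x)))) 0 = -1" if "\<rho> > 0" for \<rho>
    using winding_number_exp_loop(2)[of "Q z * of_real \<rho>"] that by (simp only: mult.assoc) simp
  moreover have "continuous_on UNIV (\<lambda>w. cnj (Q z * w))" by (intro continuous_intros)
  note loop_winding_dominant[OF z this PQ, of "\<lambda>w. P z * w"]
  ultimately show "\<exists>d>0. \<forall>\<rho>. 0 < \<rho> \<longrightarrow> \<rho> < d \<longrightarrow> cball z \<rho> \<subseteq> strip T \<longrightarrow> winding_number (loop z \<rho>) 0 = -1"
    by (simp add: norm_mult del: complex_cnj_mult)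
qed

text \<open>Lewy's theorem is not needed: the local degree of an injective map is constant, so the
  Jacobian does not change sign.\<close>

lemma jacobian_sign_constant:
  assumes inj: "\<And>z w. z \<in> strip T \<Longrightarrow> w \<in> strip T \<Longrightarrow> cmod (z - w) < 1 \<Longrightarrow> h z = h w \<Longrightarrow> z = w"
    and z0: "z0 \<in> strip T" "cmod (P z0) > cmod (Q z0)" and z1: "z1 \<in> strip T" "cmod (P z1) < cmod (Q z1)"
  shows False
proof -
  let ?e = "\<lambda>x::real. exp (2 * of_real pi * \<i> * of_real x)"
  obtain d0 where d0: "d0 > 0" "\<And>\<rho>. 0 < \<rho> \<Longrightarrow> \<rho> < d0 \<Longrightarrow> cball z0 \<rho> \<subseteq> strip T \<Longrightarrow> winding_number (loop z0 \<rho>) 0 = 1"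
    using loop_winding(1)[OF z0] by blast
  obtain d1 where d1: "d1 > 0" "\<And>\<rho>. 0 < \<rho> \<Longrightarrow> \<rho> < d1 \<Longrightarrow> cball z1 \<rho> \<subseteq> strip T \<Longrightarrow> winding_number (loop z1 \<rho>) 0 = -1"
    using loop_winding(2)[OF z1] by blast
  \<comment> \<open>One radius must serve along the whole segment: at its ends it makes the local
    degree computable, and below 1 it keeps each circle in the range of local injectivity.\<close>
  define D where "D = {d0, d1, 1, Re z0, Re z1, T - Re z0, T - Re z1}"
  define \<rho> where "\<rho> = Min D / 2"
  have "0 < Min D" using d0(1) d1(1) z0 z1 by (simp add: D_def strip_def)
  then have \<rho>0: "0 < \<rho>" by (simp add: \<rho>_def)
  have \<rho>D: "2 * \<rho> \<le> x" if "x \<in> D" for x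
  proof -
    have "Min D \<le> x" by (rule Min_le[OF _ that]) (simp add: D_def)
    then show ?thesis by (simp add: \<rho>_def)
  qed
  have \<rho>: "2*\<rho> \<le> d0" "2*\<rho> \<le> d1" "2*\<rho> \<le> 1" "2*\<rho> \<le> Re z0" "2*\<rho> \<le> Re z1" "2*\<rho> \<le> T - Re z0" "2*\<rho> \<le> T - Re z1"
    using \<rho>D unfolding D_def by blast+
  define \<gamma> where "\<gamma> l = (1 - of_real l) * z0 + of_real l * z1" for l :: real
  have ball: "cball (\<gamma> l) \<rho> \<subseteq> strip T" if l: "l \<in> {0..1}" for l
  proof
    fix u assume "u \<in> cball (\<gamma> l) \<rho>"
    then have "\<bar>Re (u - \<gamma> l)\<bar> \<le> \<rho>"
      using abs_Re_le_cmod[of "u - \<gamma> l"] by (simp add: dist_norm norm_minus_commute)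
    then have u: "\<bar>Re u - Re (\<gamma> l)\<bar> \<le> \<rho>" by simp
    have R: "Re (\<gamma> l) = (1 - l) * Re z0 + l * Re z1" by (simp add: \<gamma>_def)
    have "(1 - l) * (2*\<rho>) + l * (2*\<rho>) \<le> Re (\<gamma> l)"
      unfolding R using l \<rho> by (intro add_mono mult_left_mono) auto
    moreover have "Re (\<gamma> l) \<le> (1 - l) * (T - 2*\<rho>) + l * (T - 2*\<rho>)"
      unfolding R using l \<rho> by (intro add_mono mult_left_mono) auto
    ultimately have "2*\<rho> \<le> Re (\<gamma> l)" "Re (\<gamma> l) \<le> T - 2*\<rho>" by (simp_all add: algebra_simps)
    then have "0 < Re u" "Re u < T" using u \<rho>0 by linarith+
    then show "u \<in> strip T" by (simp add: strip_def)
  qed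
  have pt: "\<gamma> l + of_real \<rho> * ?e x \<in> strip T" if "l \<in> {0..1}" for l x
    using \<rho>0 by (intro subsetD[OF ball[OF that]]) (simp add: dist_norm norm_mult)
  have ctr: "\<gamma> l \<in> strip T" if "l \<in> {0..1}" for l
    using \<rho>0 by (intro subsetD[OF ball[OF that]]) simp
  have nz: "loop (\<gamma> l) \<rho> x \<noteq> 0" if "l \<in> {0..1}" for l x
  proof
    assume "loop (\<gamma> l) \<rho> x = 0"
    then have "h (\<gamma> l + of_real \<rho> * ?e x) = h (\<gamma> l)" by simp
    moreover have "cmod (\<gamma> l + of_real \<rho> * ?e x - \<gamma> l) = \<rho>" using \<rho>0 by (simp add: norm_mult)
    then have "cmod (\<gamma> l + of_real \<rho> * ?e x - \<gamma> l) < 1" using \<rho>(3) \<rho>0 by linarith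
    ultimately have "\<gamma> l + of_real \<rho> * ?e x = \<gamma> l"
      by (intro inj[OF pt[OF that] ctr[OF that]])
    then show False using \<rho>0 by simp
  qed
  \<comment> \<open>The centre moves along the segment from z0 to z1. Injectivity keeps every
    intermediate loop away from 0.\<close>
  have "homotopic_loops (- {0}) (loop z0 \<rho>) (loop z1 \<rho>)"
    unfolding homotopic_loops
  proof (intro exI conjI)
    let ?H = "\<lambda>p. loop (\<gamma> (fst p)) \<rho> (snd p)"
    have cg: "continuous_on ({0..1} \<times> {0..1}) (\<lambda>p. \<gamma> (fst p))"
      unfolding \<gamma>_def by (intro continuous_intros)
    show "continuous_on ({0..1} \<times> {0..1}) ?H"
    proof (intro continuous_on_diff)
      show "continuous_on ({0..1} \<times> {0..1}) (\<lambda>p. h (\<gamma> (fst p)))"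
        by (rule continuous_on_compose2[OF cont_h cg]) (force intro: ctr)
      show "continuous_on ({0..1} \<times> {0..1}) (\<lambda>p. h (\<gamma> (fst p) + of_real \<rho> * ?e (snd p)))"
        by (rule continuous_on_compose2[OF cont_h]) (intro continuous_intros cg, force intro: pt)
    qed
    show "?H \<in> {0..1} \<times> {0..1} \<rightarrow> - {0}"
    proof
      fix p :: "real \<times> real" assume "p \<in> {0..1} \<times> {0..1}"
      then have "fst p \<in> {0..1}" by (rule mem_Times_iff[THEN iffD1, THEN conjunct1])
      from nz[OF this] show "?H p \<in> - {0}" by simp
    qed
    show "\<forall>x\<in>{0..1}. ?H (0, x) = loop z0 \<rho> x" "\<forall>x\<in>{0..1}. ?H (1, x) = loop z1 \<rho> x"
      by (simp_all add: \<gamma>_def)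
    show "\<forall>t\<in>{0..1}. pathfinish (?H \<circ> Pair t) = pathstart (?H \<circ> Pair t)"
      by (simp add: pathfinish_def pathstart_def)
  qed
  then have "winding_number (loop z0 \<rho>) 0 = winding_number (loop z1 \<rho>) 0"
    by (rule winding_number_homotopic_loops)
  moreover have "winding_number (loop z0 \<rho>) 0 = 1"
    using ball[of 0] \<rho> \<rho>0 by (intro d0(2)) (auto simp: \<gamma>_def)
  moreover have "winding_number (loop z1 \<rho>) 0 = -1"
    using ball[of 1] \<rho> \<rho>0 by (intro d1(2)) (auto simp: \<gamma>_def)
  ultimately show False by simp
qed

end

section \<open>Lifts to the universal cover and the degree of a homeomorphism\<close>

lemma integer_valued_constant:
  fixes f :: "complex \<Rightarrow> complex"
  assumes "connected S" "continuous_on S f" and int: "\<And>z. z \<in> S \<Longrightarrow> \<exists>n::int. f z = of_int n * (2 * of_real pi * \<i>)"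
  obtains n :: int where "\<And>z. z \<in> S \<Longrightarrow> f z = of_int n * (2 * of_real pi * \<i>)"
proof -
  have "f constant_on S"
  proof (rule continuous_discrete_range_constant[OF assms(1,2)])
    fix x assume x: "x \<in> S"
    show "\<exists>e>0. \<forall>y. y \<in> S \<and> f y \<noteq> f x \<longrightarrow> e \<le> norm (f y - f x)"
    proof (intro exI[of _ "2*pi"] conjI allI impI)
      fix y assume y: "y \<in> S \<and> f y \<noteq> f x"
      obtain m n :: int where mn: "f x = of_int m * (2 * of_real pi * \<i>)" "f y = of_int n * (2 * of_real pi * \<i>)"
        using int x y by metis
      then have "f y - f x = of_int (n - m) * (2 * of_real pi * \<i>)" by (simp add: algebra_simps)
      then have "norm (f y - f x) = \<bar>real_of_int (n - m)\<bar> * (2*pi)"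
        by (simp only: norm_mult norm_of_int) simp
      moreover have "n \<noteq> m" using mn y by auto
      then have "1 \<le> \<bar>real_of_int (n - m)\<bar>" by linarith
      ultimately show "2*pi \<le> norm (f y - f x)" using mult_right_mono[of 1 "\<bar>real_of_int (n - m)\<bar>" "2*pi"] by simp
    qed simp
  qed
  then obtain c where c: "\<And>z. z \<in> S \<Longrightarrow> f z = c" unfolding constant_on_def by blast
  show ?thesis
  proof (cases "S = {}")
    case True
    then show ?thesis using that by blast
  next
    case False
    then obtain z where z: "z \<in> S" by blast
    obtain n :: int where "f z = of_int n * (2 * of_real pi * \<i>)" using int[OF z] by blast
    then show ?thesis using that[of n] c z by metis
  qed
qed

lemma exp_eq_imp_int: "exp z = exp w \<Longrightarrow> \<exists>n::int. z - w = of_int n * (2 * of_real pi * \<i>)"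
  by (auto simp: exp_eq algebra_simps)

lemma strip_shift [simp]: "z + of_int n * (2 * of_real pi * \<i>) \<in> strip T \<longleftrightarrow> z \<in> strip T"
  by (simp add: strip_def)

text \<open>The change of \<open>L\<close> under one period is a multiple of 2\<pi>\<i> that varies
  continuously, hence is constant. All multiples \<open>k\<close> are covered because the lift of
  the inverse is later shifted by the degree of \<open>h\<close>.\<close>

lemma lift_deck:
  assumes cont: "continuous_on (strip T) L" and per: "\<And>z. z \<in> strip T \<Longrightarrow> exp (L (z + 2 * of_real pi * \<i>)) = exp (L z)"
  obtains n :: int where "\<And>z (k::int). z \<in> strip T \<Longrightarrow> L (z + of_int k * (2 * of_real pi * \<i>)) = L z + of_int (n * k) * (2 * of_real pi * \<i>)"
proof -
  have sh: "z + 2 * of_real pi * \<i> \<in> strip T" if "z \<in> strip T" for z using that by (simp add: strip_def)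
  obtain n :: int where n: "\<And>z. z \<in> strip T \<Longrightarrow> L (z + 2 * of_real pi * \<i>) - L z = of_int n * (2 * of_real pi * \<i>)"
  proof (rule integer_valued_constant[of "strip T" "\<lambda>z. L (z + 2 * of_real pi * \<i>) - L z"])
    show "connected (strip T)" by (rule convex_connected[OF convex_strip])
    show "continuous_on (strip T) (\<lambda>z. L (z + 2 * of_real pi * \<i>) - L z)"
      by (intro continuous_intros cont continuous_on_compose2[OF cont]) (use sh in auto)
    show "\<exists>n::int. L (z + 2 * of_real pi * \<i>) - L z = of_int n * (2 * of_real pi * \<i>)" if "z \<in> strip T" for z
      by (rule exp_eq_imp_int[OF per[OF that]])
  qed blast
  have up: "L (z + of_nat k * (2 * of_real pi * \<i>)) = L z + of_int (n * int k) * (2 * of_real pi * \<i>)" if z: "z \<in> strip T" for z k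
  proof (induction k)
    case (Suc k)
    have "z + of_nat k * (2 * of_real pi * \<i>) \<in> strip T" using strip_shift[of z "int k" T] z by simp
    from n[OF this] Suc show ?case by (simp add: algebra_simps)
  qed simp
  have "L (z + of_int k * (2 * of_real pi * \<i>)) = L z + of_int (n * k) * (2 * of_real pi * \<i>)" if z: "z \<in> strip T" for z k
  proof (cases "k \<ge> 0")
    case True
    then show ?thesis using up[OF z, of "nat k"] by simp
  next
    case False
    have "z + of_int k * (2 * of_real pi * \<i>) \<in> strip T" using z by simp
    from up[OF this, of "nat (-k)"] False show ?thesis by (simp add: algebra_simps of_nat_nat)
  qed
  then show ?thesis by (rule that)
qed

text \<open>Lifting a homeomorphism of annuli and its inverse to the universal covers shows that the
  degree is invertible in the integers.\<close>

lemma homeomorphism_degree: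
  assumes r: "0 < r" "r < R" and s: "0 < rs" "rs < Rs"
    and hom: "homeomorphism (annulus r R) (annulus rs Rs) h g"
  obtains L n where "continuous_on (strip (ln (R/r))) L"
    "\<And>z. z \<in> strip (ln (R/r)) \<Longrightarrow> h (of_real r * exp z) = of_real rs * exp (L z)"
    "n = 1 \<or> n = (-1::int)"
    "\<And>z. z \<in> strip (ln (R/r)) \<Longrightarrow> L (z + 2 * of_real pi * \<i>) = L z + of_int n * (2 * of_real pi * \<i>)"
proof -
  let ?S = "strip (ln (R/r))" and ?S' = "strip (ln (Rs/rs))"
  have hc: "continuous_on (annulus r R) h" and gc: "continuous_on (annulus rs Rs) g"
    and hg: "\<And>z. z \<in> annulus r R \<Longrightarrow> h z \<in> annulus rs Rs \<and> g (h z) = z"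
    and gh: "\<And>w. w \<in> annulus rs Rs \<Longrightarrow> g w \<in> annulus r R \<and> h (g w) = w"
    using hom unfolding homeomorphism_def by auto
  have lift: "\<exists>M. continuous_on (strip (ln (b/a))) M \<and> (\<forall>z\<in>strip (ln (b/a)). f (of_real a * exp z) = of_real c * exp (M z))"
    if ab: "0 < a" "a < b" and c: "0 < c" and f: "continuous_on (annulus a b) f" "\<And>z. z \<in> annulus a b \<Longrightarrow> f z \<noteq> 0" for a b c :: real and f :: "complex \<Rightarrow> complex"
  proof -
    have inA: "of_real a * exp z \<in> annulus a b" if "z \<in> strip (ln (b/a))" for z
      by (rule exp_in_annulus[OF ab(1) that ab(2)])
    have "continuous_on (strip (ln (b/a))) (\<lambda>z. f (of_real a * exp z) / of_real c)"
      by (intro continuous_intros continuous_on_compose2[OF f(1)]) (use inA c in auto)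
    then obtain M where "continuous_on (strip (ln (b/a))) M" "\<And>z. z \<in> strip (ln (b/a)) \<Longrightarrow> f (of_real a * exp z) / of_real c = exp (M z)"
      by (rule continuous_logarithm_on_contractible[OF _ convex_imp_contractible[OF convex_strip]])
        (use f(2) inA c in auto)
    moreover from this(2) have "f (of_real a * exp z) = of_real c * exp (M z)" if "z \<in> strip (ln (b/a))" for z
      using that c by (metis nonzero_mult_div_cancel_left of_real_eq_0_iff order_less_irrefl times_divide_eq_right)
    ultimately show ?thesis by blast
  qed
  have nz: "z \<noteq> 0" if "z \<in> annulus a b" "0 < a" for a b z using that by (auto simp: annulus_def)
  obtain L where L: "continuous_on ?S L" "\<And>z. z \<in> ?S \<Longrightarrow> h (of_real r * exp z) = of_real rs * exp (L z)"
    using lift[OF r s(1) hc] hg nz[OF _ s(1)] by blast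
  obtain M where M: "continuous_on ?S' M" "\<And>z. z \<in> ?S' \<Longrightarrow> g (of_real rs * exp z) = of_real r * exp (M z)"
    using lift[OF s r(1) gc] gh nz[OF _ r(1)] by blast
  have LS: "L z \<in> ?S'" if z: "z \<in> ?S" for z
  proof -
    have "of_real rs * exp (L z) \<in> annulus rs Rs"
      using hg[OF exp_in_annulus[OF r(1) z r(2)]] L(2)[OF z] by simp
    then have "1 < exp (Re (L z))" "exp (Re (L z)) < Rs / rs"
      using s by (auto simp: annulus_def norm_mult field_simps)
    moreover have "Re (L z) < ln (Rs/rs)"
      using calculation(2) s by (metis divide_pos_pos exp_gt_zero ln_exp ln_less_cancel_iff order_less_trans)
    ultimately show ?thesis by (simp add: strip_def)
  qed
  have e2: "exp (z + 2 * of_real pi * \<i>) = exp z" for z by (simp add: exp_add)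
  have sh: "z + 2 * of_real pi * \<i> \<in> strip A" if "z \<in> strip A" for z A using that by (simp add: strip_def)
  obtain n where n: "\<And>z (k::int). z \<in> ?S \<Longrightarrow> L (z + of_int k * (2 * of_real pi * \<i>)) = L z + of_int (n * k) * (2 * of_real pi * \<i>)"
  proof (rule lift_deck[OF L(1)])
    fix z assume z: "z \<in> ?S"
    have "of_real rs * exp (L (z + 2 * of_real pi * \<i>)) = of_real rs * exp (L z)"
      using L(2)[OF z] L(2)[OF sh[OF z]] unfolding e2 by simp
    then show "exp (L (z + 2 * of_real pi * \<i>)) = exp (L z)" using s by simp
  qed blast
  obtain m where m: "\<And>z (k::int). z \<in> ?S' \<Longrightarrow> M (z + of_int k * (2 * of_real pi * \<i>)) = M z + of_int (m * k) * (2 * of_real pi * \<i>)"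
  proof (rule lift_deck[OF M(1)])
    fix z assume z: "z \<in> ?S'"
    have "of_real r * exp (M (z + 2 * of_real pi * \<i>)) = of_real r * exp (M z)"
      using M(2)[OF z] M(2)[OF sh[OF z]] unfolding e2 by simp
    then show "exp (M (z + 2 * of_real pi * \<i>)) = exp (M z)" using r by simp
  qed blast
  \<comment> \<open>The composition of the lifts covers the identity, so it is a translation by a
    fixed multiple of the period. Comparing its effect at \<open>z\<close> and one period above
    yields m n = 1.\<close>
  obtain c :: int where c: "\<And>z. z \<in> ?S \<Longrightarrow> M (L z) - z = of_int c * (2 * of_real pi * \<i>)"
  proof (rule integer_valued_constant[of ?S "\<lambda>z. M (L z) - z"])
    show "connected ?S" by (rule convex_connected[OF convex_strip])
    show "continuous_on ?S (\<lambda>z. M (L z) - z)"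
      by (intro continuous_intros continuous_on_compose2[OF M(1) L(1)]) (use LS in auto)
    fix z assume z: "z \<in> ?S"
    have "of_real r * exp (M (L z)) = of_real r * exp z"
      using M(2)[OF LS[OF z]] L(2)[OF z] hg[OF exp_in_annulus[OF r(1) z r(2)]] by simp
    then have "exp (M (L z)) = exp z" using r by simp
    then show "\<exists>n::int. M (L z) - z = of_int n * (2 * of_real pi * \<i>)" by (rule exp_eq_imp_int)
  qed blast
  define z where "z = Complex (ln (R/r) / 2) 0"
  have z: "z \<in> ?S" using r by (simp add: z_def)
  have "M (L (z + 2 * of_real pi * \<i>)) = M (L z) + of_int (m * n) * (2 * of_real pi * \<i>)"
    using n[OF z, of 1] m[OF LS[OF z], of n] by simp
  moreover have "M (L (z + 2 * of_real pi * \<i>)) = M (L z) + 2 * of_real pi * \<i>"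
    using c[OF z] c[OF sh[OF z]] by (simp add: algebra_simps)
  ultimately have "of_int (m * n) * (2 * of_real pi * \<i>) = 1 * (2 * of_real pi * \<i>)" by simp
  then have "of_int (m * n) = (1::complex)" using mult_right_cancel[of "2 * of_real pi * \<i>"] by simp
  then have "m * n = 1" by (metis of_int_1 of_int_eq_iff)
  then have "n = 1 \<or> n = -1" by (metis mult.commute zmult_eq_1_iff)
  moreover have "L (z + 2 * of_real pi * \<i>) = L z + of_int n * (2 * of_real pi * \<i>)" if "z \<in> ?S" for z
    using n[OF that, of 1] by simp
  ultimately show ?thesis using that L by blast
qed

section \<open>Boundary correspondence\<close>

lemma connected_open_annulus: "connected (annulus a b)"
  using connected_annulus(1)[of a "0::complex" b] by (simp add: annulus_def)

text \<open>The sets \<open>N d\<close> are connected neighbourhoods of one end. The preimage of a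
  compact middle annulus is compact, so small \<open>N d\<close> miss it, and connectedness puts
  their image near a single boundary circle. As the \<open>N d\<close> are nested, that circle is
  the same for all of them.\<close>

lemma homeomorphism_end_limit:
  fixes N :: "real \<Rightarrow> complex set"
  assumes hom: "homeomorphism (annulus r R) (annulus rs Rs) h g" and s: "rs < Rs"
    and conn: "\<And>d. 0 < d \<Longrightarrow> connected (N d)" and ne: "\<And>d. 0 < d \<Longrightarrow> N d \<noteq> {}"
    and sub: "\<And>d. N d \<subseteq> annulus r R" and mono: "\<And>d d'. d \<le> d' \<Longrightarrow> N d \<subseteq> N d'"
    and esc: "\<And>K. compact K \<Longrightarrow> K \<subseteq> annulus r R \<Longrightarrow> \<exists>d>0. N d \<inter> K = {}"
  shows "\<exists>v\<in>{rs, Rs}. \<forall>e>0. \<exists>d>0. \<forall>z\<in>N d. \<bar>cmod (h z) - v\<bar> < e"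
proof -
  have hc: "continuous_on (annulus r R) h" and gc: "continuous_on (annulus rs Rs) g"
    and hg: "\<And>z. z \<in> annulus r R \<Longrightarrow> h z \<in> annulus rs Rs \<and> g (h z) = z"
    and gh: "\<And>w. w \<in> annulus rs Rs \<Longrightarrow> g w \<in> annulus r R \<and> h (g w) = w"
    using hom unfolding homeomorphism_def by auto
  have dich: "\<exists>d>0. (\<forall>z\<in>N d. cmod (h z) < rs + e) \<or> (\<forall>z\<in>N d. cmod (h z) > Rs - e)"
    if e: "0 < e" "2 * e < Rs - rs" for e
  proof -
    let ?K = "{w. rs + e \<le> cmod w \<and> cmod w \<le> Rs - e}"
    have K: "?K \<subseteq> annulus rs Rs" using e by (auto simp: annulus_def)
    have "?K = cball 0 (Rs - e) - ball 0 (rs + e)" by auto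
    then have "compact ?K" by (simp add: compact_diff)
    then have "compact (g ` ?K)" by (rule compact_continuous_image[OF continuous_on_subset[OF gc K]])
    moreover have "g ` ?K \<subseteq> annulus r R" using gh K by blast
    ultimately obtain d where d: "d > 0" "N d \<inter> g ` ?K = {}" using esc by blast
    have out: "cmod (h z) < rs + e \<or> cmod (h z) > Rs - e" if z: "z \<in> N d" for z
    proof (rule ccontr)
      assume "\<not> ?thesis"
      then have "h z \<in> ?K" by auto
      then have "g (h z) \<in> g ` ?K" by (rule imageI)
      moreover have "g (h z) = z" using hg sub z by blast
      ultimately show False using d(2) z by auto
    qed
    have c: "connected (h ` N d)"
      by (rule connected_continuous_image[OF continuous_on_subset[OF hc sub] conn[OF d(1)]])
    have o: "open {w::complex. cmod w < rs + e}" "open {w::complex. cmod w > Rs - e}"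
      by (auto intro!: open_Collect_less continuous_intros)
    have "{w. cmod w < rs + e} \<inter> h ` N d = {} \<or> {w. cmod w > Rs - e} \<inter> h ` N d = {}"
      by (rule connectedD[OF c o]) (use out e in auto)
    then show ?thesis using out d(1) by blast
  qed
  \<comment> \<open>A third of the width keeps the two boundary layers disjoint, for this and every
    smaller thickness.\<close>
  define e0 where "e0 = (Rs - rs) / 3"
  have e0: "0 < e0" "2 * e0 < Rs - rs" using s by (auto simp: e0_def)
  have bnd: "rs < cmod (h z)" "cmod (h z) < Rs" if "z \<in> N d" for z d
    using hg[of z] sub[of d] that by (auto simp: annulus_def)
  obtain d0 where d0: "d0 > 0" "(\<forall>z\<in>N d0. cmod (h z) < rs + e0) \<or> (\<forall>z\<in>N d0. cmod (h z) > Rs - e0)"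
    using dich[OF e0] by blast
  have common: "\<exists>z. z \<in> N d0 \<and> z \<in> N d1" if "d1 > 0" for d1
  proof -
    have "N (min d0 d1) \<noteq> {}" using ne d0(1) that by simp
    moreover have "N (min d0 d1) \<subseteq> N d0" "N (min d0 d1) \<subseteq> N d1" by (simp_all add: mono)
    ultimately show ?thesis by blast
  qed
  have refine: "\<exists>e' d1. 0 < e' \<and> e' \<le> e \<and> e' \<le> e0 \<and> 0 < d1 \<and>
      ((\<forall>z\<in>N d1. cmod (h z) < rs + e') \<or> (\<forall>z\<in>N d1. cmod (h z) > Rs - e'))" if "e > 0" for e
  proof -
    have e': "0 < min e e0" "2 * min e e0 < Rs - rs" "min e e0 \<le> e" "min e e0 \<le> e0" using that e0 by auto
    from dich[OF e'(1,2)] e' show ?thesis by blast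
  qed
  from d0(2) show ?thesis
  proof
    assume low: "\<forall>z\<in>N d0. cmod (h z) < rs + e0"
    have "\<exists>d>0. \<forall>z\<in>N d. \<bar>cmod (h z) - rs\<bar> < e" if "e > 0" for e
    proof -
      obtain e' d1 where e': "e' \<le> e" "e' \<le> e0" and d1: "0 < d1"
        "(\<forall>z\<in>N d1. cmod (h z) < rs + e') \<or> (\<forall>z\<in>N d1. cmod (h z) > Rs - e')"
        using refine[OF \<open>e > 0\<close>] by blast
      obtain z where z: "z \<in> N d0" "z \<in> N d1" using common[OF d1(1)] by blast
      have "cmod (h z) < rs + e0" using low z by blast
      then have "\<not> cmod (h z) > Rs - e'" using e' e0 by linarith
      then have *: "\<forall>z\<in>N d1. cmod (h z) < rs + e'" using d1(2) z by blast
      have "\<bar>cmod (h z) - rs\<bar> < e" if "z \<in> N d1" for z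
        using bspec[OF * that] bnd[OF that] e' by linarith
      then show ?thesis using d1(1) by blast
    qed
    then show ?thesis by blast
  next
    assume high: "\<forall>z\<in>N d0. cmod (h z) > Rs - e0"
    have "\<exists>d>0. \<forall>z\<in>N d. \<bar>cmod (h z) - Rs\<bar> < e" if "e > 0" for e
    proof -
      obtain e' d1 where e': "e' \<le> e" "e' \<le> e0" and d1: "0 < d1"
        "(\<forall>z\<in>N d1. cmod (h z) < rs + e') \<or> (\<forall>z\<in>N d1. cmod (h z) > Rs - e')"
        using refine[OF \<open>e > 0\<close>] by blast
      obtain z where z: "z \<in> N d0" "z \<in> N d1" using common[OF d1(1)] by blast
      have "cmod (h z) > Rs - e0" using high z by blast
      then have "\<not> cmod (h z) < rs + e'" using e' e0 by linarith
      then have *: "\<forall>z\<in>N d1. cmod (h z) > Rs - e'" using d1(2) z by blast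
      have "\<bar>cmod (h z) - Rs\<bar> < e" if "z \<in> N d1" for z
        using bspec[OF * that] bnd[OF that] e' by linarith
      then show ?thesis using d1(1) by blast
    qed
    then show ?thesis by blast
  qed
qed

lemma annulus_nonempty:
  assumes "0 \<le> a" "a < b"
  shows "annulus a b \<noteq> {}"
proof -
  obtain x where "a < x" "x < b" using dense[OF assms(2)] by blast
  then have "of_real x \<in> annulus a b" using assms by (simp add: annulus_def)
  then show ?thesis by blast
qed

lemma compact_in_annulus:
  assumes "compact K" "K \<subseteq> annulus r R"
  shows "\<exists>d>0. \<forall>z\<in>K. r + d \<le> cmod z \<and> cmod z \<le> R - d"
proof (cases "K = {}")
  case True
  then show ?thesis by (intro exI[of _ 1]) simp
next
  case False
  have c: "continuous_on K cmod" by (intro continuous_intros)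
  obtain x where x: "x \<in> K" "\<And>z. z \<in> K \<Longrightarrow> cmod x \<le> cmod z"
    using continuous_attains_inf[OF assms(1) False c] by blast
  obtain y where y: "y \<in> K" "\<And>z. z \<in> K \<Longrightarrow> cmod z \<le> cmod y"
    using continuous_attains_sup[OF assms(1) False c] by blast
  have "r < cmod x" "cmod y < R" using x(1) y(1) assms(2) by (auto simp: annulus_def)
  define d where "d = min (cmod x - r) (R - cmod y)"
  have d: "d > 0" "d \<le> cmod x - r" "d \<le> R - cmod y"
    using \<open>r < cmod x\<close> \<open>cmod y < R\<close> by (auto simp: d_def)
  have "r + d \<le> cmod z \<and> cmod z \<le> R - d" if "z \<in> K" for z
    using x(2)[OF that] y(2)[OF that] d by linarith
  then show ?thesis using d(1) by blast
qed

text \<open>Both ends cannot tend to the same circle: points near the other circle would then come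
  from a compact middle annulus, whose image keeps a positive distance from both circles.\<close>

lemma homeomorphism_ends:
  assumes r: "0 < r" "r < R" and s: "0 < rs" "rs < Rs"
    and hom: "homeomorphism (annulus r R) (annulus rs Rs) h g"
  obtains v v' where "v = rs \<and> v' = Rs \<or> v = Rs \<and> v' = rs"
    "\<And>e. e > 0 \<Longrightarrow> \<exists>d>0. \<forall>z\<in>annulus r R. cmod z < r + d \<longrightarrow> \<bar>cmod (h z) - v\<bar> < e"
    "\<And>e. e > 0 \<Longrightarrow> \<exists>d>0. \<forall>z\<in>annulus r R. cmod z > R - d \<longrightarrow> \<bar>cmod (h z) - v'\<bar> < e"
proof -
  define N1 where "N1 d = annulus r (min R (r + d))" for d
  define N2 where "N2 d = annulus (max r (R - d)) R" for d
  have "\<exists>v\<in>{rs, Rs}. \<forall>e>0. \<exists>d>0. \<forall>z\<in>N1 d. \<bar>cmod (h z) - v\<bar> < e"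
  proof (rule homeomorphism_end_limit[OF hom s(2)])
    show "connected (N1 d)" for d unfolding N1_def by (rule connected_open_annulus)
    show "N1 d \<noteq> {}" if "0 < d" for d unfolding N1_def using r that by (intro annulus_nonempty) auto
    show "N1 d \<subseteq> annulus r R" for d by (auto simp: N1_def annulus_def)
    show "N1 d \<subseteq> N1 d'" if "d \<le> d'" for d d' using that by (auto simp: N1_def annulus_def)
    show "\<exists>d>0. N1 d \<inter> K = {}" if "compact K" "K \<subseteq> annulus r R" for K
      using compact_in_annulus[OF that] by (fastforce simp: N1_def annulus_def)
  qed
  then obtain v where v: "v \<in> {rs, Rs}" "\<And>e. e > 0 \<Longrightarrow> \<exists>d>0. \<forall>z\<in>N1 d. \<bar>cmod (h z) - v\<bar> < e" by blast
  have "\<exists>v\<in>{rs, Rs}. \<forall>e>0. \<exists>d>0. \<forall>z\<in>N2 d. \<bar>cmod (h z) - v\<bar> < e"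
  proof (rule homeomorphism_end_limit[OF hom s(2)])
    show "connected (N2 d)" for d unfolding N2_def by (rule connected_open_annulus)
    show "N2 d \<noteq> {}" if "0 < d" for d unfolding N2_def using r that by (intro annulus_nonempty) auto
    show "N2 d \<subseteq> annulus r R" for d by (auto simp: N2_def annulus_def)
    show "N2 d \<subseteq> N2 d'" if "d \<le> d'" for d d' using that by (auto simp: N2_def annulus_def)
    show "\<exists>d>0. N2 d \<inter> K = {}" if "compact K" "K \<subseteq> annulus r R" for K
      using compact_in_annulus[OF that] by (fastforce simp: N2_def annulus_def)
  qed
  then obtain v' where v': "v' \<in> {rs, Rs}" "\<And>e. e > 0 \<Longrightarrow> \<exists>d>0. \<forall>z\<in>N2 d. \<bar>cmod (h z) - v'\<bar> < e" by blast
  have "v \<noteq> v'"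
  proof
    assume [simp]: "v = v'"
    obtain u where u: "u \<in> {rs, Rs}" "u \<noteq> v" using s v(1) by blast
    have uv: "\<bar>u - v\<bar> = Rs - rs" using u v(1) s by auto
    define e where "e = (Rs - rs) / 2"
    have e: "e > 0" using s(2) unfolding e_def by simp
    obtain d1 where d1: "d1 > 0" "\<And>z. z \<in> N1 d1 \<Longrightarrow> \<bar>cmod (h z) - v\<bar> < e" using v(2)[OF e] by blast
    obtain d2 where d2: "d2 > 0" "\<And>z. z \<in> N2 d2 \<Longrightarrow> \<bar>cmod (h z) - v\<bar> < e" using v'(2)[OF e] by auto
    have hc: "continuous_on (annulus r R) h"
      and hi: "h ` annulus r R = annulus rs Rs" using hom unfolding homeomorphism_def by auto
    let ?K = "{z. r + d1 \<le> cmod z \<and> cmod z \<le> R - d2}"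
    have "?K = cball 0 (R - d2) - ball 0 (r + d1)" by auto
    then have Kc: "compact ?K" by (simp add: compact_diff)
    have KA: "?K \<subseteq> annulus r R" using d1(1) d2(1) by (auto simp: annulus_def)
    have Kh: "compact (h ` ?K)" by (rule compact_continuous_image[OF continuous_on_subset[OF hc KA] Kc])
    have "h ` ?K \<subseteq> annulus rs Rs" using KA hi by blast
    from compact_in_annulus[OF Kh this]
    obtain d where d: "d > 0" "\<forall>w\<in>h ` ?K. rs + d \<le> cmod w \<and> cmod w \<le> Rs - d" by (elim exE conjE)
    \<comment> \<open>Closer than \<open>d\<close> to the circle of radius \<open>u\<close>, the
      point is outside the image of the compact part; closer than \<open>e\<close>, its modulus
      differs from \<open>v\<close> by more than \<open>e\<close>, so it does not come from the ends
      either.\<close>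
    define c where "c = min d e / 2"
    have c: "0 < c" "c < d" "c < e" using d(1) e by (auto simp: c_def min_def)
    define x where "x = (if u = rs then rs + c else Rs - c)"
    have x: "rs < x" "x < Rs" "\<bar>x - u\<bar> = c" using c u(1) by (auto simp: x_def e_def)
    have "of_real x \<in> annulus rs Rs" using x s by (simp add: annulus_def)
    then have "of_real x \<in> h ` annulus r R" unfolding hi .
    then obtain z where z: "z \<in> annulus r R" "of_real x = h z" by (rule imageE)
    have hz: "cmod (h z) = x" unfolding z(2)[symmetric] using x(1) s(1) by simp
    have "\<bar>u - v\<bar> \<le> \<bar>x - u\<bar> + \<bar>x - v\<bar>" by linarith
    then have "\<bar>x - v\<bar> > e" using c(3) unfolding x(3) uv e_def by simp
    then have "z \<notin> N1 d1" "z \<notin> N2 d2" using d1(2)[of z] d2(2)[of z] hz by auto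
    then have "z \<in> ?K" using z(1) unfolding N1_def N2_def annulus_def by auto
    then have "rs + d \<le> x \<and> x \<le> Rs - d" using bspec[OF d(2) imageI] unfolding hz[symmetric] by blast
    then show False using x(3) c u(1) by auto
  qed
  then have "v = rs \<and> v' = Rs \<or> v = Rs \<and> v' = rs" using v(1) v'(1) by blast
  moreover have "\<exists>d>0. \<forall>z\<in>annulus r R. cmod z < r + d \<longrightarrow> \<bar>cmod (h z) - v\<bar> < e" if "e > 0" for e
    using v(2)[OF that] unfolding N1_def annulus_def by auto
  moreover have "\<exists>d>0. \<forall>z\<in>annulus r R. cmod z > R - d \<longrightarrow> \<bar>cmod (h z) - v'\<bar> < e" if "e > 0" for e
    using v'(2)[OF that] unfolding N2_def annulus_def by auto
  ultimately show ?thesis by (rule that)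
qed

section \<open>Reduction to the strip\<close>

text \<open>A nonnegative Jacobian excludes degree -1, because \<open>winding_and_area\<close> makes
  the increment of the argument over a period nonnegative.\<close>

lemma annulus_mapI:
  assumes lift: "strip_lift T F G L" and n: "n = 1 \<or> n = (-1::int)"
    and deck: "\<And>z. z \<in> strip T \<Longrightarrow> L (z + 2 * of_real pi * \<i>) = L z + of_int n * (2 * of_real pi * \<i>)"
    and orient: "\<And>z. z \<in> strip T \<Longrightarrow> cmod (deriv G z) \<le> cmod (deriv F z)"
    and lim0: "\<And>e. e > 0 \<Longrightarrow> \<exists>d>0. \<forall>z\<in>strip T. Re z < d \<longrightarrow> \<bar>cmod (hmap F G z) - 1\<bar> < e"
    and limT: "\<And>e. e > 0 \<Longrightarrow> \<exists>d>0. \<forall>z\<in>strip T. Re z > T - d \<longrightarrow> \<bar>cmod (hmap F G z) - \<rho>\<bar> < e"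
    and bounds: "1 < \<rho>" "\<And>z. z \<in> strip T \<Longrightarrow> 1 < cmod (hmap F G z)" "\<And>z. z \<in> strip T \<Longrightarrow> cmod (hmap F G z) < \<rho>"
  shows "annulus_map T F G L \<rho>"
proof -
  interpret strip_lift T F G L by (rule lift)
  have deckC: "L (Complex t (y + 2*pi)) = L (Complex t y) + of_int n * (2 * of_real pi * \<i>)" if "0 < t" "t < T" for t y
  proof -
    have "Complex t y + 2 * of_real pi * \<i> = Complex t (y + 2*pi)" by (simp add: complex_eq_iff)
    then show ?thesis using deck[of "Complex t y"] that by simp
  qed
  interpret strip_loop T F G L
  proof
    fix t y :: real assume t: "0 < t" "t < T"
    have "exp (L (Complex t (y + 2*pi))) = exp (L (Complex t y))"
      unfolding deckC[OF t] by (simp add: exp_eq)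
    then show "hmap F G (Complex t (y + 2*pi)) = hmap F G (Complex t y)"
      using exp_L[of "Complex t (y + 2*pi)"] exp_L[of "Complex t y"] t by simp
  next
    fix z assume "z \<in> strip T"
    then show "0 \<le> (cmod (deriv F z))\<^sup>2 - (cmod (deriv G z))\<^sup>2" using orient by (simp add: power_mono)
  qed (use lim0 bounds in auto)
  have "0 < T/2" "T/2 < T" using T_pos by auto
  from winding_and_area(1)[OF this] deckC[OF this, of 0] have "0 \<le> real_of_int n * (2*pi)" by simp
  then have "0 \<le> real_of_int n" using pi_gt_zero by (simp add: zero_le_mult_iff)
  then have "n = 1" using n by auto
  then show ?thesis
    by unfold_locales (use limT bounds deckC in auto)
qed

lemma strip_lift_cnj:
  assumes "strip_lift T F G L"
  shows "strip_lift T G F (\<lambda>z. cnj (L z))"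
proof -
  interpret strip_lift T F G L by (rule assms)
  show ?thesis
  proof
    show "exp (cnj (L z)) = hmap G F z" if "z \<in> strip T" for z
      using arg_cong[OF exp_L[OF that], of cnj] by (simp add: exp_cnj[symmetric] hmap_def del: exp_cnj)
  qed (intro T_pos F_hol G_hol continuous_intros L_cont)+
qed

text \<open>If the orientation is reversed, the conjugate map is used instead: this exchanges
  \<open>F\<close> and \<open>G\<close>, negates the degree and keeps all moduli.\<close>

lemma cosh_le_of_ordered_ends:
  assumes lift: "strip_lift T F G L" and n: "n = 1 \<or> n = (-1::int)"
    and deck: "\<And>z. z \<in> strip T \<Longrightarrow> L (z + 2 * of_real pi * \<i>) = L z + of_int n * (2 * of_real pi * \<i>)"
    and orient: "(\<forall>z\<in>strip T. cmod (deriv G z) \<le> cmod (deriv F z)) \<or> (\<forall>z\<in>strip T. cmod (deriv F z) \<le> cmod (deriv G z))"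
    and lim0: "\<And>e. e > 0 \<Longrightarrow> \<exists>d>0. \<forall>z\<in>strip T. Re z < d \<longrightarrow> \<bar>cmod (hmap F G z) - 1\<bar> < e"
    and limT: "\<And>e. e > 0 \<Longrightarrow> \<exists>d>0. \<forall>z\<in>strip T. Re z > T - d \<longrightarrow> \<bar>cmod (hmap F G z) - \<rho>\<bar> < e"
    and bounds: "1 < \<rho>" "\<And>z. z \<in> strip T \<Longrightarrow> 1 < cmod (hmap F G z)" "\<And>z. z \<in> strip T \<Longrightarrow> cmod (hmap F G z) < \<rho>"
  shows "cosh T \<le> \<rho>"
  using orient
proof
  assume "\<forall>z\<in>strip T. cmod (deriv G z) \<le> cmod (deriv F z)"
  then interpret annulus_map T F G L \<rho>
    by (intro annulus_mapI[OF lift n deck _ lim0 limT bounds]) auto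
  show ?thesis by (rule cosh_le_R)
next
  assume o: "\<forall>z\<in>strip T. cmod (deriv F z) \<le> cmod (deriv G z)"
  have eq: "cmod (hmap G F z) = cmod (hmap F G z)" for z
  proof -
    have "hmap G F z = cnj (hmap F G z)" by (simp add: hmap_def)
    then show ?thesis by simp
  qed
  have "- n = 1 \<or> - n = -1" using n by auto
  moreover have "cnj (L (z + 2 * of_real pi * \<i>)) = cnj (L z) + of_int (- n) * (2 * of_real pi * \<i>)" if "z \<in> strip T" for z
    by (simp add: deck[OF that])
  ultimately interpret annulus_map T G F "\<lambda>z. cnj (L z)" \<rho>
    by (rule annulus_mapI[OF strip_lift_cnj[OF lift], unfolded eq]) (use o lim0 limT bounds in auto)
  show ?thesis by (rule cosh_le_R)
qed

text \<open>If the inner boundary circle goes to the outer one, the strip is reflected in its middle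
  line. This restores the order of the ends and reverses the orientation, which the symmetric form
  of \<open>orient\<close> tolerates.\<close>

lemma cosh_le_of_ends:
  assumes lift: "strip_lift T F G L" and n: "n = 1 \<or> n = (-1::int)"
    and deck: "\<And>z. z \<in> strip T \<Longrightarrow> L (z + 2 * of_real pi * \<i>) = L z + of_int n * (2 * of_real pi * \<i>)"
    and orient: "(\<forall>z\<in>strip T. cmod (deriv G z) \<le> cmod (deriv F z)) \<or> (\<forall>z\<in>strip T. cmod (deriv F z) \<le> cmod (deriv G z))"
    and ends: "v = 1 \<and> v' = \<rho> \<or> v = \<rho> \<and> v' = 1"
    and lim0: "\<And>e. e > 0 \<Longrightarrow> \<exists>d>0. \<forall>z\<in>strip T. Re z < d \<longrightarrow> \<bar>cmod (hmap F G z) - v\<bar> < e"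
    and limT: "\<And>e. e > 0 \<Longrightarrow> \<exists>d>0. \<forall>z\<in>strip T. Re z > T - d \<longrightarrow> \<bar>cmod (hmap F G z) - v'\<bar> < e"
    and bounds: "1 < \<rho>" "\<And>z. z \<in> strip T \<Longrightarrow> 1 < cmod (hmap F G z)" "\<And>z. z \<in> strip T \<Longrightarrow> cmod (hmap F G z) < \<rho>"
  shows "cosh T \<le> \<rho>"
  using ends
proof
  assume "v = 1 \<and> v' = \<rho>"
  then show ?thesis
    by (intro cosh_le_of_ordered_ends[OF lift n deck orient _ _ bounds]) (use lim0 limT in auto)
next
  assume v: "v = \<rho> \<and> v' = 1"
  interpret strip_lift T F G L by (rule lift)
  define F' where "F' z = cnj (G (of_real T - cnj z))" for z
  define G' where "G' z = cnj (F (of_real T - cnj z))" for z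
  define L' where "L' z = L (of_real T - cnj z)" for z
  have rs: "of_real T - cnj z \<in> strip T" if "z \<in> strip T" for z using that by (simp add: strip_def)
  have h': "hmap F' G' z = hmap F G (of_real T - cnj z)" for z
    by (simp add: hmap_def F'_def G'_def)
  note FG = cnj_reflect_holomorphic[OF G_hol, folded F'_def] cnj_reflect_holomorphic[OF F_hol, folded G'_def]
  show ?thesis
  proof (rule cosh_le_of_ordered_ends[of T F' G' L' n])
    show "strip_lift T F' G' L'"
    proof
      show "0 < T" by (rule T_pos)
      show "F' holomorphic_on strip T" "G' holomorphic_on strip T"
        by (rule FG(1), rule FG(3))
      show "continuous_on (strip T) L'"
        unfolding L'_def by (rule continuous_on_compose2[OF L_cont]) (auto intro!: continuous_intros rs)
      show "exp (L' z) = hmap F' G' z" if "z \<in> strip T" for z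
        using exp_L[OF rs[OF that]] by (simp add: h' L'_def)
    qed
    show "n = 1 \<or> n = -1" by (rule n)
    show "L' (z + 2 * of_real pi * \<i>) = L' z + of_int n * (2 * of_real pi * \<i>)" if "z \<in> strip T" for z
      using deck[OF rs[OF that]] by (simp add: L'_def algebra_simps)
    show "(\<forall>z\<in>strip T. cmod (deriv G' z) \<le> cmod (deriv F' z)) \<or> (\<forall>z\<in>strip T. cmod (deriv F' z) \<le> cmod (deriv G' z))"
      using orient rs by (auto simp: FG(2) FG(4))
    show "\<exists>d>0. \<forall>z\<in>strip T. Re z < d \<longrightarrow> \<bar>cmod (hmap F' G' z) - 1\<bar> < e" if "e > 0" for e
      using limT[OF that] rs v unfolding h' by force
    show "\<exists>d>0. \<forall>z\<in>strip T. Re z > T - d \<longrightarrow> \<bar>cmod (hmap F' G' z) - \<rho>\<bar> < e" if "e > 0" for e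
      using lim0[OF that] rs v unfolding h' by force
    show "1 < \<rho>" by (rule bounds)
    show "1 < cmod (hmap F' G' z)" "cmod (hmap F' G' z) < \<rho>" if "z \<in> strip T" for z
      using bounds(2,3)[OF rs[OF that]] by (simp_all add: h')
  qed
qed

lemma harmonic_homeomorphism_lift:
  assumes r: "0 < r" "r < R" and s: "0 < rs" "rs < Rs"
    and harm: "harmonic_on (annulus r R) h" and hom: "homeomorphism (annulus r R) (annulus rs Rs) h g"
  obtains F G L n where "strip_lift (ln (R/r)) F G L" "n = 1 \<or> n = (-1::int)"
    "\<And>z. z \<in> strip (ln (R/r)) \<Longrightarrow> L (z + 2 * of_real pi * \<i>) = L z + of_int n * (2 * of_real pi * \<i>)"
    "\<And>z. z \<in> strip (ln (R/r)) \<Longrightarrow> h (of_real r * exp z) = of_real rs * hmap F G z"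
    "\<And>z. z \<in> strip (ln (R/r)) \<Longrightarrow> 1 < cmod (hmap F G z)"
    "\<And>z. z \<in> strip (ln (R/r)) \<Longrightarrow> cmod (hmap F G z) < Rs / rs"
    "(\<forall>z\<in>strip (ln (R/r)). cmod (deriv G z) \<le> cmod (deriv F z)) \<or> (\<forall>z\<in>strip (ln (R/r)). cmod (deriv F z) \<le> cmod (deriv G z))"
proof -
  let ?T = "ln (R/r)"
  have rs0: "rs \<noteq> 0" using s by simp
  obtain F G where FG: "F holomorphic_on strip ?T" "G holomorphic_on strip ?T"
    "\<And>z. z \<in> strip ?T \<Longrightarrow> h (of_real r * exp z) = of_real rs * hmap F G z"
    using harmonic_map_decomposition[OF harm r rs0] by blast
  obtain L n where L: "continuous_on (strip ?T) L"
    "\<And>z. z \<in> strip ?T \<Longrightarrow> h (of_real r * exp z) = of_real rs * exp (L z)"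
    and n: "n = 1 \<or> n = (-1::int)"
    and deck: "\<And>z. z \<in> strip ?T \<Longrightarrow> L (z + 2 * of_real pi * \<i>) = L z + of_int n * (2 * of_real pi * \<i>)"
    using homeomorphism_degree[OF r s hom] by blast
  have T: "0 < ?T" using r by simp
  have eL: "exp (L z) = hmap F G z" if "z \<in> strip ?T" for z
  proof -
    have "of_real rs * exp (L z) = of_real rs * hmap F G z" using FG(3)[OF that] L(2)[OF that] by metis
    then show ?thesis using rs0 by simp
  qed
  have lift: "strip_lift ?T F G L" by unfold_locales (use T FG L eL in auto)
  interpret strip_lift ?T F G L by (rule lift)
  have bounds: "1 < cmod (hmap F G z) \<and> cmod (hmap F G z) < Rs / rs" if "z \<in> strip ?T" for z
  proof -
    have "h (of_real r * exp z) \<in> annulus rs Rs"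
      using exp_in_annulus[OF r(1) that r(2)] hom unfolding homeomorphism_def by blast
    then show ?thesis using s unfolding FG(3)[OF that] annulus_def by (simp add: norm_mult field_simps)
  qed
  \<comment> \<open>The exponential is injective on points less than 2\<pi> apart in imaginary part,
    and distance 1 is well within that range.\<close>
  have inj: "z = w" if zw: "z \<in> strip ?T" "w \<in> strip ?T" "cmod (z - w) < 1" "hmap F G z = hmap F G w" for z w
  proof -
    have "h (of_real r * exp z) = h (of_real r * exp w)" using FG(3) zw by simp
    moreover have "\<And>x. x \<in> annulus r R \<Longrightarrow> g (h x) = x" using hom unfolding homeomorphism_def by blast
    ultimately have "of_real r * exp z = of_real r * exp w"
      using exp_in_annulus[OF r(1) _ r(2)] zw by metis
    then have e: "exp z = exp w" using r by simp
    have "\<bar>Im z - Im w\<bar> < 1" using abs_Im_le_cmod[of "z - w"] zw(3) by simp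
    then have "\<bar>Im z - Im w\<bar> < 2 * pi" using pi_gt3 by linarith
    then show ?thesis by (rule exp_complex_eqI[OF _ e]) 
  qed
  have "(\<forall>z\<in>strip ?T. cmod (deriv G z) \<le> cmod (deriv F z)) \<or> (\<forall>z\<in>strip ?T. cmod (deriv F z) \<le> cmod (deriv G z))"
  proof (rule ccontr)
    assume "\<not> ?thesis"
    then obtain z w where "z \<in> strip ?T" "cmod (deriv G z) > cmod (deriv F z)" "w \<in> strip ?T" "cmod (deriv F w) > cmod (deriv G w)"
      by (auto simp: not_le)
    then show False using jacobian_sign_constant[OF inj] by blast
  qed
  then show ?thesis using that[OF lift n deck FG(3)] bounds by blast
qed

lemma end_limits_lift:
  assumes r: "0 < r" "r < R" and rs: "0 < rs"
    and H: "\<And>z. z \<in> strip (ln (R/r)) \<Longrightarrow> h (of_real r * exp z) = of_real rs * H z"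
  shows "(\<And>e. e > 0 \<Longrightarrow> \<exists>d>0. \<forall>z\<in>annulus r R. cmod z < r + d \<longrightarrow> \<bar>cmod (h z) - v\<bar> < e) \<Longrightarrow>
      e > 0 \<Longrightarrow> \<exists>d>0. \<forall>z\<in>strip (ln (R/r)). Re z < d \<longrightarrow> \<bar>cmod (H z) - v / rs\<bar> < e"
    and "(\<And>e. e > 0 \<Longrightarrow> \<exists>d>0. \<forall>z\<in>annulus r R. cmod z > R - d \<longrightarrow> \<bar>cmod (h z) - v\<bar> < e) \<Longrightarrow>
      e > 0 \<Longrightarrow> \<exists>d>0. \<forall>z\<in>strip (ln (R/r)). Re z > ln (R/r) - d \<longrightarrow> \<bar>cmod (H z) - v / rs\<bar> < e"
proof -
  let ?T = "ln (R/r)"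
  have scale: "\<bar>cmod (H z) - v / rs\<bar> < e" if z: "z \<in> strip ?T" and e: "\<bar>cmod (h (of_real r * exp z)) - v\<bar> < e * rs" for z e
  proof -
    have "cmod (h (of_real r * exp z)) - v = rs * (cmod (H z) - v / rs)"
      using rs by (simp add: H[OF z] norm_mult field_simps)
    then have "rs * \<bar>cmod (H z) - v / rs\<bar> < rs * e" using e rs by (simp add: abs_mult mult.commute)
    then show ?thesis using rs by simp
  qed
  have n: "cmod (of_real r * exp z) = r * exp (Re z)" for z using r by (simp add: norm_mult)
  {
    assume lim: "\<And>e. e > 0 \<Longrightarrow> \<exists>d>0. \<forall>z\<in>annulus r R. cmod z < r + d \<longrightarrow> \<bar>cmod (h z) - v\<bar> < e" and e: "e > 0"
    have "e * rs > 0" using e rs by simp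
    then obtain d where d: "d > 0" "\<forall>z\<in>annulus r R. cmod z < r + d \<longrightarrow> \<bar>cmod (h z) - v\<bar> < e * rs" using lim by blast
    have "\<bar>cmod (H z) - v / rs\<bar> < e" if z: "z \<in> strip ?T" "Re z < ln (1 + d / r)" for z
    proof (rule scale[OF z(1)])
      have "exp (Re z) < exp (ln (1 + d/r))" using z(2) by simp
      also have "\<dots> = 1 + d/r" using d r by (intro exp_ln) (simp add: add_pos_pos)
      finally have "r * exp (Re z) < r + d" using r by (simp add: field_simps)
      then show "\<bar>cmod (h (of_real r * exp z)) - v\<bar> < e * rs"
        using d(2) exp_in_annulus[OF r(1) z(1) r(2)] n[of z] by metis
    qed
    moreover have "ln (1 + d / r) > 0" using d r by (intro ln_gt_zero) simp
    ultimately show "\<exists>d>0. \<forall>z\<in>strip ?T. Re z < d \<longrightarrow> \<bar>cmod (H z) - v / rs\<bar> < e" by blast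
  }
  {
    assume lim: "\<And>e. e > 0 \<Longrightarrow> \<exists>d>0. \<forall>z\<in>annulus r R. cmod z > R - d \<longrightarrow> \<bar>cmod (h z) - v\<bar> < e" and e: "e > 0"
    have "e * rs > 0" using e rs by simp
    then obtain d where d: "d > 0" "\<forall>z\<in>annulus r R. cmod z > R - d \<longrightarrow> \<bar>cmod (h z) - v\<bar> < e * rs" using lim by blast
    have "\<bar>cmod (H z) - v / rs\<bar> < e" if z: "z \<in> strip ?T" "Re z > ?T - d / R" for z
    proof (rule scale[OF z(1)])
      have "R * (1 - d / R) \<le> R * exp (- (d / R))"
        using r exp_ge_add_one_self[of "- (d / R)"] by (intro mult_left_mono) auto
      then have "R - d \<le> R * exp (- (d / R))" using r by (simp add: algebra_simps)
      also have "\<dots> = r * (exp ?T * exp (- (d / R)))" using r by (simp add: exp_ln)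
      also have "\<dots> = r * exp (?T - d / R)" by (simp add: exp_diff exp_minus field_simps)
      also have "\<dots> < r * exp (Re z)" using r z(2) by simp
      finally show "\<bar>cmod (h (of_real r * exp z)) - v\<bar> < e * rs"
        using d(2) exp_in_annulus[OF r(1) z(1) r(2)] n[of z] by metis
    qed
    moreover have "d / R > 0" using d r by simp
    ultimately show "\<exists>d>0. \<forall>z\<in>strip ?T. Re z > ?T - d \<longrightarrow> \<bar>cmod (H z) - v / rs\<bar> < e" by blast
  }
qed

section \<open>The inequality and the extremal maps on the original annuli\<close>

lemma cosh_ln_quotient:
  assumes "0 < r" "0 < (R::real)"
  shows "cosh (ln (R/r)) = (R/r + r/R) / 2"
  using assms by (simp add: cosh_ln_real field_simps)

theorem nitsche_bound:
  assumes r: "0 < r" "r < R" and s: "0 < rs" "rs < Rs"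
    and harm: "harmonic_on (annulus r R) h" and hom: "homeomorphism (annulus r R) (annulus rs Rs) h g"
  shows "(R/r + r/R) / 2 \<le> Rs / rs"
proof -
  obtain F G L n where lift: "strip_lift (ln (R/r)) F G L" and n: "n = 1 \<or> n = (-1::int)"
    and deck: "\<And>z. z \<in> strip (ln (R/r)) \<Longrightarrow> L (z + 2 * of_real pi * \<i>) = L z + of_int n * (2 * of_real pi * \<i>)"
    and H: "\<And>z. z \<in> strip (ln (R/r)) \<Longrightarrow> h (of_real r * exp z) = of_real rs * hmap F G z"
    and bounds: "\<And>z. z \<in> strip (ln (R/r)) \<Longrightarrow> 1 < cmod (hmap F G z)"
    "\<And>z. z \<in> strip (ln (R/r)) \<Longrightarrow> cmod (hmap F G z) < Rs / rs"
    and orient: "(\<forall>z\<in>strip (ln (R/r)). cmod (deriv G z) \<le> cmod (deriv F z)) \<or> (\<forall>z\<in>strip (ln (R/r)). cmod (deriv F z) \<le> cmod (deriv G z))"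
    by (rule harmonic_homeomorphism_lift[OF r s harm hom]) (rule that; assumption)
  obtain v v' where v: "v = rs \<and> v' = Rs \<or> v = Rs \<and> v' = rs"
    and lims: "\<And>e. e > 0 \<Longrightarrow> \<exists>d>0. \<forall>z\<in>annulus r R. cmod z < r + d \<longrightarrow> \<bar>cmod (h z) - v\<bar> < e"
    "\<And>e. e > 0 \<Longrightarrow> \<exists>d>0. \<forall>z\<in>annulus r R. cmod z > R - d \<longrightarrow> \<bar>cmod (h z) - v'\<bar> < e"
    by (rule homeomorphism_ends[OF r s hom]) (rule that; assumption)
  have "cosh (ln (R/r)) \<le> Rs / rs"
  proof (rule cosh_le_of_ends[OF lift n deck orient])
    show "v / rs = 1 \<and> v' / rs = Rs / rs \<or> v / rs = Rs / rs \<and> v' / rs = 1" using v s by auto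
    show "1 < Rs / rs" using s by simp
  qed (use end_limits_lift(1)[OF r s(1) H lims(1)] end_limits_lift(2)[OF r s(1) H lims(2)] bounds in auto)
  then show ?thesis using r by (simp add: cosh_ln_quotient)
qed

text \<open>By the chain rule the Jacobian of the pulled-back map is that of \<open>h\<close> times
  the positive conformal factor |r exp z|^2, and it is also rs^2 (|P|^2 - |Q|^2).\<close>

lemma sense_preserving_lift:
  assumes r: "0 < r" "r < R" and rs: "0 < rs" and FG: "strip_map (ln (R/r)) F G"
    and H: "\<And>z. z \<in> strip (ln (R/r)) \<Longrightarrow> h (of_real r * exp z) = of_real rs * hmap F G z"
    and sp: "sense_preserving_on (annulus r R) h" and z: "z \<in> strip (ln (R/r))"
  shows "cmod (deriv G z) \<le> cmod (deriv F z)"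
proof -
  interpret strip_map "ln (R/r)" F G by (rule FG)
  let ?c = "of_real r * exp z"
  have c: "?c \<in> annulus r R" by (rule exp_in_annulus[OF r(1) z r(2)])
  obtain D where D: "(h has_derivative D) (at ?c)" "Im (cnj (D 1) * D \<i>) > 0"
    using sp c unfolding sense_preserving_on_def by blast
  have lin: "linear D" using D(1) has_derivative_linear by blast
  have "((\<lambda>z. of_real r * exp z) has_derivative (\<lambda>w. ?c * w)) (at z)"
    unfolding has_field_derivative_def[symmetric] by (auto intro!: derivative_eq_intros)
  from diff_chain_at[OF this D(1)] have d1: "((\<lambda>z. h (of_real r * exp z)) has_derivative (\<lambda>w. D (?c * w))) (at z)"
    by (simp add: o_def)
  have "(F has_derivative (*) (P z)) (at z)" "(G has_derivative (*) (Q z)) (at z)"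
    using dF[OF z] dG[OF z] by (simp_all add: has_field_derivative_def)
  then have "((\<lambda>z. of_real rs * hmap F G z) has_derivative (\<lambda>w. of_real rs * (P z * w + cnj (Q z * w)))) (at z)"
    unfolding hmap_def[abs_def] by (intro derivative_intros)
  then have d2: "((\<lambda>z. h (of_real r * exp z)) has_derivative (\<lambda>w. of_real rs * (P z * w + cnj (Q z * w)))) (at z)"
    by (rule has_derivative_transform_within_open[OF _ open_strip z]) (simp add: H)
  have Dw: "D (?c * w) = of_real rs * (P z * w + cnj (Q z * w))" for w
    using has_derivative_unique[OF d1 d2] by (rule fun_cong)
  have Dlin: "D w = of_real (Re w) * D 1 + of_real (Im w) * D \<i>" for w
  proof -
    have "w = Re w *\<^sub>R 1 + Im w *\<^sub>R \<i>" by (simp add: complex_eq_iff)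
    then have "D w = D (Re w *\<^sub>R 1 + Im w *\<^sub>R \<i>)" by simp
    also have "\<dots> = Re w *\<^sub>R D 1 + Im w *\<^sub>R D \<i>" using lin by (simp add: linear_add linear_scale)
    finally show ?thesis by (simp add: scaleR_conv_of_real)
  qed
  define J where "J = Im (cnj (D 1) * D \<i>)"
  have "Im (cnj (D ?c) * D (?c * \<i>)) = ((Re ?c)\<^sup>2 + (Im ?c)\<^sup>2) * J"
    unfolding Dlin[of ?c] Dlin[of "?c * \<i>"] J_def
    by (simp add: algebra_simps power2_eq_square)
  also have "(Re ?c)\<^sup>2 + (Im ?c)\<^sup>2 = (cmod ?c)\<^sup>2" by (rule cmod_power2[symmetric])
  finally have 1: "Im (cnj (D ?c) * D (?c * \<i>)) \<ge> 0" using D(2) by (simp add: J_def)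
  have "Im (cnj (D ?c) * D (?c * \<i>)) = rs\<^sup>2 * ((cmod (P z))\<^sup>2 - (cmod (Q z))\<^sup>2)"
    unfolding Dw Dw[of 1, unfolded mult_1_right]
    unfolding cmod_power2 by (simp add: algebra_simps power2_eq_square)
  then have "(cmod (Q z))\<^sup>2 \<le> (cmod (P z))\<^sup>2" using 1 rs by (simp add: zero_le_mult_iff)
  then show ?thesis by (rule power2_le_imp_le) simp
qed

text \<open>Membership in the class fixes both the orientation and the order of the ends, so
  \<open>annulus_mapI\<close> applies without conjugation or reflection. The rotation angle is the
  argument of the limiting Fourier coefficient \<open>x0\<close>.\<close>

theorem nitsche_extremal:
  assumes r: "0 < r" "r < R" and s: "0 < rs" "rs < Rs" and eq: "Rs / rs = (R/r + r/R) / 2"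
    and h: "h \<in> harm_homeo_class r R rs Rs"
  shows "\<exists>\<alpha>::real. 0 \<le> \<alpha> \<and> \<alpha> < 2 * pi \<and>
    (\<forall>z\<in>annulus r R. h z = (z / of_real r + of_real r / cnj z) / 2 * of_real rs * exp (\<i> * of_real \<alpha>))"
proof -
  let ?T = "ln (R/r)"
  obtain g where harm: "harmonic_on (annulus r R) h" and hom: "homeomorphism (annulus r R) (annulus rs Rs) h g"
    and sp: "sense_preserving_on (annulus r R) h"
    and lims: "\<And>e. e > 0 \<Longrightarrow> \<exists>d>0. \<forall>z\<in>annulus r R. cmod z < r + d \<longrightarrow> \<bar>cmod (h z) - rs\<bar> < e"
    "\<And>e. e > 0 \<Longrightarrow> \<exists>d>0. \<forall>z\<in>annulus r R. cmod z > R - d \<longrightarrow> \<bar>cmod (h z) - Rs\<bar> < e"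
    using h unfolding harm_homeo_class_def by blast
  obtain F G L n where lift: "strip_lift ?T F G L" and n: "n = 1 \<or> n = (-1::int)"
    and deck: "\<And>z. z \<in> strip ?T \<Longrightarrow> L (z + 2 * of_real pi * \<i>) = L z + of_int n * (2 * of_real pi * \<i>)"
    and H: "\<And>z. z \<in> strip ?T \<Longrightarrow> h (of_real r * exp z) = of_real rs * hmap F G z"
    and bounds: "\<And>z. z \<in> strip ?T \<Longrightarrow> 1 < cmod (hmap F G z)"
    "\<And>z. z \<in> strip ?T \<Longrightarrow> cmod (hmap F G z) < Rs / rs"
    by (rule harmonic_homeomorphism_lift[OF r s harm hom]) (rule that; assumption)
  have sm: "strip_map ?T F G" using lift by (rule strip_lift.axioms(1))
  have rs1: "rs / rs = 1" using s by simp
  interpret annulus_map ?T F G L "Rs / rs"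
  proof (rule annulus_mapI[OF lift n deck])
    show "cmod (deriv G z) \<le> cmod (deriv F z)" if "z \<in> strip ?T" for z
      by (rule sense_preserving_lift[OF r s(1) sm H sp that])
    show "1 < Rs / rs" using s by simp
  qed (use end_limits_lift(1)[OF r s(1) H lims(1)] end_limits_lift(2)[OF r s(1) H lims(2)] bounds rs1 in auto)
  have "Rs / rs = cosh ?T" using eq r by (simp add: cosh_ln_quotient)
  then obtain x0 where x0: "cmod x0 = 1"
    and form: "\<And>t y. 0 < t \<Longrightarrow> t < ?T \<Longrightarrow> 0 \<le> y \<Longrightarrow> y \<le> 2*pi \<Longrightarrow> hmap F G (Complex t y) = x0 * of_real (cosh t) * cis y"
    by (rule extremal_form) (rule that; assumption)
  have "h z = (z / of_real r + of_real r / cnj z) / 2 * of_real rs * exp (\<i> * of_real (Arg2pi x0))" if z: "z \<in> annulus r R" for z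
  proof -
    define t where "t = ln (cmod z / r)"
    define y where "y = Arg2pi z"
    have zr: "r < cmod z" "cmod z < R" using z by (auto simp: annulus_def)
    have z0: "z \<noteq> 0" using zr r by auto
    have q: "1 < cmod z / r" "cmod z / r < R / r"
      using zr r by (simp_all add: divide_strict_right_mono)
    have "ln (cmod z / r) < ?T" using q by (subst ln_less_cancel_iff) linarith+
    then have t: "0 < t" "t < ?T" using ln_gt_zero[OF q(1)] unfolding t_def by blast+
    have y: "0 \<le> y" "y \<le> 2*pi" using Arg2pi_ge_0[of z] Arg2pi_lt_2pi[of z] by (auto simp: y_def)
    have et: "exp t = cmod z / r" unfolding t_def using q by (intro exp_ln) linarith
    have zy: "z = of_real (cmod z) * cis y"
      using Arg2pi_eq[of z] by (simp add: y_def cis_conv_exp)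
    have z1: "z / of_real r = of_real (exp t) * cis y"
      unfolding et by (subst zy) simp
    \<comment> \<open>Inversion in the circle of radius \<open>r\<close> keeps the argument and
      replaces \<open>t\<close> by \<open>-t\<close>; the two terms then combine to 2 cosh t cis
      y.\<close>
    have z2: "of_real r / cnj z = of_real (exp (- t)) * cis y"
    proof -
      have "cnj z * cis y = of_real (cmod z)"
        by (subst zy) (simp add: cis_cnj cis_mult mult.assoc)
      then have "of_real r * (cnj z * cis y) = of_real r * of_real (cmod z)" by simp
      then show ?thesis using z0 r zr
        by (simp add: exp_minus et field_simps)
    qed
    have "exp (Complex t y) = of_real (exp t) * cis y" by (simp add: exp_eq_polar)
    then have "of_real r * exp (Complex t y) = z" using z1 r by (simp add: field_simps)
    then have "h z = of_real rs * (x0 * of_real (cosh t) * cis y)"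
      using H[of "Complex t y"] form[OF t y] t by simp
    also have "\<dots> = ((of_real (exp t) * cis y) + of_real (exp (-t)) * cis y) / 2 * of_real rs * x0"
      by (simp add: cosh_def algebra_simps)
    also have "x0 = exp (\<i> * of_real (Arg2pi x0))" using Arg2pi_eq[of x0] x0 by simp
    finally show ?thesis unfolding z1 z2 .
  qed
  then show ?thesis using Arg2pi_ge_0[of x0] Arg2pi_lt_2pi[of x0] by blast
qed

section \<open>Existence\<close>

lemma Re_derivative_line:
  assumes "(f has_field_derivative D) (at z)"
  shows "((\<lambda>t. Re (f (z + c * of_real t))) has_real_derivative Re (c * D)) (at 0)"
proof -
  have l: "((\<lambda>t. z + c * of_real t) has_vector_derivative c) (at 0)"
    by (auto intro!: derivative_eq_intros)
  have "((f \<circ> (\<lambda>t. z + c * of_real t)) has_vector_derivative c * D) (at 0)"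
    by (rule field_vector_diff_chain_at[OF l]) (use assms in simp)
  then show ?thesis
    unfolding has_real_derivative_iff_has_vector_derivative o_def
    by (rule bounded_linear.has_vector_derivative[OF bounded_linear_Re])
qed

lemma Re_holomorphic_imp_harmonic:
  assumes S: "open S" and F: "F holomorphic_on S"
  shows "harmonic_real_on S (\<lambda>z. Re (F z))"
proof -
  have F1: "deriv F holomorphic_on S" and F2: "deriv (deriv F) holomorphic_on S"
    using F S by (auto intro: holomorphic_deriv)
  have d1: "(F has_field_derivative deriv F z) (at z)" "(deriv F has_field_derivative deriv (deriv F) z) (at z)" if "z \<in> S" for z
    using holomorphic_derivI[OF F S that] holomorphic_derivI[OF F1 S that] by auto
  have d2: "((\<lambda>z. \<i> * deriv F z) has_field_derivative \<i> * deriv (deriv F) z) (at z)" if "z \<in> S" for z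
    by (intro DERIV_cmult d1 that)
  show ?thesis
    unfolding harmonic_real_on_def
  proof (intro exI conjI ballI)
    fix z assume z: "z \<in> S"
    show "((\<lambda>t. Re (F (z + of_real t))) has_real_derivative Re (deriv F z)) (at 0)"
      using Re_derivative_line[OF d1(1)[OF z], of 1] by simp
    show "((\<lambda>t. Re (F (z + \<i> * of_real t))) has_real_derivative Re (\<i> * deriv F z)) (at 0)"
      by (rule Re_derivative_line[OF d1(1)[OF z]])
    show "((\<lambda>t. Re (deriv F (z + of_real t))) has_real_derivative Re (deriv (deriv F) z)) (at 0)"
      using Re_derivative_line[OF d1(2)[OF z], of 1] by simp
    show "((\<lambda>t. Re (deriv F (z + \<i> * of_real t))) has_real_derivative Re (\<i> * deriv (deriv F) z)) (at 0)"
      by (rule Re_derivative_line[OF d1(2)[OF z]])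
    show "((\<lambda>t. Re (\<i> * deriv F (z + of_real t))) has_real_derivative Re (\<i> * deriv (deriv F) z)) (at 0)"
      using Re_derivative_line[OF d2[OF z], of 1] by simp
    show "((\<lambda>t. Re (\<i> * deriv F (z + \<i> * of_real t))) has_real_derivative Re (\<i> * (\<i> * deriv (deriv F) z))) (at 0)"
      by (rule Re_derivative_line[OF d2[OF z]])
    show "Re (deriv (deriv F) z) + Re (\<i> * (\<i> * deriv (deriv F) z)) = 0"
      by simp
  qed (intro continuous_intros holomorphic_on_imp_continuous_on F F1 F2)+
qed

text \<open>The second term is the conjugate of b/z. The real part is therefore that of a z + b/z,
  and the imaginary part is that of a z - b/z, itself the real part of -\<i> times this
  function.\<close>

lemma nitsche_map_harmonic:
  fixes a b :: real
  assumes r: "0 \<le> r"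
  shows "harmonic_on (annulus r R) (\<lambda>z. of_real a * z + of_real b / cnj z)"
proof -
  have nz: "z \<noteq> 0" if "z \<in> annulus r R" for z using that r by (auto simp: annulus_def)
  have inv: "of_real b / cnj z = cnj (of_real b / z)" for z by simp
  have "(\<lambda>z. Re (of_real a * z + of_real b / cnj z)) = (\<lambda>z. Re (of_real a * z + of_real b / z))"
    unfolding inv by (simp only: plus_complex.sel cnj.sel)
  moreover have "(\<lambda>z. Im (of_real a * z + of_real b / cnj z)) = (\<lambda>z. Re (- \<i> * (of_real a * z - of_real b / z)))"
    unfolding inv by (simp add: fun_eq_iff del: complex_cnj_divide)
  moreover have "(\<lambda>z. of_real a * z + of_real b / z) holomorphic_on annulus r R"
    "(\<lambda>z. - \<i> * (of_real a * z - of_real b / z)) holomorphic_on annulus r R"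
    using nz by (auto intro!: holomorphic_intros)
  ultimately show ?thesis
    unfolding harmonic_on_def by (simp only: Re_holomorphic_imp_harmonic[OF open_annulus])
qed

text \<open>A map that keeps arguments and changes the modulus \<open>x\<close> to a x + b/x. The
  radius condition says that this profile has nonnegative derivative at \<open>r\<close>, and then
  it increases on all of [r, R].\<close>

lemma nitsche_map_exists:
  assumes r: "0 < r" "r < R" and s: "0 < rs" "rs < Rs" and le: "(R/r + r/R) / 2 \<le> Rs / rs"
  shows "\<exists>h g. harmonic_on (annulus r R) h \<and> homeomorphism (annulus r R) (annulus rs Rs) h g"
proof -
  define K where "K = R\<^sup>2 - r\<^sup>2"
  have K: "K > 0" using r by (simp add: K_def power_strict_mono)
  \<comment> \<open>\<open>a\<close> and \<open>b\<close> solve the two linear equations f r = rs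
    and f R = Rs.\<close>
  define a where "a = (R * Rs - r * rs) / K"
  define b where "b = r * R * (R * rs - r * Rs) / K"
  define f where "f x = a * x + b / x" for x
  have R0: "0 < R" using r by simp
  have cond: "rs * (R\<^sup>2 + r\<^sup>2) \<le> 2 * r * R * Rs"
    using le r R0 s by (simp add: field_simps power2_eq_square)
  have "r * rs < R * Rs" using r s by (intro mult_strict_mono) auto
  then have a: "a > 0" using K by (simp add: a_def)
  \<comment> \<open>This is f'(r) \<ge> 0; after clearing denominators it is the condition on the
    radii.\<close>
  have ba: "b \<le> a * r\<^sup>2"
  proof -
    have "R * (R * rs - r * Rs) \<le> r * (R * Rs - r * rs)" using cond by (simp add: algebra_simps power2_eq_square)
    then have "r * (R * (R * rs - r * Rs)) / K \<le> r * (r * (R * Rs - r * rs)) / K"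
      using r K by (intro divide_right_mono mult_left_mono) auto
    then show ?thesis by (simp add: a_def b_def power2_eq_square mult_ac)
  qed
  have fr: "f r = rs"
  proof -
    have "f r = (r * (R * Rs - r * rs) + R * (R * rs - r * Rs)) / K"
      using r K by (simp add: f_def a_def b_def field_simps)
    also have "\<dots> = (rs * K) / K" by (simp add: K_def algebra_simps power2_eq_square)
    finally show ?thesis using K by simp
  qed
  have fR: "f R = Rs"
  proof -
    have "f R = (R * (R * Rs - r * rs) + r * (R * rs - r * Rs)) / K"
      using R0 K by (simp add: f_def a_def b_def field_simps)
    also have "\<dots> = (Rs * K) / K" by (simp add: K_def algebra_simps power2_eq_square)
    finally show ?thesis using K by simp
  qed
  have mono: "f x < f y" if xy: "r \<le> x" "x < y" for x y
  proof -
    have x0: "0 < x" "0 < y" using r xy by auto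
    have "r * r < x * y" using xy r x0 by (intro mult_le_less_imp_less) auto
    then have "a * r\<^sup>2 < a * (x * y)" using a by (simp add: power2_eq_square)
    then have "b < a * (x * y)" using ba by linarith
    then have "b / (x * y) < a" using x0 by (simp add: pos_divide_less_eq)
    then have "0 < (y - x) * (a - b / (x * y))" using xy by simp
    also have "\<dots> = f y - f x" using x0 by (simp add: f_def field_simps)
    finally show ?thesis by simp
  qed
  define h where "h z = of_real a * z + of_real b / cnj z" for z
  have hz: "h z = z * of_real (f (cmod z) / cmod z)" if "z \<noteq> 0" for z
  proof -
    have "of_real b / cnj z = z * of_real (b / (cmod z)\<^sup>2)"
    proof -
      have "of_real (b / (cmod z)\<^sup>2) = of_real b / (z * cnj z)"
        by (simp only: of_real_divide complex_norm_square)
      also have "z * \<dots> = of_real b / cnj z" using that by simp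
      finally show ?thesis by (rule sym)
    qed
    moreover have "f (cmod z) / cmod z = a + b / (cmod z)\<^sup>2"
      using that by (simp add: f_def add_divide_distrib power2_eq_square)
    ultimately show ?thesis by (simp add: h_def distrib_left mult.commute)
  qed
  have fpos: "f x > 0" if "r < x" for x using mono[of r x] that fr s by simp
  have A: "z \<noteq> 0" "r < cmod z" "cmod z < R" if "z \<in> annulus r R" for z using that r by (auto simp: annulus_def)
  have norm_h: "cmod (h z) = f (cmod z)" if "z \<in> annulus r R" for z
    using A[OF that] fpos[of "cmod z"] by (simp add: hz norm_mult norm_divide)
  have harm: "harmonic_on (annulus r R) h"
    unfolding h_def[abs_def] using r by (intro nitsche_map_harmonic) simp
  have cont: "continuous_on (annulus r R) h"
    unfolding h_def[abs_def] using A by (intro continuous_intros) auto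
  have inj: "inj_on h (annulus r R)"
  proof (rule inj_onI)
    fix z w assume zw: "z \<in> annulus r R" "w \<in> annulus r R" "h z = h w"
    have "f (cmod z) = f (cmod w)" using norm_h zw by metis
    then have e: "cmod z = cmod w"
      using mono[of "cmod z" "cmod w"] mono[of "cmod w" "cmod z"] A[OF zw(1)] A[OF zw(2)] by linarith
    have "f (cmod w) / cmod w \<noteq> 0" using fpos[of "cmod w"] A[OF zw(2)] by simp
    then show "z = w" using zw(3) A[OF zw(1)] A[OF zw(2)] by (simp add: hz e)
  qed
  have image: "h ` annulus r R = annulus rs Rs"
  proof
    show "h ` annulus r R \<subseteq> annulus rs Rs"
    proof
      fix w assume "w \<in> h ` annulus r R"
      then obtain z where z: "z \<in> annulus r R" "w = h z" by blast
      then show "w \<in> annulus rs Rs"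
        using norm_h[OF z(1)] mono[of r "cmod z"] mono[of "cmod z" R] A[OF z(1)] fr fR by (simp add: annulus_def)
    qed
    show "annulus rs Rs \<subseteq> h ` annulus r R"
    proof
      fix w assume "w \<in> annulus rs Rs"
      then have w: "rs < cmod w" "cmod w < Rs" by (auto simp: annulus_def)
      have "continuous_on {r..R} f" unfolding f_def using r by (intro continuous_intros) auto
      then obtain x where x: "r \<le> x" "x \<le> R" "f x = cmod w"
        using IVT'[of f r "cmod w" R] fr fR w r by auto
      have "x \<noteq> r" "x \<noteq> R" using x w fr fR by auto
      then have xr: "r < x" "x < R" using x by auto
      define z where "z = of_real (x / cmod w) * w"
      have w0: "cmod w > 0" using w s by linarith
      have nz: "cmod z = x" using xr r w0 by (simp add: z_def norm_mult norm_divide)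
      then have z: "z \<in> annulus r R" using xr by (simp add: annulus_def)
      have "h z = z * of_real (cmod w / x)" using hz[of z] A[OF z] by (simp add: nz x)
      also have "\<dots> = w" using xr r w0 by (simp add: z_def)
      finally show "w \<in> h ` annulus r R" using z by blast
    qed
  qed
  \<comment> \<open>Continuity of the inverse comes from invariance of domain rather than from a
    formula for it.\<close>
  obtain g where "homeomorphism (annulus r R) (h ` annulus r R) h g"
    using invariance_of_domain_homeomorphism[OF open_annulus cont _ inj] by auto
  then show ?thesis using harm unfolding image by blast
qed

theorem theorem1p3:
  fixes r R rs Rs :: real
  assumes "0 < r" "r < R" "0 < rs" "rs < Rs"
  shows "((\<exists>h. harmonic_on (annulus r R) h \<and>
              (\<exists>g. homeomorphism (annulus r R) (annulus rs Rs) h g))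
           \<longleftrightarrow> Rs / rs \<ge> (R / r + r / R) / 2) \<and>
         (Rs / rs = (R / r + r / R) / 2 \<longrightarrow>
           (\<forall>h\<in>harm_homeo_class r R rs Rs. \<exists>\<alpha>::real. 0 \<le> \<alpha> \<and> \<alpha> < 2 * pi \<and>
              (\<forall>z\<in>annulus r R.
                 h z = (z / of_real r + of_real r / cnj z) / 2 * of_real rs * exp (\<i> * of_real \<alpha>))))"
proof (intro conjI impI ballI iffI)
  show "Rs / rs \<ge> (R / r + r / R) / 2"
    if "\<exists>h. harmonic_on (annulus r R) h \<and> (\<exists>g. homeomorphism (annulus r R) (annulus rs Rs) h g)"
    using that nitsche_bound[OF assms] by blast
  show "\<exists>h. harmonic_on (annulus r R) h \<and> (\<exists>g. homeomorphism (annulus r R) (annulus rs Rs) h g)"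
    if "Rs / rs \<ge> (R / r + r / R) / 2"
    using nitsche_map_exists[OF assms that] by blast
qed (rule nitsche_extremal[OF assms])

end
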